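(* Let $K$ be a number field of unit rank at least $3$. Then $M(K)$ is attained in $\operatorname{Spec}(\overline K)$, $M(K)$ is an isolated point of $\operatorname{Spec}(\overline K)$, and $M(K)$ is computable in finite time (that is, there is an algorithm which, given as input any number field $K$ of unit rank at least $3$, terminates after finitely many steps and outputs $M(K)$).
   Context: $\mathcal O_K$ is the ring of integers of $K$, and the unit rank of $K$ is the rank of $\mathcal O_K^*$. Let $r_1$ be the number of real embeddings $\sigma_1,\dots,\sigma_{r_1}$ of $K$ and $r_2$ the number of pairs of conjugate non-real embeddings, with representatives $\sigma_{r_1+1},\dots,\sigma_{r_1+r_2}$. Put $\overline K=K\otimes_{\mathbb Q}\mathbb R$, identified with $\mathbb R^{r_1}\oplus\mathbb C^{r_2}$ via $\theta\otimes s\mapsto (s\sigma_i(\theta))_{1\le i\le r_1+r_2}$; $K$ is viewed inside $\overline K$ by $x\mapsto x\otimes 1$. For $x=(x_i)\in\overline K$ set $N_{\overline K}(x)=\prod_{i=1}^{r_1}x_i\prod_{i=r_1+1}^{r_1+r_2}|x_i|^2$, which extends the field norm $N_K$. For $x\in\overline K$ let $m_{\overline K}(x)=\inf_{y\in x+\mathcal O_K}|N_{\overline K}(y)|$. The inhomogeneous spectrum is $\operatorname{Spec}(\overline K)=\{m_{\overline K}(x):x\in\overline K\}$. The Euclidean minimum is $M(K)=\sup_{x\in K}\inf_{y\in x+\mathcal O_K}|N_K(y)|$ (it is known that $M(K)=\sup_{x\in\overline K}m_{\overline K}(x)$). $M(K)$ is said to be attained in $\operatorname{Spec}(\overline K)$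 if for every $x\in\overline K$ there exists $y\in x+\mathcal O_K$ with $|N_{\overline K}(y)|\le M(K)$; equivalently, whenever $x\in\overline K$ satisfies $m_{\overline K}(x)=M(K)$, there is $y\in x+\mathcal O_K$ with $|N_{\overline K}(y)|=M(K)$. The algorithm is given $K$ by finite data (e.g. a defining polynomial). *)

theory Defs
  imports
    "HOL-Analysis.Isolated"
    "HOL-Library.Extended_Nat"
    "HOL-Library.FuncSet"
    "HOL-Library.Nat_Bijection"
    "HOL-Computational_Algebra.Polynomial"
begin

section \<open>Number fields\<close>

text \<open>
  A number field is a subfield of some ambient field of characteristic zero that has finite
  degree over the rationals. An abstract number field is the case \<open>K = UNIV\<close>.
\<close>

definition number_field :: "'a::field_char_0 set \<Rightarrow> bool" where
  "number_field K \<longleftrightarrow>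
     0 \<in> K \<and> 1 \<in> K \<and>
     (\<forall>x\<in>K. \<forall>y\<in>K. x + y \<in> K \<and> x - y \<in> K \<and> x * y \<in> K) \<and>
     (\<forall>x\<in>K. inverse x \<in> K) \<and>
     (\<exists>B. finite B \<and> B \<subseteq> K \<and> (\<forall>x\<in>K. \<exists>c::'a \<Rightarrow> rat. x = (\<Sum>b\<in>B. of_rat (c b) * b)))"

definition ring_of_integers :: "'a::field_char_0 set \<Rightarrow> 'a set" where
  "ring_of_integers K = {x \<in> K. algebraic_int x}"

definition integer_units :: "'a::field_char_0 set \<Rightarrow> 'a set" where
  "integer_units K = {u \<in> ring_of_integers K. \<exists>v\<in>ring_of_integers K. u * v = 1}"

definition mult_independent :: "'a::field_char_0 set \<Rightarrow> bool" where
  "mult_independent S \<longleftrightarrow>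
     (\<forall>e::'a \<Rightarrow> int. (\<Prod>u\<in>S. u powi e u) = 1 \<longrightarrow> (\<forall>u\<in>S. e u = 0))"

text \<open>The rank of the abelian group of units, i.e. the dimension of its tensor product with the
  rationals. It takes values in the extended naturals so that the supremum always exists.\<close>

definition unit_rank :: "'a::field_char_0 set \<Rightarrow> enat" where
  "unit_rank K =
     (SUP S\<in>{S. finite S \<and> S \<subseteq> integer_units K \<and> mult_independent S}. enat (card S))"

text \<open>Embeddings are made extensional, so that each of them occurs only once as a function.\<close>

definition embeddings :: "'a::field_char_0 set \<Rightarrow> ('a \<Rightarrow> complex) set" where
  "embeddings K =
     {\<sigma> \<in> extensional K. \<sigma> 1 = 1 \<and>
        (\<forall>x\<in>K. \<forall>y\<in>K. \<sigma> (x + y) = \<sigma> x + \<sigma> y \<and> \<sigma> (x * y) = \<sigma> x * \<sigma> y)}"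

definition field_norm :: "'a::field_char_0 set \<Rightarrow> 'a \<Rightarrow> complex" where
  "field_norm K x = (\<Prod>\<sigma>\<in>embeddings K. \<sigma> x)"

definition real_embedding :: "'a::field_char_0 set \<Rightarrow> ('a \<Rightarrow> complex) \<Rightarrow> bool" where
  "real_embedding K \<sigma> \<longleftrightarrow> \<sigma> ` K \<subseteq> \<real>"

definition conj_embedding :: "'a::field_char_0 set \<Rightarrow> ('a \<Rightarrow> complex) \<Rightarrow> ('a \<Rightarrow> complex)" where
  "conj_embedding K \<sigma> = restrict (\<lambda>x. cnj (\<sigma> x)) K"

text \<open>
  A choice \<open>\<Phi> = {\<sigma>\<^sub>1, \<dots>, \<sigma>\<^sub>r}\<close> with \<open>r = r\<^sub>1 + r\<^sub>2\<close>: all real embeddings (these are their own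
  conjugates) and one embedding from each pair of conjugate non-real ones.
\<close>

definition embedding_reps :: "'a::field_char_0 set \<Rightarrow> ('a \<Rightarrow> complex) set \<Rightarrow> bool" where
  "embedding_reps K \<Phi> \<longleftrightarrow>
     \<Phi> \<subseteq> embeddings K \<and>
     (\<forall>\<tau>\<in>embeddings K. \<exists>!\<sigma>. \<sigma> \<in> \<Phi> \<and> (\<sigma> = \<tau> \<or> \<sigma> = conj_embedding K \<tau>))"


section \<open>Euclidean minimum and inhomogeneous spectrum\<close>

text \<open>
  The tensor product of \<open>K\<close> with the reals, in its coordinates indexed by \<open>\<Phi>\<close>: real coordinates
  at the real embeddings and complex ones at the others.
\<close>

definition K_bar :: "'a::field_char_0 set \<Rightarrow> ('a \<Rightarrow> complex) set \<Rightarrow> (('a \<Rightarrow> complex) \<Rightarrow> complex) set" where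
  "K_bar K \<Phi> = (\<Pi>\<^sub>E \<sigma>\<in>\<Phi>. if real_embedding K \<sigma> then \<real> else UNIV)"

definition norm_bar ::
    "'a::field_char_0 set \<Rightarrow> ('a \<Rightarrow> complex) set \<Rightarrow> (('a \<Rightarrow> complex) \<Rightarrow> complex) \<Rightarrow> real" where
  "norm_bar K \<Phi> x =
     (\<Prod>\<sigma>\<in>\<Phi>. if real_embedding K \<sigma> then Re (x \<sigma>) else (cmod (x \<sigma>))\<^sup>2)"

text \<open>The coset of \<open>x\<close> modulo the ring of integers, which is embedded by \<open>a \<mapsto> (\<sigma> a)\<^sub>\<sigma>\<close>.\<close>

definition integer_coset ::
    "'a::field_char_0 set \<Rightarrow> ('a \<Rightarrow> complex) set \<Rightarrow> (('a \<Rightarrow> complex) \<Rightarrow> complex) \<Rightarrow>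
     (('a \<Rightarrow> complex) \<Rightarrow> complex) set" where
  "integer_coset K \<Phi> x = (\<lambda>a. restrict (\<lambda>\<sigma>. x \<sigma> + \<sigma> a) \<Phi>) ` ring_of_integers K"

definition min_bar ::
    "'a::field_char_0 set \<Rightarrow> ('a \<Rightarrow> complex) set \<Rightarrow> (('a \<Rightarrow> complex) \<Rightarrow> complex) \<Rightarrow> real" where
  "min_bar K \<Phi> x = (INF y\<in>integer_coset K \<Phi> x. \<bar>norm_bar K \<Phi> y\<bar>)"

definition inhomogeneous_spectrum ::
    "'a::field_char_0 set \<Rightarrow> ('a \<Rightarrow> complex) set \<Rightarrow> real set" where
  "inhomogeneous_spectrum K \<Phi> = min_bar K \<Phi> ` K_bar K \<Phi>"

text \<open>The supremum is taken in the reals; for a number field the set is bounded above.\<close>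

definition euclidean_minimum :: "'a::field_char_0 set \<Rightarrow> real" where
  "euclidean_minimum K =
     (SUP x\<in>K. INF y\<in>(\<lambda>a. x + a) ` ring_of_integers K. cmod (field_norm K y))"

definition minimum_attained :: "'a::field_char_0 set \<Rightarrow> ('a \<Rightarrow> complex) set \<Rightarrow> bool" where
  "minimum_attained K \<Phi> \<longleftrightarrow>
     (\<forall>x\<in>K_bar K \<Phi>. \<exists>y\<in>integer_coset K \<Phi> x. \<bar>norm_bar K \<Phi> y\<bar> \<le> euclidean_minimum K)"


section \<open>Algorithms\<close>

text \<open>
  Algorithms are programs for Kleene's partial recursive functions, and \<open>computes p xs y\<close> says
  that the program \<open>p\<close> halts on the input \<open>xs\<close> with output \<open>y\<close>.
\<close>

datatype recf =
    Zero_f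
  | Succ_f
  | Proj_f nat
  | Comp_f recf "recf list"
  | Prim_f recf recf
  | Min_f recf

inductive computes :: "recf \<Rightarrow> nat list \<Rightarrow> nat \<Rightarrow> bool" where
  zero: "computes Zero_f xs 0"
| succ: "computes Succ_f [x] (Suc x)"
| proj: "i < length xs \<Longrightarrow> computes (Proj_f i) xs (xs ! i)"
| comp: "length ys = length gs \<Longrightarrow> (\<And>i. i < length gs \<Longrightarrow> computes (gs ! i) xs (ys ! i)) \<Longrightarrow>
         computes f ys z \<Longrightarrow> computes (Comp_f f gs) xs z"
| prim_0: "computes f xs y \<Longrightarrow> computes (Prim_f f g) (0 # xs) y"
| prim_Suc: "computes (Prim_f f g) (n # xs) r \<Longrightarrow> computes g (n # r # xs) y \<Longrightarrow>
             computes (Prim_f f g) (Suc n # xs) y"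
| min: "computes f (n # xs) 0 \<Longrightarrow> (\<And>m. m < n \<Longrightarrow> \<exists>k. computes f (m # xs) (Suc k)) \<Longrightarrow>
        computes (Min_f f) xs n"

inductive_cases computes_zeroE: "computes Zero_f xs z"
inductive_cases computes_succE: "computes Succ_f xs z"
inductive_cases computes_projE: "computes (Proj_f i) xs z"
inductive_cases computes_compE: "computes (Comp_f f gs) xs z"
inductive_cases computes_prim_0E: "computes (Prim_f f g) (0 # xs) z"
inductive_cases computes_prim_SucE: "computes (Prim_f f g) (Suc n # xs) z"
inductive_cases computes_minE: "computes (Min_f f) xs z"

lemma computes_deterministic:
  "computes p xs y \<Longrightarrow> computes p xs z \<Longrightarrow> y = z"
proof (induction arbitrary: z rule: computes.induct)
  case (zero xs)
  then show ?case by (elim computes_zeroE) simp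
next
  case (succ x)
  then show ?case by (elim computes_succE) simp
next
  case (proj i xs)
  from proj.prems show ?case by (rule computes_projE) simp
next
  case (comp ys gs xs f y)
  from comp.prems obtain ys' where ys': "length ys' = length gs"
    "\<And>i. i < length gs \<Longrightarrow> computes (gs ! i) xs (ys' ! i)" "computes f ys' z"
    by (rule computes_compE) blast
  have "ys = ys'"
    by (rule nth_equalityI) (use comp.hyps(1) comp.IH(1) ys' in simp_all)
  with comp.IH(2) ys'(3) show ?case by blast
next
  case (prim_0 f xs y g)
  from prim_0.prems have "computes f xs z" by (rule computes_prim_0E)
  then show ?case by (rule prim_0.IH)
next
  case (prim_Suc f g n xs r y)
  from prim_Suc.prems obtain r' where "computes (Prim_f f g) (n # xs) r'" "computes g (n # r' # xs) z"
    by (rule computes_prim_SucE)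
  with prim_Suc.IH show ?case by blast
next
  case (min f n xs)
  from min.prems have z: "computes f (z # xs) 0"
    by (rule computes_minE)
  from min.prems have z': "\<exists>k. computes f (m # xs) (Suc k)" if "m < z" for m
    by (rule computes_minE) (use that in blast)
  show ?case
  proof (cases n z rule: linorder_cases)
    case less
    with z' obtain k where "computes f (n # xs) (Suc k)" by blast
    from min.IH(1)[OF this] show ?thesis by simp
  next
    case greater
    with min.IH(2) obtain k where "\<forall>w. computes f (z # xs) w \<longrightarrow> Suc k = w" by blast
    with z show ?thesis by blast
  qed
qed

definition encode_rat :: "rat \<Rightarrow> nat" where
  "encode_rat q = (case quotient_of q of (a, b) \<Rightarrow> prod_encode (int_encode a, nat b))"

definition encode_poly :: "rat poly \<Rightarrow> nat" where
  "encode_poly f = list_encode (map encode_rat (coeffs f))"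

text \<open>The field generated by \<open>\<theta>\<close> over the rationals, for algebraic \<open>\<theta>\<close>.\<close>

definition rat_adjoin :: "complex \<Rightarrow> complex set" where
  "rat_adjoin \<theta> = range (\<lambda>g::rat poly. poly (map_poly of_rat g) \<theta>)"

end

theory Submission
  imports Defs "HOL-Analysis.Analysis" "HOL-Analysis.Kronecker_Approximation_Theorem"
    "HOL-Library.Function_Algebras" "HOL-Computational_Algebra.Computational_Algebra"
begin

text \<open>
  The set of points whose minimum is at least \<open>t\<close> is closed and invariant under integers and units. A
  unit that is large at one place only, applied to a non-isolated point of such a set, produces a whole
  line in a closed invariant set. Arguments of Boshernitzan and Berend type then give torsion points in
  every nonempty closed invariant set; if the unit group cannot separate a place from its conjugate,
  the field has complex multiplication, which is treated through its conjugation. A line at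
  the top level \<open>M\<close> is impossible: translates of norm exactly \<open>M\<close> would be perpendicular to it, but
  it contains torsion points of every order. So only finitely many classes,
  all of them torsion, have minimum near \<open>M\<close>, which yields attainment and isolation. Together with a covering
  of the remaining points by small cubes they form a finite rational certificate for \<open>M\<close>; the algorithm searches
  for one, computing norms from the coefficients of the defining polynomial by Newton's identities.
\<close>

section \<open>Sums and products of algebraic integers\<close>

text \<open>The obstacle is rotation. At a real place the line produced by units near 1 is the whole
  axis; at a nonreal place the axis is a plane, and the line has to be rotated into a direction that
  is dense modulo integers. This fails only if a subgroup of finite index consists of units that are
  real at the place. Conjugation is then a field automorphism and these units are real at every
  place, so that imaginary and real parts can be treated one after the other. In the certificate,
  the lower and the upper bound both rest on units whose conjugates are at most \<open>CC\<close>. A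
  translate of small norm is moved by such units into a box of known size, so the lower bound is a
  check of finitely many norms. A point close to the listed torsion points whose minimum exceeds the
  candidate stays close to them under these units; since some of them expand at any given place, its
  distance from the list is 0. This is why \<open>R\<close>, \<open>AA\<close>, \<open>BB\<close>,
  \<open>DD\<close> and \<open>CC\<close> are explicit natural numbers and not merely shown to
  exist.\<close>

lemma int_sequence_ideal_finitely_generated:
  fixes a :: "nat => int"
  shows "\<exists>K. \<forall>k. \<exists>e::nat => int. a k = (\<Sum>i<K. e i * a i)"
proof (cases "\<forall>k. a k = 0")
  case True
  then show ?thesis by (intro exI[of _ 0]) auto
next
  case False
  define P where "P d \<longleftrightarrow> d > 0 & (\<exists>K e. int d = (\<Sum>i<K. e i * a i))" for d :: nat
  from False obtain k where k: "a k ~= 0" by blast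
  have a_eq: "b * a k = (\<Sum>i<K + Suc k. (if i = k then b else 0) * a i)" for b K k
    by (simp add: if_distrib[of "%x. x * _"] cong: if_cong)
  have "P (nat \<bar>a k\<bar>)" unfolding P_def
  proof (intro conjI exI)
    show "int (nat \<bar>a k\<bar>) = (\<Sum>i<0 + Suc k. (if i = k then sgn (a k) else 0) * a i)"
      unfolding a_eq[symmetric] using abs_sgn[of "a k"] by (simp add: mult.commute)
  qed (use k in simp)
  then obtain d where d: "P d" and min: "!!d'. P d' ==> d <= d'" using LeastI[of P] Least_le[of P] by blast
  from d obtain K e where Ke: "int d = (\<Sum>i<K. e i * a i)" and dpos: "d > 0" unfolding P_def by blast
  have "\<exists>e'. a k = (\<Sum>i<K. e' i * a i)" for k
  proof -
    define q where "q = a k div int d"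
    have d_eq: "int d = (\<Sum>i<K + Suc k. (if i < K then e i else 0) * a i)"
      unfolding Ke by (intro sum.mono_neutral_cong_left) auto
    have "a k mod int d = 1 * a k - q * int d" by (simp add: q_def minus_div_mult_eq_mod)
    also have "... = (\<Sum>i<K + Suc k. ((if i = k then 1 else 0) - q * (if i < K then e i else 0)) * a i)"
      unfolding a_eq[of 1 k K] by (subst d_eq) (simp only: sum_distrib_left sum_subtractf[symmetric] left_diff_distrib mult.assoc)
    finally have "\<exists>K e. a k mod int d = (\<Sum>i<K. e i * a i)" by (intro exI)
    then have "a k mod int d = 0"
      using min[of "nat (a k mod int d)"] dpos pos_mod_bound[of "int d" "a k"] pos_mod_sign[of "int d" "a k"]
      unfolding P_def by force
    then have "a k = q * int d" by (simp add: q_def mod_eq_0_iff_dvd)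
    also have "... = (\<Sum>i<K. (q * e i) * a i)" unfolding Ke by (simp add: sum_distrib_left mult_ac)
    finally show ?thesis by (rule exI[of _ "%i. q * e i"])
  qed
  then show ?thesis by blast
qed

text \<open>Noetherianity of the group of integer vectors indexed by \<open>J\<close>. In
  \<open>algebraic_int_if_powers_in_span\<close> it replaces the determinant trick: for the
  coordinates of the powers of \<open>s\<close> it is already a monic relation. In the induction,
  finitely many vectors generate everything that occurs in coordinate \<open>l\<close>; subtracting
  their combinations clears that coordinate.\<close>

lemma int_vectors_dependent:
  fixes c :: "nat => 'i => int"
  assumes "finite J" shows "\<exists>m d. \<forall>j\<in>J. c m j = (\<Sum>k<m. d k * c k j)" using assms
proof (induction J arbitrary: c rule: finite_induct)
  case (insert l J)
  obtain K e where e: "!!k. c k l = (\<Sum>i<K. e k i * c i l)"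
    using int_sequence_ideal_finitely_generated[of "%k. c k l"] by metis
  define c' where "c' k j = c (K + k) j - (\<Sum>i<K. e (K + k) i * c i j)" for k j
  obtain m d where md: "\<forall>j\<in>J. c' m j = (\<Sum>k<m. d k * c' k j)" using insert.IH by blast
  have "c' k l = 0" for k using e[of "K + k"] by (simp add: c'_def)
  then have md': "c' m j = (\<Sum>k<m. d k * c' k j)" if "j \<in> insert l J" for j using md that by auto
  define D where "D i = (if i < K then e (K + m) i - (\<Sum>k<m. d k * e (K + k) i) else d (i - K))" for i
  have "c (K + m) j = (\<Sum>k<K + m. D k * c k j)" if "j \<in> insert l J" for j
  proof -
    have "(\<Sum>k<K + m. D k * c k j) = (\<Sum>k<K. D k * c k j) + (\<Sum>k<m. d k * c (K + k) j)"
      using sum.atLeastLessThan_concat[of 0 K "K + m" "%k. D k * c k j"] sum.shift_bounds_nat_ivl[of "%k. D k * c k j" 0 K m]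
      by (simp add: D_def lessThan_atLeast0 add.commute)
    also have "(\<Sum>k<K. D k * c k j) = (\<Sum>i<K. e (K + m) i * c i j) - (\<Sum>k<m. \<Sum>i<K. d k * (e (K + k) i * c i j))"
      by (subst sum.swap) (simp add: D_def left_diff_distrib sum_subtractf sum_distrib_right mult.assoc)
    finally show ?thesis using md'[OF that] by (simp add: c'_def right_diff_distrib sum_subtractf sum_distrib_left)
  qed
  then show ?case by blast
qed auto

interpretation Zm: module "%k x. of_int k * (x :: 'a::field_char_0)" by unfold_locales (simp_all add: algebra_simps)

lemma Zm_span_mult: assumes "x \<in> Zm.span V" "y \<in> Zm.span W" shows "x * y \<in> Zm.span ((%(v, w). v * w) ` (V \<times> W))"
  using assms(1)
proof (induction rule: Zm.span_induct_alt)
  case (step c v x)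
  have "v * y \<in> Zm.span ((%(v, w). v * w) ` (V \<times> W))" using assms(2)
  proof (induction rule: Zm.span_induct_alt)
    case (step d w y)
    then have "v * w \<in> (%(v, w). v * w) ` (V \<times> W)" using \<open>v \<in> V\<close> by auto
    from Zm.span_add[OF Zm.span_scale[OF Zm.span_base[OF this], of d] step(2)]
    show ?case by (simp add: algebra_simps)
  qed (simp add: Zm.span_zero)
  from Zm.span_add[OF Zm.span_scale[OF this, of c] step(2)]
  show ?case by (simp add: algebra_simps)
qed (simp add: Zm.span_zero)

lemma algebraic_int_if_powers_in_span:
  fixes s :: "'a::field_char_0"
  assumes W: "finite W" and s: "!!k. s ^ k \<in> Zm.span W"
  shows "algebraic_int s"
proof -
  have "\<exists>c. s ^ k = (\<Sum>w\<in>W. of_int (c w) * w)" for k using s[of k] unfolding Zm.span_finite[OF W] by auto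
  then obtain c where c: "!!k. s ^ k = (\<Sum>w\<in>W. of_int (c k w) * w)" by metis
  obtain m d where md: "\<forall>w\<in>W. c m w = (\<Sum>k<m. d k * c k w)" using int_vectors_dependent[OF W] by blast
  have "of_int (c m w) * w = (\<Sum>k<m. of_int (d k) * (of_int (c k w) * w))" if "w \<in> W" for w
  proof -
    have "(of_int (c m w) :: 'a) = (\<Sum>k<m. of_int (d k) * of_int (c k w))" using md that by simp
    then show ?thesis by (simp only: sum_distrib_right mult.assoc)
  qed
  then have "s ^ m = (\<Sum>w\<in>W. \<Sum>k<m. of_int (d k) * (of_int (c k w) * w))" by (subst c) (rule sum.cong[OF refl])
  also have "... = (\<Sum>k<m. of_int (d k) * s ^ k)" by (subst sum.swap) (simp add: c sum_distrib_left)
  finally have eq: "s ^ m = (\<Sum>k<m. of_int (d k) * s ^ k)" .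
  define p where "p = monom 1 m - (\<Sum>k<m. monom (d k) k)"
  have p: "coeff p i = (if i = m then 1 else if i < m then - d i else 0)" for i by (auto simp: p_def coeff_sum)
  have "degree p = m" by (intro antisym degree_le le_degree) (auto simp: p)
  moreover have "map_poly of_int p = (monom 1 m - (\<Sum>k<m. monom (of_int (d k)) k) :: 'a poly)"
    by (rule poly_eqI) (auto simp: coeff_map_poly p coeff_sum)
  then have "poly (map_poly of_int p) s = 0" by (simp add: eq poly_sum poly_monom)
  ultimately show ?thesis unfolding algebraic_int_altdef_ipoly by (intro exI[of _ p]) (simp add: p)
qed

lemma algebraic_int_power_in_span:
  fixes x :: "'a::field_char_0"
  assumes "algebraic_int x" shows "\<exists>n. \<forall>k. x ^ k \<in> Zm.span ((%i. x ^ i) ` {..<n})"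
proof -
  obtain p where p: "poly (map_poly of_int p) x = 0" "lead_coeff p = 1" using assms unfolding algebraic_int_altdef_ipoly by blast
  define n where "n = degree p"
  have "0 = (\<Sum>i\<le>n. of_int (coeff p i) * x ^ i)"
    using p(1) by (simp add: poly_altdef coeff_map_poly degree_map_poly n_def)
  also have "... = x ^ n + (\<Sum>i<n. of_int (coeff p i) * x ^ i)" using p(2) by (simp add: lessThan_Suc_atMost[symmetric] n_def)
  finally have xn: "x ^ n = (\<Sum>i<n. of_int (- coeff p i) * x ^ i)" by (simp add: sum_negf eq_neg_iff_add_eq_0)
  have "x ^ k \<in> Zm.span ((%i. x ^ i) ` {..<n})" for k
  proof (induction k rule: less_induct)
    case (less k)
    show ?case
    proof (cases "k < n")
      case False
      then have "x ^ k = x ^ n * x ^ (k - n)" by (simp flip: power_add)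
      also have "... = (\<Sum>i<n. of_int (- coeff p i) * x ^ (i + (k - n)))"
        unfolding xn sum_distrib_right power_add mult.assoc ..
      also have "... \<in> Zm.span ((%i. x ^ i) ` {..<n})" by (intro Zm.span_sum Zm.span_scale less.IH) (use False in auto)
      finally show ?thesis .
    qed (auto intro: Zm.span_base)
  qed
  then show ?thesis by blast
qed

lemma algebraic_int_products_in_span:
  fixes x y :: "'a::field_char_0"
  assumes "algebraic_int x" "algebraic_int y"
  shows "\<exists>W. finite W & (\<forall>i j. x ^ i * y ^ j \<in> Zm.span W)"
proof -
  obtain n m where "!!k. x ^ k \<in> Zm.span ((%i. x ^ i) ` {..<n})" "!!k. y ^ k \<in> Zm.span ((%i. y ^ i) ` {..<m})"
    using algebraic_int_power_in_span assms by blast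
  then show ?thesis using Zm_span_mult by (metis finite_cartesian_product finite_imageI finite_lessThan)
qed

lemma algebraic_int_times:
  assumes "algebraic_int x" "algebraic_int (y :: 'a::field_char_0)" shows "algebraic_int (x * y)"
  using algebraic_int_products_in_span[OF assms] algebraic_int_if_powers_in_span by (metis power_mult_distrib)

lemma algebraic_int_plus:
  assumes "algebraic_int x" "algebraic_int (y :: 'a::field_char_0)" shows "algebraic_int (x + y)"
proof -
  obtain W where W: "finite W" "!!i j. x ^ i * y ^ j \<in> Zm.span W" using algebraic_int_products_in_span[OF assms] by blast
  have "(x + y) ^ k \<in> Zm.span W" for k
  proof -
    have "(x + y) ^ k = (\<Sum>i\<le>k. of_int (int (k choose i)) * (x ^ i * y ^ (k - i)))"
      by (simp add: binomial_ring mult.assoc)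
    also have "... \<in> Zm.span W" by (intro Zm.span_sum Zm.span_scale W)
    finally show ?thesis .
  qed
  with W(1) show ?thesis by (rule algebraic_int_if_powers_in_span)
qed

lemma algebraic_int_diff: "algebraic_int x ==> algebraic_int y ==> algebraic_int (x - y :: 'a::field_char_0)"
  using algebraic_int_plus[of x "- y"] by simp

lemma algebraic_int_sum: "(!!i. i \<in> I ==> algebraic_int (f i)) ==> algebraic_int (sum f I :: 'a::field_char_0)"
  by (induction I rule: infinite_finite_induct) (auto intro: algebraic_int_plus)

lemma algebraic_int_prod: "(!!i. i \<in> I ==> algebraic_int (f i)) ==> algebraic_int (prod f I :: 'a::field_char_0)"
  by (induction I rule: infinite_finite_induct) (auto intro: algebraic_int_times int_imp_algebraic_int)

lemma algebraic_int_of_int: "algebraic_int (of_int k :: 'a::field_char_0)" by (rule int_imp_algebraic_int) simp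

lemma algebraic_int_pow: "algebraic_int x ==> algebraic_int (x ^ k :: 'a::field_char_0)"
  by (induction k) (auto intro: algebraic_int_times int_imp_algebraic_int)

section \<open>Polynomials over a subfield\<close>

definition subfield_set :: "'a::field set => bool" where
  "subfield_set F \<longleftrightarrow> 0 \<in> F & 1 \<in> F & (\<forall>x\<in>F. \<forall>y\<in>F. x + y \<in> F & x - y \<in> F & x * y \<in> F)
     & (\<forall>x\<in>F. inverse x \<in> F)"

definition polys_over :: "'a::field set => 'a poly set" where
  "polys_over F = {p. \<forall>i. coeff p i \<in> F}"

lemma subfield_set_sum: "subfield_set F ==> (!!i. i \<in> I ==> f i \<in> F) ==> sum f I \<in> F"
  by (induction I rule: infinite_finite_induct) (auto simp: subfield_set_def)

lemma polys_over_closed: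
  assumes "subfield_set F" "p \<in> polys_over F" "q \<in> polys_over F"
  shows "p + q \<in> polys_over F" "p - q \<in> polys_over F" "p * q \<in> polys_over F"
  using assms by (auto simp: polys_over_def coeff_mult subfield_set_def intro!: subfield_set_sum)

lemma polys_over_monom: "subfield_set F ==> c \<in> F ==> monom c k \<in> polys_over F"
  by (auto simp: polys_over_def subfield_set_def)

lemma polys_over_division:
  assumes F: "subfield_set F" and d: "d \<in> polys_over F" "d ~= 0" and p: "p \<in> polys_over F"
  shows "\<exists>q\<in>polys_over F. \<exists>r\<in>polys_over F. p = q * d + r & (r = 0 | degree r < degree d)" using p
proof (induction "degree p" arbitrary: p rule: less_induct)
  case less
  have z: "0 \<in> polys_over F" using F by (simp add: polys_over_def subfield_set_def)
  show ?case
  proof (cases "p = 0 | degree p < degree d")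
    case True
    then show ?thesis using z less.prems by (intro bexI[of _ 0] bexI[of _ p]) auto
  next
    case False
    define c where "c = lead_coeff p * inverse (lead_coeff d)"
    have c: "c \<in> F" "c * lead_coeff d = lead_coeff p" "c ~= 0"
      using F d less.prems False by (auto simp: c_def subfield_set_def polys_over_def)
    define m where "m = monom c (degree p - degree d)"
    have m: "m \<in> polys_over F" using F c by (simp add: m_def polys_over_monom)
    have deg_m: "degree (m * d) = degree p" using False d c by (auto simp: m_def degree_mult_eq degree_monom_eq)
    have lead_m: "lead_coeff (m * d) = lead_coeff p" unfolding lead_coeff_mult using c by (simp add: m_def degree_monom_eq)
    have p': "p - m * d \<in> polys_over F" using F m d less.prems by (intro polys_over_closed)
    have small: "p - m * d = 0 | degree (p - m * d) < degree p"
      using deg_m lead_m by (metis (no_types, lifting) coeff_diff degree_diff_le_max diff_self leading_coeff_0_iff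
          less_le_not_le linorder_le_less_linear max.idem order_antisym)
    show ?thesis
    proof (cases "p - m * d = 0")
      case True
      then show ?thesis using m z by (intro bexI[of _ m] bexI[of _ 0]) auto
    next
      case False
      then obtain q r where qr: "q \<in> polys_over F" "r \<in> polys_over F"
          "p - m * d = q * d + r" "r = 0 | degree r < degree d" using less.hyps[OF _ p'] small by blast
      then have "p = (q + m) * d + r" by (simp add: algebra_simps)
      then show ?thesis using qr F m by (metis polys_over_closed(1))
    qed
  qed
qed

text \<open>Since the Euclidean algorithm does not leave the subfield, the greatest common divisor
  of two polynomials over a subfield has its coefficients there.\<close>

lemma polys_over_gcd:
  assumes F: "subfield_set F" and p: "p \<in> polys_over F" "p ~= 0" and q: "q \<in> polys_over F"
  shows "\<exists>d\<in>polys_over F. \<exists>A\<in>polys_over F. \<exists>B\<in>polys_over F. lead_coeff d = 1 & d = A * p + B * q & d dvd p & d dvd q"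
proof -
  define I where "I = {d. \<exists>A\<in>polys_over F. \<exists>B\<in>polys_over F. d = A * p + B * q}"
  have one: "1 \<in> polys_over F" and zero: "0 \<in> polys_over F"
    using F by (auto simp: polys_over_def subfield_set_def coeff_1)
  have pI: "p \<in> I" unfolding I_def using one zero by force
  have qI: "q \<in> I" unfolding I_def using one zero by force
  have IF: "I \<subseteq> polys_over F" unfolding I_def using F p q by (auto intro!: polys_over_closed)
  define k where "k = (LEAST k. \<exists>d\<in>I. d ~= 0 & degree d = k)"
  have "\<exists>d\<in>I. d ~= 0 & degree d = k" unfolding k_def by (rule LeastI_ex) (use pI p in blast)
  then obtain d0 where d0: "d0 \<in> I" "d0 ~= 0" "degree d0 = k" by blast
  have min: "\<not> (degree d < k)" if "d \<in> I" "d ~= 0" for d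
    unfolding k_def using that by (metis (mono_tags, lifting) not_less_Least)
  have lin: "a - r * b \<in> I" if aI: "a \<in> I" and bI: "b \<in> I" and r: "r \<in> polys_over F" for a b r
  proof -
    obtain A B where AB: "A \<in> polys_over F" "B \<in> polys_over F" "a = A * p + B * q" using aI unfolding I_def by blast
    obtain A' B' where "A' \<in> polys_over F" "B' \<in> polys_over F" "b = A' * p + B' * q" using bI unfolding I_def by blast
    with AB have "a - r * b = (A - r * A') * p + (B - r * B') * q"
      "A - r * A' \<in> polys_over F" "B - r * B' \<in> polys_over F"
      using r F by (auto simp: algebra_simps intro!: polys_over_closed)
    then show ?thesis unfolding I_def by blast
  qed
  have dvd: "d0 dvd a" if aI: "a \<in> I" for a
  proof -
    obtain s r where sr: "s \<in> polys_over F" "a = s * d0 + r" "r = 0 | degree r < degree d0"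
      using polys_over_division[OF F subsetD[OF IF d0(1)] d0(2) subsetD[OF IF aI]] by blast
    have "r = a - s * d0" using sr by simp
    then have "r \<in> I" using lin[OF aI d0(1) sr(1)] by simp
    then have "r = 0" using sr(3) min d0 by blast
    then show ?thesis using sr by simp
  qed
  define c where "c = inverse (lead_coeff d0)"
  have c: "c \<in> F" "c ~= 0" "c * lead_coeff d0 = 1" using F d0 IF by (auto simp: c_def subfield_set_def polys_over_def)
  define d where "d = [:c:] * d0"
  have cF: "[:c:] \<in> polys_over F" using polys_over_monom[OF F c(1), of 0] by (simp add: monom_0)
  obtain A B where AB: "A \<in> polys_over F" "B \<in> polys_over F" "d0 = A * p + B * q" using d0(1) unfolding I_def by blast
  have "d = ([:c:] * A) * p + ([:c:] * B) * q" by (simp add: d_def AB(3) smult_add_right)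
  moreover have "[:c:] * A \<in> polys_over F" "[:c:] * B \<in> polys_over F" "d \<in> polys_over F"
    unfolding d_def using cF AB F IF d0(1) by (blast intro: polys_over_closed)+
  moreover have "lead_coeff d = 1" using c by (simp add: d_def)
  moreover have "d dvd p" "d dvd q" using dvd[OF pI] dvd[OF qI] c by (auto simp: d_def smult_dvd_iff)
  ultimately show ?thesis by blast
qed

section \<open>Evaluation of rational polynomials\<close>

definition ev :: "rat poly => 'a::field_char_0 => 'a" where
  "ev h z = poly (map_poly of_rat h) z"

lemma map_poly_of_rat_add: "map_poly of_rat (p + q) = (map_poly of_rat p + map_poly of_rat q :: 'a::field_char_0 poly)"
  by (rule poly_eqI) (simp add: coeff_map_poly of_rat_add)

lemma map_poly_of_rat_diff: "map_poly of_rat (p - q) = (map_poly of_rat p - map_poly of_rat q :: 'a::field_char_0 poly)"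
  by (rule poly_eqI) (simp add: coeff_map_poly of_rat_diff)

lemma map_poly_of_rat_mult: "map_poly of_rat (p * q) = (map_poly of_rat p * map_poly of_rat q :: 'a::field_char_0 poly)"
  by (rule poly_eqI) (simp add: coeff_map_poly coeff_mult of_rat_sum of_rat_mult)

lemma ev_add [simp]: "ev (p + q) z = ev p z + ev q z" by (simp add: ev_def map_poly_of_rat_add)
lemma ev_diff [simp]: "ev (p - q) z = ev p z - ev q z" by (simp add: ev_def map_poly_of_rat_diff)
lemma ev_mult [simp]: "ev (p * q) z = ev p z * ev q z" by (simp add: ev_def map_poly_of_rat_mult)
lemma ev_0 [simp]: "ev 0 z = 0" by (simp add: ev_def)
lemma ev_1 [simp]: "ev 1 z = 1" by (simp add: ev_def)
lemma ev_const [simp]: "ev [:c:] z = of_rat c" by (simp add: ev_def map_poly_pCons)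
lemma ev_pCons [simp]: "ev (pCons c p) z = of_rat c + z * ev p z" by (simp add: ev_def map_poly_pCons)
lemma ev_monom [simp]: "ev (monom c k) z = of_rat c * z ^ k" by (simp add: ev_def map_poly_monom poly_monom)
lemma ev_power [simp]: "ev (p ^ k) z = ev p z ^ k" by (induction k) auto
lemma ev_uminus [simp]: "ev (- p) z = - ev p z" using ev_diff[of 0 p z] by simp
lemma ev_smult [simp]: "ev (smult c p) z = of_rat c * ev p z" using ev_mult[of "[:c:]" p z] by simp
lemma ev_sum: "ev (sum f I) z = (\<Sum>i\<in>I. ev (f i) z)" by (induction I rule: infinite_finite_induct) auto
lemma ev_pcompose [simp]: "ev (pcompose p q) z = ev p (ev q z)" by (induction p) (auto simp: pcompose_pCons)

lemma ev_altdef: "ev h z = (\<Sum>i\<le>degree h. of_rat (coeff h i) * z ^ i)"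
  by (simp add: ev_def poly_altdef degree_map_poly coeff_map_poly)

lemma ev_altdef': "degree h < n ==> ev h z = (\<Sum>i<n. of_rat (coeff h i) * z ^ i)"
  unfolding ev_altdef by (rule sum.mono_neutral_left) (auto simp: coeff_eq_0)

lemma cnj_of_rat [simp]: "cnj (of_rat r) = of_rat r" by (cases r) (simp add: of_rat_rat)

lemma ev_cnj: "ev h (cnj z) = cnj (ev h z)" by (simp add: ev_altdef)

lemma of_int_poly_conv_ev: "poly (map_poly of_int p) z = ev (map_poly of_int p) z"
proof -
  have "map_poly of_rat (map_poly of_int p) = (map_poly of_int p :: 'a poly)" by (rule poly_eqI) (simp add: coeff_map_poly)
  then show ?thesis by (simp add: ev_def)
qed

lemma irreducible_ev_bezout:
  assumes irr: "irreducible (G :: rat poly)" and nd: "\<not> G dvd h"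
  shows "\<exists>A B. A * G + B * h = 1"
proof -
  have F: "subfield_set (UNIV :: rat set)" by (simp add: subfield_set_def)
  have U: "polys_over (UNIV :: rat set) = UNIV" by (simp add: polys_over_def)
  have G0: "G ~= 0" using irr by auto
  obtain d A B where d: "lead_coeff d = 1" "d = A * G + B * h" "d dvd G" "d dvd h" using polys_over_gcd[OF F, of G h] G0 U by auto
  obtain e where e: "G = d * e" using d(3) by blast
  have "d dvd 1"
  proof (rule ccontr)
    assume "\<not> d dvd 1"
    then have "e dvd 1" using irreducibleD[OF irr e] by blast
    then have "G dvd d" using e by (metis dvd_mult_unit_iff dvd_refl)
    then show False using d(4) nd by (meson dvd_trans)
  qed
  then obtain k where "1 = d * k" by blast
  then have "(k * A) * G + (k * B) * h = 1" using d(2) by (simp add: algebra_simps)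
  then show ?thesis by blast
qed

lemma irreducible_ev_zero_iff:
  assumes irr: "irreducible G" and z: "ev G (z::'a::field_char_0) = 0"
  shows "ev h z = 0 \<longleftrightarrow> G dvd h"
proof
  assume h: "ev h z = 0"
  show "G dvd h"
  proof (rule ccontr)
    assume "\<not> G dvd h"
    then obtain A B where "A * G + B * h = 1" using irreducible_ev_bezout[OF irr] by blast
    then have "ev (A * G + B * h) z = 1" by simp
    then show False using h z by simp
  qed
next
  assume "G dvd h"
  then show "ev h z = 0" using z by (auto elim!: dvdE)
qed

section \<open>Newton's identities\<close>

text \<open>Up to the sign (-1)^k this is the k-th elementary symmetric function. With this sign it
  is a coefficient of the monic polynomial with roots \<open>f i\<close>, so it can be read off from
  \<open>g\<close> directly.\<close>

definition esym :: "('i => 'a::field_char_0) => 'i set => nat => 'a" where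
  "esym f S k = fps_nth (\<Prod>i\<in>S. 1 - fps_const (f i) * fps_X) k"

definition psum :: "('i => 'a::field_char_0) => 'i set => nat => 'a" where
  "psum f S k = (\<Sum>i\<in>S. f i ^ k)"

text \<open>Logarithmic derivative of \<open>P S\<close>: the generating function of the powers of
  \<open>f i\<close> is 1 / (1 - f i X), which is 1 plus f i X / (1 - f i X). Multiplying the sum of
  these by \<open>P S\<close> avoids division.\<close>

lemma newton_fps:
  fixes f :: "'i => 'a::field_char_0"
  assumes "finite S"
  defines "P \<equiv> %S. (\<Prod>i\<in>S. 1 - fps_const (f i) * fps_X)"
  shows "P S * Abs_fps (psum f S) = of_nat (card S) * P S - fps_X * fps_deriv (P S)" using assms(1)
proof (induction S)
  case empty
  have "Abs_fps (psum f {}) = 0" by (rule fps_ext) (simp add: psum_def)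
  then show ?case by (simp add: P_def)
next
  case (insert j S)
  define A where "A = fps_const (f j) * fps_X"
  define E where "E = Abs_fps (%k. f j ^ k)"
  have AE: "(1 - A) * E = 1"
  proof (rule fps_ext)
    fix k show "fps_nth ((1 - A) * E) k = fps_nth 1 k" by (cases k) (auto simp: A_def E_def algebra_simps)
  qed
  have P: "P (insert j S) = P S * (1 - A)" using insert by (simp add: P_def A_def mult.commute)
  have Q: "Abs_fps (psum f (insert j S)) = Abs_fps (psum f S) + E" using insert by (intro fps_ext) (simp add: psum_def E_def)
  have XA: "fps_X * fps_deriv A = A" by (simp add: A_def)
  have "P (insert j S) * Abs_fps (psum f (insert j S)) = (P S * Abs_fps (psum f S)) * (1 - A) + P S * ((1 - A) * E)"
    unfolding P Q by (simp add: algebra_simps)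
  also have "... = (of_nat (card S) * P S - fps_X * fps_deriv (P S)) * (1 - A) + P S" unfolding insert.IH AE by simp
  also have "... = of_nat (card (insert j S)) * P (insert j S) - fps_X * fps_deriv (P (insert j S))"
  proof -
    have "fps_X * fps_deriv (P S * (1 - A)) = fps_X * fps_deriv (P S) * (1 - A) - P S * (fps_X * fps_deriv A)"
      by (simp add: algebra_simps)
    then show ?thesis unfolding P XA using insert(1,2) by (simp add: algebra_simps)
  qed
  finally show ?case .
qed

lemma newton_identity:
  fixes f :: "'i => 'a::field_char_0"
  assumes "finite S"
  shows "(\<Sum>i\<le>k. esym f S i * psum f S (k - i)) = (of_nat (card S) - of_nat k) * esym f S k"
proof -
  define F where "F = (\<Prod>i\<in>S. 1 - fps_const (f i) * fps_X)"
  have F: "esym f S i = fps_nth F i" for i by (simp add: esym_def F_def)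
  have "fps_nth (F * Abs_fps (psum f S)) k = fps_nth (of_nat (card S) * F - fps_X * fps_deriv F) k"
    using newton_fps[OF assms, of f] by (simp add: F_def)
  moreover have "fps_nth (F * Abs_fps (psum f S)) k = (\<Sum>i\<le>k. esym f S i * psum f S (k - i))"
    by (simp add: fps_mult_nth F atLeast0AtMost)
  moreover have "fps_nth (of_nat (card S) * F - fps_X * fps_deriv F) k = (of_nat (card S) - of_nat k) * esym f S k"
    by (cases k) (simp_all add: F fps_of_nat[symmetric] algebra_simps)
  ultimately show ?thesis by simp
qed

lemma esym_0 [simp]: "esym f S 0 = 1" by (induction S rule: infinite_finite_induct) (simp_all add: esym_def)

lemma esym_rec:
  fixes f :: "'i => 'a::field_char_0"
  assumes "finite S" "k > 0"
  shows "esym f S k = - (\<Sum>i<k. esym f S i * psum f S (k - i)) / of_nat k"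
proof -
  have "{..k} = insert k {..<k}" by auto
  then have "esym f S k * of_nat (card S) + (\<Sum>i<k. esym f S i * psum f S (k - i)) =
    (of_nat (card S) - of_nat k) * esym f S k" using newton_identity[OF assms(1), of f k] by (simp add: psum_def)
  then have "esym f S k * of_nat k = - (\<Sum>i<k. esym f S i * psum f S (k - i))" by (simp add: algebra_simps add_eq_0_iff)
  then show ?thesis using assms(2) by (simp add: field_simps)
qed

lemma psum_rec:
  fixes f :: "'i => 'a::field_char_0"
  assumes "finite S"
  shows "psum f S k = (of_nat (card S) - of_nat k) * esym f S k - (\<Sum>i<k. esym f S (Suc i) * psum f S (k - Suc i))"
proof -
  have "(\<Sum>i\<le>k. esym f S i * psum f S (k - i)) = psum f S k + (\<Sum>i<k. esym f S (Suc i) * psum f S (k - Suc i))"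
    by (subst sum.atMost_shift) simp
  then show ?thesis using newton_identity[OF assms, of f k] by simp
qed

lemma esym_conv_coeff:
  fixes f :: "'i => 'a::field_char_0"
  shows "esym f S k = coeff (\<Prod>i\<in>S. [:1, - f i:]) k"
proof -
  have "(\<Prod>i\<in>S. 1 - fps_const (f i) * fps_X) = fps_of_poly (\<Prod>i\<in>S. [:1, - f i:])"
    by (simp add: fps_of_poly_prod fps_of_poly_pCons)
       (intro prod.cong, auto simp: fps_of_poly_pCons algebra_simps)
  then show ?thesis by (simp add: esym_def)
qed

lemma esym_conv_coeff':
  fixes f :: "'i => 'a::field_char_0"
  assumes "finite S"
  shows "esym f S k = (if k <= card S then coeff (\<Prod>i\<in>S. [:- f i, 1:]) (card S - k) else 0)"
proof -
  have r: "reflect_poly [:- f i, 1:] = [:1, - f i:]" for i by (simp add: reflect_poly_def cCons_def)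
  have d: "degree (\<Prod>i\<in>S. [:- f i, 1:]) = card S" by (subst degree_prod_eq_sum_degree) auto
  have "(\<Prod>i\<in>S. [:1, - f i:]) = reflect_poly (\<Prod>i\<in>S. [:- f i, 1:])" by (simp add: reflect_poly_prod r)
  then show ?thesis using d by (simp add: esym_conv_coeff coeff_reflect_poly)
qed

lemma esym_last:
  fixes f :: "'i => 'a::field_char_0"
  assumes "finite S"
  shows "esym f S (card S) = (\<Prod>i\<in>S. - f i)"
proof -
  have "esym f S (card S) = coeff (\<Prod>i\<in>S. [:- f i, 1:]) 0" using assms by (simp add: esym_conv_coeff')
  also have "... = poly (\<Prod>i\<in>S. [:- f i, 1:]) 0" by (rule poly_0_coeff_0[symmetric])
  also have "... = (\<Prod>i\<in>S. - f i)" by (simp add: poly_prod)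
  finally show ?thesis .
qed

lemma algebraic_int_coeff_prod:
  fixes f :: "'i => 'a::field_char_0"
  assumes "!!i. i \<in> S ==> algebraic_int (f i)"
  shows "algebraic_int (coeff (\<Prod>i\<in>S. [:- f i, 1:]) k)" using assms
proof (induction S arbitrary: k rule: infinite_finite_induct)
  case (insert j S)
  then show ?case by (cases k) (auto intro!: algebraic_int_plus algebraic_int_diff algebraic_int_times)
qed (auto simp: coeff_1 intro: int_imp_algebraic_int)

section \<open>A number field and its Minkowski space\<close>

locale numfield =
  fixes g :: "int poly"
  assumes monic: "lead_coeff g = 1" and irr: "irreducible (map_poly of_int g :: rat poly)"
begin

abbreviation G :: "rat poly" where "G \<equiv> map_poly of_int g"

definition Z :: "complex set" where "Z = {z. ev G z = 0}"

definition n :: nat where "n = degree g"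

text \<open>Elements of the Minkowski space are functions on the complex plane of which only the values
  on \<open>Z\<close> matter; the field and its ring of integers are embedded by evaluation.\<close>

definition EE :: "(complex => complex) set" where
  "EE = {x. \<forall>z\<in>Z. x (cnj z) = cnj (x z)}"

definition KF :: "(complex => complex) set" where
  "KF = {a. \<exists>h. \<forall>z\<in>Z. a z = ev h z}"

definition OK :: "(complex => complex) set" where
  "OK = {a \<in> KF. \<forall>z\<in>Z. algebraic_int (a z)}"

definition UK :: "(complex => complex) set" where
  "UK = {u \<in> OK. \<exists>v\<in>OK. \<forall>z\<in>Z. u z * v z = 1}"

definition N :: "(complex => complex) => real" where
  "N x = (\<Prod>z\<in>Z. cmod (x z))"

lemma G_monic: "lead_coeff G = 1" using monic by (simp add: degree_map_poly coeff_map_poly)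

lemma degree_G: "degree G = n" by (simp add: n_def degree_map_poly)

lemma n_pos: "n > 0"
proof (rule ccontr)
  assume "\<not> n > 0"
  then have "degree G = 0" using degree_G by simp
  then obtain c where c: "G = [:c:]" by (auto elim: degree_eq_zeroE)
  then have "G = 1" using G_monic by (simp add: one_pCons)
  then show False using irr by simp
qed

lemma ev_zero_iff: "z \<in> Z ==> ev h z = 0 \<longleftrightarrow> G dvd h"
  unfolding Z_def by (simp add: irreducible_ev_zero_iff[OF irr])

lemma cpoly_rsquarefree: "rsquarefree (map_poly of_rat G :: complex poly)" unfolding rsquarefree_roots
proof (intro allI notI)
  fix a :: complex
  assume a: "poly (map_poly of_rat G) a = 0 & poly (pderiv (map_poly of_rat G)) a = 0"
  have "pderiv (map_poly of_rat G) = (map_poly of_rat (pderiv G) :: complex poly)"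
    by (rule poly_eqI) (simp add: coeff_pderiv coeff_map_poly of_rat_mult of_rat_add)
  then have "ev G a = 0" "ev (pderiv G) a = 0" using a by (auto simp: ev_def)
  then have "G dvd pderiv G" using irreducible_ev_zero_iff[OF irr] by blast
  moreover have "pderiv G ~= 0" using n_pos degree_G by (simp add: pderiv_eq_0_iff)
  moreover have "degree (pderiv G) < degree G" using n_pos degree_G by (simp add: degree_pderiv)
  ultimately show False by (meson dvd_imp_degree_le leD)
qed

lemma cpoly_factor: "(map_poly of_rat G :: complex poly) = (\<Prod>z\<in>Z. [:- z, 1:])"
  using complex_poly_decompose_rsquarefree[OF cpoly_rsquarefree] G_monic
  by (simp add: Z_def ev_def degree_map_poly coeff_map_poly)

lemma finite_Z: "finite Z"
proof -
  have "(map_poly of_rat G :: complex poly) ~= 0" using cpoly_rsquarefree by (auto simp: rsquarefree_def)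
  from poly_roots_finite[OF this] show ?thesis by (simp add: Z_def ev_def)
qed

lemma card_Z: "card Z = n"
proof -
  have "n = degree (map_poly of_rat G :: complex poly)" by (simp add: degree_map_poly degree_G)
  also have "... = card Z" unfolding cpoly_factor by (subst degree_prod_eq_sum_degree) auto
  finally show ?thesis by simp
qed

lemma Z_nonempty: "Z ~= {}" using card_Z n_pos by auto

lemma cnj_Z: "z \<in> Z ==> cnj z \<in> Z" by (simp add: Z_def ev_cnj)

lemma algebraic_int_Z: "z \<in> Z ==> algebraic_int z"
  unfolding algebraic_int_altdef_ipoly Z_def using monic by (auto simp: of_int_poly_conv_ev)

subsection \<open>Closure properties\<close>

lemma KFI: "(!!z. z \<in> Z ==> a z = ev h z) ==> a \<in> KF" by (auto simp: KF_def)

lemma KF_ev: "(%z. ev h z) \<in> KF" by (auto simp: KF_def)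

lemma KF_cong: "a \<in> KF ==> (!!z. z \<in> Z ==> a z = b z) ==> b \<in> KF" by (simp add: KF_def)

lemma OK_cong: "a \<in> OK ==> (!!z. z \<in> Z ==> a z = b z) ==> b \<in> OK" using KF_cong by (fastforce simp add: OK_def)

lemma KF_add: "a \<in> KF ==> b \<in> KF ==> a + b \<in> KF" unfolding KF_def by clarsimp (metis ev_add)
lemma KF_diff: "a \<in> KF ==> b \<in> KF ==> a - b \<in> KF" unfolding KF_def by clarsimp (metis ev_diff)
lemma KF_mult: "a \<in> KF ==> b \<in> KF ==> a * b \<in> KF" unfolding KF_def by clarsimp (metis ev_mult)
lemma KF_of_rat: "(%z. of_rat r) \<in> KF" by (rule KFI[of _ "[:r:]"]) simp
lemma KF_0: "0 \<in> KF" by (rule KFI[of _ 0]) simp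
lemma KF_1: "1 \<in> KF" by (rule KFI[of _ 1]) simp
lemma KF_power: "a \<in> KF ==> a ^ k \<in> KF" by (induction k) (auto intro: KF_mult KF_1)

lemma power_fun_apply [simp]: "(a ^ k) x = (a x :: complex) ^ k" for a :: "complex => complex" by (induction k) auto

text \<open>The conjugates of a field element vanish together because \<open>G\<close> is
  irreducible: a polynomial that vanishes at one root is divisible by \<open>G\<close>.\<close>

lemma KF_zero: "a \<in> KF ==> z \<in> Z ==> w \<in> Z ==> a z = 0 ==> a w = 0" using ev_zero_iff by (auto simp: KF_def)

lemma KF_eq: "a \<in> KF ==> b \<in> KF ==> z \<in> Z ==> w \<in> Z ==> a z = b z ==> a w = b w"
  using KF_zero[of "a - b" z w] KF_diff by auto

lemma KF_inverse: assumes "a \<in> KF" "z \<in> Z" "a z ~= 0"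
  shows "(%z. inverse (a z)) \<in> KF"
proof -
  obtain h where h: "!!z. z \<in> Z ==> a z = ev h z" using assms by (auto simp: KF_def)
  then have "\<not> G dvd h" using assms ev_zero_iff by auto
  then obtain A B where "A * G + B * h = 1" using irreducible_ev_bezout[OF irr] by blast
  then have "ev (A * G + B * h) w = 1" for w :: complex by simp
  then have "ev B w * ev h w = 1" if "w \<in> Z" for w using that by (simp add: Z_def) (metis add_0 mult_zero_right)
  then show ?thesis using h by (intro KFI[of _ B]) (metis inverse_unique mult.commute)
qed

lemma KF_divide: "a \<in> KF ==> b \<in> KF ==> z \<in> Z ==> b z ~= 0 ==> (%z. a z / b z) \<in> KF"
  using KF_mult[OF _ KF_inverse, of a b z] by (simp add: times_fun_def divide_inverse)

lemma KF_EE: "KF \<subseteq> EE" by (auto simp: KF_def EE_def ev_cnj cnj_Z)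

lemma OK_KF: "OK \<subseteq> KF" by (auto simp: OK_def)
lemma OK_EE: "OK \<subseteq> EE" using OK_KF KF_EE by auto
lemma UK_OK: "UK \<subseteq> OK" by (auto simp: UK_def)

lemma EE_add: "x \<in> EE ==> y \<in> EE ==> x + y \<in> EE" by (auto simp: EE_def)
lemma EE_diff: "x \<in> EE ==> y \<in> EE ==> x - y \<in> EE" by (auto simp: EE_def)
lemma EE_mult: "x \<in> EE ==> y \<in> EE ==> x * y \<in> EE" by (auto simp: EE_def)
lemma EE_scale: "x \<in> EE ==> (%z. of_real s * x z) \<in> EE" by (auto simp: EE_def)
lemma EE_0: "0 \<in> EE" by (auto simp: EE_def)

lemma OK_add: "a \<in> OK ==> b \<in> OK ==> a + b \<in> OK" by (auto simp: OK_def KF_add algebraic_int_plus)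
lemma OK_diff: "a \<in> OK ==> b \<in> OK ==> a - b \<in> OK" by (auto simp: OK_def KF_diff algebraic_int_diff)
lemma OK_mult: "a \<in> OK ==> b \<in> OK ==> a * b \<in> OK" by (auto simp: OK_def KF_mult algebraic_int_times)
lemma OK_0: "0 \<in> OK" by (auto simp: OK_def KF_0)
lemma OK_1: "1 \<in> OK" by (auto simp: OK_def KF_1 int_imp_algebraic_int)
lemma OK_uminus: "a \<in> OK ==> - a \<in> OK" using OK_diff[OF OK_0, of a] by simp
lemma OK_of_int: "(%z. of_int k) \<in> OK" using KF_of_rat[of "of_int k"] by (auto simp: OK_def algebraic_int_of_int)
lemma OK_scale: "a \<in> OK ==> (%z. of_int k * a z) \<in> OK" using OK_mult[OF OK_of_int, of a k] by (simp add: times_fun_def)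

lemma OK_int_poly: "(%z. poly (map_poly of_int p) z) \<in> OK"
proof -
  have "(%z. poly (map_poly of_int p) z) \<in> KF" by (rule KFI[of _ "map_poly of_int p"]) (rule of_int_poly_conv_ev)
  moreover have "algebraic_int (poly (map_poly of_int p) z)" if "z \<in> Z" for z
    using algebraic_int_Z[OF that] unfolding poly_altdef
    by (intro algebraic_int_sum algebraic_int_times algebraic_int_pow) (auto simp: coeff_map_poly algebraic_int_of_int)
  ultimately show ?thesis by (auto simp: OK_def)
qed

lemma OK_int_sum: "(%z. \<Sum>i<m. of_int (c i) * z ^ i) \<in> OK"
proof -
  have "map_poly of_int (\<Sum>i<m. monom (c i) i) = (\<Sum>i<m. monom (of_int (c i)) i :: complex poly)"
    by (rule poly_eqI) (simp add: coeff_map_poly coeff_sum)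
  then show ?thesis using OK_int_poly[of "\<Sum>i<m. monom (c i) i"] by (simp add: poly_sum poly_monom)
qed

text \<open>One conjugate decides integrality: a monic integral equation at \<open>z\<close>,
  composed with the polynomial that represents \<open>a\<close>, vanishes at one root of
  \<open>G\<close> and hence at all.\<close>

lemma OK_I: assumes "a \<in> KF" "z \<in> Z" "algebraic_int (a z)" shows "a \<in> OK"
proof -
  obtain h where h: "!!z. z \<in> Z ==> a z = ev h z" using assms by (auto simp: KF_def)
  obtain p where p: "poly (map_poly of_int p) (a z) = 0" "lead_coeff p = 1"
    using assms(3) unfolding algebraic_int_altdef_ipoly by blast
  have "ev (pcompose (map_poly of_int p) h) z = 0" using p h assms by (simp flip: of_int_poly_conv_ev)
  then have "ev (pcompose (map_poly of_int p) h) w = 0" if "w \<in> Z" for w using ev_zero_iff that assms by blast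
  then have "poly (map_poly of_int p) (a w) = 0" if "w \<in> Z" for w using that h by (simp flip: of_int_poly_conv_ev)
  then show ?thesis using p assms(1) unfolding OK_def algebraic_int_altdef_ipoly by blast
qed

lemma OK_multiple: assumes "a \<in> KF" shows "\<exists>q::nat. q > 0 & (%z. of_nat q * a z) \<in> OK"
proof -
  obtain h where h: "!!z. z \<in> Z ==> a z = ev h z" using assms by (auto simp: KF_def)
  have "\<exists>q::nat. q > 0 & (\<exists>p. \<forall>z::complex. of_nat q * ev h z = poly (map_poly of_int p) z)"
  proof (induction h)
    case 0
    show ?case by (intro exI[of _ 1] conjI exI[of _ 0]) auto
  next
    case (pCons c h)
    obtain q p where q: "q > 0" "!!z::complex. of_nat q * ev h z = poly (map_poly of_int p) z" using pCons.IH by blast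
    obtain s t where st: "c = of_int s / of_int t" "t > 0" by (metis quotient_of_div quotient_of_denom_pos prod.exhaust)
    have ct: "of_int t * of_rat c = (of_int s :: complex)" using st by (simp add: of_rat_divide)
    show ?case
    proof (intro exI conjI allI)
      show "nat t * q > 0" using q st by simp
      fix z :: complex
      have "of_nat (nat t * q) * ev (pCons c h) z = of_int t * of_nat q * (of_rat c + z * ev h z)" using st by simp
      also have "... = of_nat q * (of_int t * of_rat c) + of_int t * z * (of_nat q * ev h z)" by (simp add: algebra_simps)
      also have "... = poly (map_poly of_int (pCons (int q * s) (smult t p))) z"
        unfolding ct q(2) by (simp add: map_poly_pCons map_poly_smult)
      finally show "of_nat (nat t * q) * ev (pCons c h) z = poly (map_poly of_int (pCons (int q * s) (smult t p))) z" .
    qed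
  qed
  then obtain q p where q: "q > 0" "!!z::complex. of_nat q * ev h z = poly (map_poly of_int p) z" by blast
  have "(%z. of_nat q * a z) \<in> OK" by (rule OK_cong[OF OK_int_poly[of p]]) (simp add: h q(2)[symmetric])
  then show ?thesis using q(1) by blast
qed

subsection \<open>Symmetric functions of the conjugates are rational\<close>

lemma esym_id: "esym (%z. z) Z k = (if k <= n then of_int (coeff g (n - k)) else 0)"
  by (simp add: esym_conv_coeff'[OF finite_Z] card_Z flip: cpoly_factor) (simp add: coeff_map_poly)

text \<open>Newton's identities in the form \<open>psum_rec\<close> contain no division, so
  integrality is inherited from the coefficients of \<open>g\<close>.\<close>

lemma psum_id_int: "psum (%z. z) Z k \<in> \<int>"
proof (induction k rule: less_induct)
  case (less k)
  have "esym (%z. z) Z i \<in> \<int>" for i by (simp add: esym_id)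
  then show ?case by (subst psum_rec[OF finite_Z]) (auto intro!: Ints_diff Ints_mult Ints_sum less)
qed

lemma psum_ev: "psum (ev h) Z k = (\<Sum>i\<le>degree (h ^ k). of_rat (coeff (h ^ k) i) * psum (%z. z) Z i)"
proof -
  have "psum (ev h) Z k = (\<Sum>z\<in>Z. ev (h ^ k) z)" by (simp add: psum_def)
  also have "... = (\<Sum>i\<le>degree (h ^ k). of_rat (coeff (h ^ k) i) * psum (%z. z) Z i)"
    unfolding ev_altdef by (subst sum.swap) (simp add: psum_def sum_distrib_left)
  finally show ?thesis .
qed

lemma psum_ev_rat: "psum (ev h) Z k \<in> \<rat>"
  unfolding psum_ev using psum_id_int Ints_subset_Rats by (intro Rats_sum Rats_mult) auto

lemma esym_ev_rat: "esym (ev h) Z k \<in> \<rat>"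
proof (induction k rule: less_induct)
  case (less k)
  show ?case
  proof (cases "k = 0")
    case False
    then show ?thesis
      by (subst esym_rec[OF finite_Z]) (auto intro!: Rats_divide Rats_minus_iff[THEN iffD2] Rats_sum Rats_mult less psum_ev_rat)
  qed simp
qed

lemma esym_cong: "(!!z. z \<in> S ==> f z = f' z) ==> esym f S k = esym f' S k" by (simp add: esym_def cong: prod.cong)

lemma esym_OK_int: assumes "a \<in> OK" shows "esym a Z k \<in> \<int>"
proof (rule rational_algebraic_int_is_int)
  show "algebraic_int (esym a Z k)"
    using assms by (auto simp: esym_conv_coeff'[OF finite_Z] OK_def intro!: algebraic_int_coeff_prod)
  obtain h where "!!z. z \<in> Z ==> a z = ev h z" using assms by (auto simp: KF_def OK_def)
  then show "esym a Z k \<in> \<rat>" using esym_ev_rat[of h k] esym_cong[of Z a "ev h"] by simp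
qed

text \<open>This is the integrality test that the algorithm runs: n + 1 rational numbers are
  inspected instead of complex conjugates.\<close>

lemma OK_iff_esym_int: assumes "a \<in> KF" shows "a \<in> OK \<longleftrightarrow> (\<forall>k\<le>n. esym a Z k \<in> \<int>)"
proof
  assume e: "\<forall>k\<le>n. esym a Z k \<in> \<int>"
  have "algebraic_int (a z)" if z: "z \<in> Z" for z
  proof -
    define p where "p = (\<Prod>z\<in>Z. [:- a z, 1:])"
    have d: "degree p = n" unfolding p_def card_Z[symmetric] by (subst degree_prod_eq_sum_degree) auto
    show ?thesis
    proof (rule algebraic_int.intros)
      show "lead_coeff p = 1" by (simp add: p_def lead_coeff_prod)
      show "poly p (a z) = 0" using z finite_Z by (auto simp: p_def poly_prod)
      show "\<forall>i. coeff p i \<in> \<int>"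
      proof
        fix i show "coeff p i \<in> \<int>"
        proof (cases "i <= n")
          case True
          then have "coeff p i = esym a Z (n - i)" by (simp add: esym_conv_coeff'[OF finite_Z] card_Z p_def)
          then show ?thesis using e by simp
        next
          case False then show ?thesis using d by (simp add: coeff_eq_0)
        qed
      qed
    qed
  qed
  then show "a \<in> OK" using assms by (auto simp: OK_def)
qed (use esym_OK_int in auto)

lemma N_esym: "N a = cmod (esym a Z n)" using esym_last[OF finite_Z, of a] by (simp add: N_def card_Z flip: prod_norm)

lemma N_OK_nat: assumes "a \<in> OK" shows "\<exists>k::nat. N a = of_nat k"
proof -
  obtain k where "esym a Z n = of_int k" using esym_OK_int[OF assms] by (auto elim: Ints_cases)
  then have "N a = of_nat (nat \<bar>k\<bar>)" by (simp add: N_esym)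
  then show ?thesis by blast
qed

lemma N_nonneg: "N x >= 0" by (simp add: N_def prod_nonneg)

lemma N_mult: "N (x * y) = N x * N y" by (simp add: N_def norm_mult prod.distrib)

lemma N_cong: "(!!z. z \<in> Z ==> x z = y z) ==> N x = N y" by (simp add: N_def)

lemma N_zero_iff: "N x = 0 \<longleftrightarrow> (\<exists>z\<in>Z. x z = 0)" using finite_Z by (simp add: N_def)

lemma N_ge_1: assumes "a \<in> OK" "z \<in> Z" "a z ~= 0" shows "N a >= 1"
proof -
  obtain k where k: "N a = of_nat k" using N_OK_nat[OF assms(1)] by blast
  have "N a ~= 0" using KF_zero[of a _ z] assms OK_KF by (auto simp: N_zero_iff)
  then show ?thesis using k by simp
qed

lemma N_1: "N 1 = 1" by (simp add: N_def)

lemma N_UK: assumes "u \<in> UK" shows "N u = 1"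
proof -
  obtain v where v: "v \<in> OK" "u \<in> OK" "!!z. z \<in> Z ==> u z * v z = 1" using assms by (auto simp: UK_def)
  obtain k l :: nat where kl: "N u = k" "N v = l" using N_OK_nat v by metis
  have "N u * N v = 1" unfolding N_mult[symmetric] using v(3) N_cong[of "u * v" 1] N_1 by simp
  then have "k * l = 1" using kl by (metis of_nat_1 of_nat_eq_iff of_nat_mult)
  then show ?thesis using kl by simp
qed

lemma UK_nonzero: "u \<in> UK ==> z \<in> Z ==> u z ~= 0" by (auto simp: UK_def)

lemma UK_mult: assumes "u \<in> UK" "v \<in> UK" shows "u * v \<in> UK"
proof -
  obtain u' v' where "u' \<in> OK" "v' \<in> OK" "!!z. z \<in> Z ==> u z * u' z = 1" "!!z. z \<in> Z ==> v z * v' z = 1"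
    using assms by (auto simp: UK_def)
  then have "u' * v' \<in> OK" "!!z. z \<in> Z ==> (u * v) z * (u' * v') z = 1"
    by (auto simp: OK_mult) (metis mult.assoc mult.left_commute mult_1)
  then show ?thesis using assms OK_mult UK_OK unfolding UK_def by blast
qed

lemma UK_1: "1 \<in> UK" by (auto simp: UK_def OK_1 intro!: bexI[of _ 1])
lemma UK_power: "u \<in> UK ==> u ^ k \<in> UK" by (induction k) (auto intro: UK_mult UK_1)

lemma UK_inverse: assumes "u \<in> UK" shows "(%z. inverse (u z)) \<in> UK"
proof -
  obtain v where v: "v \<in> OK" "u \<in> OK" "!!z. z \<in> Z ==> u z * v z = 1" using assms by (auto simp: UK_def)
  then have e: "z \<in> Z ==> v z = inverse (u z)" for z by (metis inverse_unique)
  have "(%z. inverse (u z)) \<in> OK" by (rule OK_cong[OF v(1) e])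
  then show ?thesis using v(2) UK_nonzero[OF assms] by (auto simp: UK_def intro!: bexI[of _ u])
qed

end

lemma bolzano_weierstrass_pointwise:
  fixes f :: "nat => 'i => complex"
  assumes "finite S" "!!k z. z \<in> S ==> cmod (f k z) <= B"
  shows "\<exists>l r. strict_mono (r :: nat => nat) & (\<forall>z\<in>S. (%k. f (r k) z) \<longlonglongrightarrow> l z)"
  using assms
proof (induction S rule: finite_induct)
  case empty
  then show ?case by (intro exI[of _ undefined] exI[of _ id]) (auto simp: strict_mono_def)
next
  case (insert w S)
  obtain l r where r: "strict_mono (r :: nat => nat)" "\<forall>z\<in>S. (%k. f (r k) z) \<longlonglongrightarrow> l z"
    using insert.IH insert.prems by (metis insertCI)
  have "bounded (range (%k. f (r k) w))" using insert.prems by (auto simp: bounded_iff)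
  then obtain c s where s: "strict_mono (s :: nat => nat)" "((%k. f (r k) w) \<circ> s) \<longlonglongrightarrow> c"
    using bounded_imp_convergent_subsequence by blast
  show ?case
  proof (intro exI conjI ballI)
    show "strict_mono (r \<circ> s)" using r(1) s(1) by (rule strict_mono_o)
    fix z assume z: "z \<in> insert w S"
    show "(%k. f ((r \<circ> s) k) z) \<longlonglongrightarrow> (l(w := c)) z"
    proof (cases "z = w")
      case True then show ?thesis using s(2) by (simp add: o_def)
    next
      case False
      then show ?thesis using z LIMSEQ_subseq_LIMSEQ[OF _ s(1), of "%k. f (r k) z"] r(2) by (simp add: o_def)
    qed
  qed
qed

context numfield begin

section \<open>Coefficients and lattices\<close>

text \<open>An elementary bound for the absolute values of all roots. It is a natural number
  computed from the coefficients, since the search has to recompute it.\<close>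

definition R :: nat where "R = 1 + (\<Sum>i<n. nat \<bar>coeff g i\<bar>)"

lemma R_pos: "R >= 1" by (simp add: R_def)

lemma cmod_Z: assumes z: "z \<in> Z" shows "cmod z <= R"
proof (cases "cmod z <= 1")
  case True
  moreover have "1 <= real R" using R_pos by simp
  ultimately show ?thesis by linarith
next
  case False
  have "0 = poly (map_poly of_int g) z" using z by (simp add: Z_def of_int_poly_conv_ev)
  also have "... = (\<Sum>i\<le>n. of_int (coeff g i) * z ^ i)" by (simp add: poly_altdef degree_map_poly coeff_map_poly n_def)
  also have "... = z ^ n + (\<Sum>i<n. of_int (coeff g i) * z ^ i)"
    using monic by (simp add: n_def lessThan_Suc_atMost[symmetric])
  finally have e: "z ^ n = - (\<Sum>i<n. of_int (coeff g i) * z ^ i)" by (simp add: eq_neg_iff_add_eq_0)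
  have "cmod z ^ n = cmod (\<Sum>i<n. of_int (coeff g i) * z ^ i)" by (metis e norm_minus_cancel norm_power)
  also have "... <= (\<Sum>i<n. \<bar>of_int (coeff g i)\<bar> * cmod z ^ i)"
    by (rule order.trans[OF norm_sum]) (simp add: norm_mult norm_power)
  also have "... <= (\<Sum>i<n. \<bar>of_int (coeff g i)\<bar> * cmod z ^ (n - 1))"
    using False by (intro sum_mono mult_left_mono power_increasing) auto
  also have "... = (\<Sum>i<n. \<bar>of_int (coeff g i)\<bar>) * cmod z ^ (n - 1)" by (simp add: sum_distrib_right)
  also have "cmod z ^ n = cmod z * cmod z ^ (n - 1)" using n_pos by (simp flip: power_Suc)
  finally have "cmod z * cmod z ^ (n - 1) <= (\<Sum>i<n. \<bar>of_int (coeff g i)\<bar>) * cmod z ^ (n - 1)" .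
  moreover have "cmod z ^ (n - 1) > 0" using False by (intro zero_less_power) linarith
  ultimately have "cmod z <= (\<Sum>i<n. \<bar>of_int (coeff g i)\<bar>)" by (simp only: mult_le_cancel_right_pos)
  also have "... <= R" by (simp add: R_def)
  finally show ?thesis .
qed

text \<open>\<open>lag w\<close> divided by \<open>dl w\<close> is the Lagrange basis polynomial at
  \<open>w\<close>. The number \<open>dl w\<close> is the derivative of \<open>G\<close> at
  \<open>w\<close>, see \<open>dl_conv\<close>, so the product of all \<open>dl w\<close> is the
  discriminant up to sign.\<close>

definition lag :: "complex => complex poly" where "lag w = (\<Prod>v\<in>Z - {w}. [:- v, 1:])"

definition dl :: "complex => complex" where "dl w = (\<Prod>v\<in>Z - {w}. w - v)"

text \<open>Coefficients of the interpolation polynomial of degree less than \<open>n\<close>.\<close>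

definition cf :: "(complex => complex) => nat => complex" where
  "cf x i = (\<Sum>w\<in>Z. x w * coeff (lag w) i / dl w)"

lemma dl_nonzero: "dl w ~= 0" using finite_Z by (simp add: dl_def)

lemma degree_lag: "w \<in> Z ==> degree (lag w) < n" using n_pos finite_Z unfolding lag_def
  by (subst degree_prod_eq_sum_degree) (auto simp: card_Z)

lemma poly_lag: "w \<in> Z ==> z \<in> Z ==> poly (lag w) z = (if z = w then dl w else 0)"
  using finite_Z by (auto simp: lag_def poly_prod dl_def)

lemma poly_sum_lessThan: "degree p < m ==> (\<Sum>i<m. coeff p i * z ^ i) = poly p (z::'b::comm_ring_1)"
  unfolding poly_altdef by (rule sum.mono_neutral_right) (auto simp: coeff_eq_0)

lemma cf_expand: assumes "z \<in> Z" shows "(\<Sum>i<n. cf x i * z ^ i) = x z"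
proof -
  have "(\<Sum>i<n. cf x i * z ^ i) = (\<Sum>w\<in>Z. \<Sum>i<n. x w / dl w * (coeff (lag w) i * z ^ i))"
    unfolding cf_def sum_distrib_right by (subst sum.swap) (intro sum.cong refl, simp)
  also have "... = (\<Sum>w\<in>Z. x w / dl w * poly (lag w) z)"
    by (intro sum.cong refl) (simp only: sum_distrib_left[symmetric] poly_sum_lessThan[OF degree_lag])
  also have "... = (\<Sum>w\<in>Z. if z = w then x w else 0)" using assms by (intro sum.cong refl) (simp add: poly_lag dl_nonzero)
  finally show ?thesis using assms finite_Z by simp
qed

lemma expansion_unique:
  assumes "!!z. z \<in> Z ==> (\<Sum>i<n. c i * z ^ i) = (\<Sum>i<n. d i * z ^ i)" "i < n"
  shows "c i = d i"
proof -
  define p where "p c = (\<Sum>i<n. monom (c i) i)" for c :: "nat => complex"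
  have cp: "coeff (p c) i = (if i < n then c i else 0)" for c i by (simp add: p_def coeff_sum)
  have deg: "degree (p c) < n" for c using n_pos by (metis cp degree_0 leading_coeff_0_iff)
  have poly: "poly (p c) z = (\<Sum>i<n. c i * z ^ i)" for c z by (simp add: p_def poly_sum poly_monom)
  have "p c = p d" by (rule poly_eqI_degree[of Z]) (simp_all add: poly assms card_Z deg)
  then show ?thesis using assms(2) cp by metis
qed

lemma cf_eqI: "(!!z. z \<in> Z ==> x z = (\<Sum>i<n. c i * z ^ i)) ==> i < n ==> cf x i = c i"
  by (rule expansion_unique) (simp_all add: cf_expand)

lemma cf_real: assumes "x \<in> EE" "i < n" shows "cf x i \<in> \<real>"
proof -
  have "cf x i = cnj (cf x i)"
  proof (rule cf_eqI[OF _ assms(2)])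
    fix z assume z: "z \<in> Z"
    have "(\<Sum>i<n. cnj (cf x i) * z ^ i) = cnj (\<Sum>i<n. cf x i * (cnj z) ^ i)" by simp
    also have "... = cnj (x (cnj z))" by (simp only: cf_expand[OF cnj_Z[OF z]])
    also have "... = x z" using assms(1) z by (simp add: EE_def)
    finally show "x z = (\<Sum>i<n. cnj (cf x i) * z ^ i)" by simp
  qed
  then show ?thesis by (metis Reals_cnj_iff)
qed

lemma EE_expand: assumes "x \<in> EE"
  obtains c :: "nat => real" where "!!z. z \<in> Z ==> x z = (\<Sum>i<n. of_real (c i) * z ^ i)"
    "!!i. i < n ==> cf x i = of_real (c i)"
proof
  show cf: "cf x i = of_real (Re (cf x i))" if "i < n" for i using cf_real[OF assms that] by simp
  show "x z = (\<Sum>i<n. of_real (Re (cf x i)) * z ^ i)" if "z \<in> Z" for z using cf_expand[OF that, of x] cf by simp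
qed

lemma EE_expand': "x \<in> EE ==> \<exists>c. \<forall>z\<in>Z. x z = (\<Sum>i<n. of_real (c i) * z ^ i)" by (metis EE_expand)

lemma EE_real_sum: "(%z. \<Sum>i<m. of_real (c i) * z ^ i) \<in> EE" by (simp add: EE_def)

lemma KF_expand: assumes "a \<in> KF"
  obtains c :: "nat => rat" where "!!z. z \<in> Z ==> a z = (\<Sum>i<n. of_rat (c i) * z ^ i)"
    "!!i. i < n ==> cf a i = of_rat (c i)"
proof -
  obtain h where h: "!!z. z \<in> Z ==> a z = ev h z" using assms by (auto simp: KF_def)
  define h' where "h' = h mod G"
  have "degree h' < n" unfolding h'_def using degree_mod_less'[of G h] n_pos degree_G
    by (metis degree_0 degree_mod_less less_nat_zero_code)
  moreover have "ev h' z = ev h z" if "z \<in> Z" for z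
  proof -
    have "h = h div G * G + h'" unfolding h'_def by (rule div_mult_mod_eq[symmetric])
    then have "ev h z = ev (h div G) z * ev G z + ev h' z" by (metis ev_add ev_mult)
    then show ?thesis using that by (simp add: Z_def)
  qed
  ultimately have e: "a z = (\<Sum>i<n. of_rat (coeff h' i) * z ^ i)" if "z \<in> Z" for z using h that by (simp add: ev_altdef')
  show ?thesis using that[of "coeff h'"] e cf_eqI[of a "%i. of_rat (coeff h' i)"] by blast
qed

lemma KF_expand': "a \<in> KF ==> \<exists>c. \<forall>z\<in>Z. a z = (\<Sum>i<n. of_rat (c i) * z ^ i)" by (metis KF_expand)

lemma KF_rat_sum: "(%z. \<Sum>i<m. of_rat (c i) * z ^ i) \<in> KF"
  by (rule KFI[of _ "\<Sum>i<m. monom (c i) i"]) (simp add: ev_sum)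

lemma cmod_expand_le:
  assumes "z \<in> Z" "!!i. i < n ==> cmod (c i) <= b"
  shows "cmod (\<Sum>i<n. c i * z ^ i) <= real n * real R ^ n * b"
proof -
  have "cmod (\<Sum>i<n. c i * z ^ i) <= (\<Sum>i<n. b * real R ^ n)"
  proof (rule order.trans[OF norm_sum], rule sum_mono)
    fix i assume i: "i \<in> {..<n}"
    have "cmod z ^ i <= real R ^ i" using cmod_Z[OF assms(1)] by (simp add: power_mono)
    also have "... <= real R ^ n" using i R_pos by (simp add: power_increasing)
    finally show "cmod (c i * z ^ i) <= b * real R ^ n" unfolding norm_mult norm_power using i assms(2)[of i]
      by (intro mult_mono) (auto intro: order.trans[OF norm_ge_zero])
  qed
  then show ?thesis by (simp add: mult_ac)
qed

text \<open>\<open>W\<close> bounds the absolute value of the discriminant, each difference of roots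
  being at most 2 R. \<open>BB\<close> passes from bounds on coefficients to bounds on conjugates,
  and \<open>AA\<close> from conjugates to coefficients. \<open>DD\<close> is a denominator for the
  coefficients of all integers of the field; a factorial is taken because it is divisible by the
  discriminant whatever its value.\<close>

definition W :: nat where "W = ((2 * R) ^ n) ^ n"
definition AA :: nat where "AA = n * (1 + R) ^ n * W"
definition DD :: nat where "DD = fact W"
definition BB :: nat where "BB = n * R ^ n"

lemma dl_le: assumes "w \<in> Z" shows "cmod (dl w) <= real ((2 * R) ^ n)"
proof -
  have "cmod (dl w) = (\<Prod>v\<in>Z - {w}. cmod (w - v))" by (simp add: dl_def prod_norm)
  also have "... <= (\<Prod>v\<in>Z - {w}. real (2 * R))"
  proof (rule prod_mono)
    fix v assume "v \<in> Z - {w}"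
    then show "0 <= cmod (w - v) & cmod (w - v) <= real (2 * R)"
      using cmod_Z[OF assms] cmod_Z[of v] norm_triangle_ineq4[of w v] by auto
  qed
  also have "... = real ((2 * R) ^ (n - 1))" using assms finite_Z by (simp add: card_Z)
  also have "... <= real ((2 * R) ^ n)" unfolding of_nat_le_iff using R_pos by (intro power_increasing) auto
  finally show ?thesis by simp
qed

lemma dl_conv: assumes "w \<in> Z" shows "dl w = ev (pderiv G) w"
proof -
  have "pderiv (map_poly of_rat G) = (map_poly of_rat (pderiv G) :: complex poly)"
    by (rule poly_eqI) (simp add: coeff_pderiv coeff_map_poly of_rat_mult of_rat_add)
  then have "ev (pderiv G) w = poly (pderiv (\<Prod>z\<in>Z. [:- z, 1:])) w" by (simp add: ev_def flip: cpoly_factor)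
  also have "... = (\<Sum>a\<in>Z. poly (lag a) w)" by (simp add: pderiv_prod poly_sum lag_def pderiv_pCons)
  also have "... = (\<Sum>a\<in>Z. if w = a then dl w else 0)" using assms by (intro sum.cong refl) (simp add: poly_lag)
  finally show ?thesis using assms finite_Z by simp
qed

lemma dl_OK: "dl \<in> OK"
proof (rule OK_cong[OF OK_int_poly[of "pderiv g"]])
  fix z assume "z \<in> Z"
  have "map_poly of_int (pderiv g) = pderiv G" by (rule poly_eqI) (simp add: coeff_pderiv coeff_map_poly)
  then show "poly (map_poly of_int (pderiv g)) z = dl z"
    using dl_conv[OF \<open>z \<in> Z\<close>] by (simp add: of_int_poly_conv_ev)
qed

lemma N_dl: "1 <= N dl" "N dl <= W"
proof -
  show "1 <= N dl" using N_ge_1[OF dl_OK] Z_nonempty dl_nonzero by blast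
  have "N dl <= (\<Prod>w\<in>Z. real ((2 * R) ^ n))" unfolding N_def by (rule prod_mono) (use dl_le in auto)
  also have "... = W" by (simp add: card_Z W_def)
  finally show "N dl <= W" .
qed

text \<open>The norm of \<open>dl\<close> is at least 1, so one conjugate can be small only if
  others are large, and \<open>dl_le\<close> limits these.\<close>

lemma dl_ge: assumes w: "w \<in> Z" shows "1 <= cmod (dl w) * real W"
proof -
  have "1 <= N dl" by (rule N_dl)
  also have "N dl = cmod (dl w) * (\<Prod>v\<in>Z - {w}. cmod (dl v))" unfolding N_def using finite_Z w by (simp add: prod.remove)
  also have "... <= cmod (dl w) * (\<Prod>v\<in>Z - {w}. real ((2 * R) ^ n))"
    by (intro mult_left_mono prod_mono) (use dl_le in auto)
  also have "... = cmod (dl w) * real (((2 * R) ^ n) ^ (n - 1))" using finite_Z w by (simp add: card_Z)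
  also have "... <= cmod (dl w) * real W"
    unfolding W_def of_nat_le_iff using R_pos by (intro mult_left_mono of_nat_mono power_increasing) auto
  finally show ?thesis .
qed

lemma coeff_prod_le:
  assumes "finite S" "!!v. v \<in> S ==> cmod v <= r" "r >= 0"
  shows "cmod (coeff (\<Prod>v\<in>S. [:- v, 1:]) i) <= (1 + r) ^ card S" using assms(1,2)
proof (induction S arbitrary: i rule: finite_induct)
  case empty then show ?case by (auto simp: coeff_1)
next
  case (insert v S)
  let ?p = "\<Prod>v\<in>S. [:- v, 1:]"
  have "cmod (coeff ([:- v, 1:] * ?p) i) <= cmod v * cmod (coeff ?p i) + (case i of 0 => 0 | Suc j => cmod (coeff ?p j))"
    by (cases i) (auto simp: norm_mult norm_triangle_ineq4 intro: order.trans[OF norm_triangle_ineq4])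
  also have "... <= r * (1 + r) ^ card S + (1 + r) ^ card S"
    using insert assms(3) by (intro add_mono mult_mono) (auto split: nat.splits)
  also have "... = (1 + r) ^ card (insert v S)" using insert by (simp add: algebra_simps)
  finally show ?case using insert by simp
qed

lemma cf_le: assumes "!!z. z \<in> Z ==> cmod (x z) <= b"
  shows "cmod (cf x i) <= real AA * b"
proof -
  have "cmod (cf x i) <= (\<Sum>w\<in>Z. b * (1 + real R) ^ n * real W)" unfolding cf_def
  proof (rule order.trans[OF norm_sum], rule sum_mono)
    fix w assume w: "w \<in> Z"
    have "cmod (coeff (lag w) i) <= (1 + real R) ^ card (Z - {w})"
      unfolding lag_def using finite_Z cmod_Z by (intro coeff_prod_le) auto
    also have "... <= (1 + real R) ^ n" using finite_Z w by (intro power_increasing) (auto simp: card_Z)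
    finally have 1: "cmod (coeff (lag w) i) <= (1 + real R) ^ n" .
    have 2: "inverse (cmod (dl w)) <= real W" using dl_ge[OF w] dl_nonzero[of w] by (simp add: field_simps)
    have "cmod (x w * coeff (lag w) i / dl w) = cmod (x w) * cmod (coeff (lag w) i) * inverse (cmod (dl w))"
      by (simp add: norm_mult norm_divide norm_inverse divide_inverse)
    also have "... <= b * (1 + real R) ^ n * real W" using 1 2 assms[OF w] order.trans[OF norm_ge_zero assms[OF w]]
      by (intro mult_mono mult_nonneg_nonneg zero_le_power) auto
    finally show "cmod (x w * coeff (lag w) i / dl w) <= b * (1 + real R) ^ n * real W" .
  qed
  then show ?thesis by (simp add: card_Z AA_def mult_ac)
qed

text \<open>Multiplying Lagrange's formula by the product \<open>D0\<close> of all
  \<open>dl w\<close> leaves an algebraic integer. It is rational as well, since \<open>cf\<close>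
  recovers the rational coefficients of \<open>a\<close>. Moreover \<open>D0\<close> is a nonzero
  integer of absolute value at most \<open>W\<close>, so it divides the factorial
  \<open>DD\<close>.\<close>

lemma DD_cf_int: assumes "a \<in> OK" "i < n" shows "of_nat DD * cf a i \<in> \<int>"
proof -
  have dl_int: "algebraic_int (dl w)" if "w \<in> Z" for w using dl_OK that by (auto simp: OK_def)
  define D0 where "D0 = (\<Prod>w\<in>Z. dl w)"
  obtain k :: int where k: "D0 = of_int k"
  proof -
    have "esym dl Z n \<in> \<int>" by (rule esym_OK_int[OF dl_OK])
    moreover have "esym dl Z n = (-1) ^ n * D0" using esym_last[OF finite_Z, of dl] by (simp add: card_Z D0_def prod_uminus)
    moreover have "(-1) ^ n * ((-1) ^ n * D0) = D0" by (simp flip: mult.assoc power_mult_distrib)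
    ultimately have "D0 \<in> \<int>" by (metis Ints_mult Ints_power Ints_minus Ints_1)
    then show ?thesis using that by (auto elim: Ints_cases)
  qed
  have N0: "cmod D0 = N dl" by (simp add: D0_def N_def prod_norm)
  have "cmod D0 = real_of_int \<bar>k\<bar>" using k by simp
  then have "1 <= \<bar>k\<bar>" "\<bar>k\<bar> <= W" using N0 N_dl by linarith+
  then have "nat \<bar>k\<bar> dvd fact W" by (intro dvd_fact) auto
  then obtain m where "fact W = nat \<bar>k\<bar> * m" by blast
  then have "of_nat DD = of_int (\<bar>k\<bar> * int m) * (1::complex)"
    unfolding DD_def by (simp add: of_nat_mult[symmetric] del: of_nat_fact)
  also have "\<bar>k\<bar> = k * sgn k" by (simp add: abs_sgn)
  finally have DDk: "of_nat DD = of_int (sgn k * int m) * D0" by (simp add: k mult_ac)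
  have "algebraic_int (D0 * cf a i)"
  proof -
    have "D0 * cf a i = (\<Sum>w\<in>Z. a w * coeff (lag w) i * (\<Prod>v\<in>Z - {w}. dl v))"
      unfolding cf_def sum_distrib_left D0_def by (intro sum.cong refl) (subst prod.remove[OF finite_Z], auto simp: dl_nonzero)
    also have "algebraic_int ..." unfolding lag_def using assms dl_int
      by (intro algebraic_int_sum algebraic_int_times algebraic_int_prod algebraic_int_coeff_prod)
         (auto simp: OK_def algebraic_int_Z)
    finally show ?thesis .
  qed
  then have "algebraic_int (of_nat DD * cf a i)" unfolding DDk mult.assoc by (rule algebraic_int_times[OF algebraic_int_of_int])
  moreover have "cf a i \<in> \<rat>"
  proof (rule KF_expand[OF subsetD[OF OK_KF assms(1)]])
    fix c assume "!!j. j < n ==> cf a j = of_rat (c j)"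
    then show "cf a i \<in> \<rat>" using assms(2) by simp
  qed
  ultimately show ?thesis by (intro rational_algebraic_int_is_int Rats_mult) auto
qed

section \<open>Convergence\<close>

definition conv :: "(nat => complex => complex) => (complex => complex) => bool" where
  "conv f l \<longleftrightarrow> (\<forall>z\<in>Z. (%k. f k z) \<longlonglongrightarrow> l z)"

definition closedZ :: "(complex => complex) set => bool" where
  "closedZ X \<longleftrightarrow> (\<forall>f l. (\<forall>k. f k \<in> X) --> conv f l --> l \<in> X)"

lemma closedZD: "closedZ X ==> (!!k. f k \<in> X) ==> conv f l ==> l \<in> X" by (auto simp: closedZ_def)

text \<open>A constant sequence converges on \<open>Z\<close> to every function that agrees with it
  there, so closed sets are blind to values outside \<open>Z\<close>.\<close>

lemma closedZ_cong: "closedZ X ==> x \<in> X ==> (!!z. z \<in> Z ==> x z = y z) ==> y \<in> X"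
  by (rule closedZD[of X "%_. x"]) (auto simp: conv_def)

lemma conv_const: "conv (%_. x) x" by (simp add: conv_def)
lemma conv_add: "conv f l ==> conv f' l' ==> conv (%k. f k + f' k) (l + l')" by (auto simp: conv_def intro: tendsto_add)
lemma conv_diff: "conv f l ==> conv f' l' ==> conv (%k. f k - f' k) (l - l')" by (auto simp: conv_def intro: tendsto_diff)
lemma conv_mult: "conv f l ==> conv f' l' ==> conv (%k. f k * f' k) (l * l')" by (auto simp: conv_def intro: tendsto_mult)
lemma conv_subseq: "conv f l ==> strict_mono r ==> conv (%k. f (r k)) l"
  unfolding conv_def using LIMSEQ_subseq_LIMSEQ[of _ _ r] by (auto simp: o_def)

lemma bounded_conv_subseq:
  assumes "!!k z. z \<in> Z ==> cmod (f k z) <= B"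
  shows "\<exists>l r. strict_mono (r :: nat => nat) & conv (%k. f (r k)) l"
  using bolzano_weierstrass_pointwise[OF finite_Z, of f B] assms unfolding conv_def by blast

lemma conv_N: "conv f l ==> (%k. N (f k)) \<longlonglongrightarrow> N l"
  unfolding conv_def N_def by (intro tendsto_prod tendsto_norm) auto

lemma closedZ_EE: "closedZ EE" unfolding closedZ_def
proof (intro allI impI)
  fix f l assume f: "\<forall>k. f k \<in> EE" and c: "conv f l"
  show "l \<in> EE" unfolding EE_def
  proof (intro CollectI ballI)
    fix z assume z: "z \<in> Z"
    have "(%k. f k (cnj z)) \<longlonglongrightarrow> l (cnj z)" using c cnj_Z[OF z] by (auto simp: conv_def)
    moreover have "(%k. cnj (f k z)) \<longlonglongrightarrow> cnj (l z)" using c z by (auto simp: conv_def intro: tendsto_cnj)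
    moreover have "f k (cnj z) = cnj (f k z)" for k using f z by (auto simp: EE_def)
    ultimately show "l (cnj z) = cnj (l z)" by (simp add: LIMSEQ_unique)
  qed
qed

text \<open>The powers of the root already span a lattice of integers with a bounded fundamental
  parallelepiped, so rounding the coefficients down suffices.\<close>

lemma reduce_OK: assumes "x \<in> EE" shows "\<exists>a\<in>OK. \<forall>z\<in>Z. cmod ((x + a) z) <= BB"
proof -
  obtain c where c: "!!z. z \<in> Z ==> x z = (\<Sum>i<n. of_real (c i) * z ^ i)" using EE_expand'[OF assms] by blast
  define a where "a = (%z::complex. \<Sum>i<n. of_int (- \<lfloor>c i\<rfloor>) * z ^ i)"
  have "a \<in> OK" unfolding a_def by (rule OK_int_sum)
  moreover have "cmod ((x + a) z) <= BB" if z: "z \<in> Z" for z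
  proof -
    have "(x + a) z = (\<Sum>i<n. of_real (c i - \<lfloor>c i\<rfloor>) * z ^ i)"
      using c z by (simp add: a_def algebra_simps sum_negf sum_subtractf)
    also have "cmod ... <= real n * real R ^ n * 1"
      by (rule cmod_expand_le[OF z]) (simp add: frac_def[symmetric] frac_lt_1 less_imp_le del: of_real_diff)
    finally show ?thesis by (simp add: BB_def)
  qed
  ultimately show ?thesis by blast
qed

text \<open>The norm is a natural number, and here it is below 1. This is the discreteness of the
  lattice of integers.\<close>

lemma OK_small: assumes "a \<in> OK" "!!z. z \<in> Z ==> cmod (a z) < 1" "z \<in> Z" shows "a z = 0"
proof (rule ccontr)
  assume nz: "a z ~= 0"
  have "N a < 1"
  proof -
    have "N a = cmod (a z) * (\<Prod>w\<in>Z - {z}. cmod (a w))"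
      unfolding N_def using finite_Z assms(3) by (simp add: prod.remove)
    also have "... <= cmod (a z) * (\<Prod>w\<in>Z - {z}. 1)"
      by (intro mult_left_mono prod_mono) (use assms(2) in \<open>auto intro: less_imp_le\<close>)
    also have "... < 1" using assms by simp
    finally show ?thesis .
  qed
  then show False using N_ge_1[OF assms(1,3) nz] by simp
qed

lemma OK_eventually_equal:
  assumes "!!k. a k \<in> OK" "conv a l"
  shows "\<exists>K. \<forall>i\<ge>K. \<forall>j\<ge>K. \<forall>z\<in>Z. a i z = a j z"
proof -
  have "\<exists>K. \<forall>i\<ge>K. \<forall>j\<ge>K. cmod (a i z - a j z) < 1" if "z \<in> Z" for z
  proof -
    have "Cauchy (%k. a k z)" using assms(2) that by (auto simp: conv_def intro: LIMSEQ_imp_Cauchy)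
    then show ?thesis by (auto dest!: CauchyD[of _ 1])
  qed
  then obtain K where K: "!!z i j. z \<in> Z ==> i >= K z ==> j >= K z ==> cmod (a i z - a j z) < 1" by metis
  define M where "M = (\<Sum>z\<in>Z. K z)"
  have KM: "K z <= M" if "z \<in> Z" for z unfolding M_def by (rule member_le_sum) (use that finite_Z in auto)
  have "a i z = a j z" if i: "i >= M" and j: "j >= M" and z: "z \<in> Z" for i j z
  proof -
    have "(a i - a j) z = 0"
    proof (rule OK_small[OF _ _ z])
      show "a i - a j \<in> OK" by (intro OK_diff assms(1))
      fix w assume "w \<in> Z"
      then show "cmod ((a i - a j) w) < 1" using K[of w i j] KM[of w] i j by auto
    qed
    then show ?thesis by simp
  qed
  then show ?thesis by blast
qed

lemma OK_bounded_repeat: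
  assumes "!!k. a k \<in> OK" "!!k z. z \<in> Z ==> cmod (a k z) <= B"
  shows "\<exists>i j :: nat. i < j & (\<forall>z\<in>Z. a i z = a j z)"
proof -
  obtain l r where r: "strict_mono (r :: nat => nat)" "conv (%k. a (r k)) l" using bounded_conv_subseq[of a B] assms(2) by blast
  obtain K where "\<forall>i\<ge>K. \<forall>j\<ge>K. \<forall>z\<in>Z. a (r i) z = a (r j) z"
    using OK_eventually_equal[OF _ r(2)] assms(1) by auto
  then show ?thesis using r(1) by (intro exI[of _ "r K"] exI[of _ "r (Suc K)"]) (simp add: strict_mono_def)
qed

lemma closedZ_OK: "closedZ OK" unfolding closedZ_def
proof (intro allI impI)
  fix f l assume f: "\<forall>k. f k \<in> OK" and c: "conv f l"
  obtain K where K: "\<forall>i\<ge>K. \<forall>j\<ge>K. \<forall>z\<in>Z. f i z = f j z" using OK_eventually_equal[OF _ c] f by blast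
  have "f K z = l z" if "z \<in> Z" for z
  proof -
    have "(%k. f k z) \<longlonglongrightarrow> l z" using c that by (auto simp: conv_def)
    moreover have "(%k. f k z) \<longlonglongrightarrow> f K z"
      by (rule tendsto_eventually) (use K that in \<open>auto simp: eventually_sequentially intro!: exI[of _ K]\<close>)
    ultimately show ?thesis by (simp add: LIMSEQ_unique)
  qed
  then show "l \<in> OK" using f OK_cong by blast
qed

lemma KF_dense: assumes "x \<in> EE" shows "\<exists>f. (\<forall>k. f k \<in> KF) & conv f x"
proof -
  obtain c where c: "!!z. z \<in> Z ==> x z = (\<Sum>i<n. of_real (c i) * z ^ i)" using EE_expand'[OF assms] by blast
  have "\<exists>q::nat => rat. (%k. real_of_rat (q k)) \<longlonglongrightarrow> c i" for i
  proof -
    have "\<exists>q. real_of_rat q > c i & real_of_rat q < c i + inverse (of_nat (Suc k))" for k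
      using of_rat_dense[of "c i" "c i + inverse (of_nat (Suc k))"] by auto
    then obtain q where q: "!!k. real_of_rat (q k) > c i" "!!k. real_of_rat (q k) < c i + inverse (of_nat (Suc k))" by metis
    have "(%k. real_of_rat (q k)) \<longlonglongrightarrow> c i"
    proof (rule tendsto_sandwich[of "%_. c i" _ _ "%k. c i + inverse (of_nat (Suc k))"])
      show "(%k. c i + inverse (real (Suc k))) \<longlonglongrightarrow> c i"
        using tendsto_add[OF tendsto_const LIMSEQ_inverse_real_of_nat, of "c i"] by simp
    qed (use q in \<open>auto intro!: always_eventually less_imp_le\<close>)
    then show ?thesis by blast
  qed
  then obtain q :: "nat => nat => rat" where q: "!!i. (%k. real_of_rat (q i k)) \<longlonglongrightarrow> c i" by metis
  have oo: "of_real (of_rat r) = (of_rat r :: complex)" for r by (cases r) (simp add: of_rat_rat)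
  have "conv (%k z. \<Sum>i<n. of_rat (q i k) * z ^ i) x" unfolding conv_def
  proof
    fix z assume z: "z \<in> Z"
    have "(%k. \<Sum>i<n. of_real (of_rat (q i k)) * z ^ i) \<longlonglongrightarrow> (\<Sum>i<n. of_real (c i) * z ^ i)"
      by (intro tendsto_intros q)
    then show "(%k. \<Sum>i<n. of_rat (q i k) * z ^ i) \<longlonglongrightarrow> x z" using c[OF z] by (simp add: oo)
  qed
  moreover have "(%z. \<Sum>i<n. of_rat (q i k) * z ^ i) \<in> KF" for k by (rule KF_rat_sum)
  ultimately show ?thesis by (intro exI[of _ "%k z. \<Sum>i<n. of_rat (q i k) * z ^ i"] conjI allI)
qed

end

context numfield begin

section \<open>Units with one large conjugate\<close>

abbreviation PP :: "complex => complex set" where "PP w \<equiv> {w, cnj w}"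

lemma PP_Z: "w \<in> Z ==> PP w \<subseteq> Z" using cnj_Z by auto

lemma BB_pos: "BB >= 1" using n_pos R_pos by (simp add: BB_def Suc_le_eq)

text \<open>\<open>C0\<close> is the constant of \<open>exists_small_off_place\<close>: a factor 3
  comes from the length of the interval that is divided into cells, a factor 2 from combining real
  and imaginary part. \<open>C1\<close> bounds the norms of the elements found with it. In
  \<open>CC\<close> the base 4 C0^(n+1) is the ratio of consecutive scales, and C1^(n+1) is the
  number of pairs of a norm and a residue vector, which limits the number of scales to be
  tried.\<close>

definition C0 :: nat where "C0 = 6 * BB"
definition C1 :: nat where "C1 = C0 ^ n"
definition CC :: nat where "CC = C0 ^ (n + 1) * (4 * C0 ^ (n + 1)) ^ (C1 ^ (n + 1) * n)"

lemma C0_pos: "C0 >= 1" using BB_pos by (simp add: C0_def)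

definition li :: "(nat => int) => complex => complex" where
  "li c z = (\<Sum>i<n. of_int (c i) * z ^ i)"

lemma li_OK: "li c \<in> OK" unfolding li_def by (rule OK_int_sum)

lemma li_diff: "li c z - li d z = li (%i. c i - d i) z" by (simp add: li_def sum_subtractf algebra_simps)

lemma li_nonzero: assumes "i < n" "c i ~= 0" "w \<in> Z" shows "li c w ~= 0"
proof
  assume "li c w = 0"
  then have "li c z = 0" if "z \<in> Z" for z using KF_zero[of "li c" w z] li_OK OK_KF assms(3) that by blast
  then have "of_int (c i) = (0::complex)" using expansion_unique[of "%i. of_int (c i)" "%_. 0" i] assms(1) by (simp add: li_def)
  then show False using assms(2) by simp
qed

lemma li_le: "z \<in> Z ==> (!!i. i < n ==> \<bar>c i\<bar> <= H) ==> cmod (li c z) <= real BB * of_int H"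
  unfolding li_def BB_def using cmod_expand_le[of z "%i. of_int (c i)" "of_int H"]
  by (simp add: norm_of_int) (metis norm_of_int of_int_abs of_int_le_iff)

text \<open>A pigeonhole argument in which only the conjugates outside of \<open>PP w\<close> are controlled.
  Each pair of conjugates is represented by its real and its imaginary part.\<close>

lemma exists_small_off_place:
  assumes w: "w \<in> Z" and s: "s >= 1"
  defines "e \<equiv> card (PP w)"
  assumes e: "e < n"
  shows "\<exists>c. (\<exists>i<n. c i ~= 0) & (\<forall>z\<in>Z - PP w. cmod (li c z) * real s ^ e <= C0) \<and>
    (\<forall>z\<in>PP w. cmod (li c z) <= C0 * real s ^ (n - e))"
proof -
  \<comment> \<open>\<open>H\<close> and \<open>k\<close> are balanced: there are (H + 1)^n
    coefficient vectors with entries up to \<open>H\<close>, but only k^(n - e) = H^n cells.\<close>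
  define H :: nat where "H = s ^ (n - e)"
  define k :: nat where "k = s ^ n"
  have H1: "H >= 1" "k >= 1" using s by (auto simp: H_def k_def)
  define rho where "rho a z = (if Im z >= 0 then Re (a z) else Im (a z))" for a :: "complex => complex" and z
  \<comment> \<open>The summand 1 keeps the shifted values strictly below \<open>L\<close>, so that
    the cell index is below \<open>k\<close>.\<close>
  define L :: real where "L = 2 * BB * H + 1"
  have L0: "L > 0" unfolding L_def of_nat_0_less_iff by simp
  define A where "A = (\<Pi>\<^sub>E i\<in>{..<n}. {0..int H})"
  define cell where "cell c = (\<lambda>z\<in>Z - PP w. \<lfloor>(rho (li c) z + BB * H) * k / L\<rfloor>)" for c
  have cA: "card A = (H + 1) ^ n" by (simp add: A_def card_PiE nat_add_distrib)
  have inner: "\<lfloor>(rho (li c) z + BB * H) * k / L\<rfloor> \<in> {0..<int k}"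
    if c: "c \<in> A" and z: "z \<in> Z" for c z
  proof -
    have "\<bar>c i\<bar> <= int H" if "i < n" for i using c that by (auto simp: A_def PiE_def Pi_def)
    from li_le[OF z this] have "cmod (li c z) <= real BB * of_int (int H)" by simp
    then have "\<bar>rho (li c) z\<bar> <= BB * H"
      unfolding rho_def using abs_Re_le_cmod[of "li c z"] abs_Im_le_cmod[of "li c z"] by auto
    then have r: "0 <= rho (li c) z + BB * H" "rho (li c) z + BB * H < L" by (auto simp: L_def mult.commute[of "real H"])
    have "(rho (li c) z + BB * H) * k / L < L * k / L"
      using r L0 H1 by (intro divide_strict_right_mono mult_strict_right_mono) auto
    then have "(rho (li c) z + BB * H) * k / L < k" using L0 by simp
    moreover have "0 <= (rho (li c) z + BB * H) * k / L" using r L0 by simp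
    ultimately show ?thesis by (simp add: floor_less_iff)
  qed
  then have rng: "cell ` A \<subseteq> (\<Pi>\<^sub>E z\<in>Z - PP w. {0..<int k})"
    unfolding cell_def by (intro image_subsetI) (simp only: restrict_PiE_iff, blast)
  have "card (cell ` A) <= card (\<Pi>\<^sub>E z\<in>Z - PP w. {0..<int k})"
    using finite_Z by (intro card_mono[OF _ rng] finite_PiE) auto
  also have "... = k ^ (n - e)" using finite_Z PP_Z[OF w] by (simp add: card_PiE card_Diff_subset card_Z e_def)
  also have "... = H ^ n" by (simp add: k_def H_def power_mult[symmetric] mult.commute)
  also have "... < card A" unfolding cA using n_pos by (intro power_strict_mono) auto
  finally have "\<not> inj_on cell A" by (rule pigeonhole)
  then obtain c d where cd: "c \<in> A" "d \<in> A" "c ~= d" "cell c = cell d" by (auto simp: inj_on_def)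
  define b where "b i = c i - d i" for i
  have ex: "\<exists>i<n. b i ~= 0"
  proof (rule ccontr)
    assume "\<not> ?thesis"
    then have "c = d" using cd(1,2) unfolding A_def b_def by (intro PiE_ext[of c "{..<n}" _ d]) auto
    then show False using cd by simp
  qed
  have bH: "\<bar>b i\<bar> <= int H" if "i < n" for i
  proof -
    have "c i \<in> {0..int H}" "d i \<in> {0..int H}" using cd(1,2) that by (auto simp: A_def PiE_def Pi_def)
    then show ?thesis by (auto simp: b_def)
  qed
  have rho_small: "\<bar>rho (li b) z\<bar> <= L / k" if z: "z \<in> Z - PP w" for z
  proof -
    have "\<lfloor>(rho (li c) z + BB * H) * k / L\<rfloor> = \<lfloor>(rho (li d) z + BB * H) * k / L\<rfloor>"
      using fun_cong[OF cd(4), of z] z by (simp add: cell_def)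
    then have "\<bar>(rho (li c) z + BB * H) * k / L - (rho (li d) z + BB * H) * k / L\<bar> < 1" by linarith
    moreover have "rho (li c) z - rho (li d) z = rho (li b) z"
    proof -
      have "(%i. c i - d i) = b" by (simp add: b_def fun_eq_iff)
      then have "li c z - li d z = li b z" using li_diff[of c z d] by simp
      then show ?thesis by (auto simp: rho_def simp flip: minus_complex.sel)
    qed
    then have "(rho (li c) z + BB * H) * k / L - (rho (li d) z + BB * H) * k / L = rho (li b) z * k / L"
      by (simp add: diff_divide_distrib[symmetric] left_diff_distrib[symmetric])
    ultimately have "\<bar>rho (li b) z\<bar> * (k / L) < 1" using L0 by (simp add: abs_mult)
    then show ?thesis using L0 H1 by (simp add: field_simps)
  qed
  have LH: "L / k <= 3 * BB * H / k"
  proof -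
    have "1 <= real BB * real H" using BB_pos H1 by (metis mult_mono' of_nat_0_le_iff of_nat_1 of_nat_mono mult_1 of_nat_le_0_iff zero_le_one)
    then show ?thesis by (intro divide_right_mono) (auto simp: L_def mult.commute[of "real H"])
  qed
  have ks: "H * s ^ e = k" using e by (simp add: H_def k_def power_add[symmetric])
  have off: "cmod (li b z) * real s ^ e <= C0" if z: "z \<in> Z - PP w" for z
  proof -
    have cz: "cnj z \<in> Z - PP w" using z cnj_Z by auto
    have EEb: "li b (cnj z) = cnj (li b z)" using li_OK OK_EE z by (auto simp: EE_def)
    have "cmod (li b z) <= 2 * (L / k)"
    proof (cases "Im z = 0")
      case True
      then have "cnj z = z" by (simp add: complex_eq_iff)
      then have "Im (li b z) = 0" using EEb by (metis complex_cnj_cnj Reals_cnj_iff complex_is_Real_iff)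
      then have "cmod (li b z) = \<bar>rho (li b) z\<bar>" using True by (simp add: rho_def cmod_def)
      then show ?thesis using rho_small[OF z] by linarith
    next
      case False
      have "\<bar>Re (li b z)\<bar> + \<bar>Im (li b z)\<bar> = \<bar>rho (li b) z\<bar> + \<bar>rho (li b) (cnj z)\<bar>"
        using False EEb by (auto simp: rho_def)
      then show ?thesis using cmod_le[of "li b z"] rho_small[OF z] rho_small[OF cz] by linarith
    qed
    also have "... <= 6 * BB * H / k" using LH by simp
    finally have "cmod (li b z) * real s ^ e <= 6 * BB * H / k * real s ^ e" by (rule mult_right_mono) simp
    also have "... = 6 * BB * (H * s ^ e) / k" by simp
    also have "... = C0" using H1 unfolding ks C0_def by simp
    finally show ?thesis .
  qed
  have on: "cmod (li b z) <= C0 * real s ^ (n - e)" if z: "z \<in> PP w" for z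
  proof -
    have "cmod (li b z) <= real BB * of_int (int H)" by (rule li_le) (use z PP_Z[OF w] bH in auto)
    also have "... <= C0 * real s ^ (n - e)" by (simp add: C0_def H_def mult_right_mono)
    finally show ?thesis .
  qed
  show ?thesis using ex off on by blast
qed

text \<open>Up to sign, \<open>N a\<close> divided by a conjugate is the product of the other
  conjugates. That product is integral, and the quotient lies in the field because the norm is
  rational.\<close>

lemma conorm_OK: assumes "a \<in> OK" shows "(%z. of_real (N a) / a z) \<in> OK"
proof (cases "\<exists>w\<in>Z. a w = 0")
  case True
  then have "N a = 0" by (simp add: N_zero_iff)
  then show ?thesis using OK_0 by (simp add: zero_fun_def)
next
  case False
  obtain w where w: "w \<in> Z" using Z_nonempty by blast
  obtain k :: nat where k: "N a = k" using N_OK_nat[OF assms] by blast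
  have kf: "(%z. of_real (N a) / a z) \<in> KF" using KF_divide[OF KF_of_rat[of "of_nat k"], of a w] assms False w k OK_KF by auto
  obtain j :: int where j: "(\<Prod>z\<in>Z. a z) = of_int j"
  proof -
    have "(\<Prod>z\<in>Z. - a z) \<in> \<int>" using esym_OK_int[OF assms, of n] esym_last[OF finite_Z, of a] card_Z by simp
    then have "(-1) ^ n * (\<Prod>z\<in>Z. a z) \<in> \<int>" by (simp add: prod_uminus card_Z)
    then have "(-1) ^ n * ((-1) ^ n * (\<Prod>z\<in>Z. a z)) \<in> \<int>" by (rule Ints_mult[rotated]) (auto intro: Ints_power)
    moreover have "(-1) ^ n * ((-1) ^ n * (\<Prod>z\<in>Z. a z)) = (\<Prod>z\<in>Z. a z)"
      by (simp flip: mult.assoc power_mult_distrib)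
    ultimately have "(\<Prod>z\<in>Z. a z) \<in> \<int>" by metis
    then show ?thesis using that by (auto elim: Ints_cases)
  qed
  have "N a = \<bar>of_int j\<bar>" unfolding N_def prod_norm j by simp
  then have N: "of_real (N a) = of_int (sgn j) * (\<Prod>z\<in>Z. a z)"
    unfolding j by (simp flip: of_int_mult) (metis abs_sgn mult.commute of_int_abs of_real_of_int_eq)
  have "of_real (N a) / a w = of_int (sgn j) * (\<Prod>z\<in>Z - {w}. a z)"
    using False w unfolding N by (subst prod.remove[OF finite_Z w]) auto
  then have "algebraic_int (of_real (N a) / a w)"
    using assms by (auto simp: OK_def intro!: algebraic_int_times algebraic_int_prod algebraic_int_of_int)
  then show ?thesis by (rule OK_I[OF kf w])
qed

text \<open>From a = b + N(b) c follows a / b = 1 + c (N(b) / b), and N(b) / b is integral by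
  \<open>conorm_OK\<close>. The same holds with \<open>a\<close> and \<open>b\<close>
  exchanged.\<close>

lemma unit_if_congruent:
  assumes a: "a \<in> OK" "b \<in> OK" and nz: "w \<in> Z" "a w ~= 0" "b w ~= 0" and N: "N a = N b"
    and c: "c \<in> OK" "!!z. z \<in> Z ==> a z - b z = of_real (N a) * c z"
  shows "(%z. a z / b z) \<in> UK"
proof -
  have nza: "a z ~= 0" "b z ~= 0" if "z \<in> Z" for z using KF_zero[of a z w] KF_zero[of b z w] a nz OK_KF that by auto
  have "(%z. a z / b z) \<in> OK"
  proof (rule OK_cong[OF OK_add[OF OK_1 OK_mult[OF c(1) conorm_OK[OF a(2)]]]])
    fix z assume z: "z \<in> Z"
    have "a z = b z + of_real (N b) * c z" using c(2)[OF z] N by (simp add: algebra_simps)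
    then show "(1 + c * (%z. of_real (N b) / b z)) z = a z / b z" using nza[OF z] by (simp add: add_divide_distrib)
  qed
  moreover have "(%z. b z / a z) \<in> OK"
  proof (rule OK_cong[OF OK_diff[OF OK_1 OK_mult[OF c(1) conorm_OK[OF a(1)]]]])
    fix z assume z: "z \<in> Z"
    have "b z = a z - of_real (N a) * c z" using c(2)[OF z] by (simp add: algebra_simps)
    then show "(1 - c * (%z. of_real (N a) / a z)) z = b z / a z" using nza[OF z] by (simp add: diff_divide_distrib)
  qed
  ultimately show ?thesis unfolding UK_def using nza by (intro CollectI conjI bexI[of _ "%z. b z / a z"]) auto
qed

text \<open>Dirichlet's argument: among sufficiently many elements of bounded norm, two are associated.\<close>

theorem exists_pisot_unit:
  assumes w: "w \<in> Z" and e: "card (PP w) < n"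
  shows "\<exists>u\<in>UK. (\<forall>z\<in>Z - PP w. cmod (u z) < 1 / 2) & 1 < cmod (u w) & cmod (u w) <= CC"
proof -
  define e where "e = card (PP w)"
  have e1: "1 <= e" "e < n" using e by (auto simp: e_def card_insert_if)
  \<comment> \<open>Large enough to absorb the factor \<open>C0 ^ (n + 1)\<close> in
    \<open>up\<close> and \<open>dn\<close> and to leave a factor 4.\<close>
  define S :: nat where "S = 4 * C0 ^ (n + 1)"
  have S1: "S >= 1" using C0_pos by (simp add: S_def)
  \<comment> \<open>The intended sizes of the conjugates at scale \<open>S ^ j\<close>: large on
    \<open>PP w\<close>, small elsewhere, with product 1.\<close>
  define om where "om j z = (if z \<in> PP w then real (S ^ j) ^ (n - e) else 1 / real (S ^ j) ^ e)" for j z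
  have om_pos: "om j z > 0" for j z using S1 by (simp add: om_def)
  have om_prod: "(\<Prod>z\<in>Z. om j z) = 1" for j
  proof -
    have "(\<Prod>z\<in>Z. om j z) = (\<Prod>z\<in>PP w. om j z) * (\<Prod>z\<in>Z - PP w. om j z)"
      by (rule prod.subset_diff[OF PP_Z[OF w] finite_Z, THEN trans]) (rule mult.commute)
    also have "(\<Prod>z\<in>PP w. om j z) = (real (S ^ j) ^ (n - e)) ^ e"
      by (simp add: om_def e_def[symmetric] del: of_nat_power)
    also have "(\<Prod>z\<in>Z - PP w. om j z) = (1 / real (S ^ j) ^ e) ^ (n - e)"
      using finite_Z PP_Z[OF w] by (simp add: om_def card_Diff_subset card_Z e_def[symmetric] del: of_nat_power)
    finally show ?thesis using S1 by (simp add: power_divide power_mult[symmetric] mult_ac)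
  qed
  have "\<exists>c. (\<exists>i<n. c i ~= 0) & (\<forall>z\<in>Z. cmod (li c z) <= C0 * om j z)" for j
  proof -
    have "S ^ j >= 1" using S1 by simp
    from exists_small_off_place[OF w this e] obtain c where c: "\<exists>i<n. c i ~= 0"
      "\<forall>z\<in>Z - PP w. cmod (li c z) * real (S ^ j) ^ e <= C0"
      "\<forall>z\<in>PP w. cmod (li c z) <= C0 * real (S ^ j) ^ (n - e)" unfolding e_def by blast
    have "cmod (li c z) <= C0 * om j z" if z: "z \<in> Z" for z
    proof (cases "z \<in> PP w")
      case True then show ?thesis using c(3) by (auto simp: om_def)
    next
      case False
      then have "cmod (li c z) * real (S ^ j) ^ e <= C0" using c(2) z by blast
      then show ?thesis using False S1 by (simp add: om_def field_simps)
    qed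
    then show ?thesis using c(1) by blast
  qed
  then obtain c where c: "!!j. \<exists>i<n. c j i ~= 0" "!!j z. z \<in> Z ==> cmod (li (c j) z) <= C0 * om j z" by metis
  define a where "a j = li (c j)" for j
  have aOK: "a j \<in> OK" for j by (simp add: a_def li_OK)
  have anz: "a j z ~= 0" if "z \<in> Z" for j z using c(1)[of j] li_nonzero that by (auto simp: a_def)
  have N1: "1 <= N (a j)" for j using N_ge_1[OF aOK w anz[OF w]] .
  have N2: "N (a j) <= C1" for j
  proof -
    have "N (a j) <= (\<Prod>z\<in>Z. C0 * om j z)" unfolding N_def
      by (rule prod_mono) (use c(2) in \<open>auto simp: a_def\<close>)
    also have "... = C1" by (simp add: prod.distrib om_prod card_Z C1_def)
    finally show ?thesis .
  qed
  \<comment> \<open>All conjugates are bounded from above in proportion to \<open>om\<close>, and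
    their product is at least 1, so none of them is much smaller than \<open>om\<close>.\<close>
  have low: "om j z <= cmod (a j z) * C0 ^ n" if z: "z \<in> Z" for j z
  proof -
    have "1 <= cmod (a j z) * (\<Prod>v\<in>Z - {z}. cmod (a j v))"
      using N1[of j] unfolding N_def using finite_Z z by (simp add: prod.remove)
    also have "... <= cmod (a j z) * (\<Prod>v\<in>Z - {z}. C0 * om j v)"
      by (intro mult_left_mono prod_mono) (use c(2) in \<open>auto simp: a_def\<close>)
    also have "(\<Prod>v\<in>Z - {z}. C0 * om j v) = C0 ^ (n - 1) * (\<Prod>v\<in>Z - {z}. om j v)"
      using finite_Z z by (simp add: prod.distrib card_Z)
    also have "(\<Prod>v\<in>Z - {z}. om j v) = 1 / om j z"
      using om_prod[of j] om_pos[of j z] prod.remove[OF finite_Z z, of "om j"] by (simp add: field_simps)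
    finally have "om j z <= cmod (a j z) * real (C0 ^ (n - 1))" using om_pos[of j z] by (simp add: field_simps)
    also have "... <= cmod (a j z) * real (C0 ^ n)" using C0_pos by (intro mult_left_mono of_nat_mono power_increasing) auto
    finally show ?thesis by simp
  qed
  define k where "k j = nat \<lfloor>N (a j)\<rfloor>" for j
  have k: "N (a j) = k j" for j using N_OK_nat[OF aOK[of j]] by (auto simp: k_def)
  have k1: "1 <= k j" "k j <= C1" for j using N1[of j] N2[of j] k[of j] by auto
  define Q where "Q = C1 ^ (n + 1)"
  \<comment> \<open>Equal cells mean equal norms and coefficients that are congruent modulo this
    norm, which is what \<open>unit_if_congruent\<close> needs.\<close>
  define cell where "cell j = (k j, \<lambda>i\<in>{..<n}. c j i mod int (k j))" for j
  have "cell ` {..Q} \<subseteq> {1..C1} \<times> (\<Pi>\<^sub>E i\<in>{..<n}. {0..<int C1})"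
  proof -
    have "0 <= c j i mod int (k j) & c j i mod int (k j) < int C1" for j i
    proof
      show "0 <= c j i mod int (k j)" using k1[of j] by simp
      have "c j i mod int (k j) < int (k j)" using k1[of j] by (intro pos_mod_bound) simp
      then show "c j i mod int (k j) < int C1" using k1[of j] by linarith
    qed
    then show ?thesis using k1 by (auto simp: cell_def split: if_splits)
  qed
  then have "card (cell ` {..Q}) <= card ({1..C1} \<times> (\<Pi>\<^sub>E i\<in>{..<n}. {0..<int C1}))"
    by (intro card_mono finite_cartesian_product finite_PiE) auto
  also have "... = Q" by (simp add: card_cartesian_product card_PiE Q_def)
  also have "... < card {..Q}" by simp
  finally have "\<not> inj_on cell {..Q}" by (rule pigeonhole)
  then obtain j l where jl: "j < l" "l <= Q" "cell j = cell l" by (auto simp: inj_on_def) (metis linorder_neqE_nat)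
  have kk: "k j = k l" using jl(3) by (simp add: cell_def)
  have md: "c j i mod int (k l) = c l i mod int (k l)" if "i < n" for i
    using jl(3) that kk by (auto simp: cell_def dest!: fun_cong[of _ _ i])
  define u where "u z = a l z / a j z" for z
  have uU: "u \<in> UK" unfolding u_def
  proof (rule unit_if_congruent[OF aOK aOK w anz[OF w] anz[OF w]])
    show "N (a l) = N (a j)" using k kk by simp
    show "li (%i. (c l i - c j i) div int (k l)) \<in> OK" by (rule li_OK)
    fix z assume "z \<in> Z"
    have "(c l i - c j i) = int (k l) * ((c l i - c j i) div int (k l))" if "i < n" for i
      using md[OF that] by (metis dvd_mult_div_cancel mod_eq_dvd_iff)
    then have "li (%i. c l i - c j i) z = (\<Sum>i<n. of_int (int (k l) * ((c l i - c j i) div int (k l))) * z ^ i)"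
      unfolding li_def by (intro sum.cong) auto
    then have "a l z - a j z = (\<Sum>i<n. of_int (int (k l) * ((c l i - c j i) div int (k l))) * z ^ i)"
      by (simp add: a_def li_diff)
    then show "a l z - a j z = of_real (N (a l)) * li (%i. (c l i - c j i) div int (k l)) z"
      by (simp add: k li_def sum_distrib_left mult.assoc)
  qed
  define d where "d = l - j"
  have d1: "d >= 1" "d <= Q" using jl by (auto simp: d_def)
  have ratio: "om l z = om j z * (if z \<in> PP w then real (S ^ d) ^ (n - e) else 1 / real (S ^ d) ^ e)" for z
    using jl(1) by (auto simp: om_def d_def power_add[symmetric] power_mult_distrib[symmetric] divide_simps
        simp flip: of_nat_mult)
  have up: "cmod (u z) <= C0 ^ (n + 1) * (if z \<in> PP w then real (S ^ d) ^ (n - e) else 1 / real (S ^ d) ^ e)"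
    if z: "z \<in> Z" for z
  proof -
    have "cmod (u z) = cmod (a l z) / cmod (a j z)" by (simp add: u_def norm_divide)
    also have "... <= C0 * om l z / (om j z / C0 ^ n)"
    proof (intro frac_le)
      show "0 <= C0 * om l z" using om_pos[of l z] by simp
      show "cmod (a l z) <= C0 * om l z" using c(2)[OF z, of l] by (simp add: a_def)
      have C: "0 < real C0 ^ n" using C0_pos by simp
      show "0 < om j z / C0 ^ n" using om_pos[of j z] C by simp
      show "om j z / C0 ^ n <= cmod (a j z)" using low[OF z, of j] C by (simp add: pos_divide_le_eq)
    qed
    also have "... = C0 ^ (n + 1) * (om l z / om j z)" by simp
    finally show ?thesis using om_pos[of j z] by (simp add: ratio)
  qed
  have dn: "cmod (u w) * C0 ^ (n + 1) >= real (S ^ d) ^ (n - e)"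
  proof -
    have "om l w <= cmod (u w) * cmod (a j w) * C0 ^ n" using low[OF w, of l] anz[OF w, of j] by (simp add: u_def norm_divide)
    also have "... <= cmod (u w) * (C0 * om j w) * C0 ^ n"
      using c(2)[OF w, of j] by (intro mult_right_mono mult_left_mono) (auto simp: a_def)
    finally have "om j w * real (S ^ d) ^ (n - e) <= om j w * (cmod (u w) * C0 ^ (n + 1))" unfolding ratio by (simp add: mult_ac)
    then show ?thesis using om_pos[of j w] by (simp only: mult_le_cancel_left_pos)
  qed
  have Sd: "S <= S ^ d" using S1 d1 by (simp add: self_le_power)
  show ?thesis
  proof (intro bexI[OF _ uU] conjI ballI)
    fix z assume z: "z \<in> Z - PP w"
    have "cmod (u z) <= C0 ^ (n + 1) / real (S ^ d) ^ e" using up[of z] z by simp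
    also have "... <= C0 ^ (n + 1) / S"
    proof (rule divide_left_mono)
      have "S <= (S ^ d) ^ e" using Sd S1 e1 self_le_power[of "S ^ d" e] by simp
      then show "real S <= real (S ^ d) ^ e" by (metis of_nat_le_iff of_nat_power)
    qed (use S1 in auto)
    also have "... = 1 / 4" using C0_pos by (simp add: S_def)
    finally show "cmod (u z) < 1 / 2" by simp
  next
    have "S <= (S ^ d) ^ (n - e)" using Sd S1 e1 self_le_power[of "S ^ d" "n - e"] by simp
    then have "real S <= real (S ^ d) ^ (n - e)" by (metis of_nat_le_iff of_nat_power)
    then have "4 * real (C0 ^ (n + 1)) <= cmod (u w) * C0 ^ (n + 1)" using dn by (simp add: S_def)
    then have "4 <= cmod (u w)" using C0_pos by (subst (asm) mult_le_cancel_right_pos) auto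
    then show "1 < cmod (u w)" by simp
  next
    have "cmod (u w) <= C0 ^ (n + 1) * real ((S ^ d) ^ (n - e))" using up[OF w] by simp
    also have "(S ^ d) ^ (n - e) <= S ^ (Q * n)"
      unfolding power_mult[symmetric] using S1 d1 by (intro power_increasing mult_mono) auto
    then have "C0 ^ (n + 1) * real ((S ^ d) ^ (n - e)) <= C0 ^ (n + 1) * real (S ^ (Q * n))"
      by (intro mult_left_mono of_nat_mono) auto
    also have "... = CC" by (simp add: CC_def S_def Q_def)
    finally show "cmod (u w) <= CC" .
  qed
qed

end

section \<open>Invariant sets\<close>

context numfield begin

text \<open>These play the role of the subgroups of finite index.\<close>

definition big :: "(complex => complex) set => bool" where
  "big V \<longleftrightarrow> V \<subseteq> UK & (\<forall>u\<in>V. \<forall>v\<in>V. u * v \<in> V) & (\<forall>u\<in>V. (%z. inverse (u z)) \<in> V)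
     & (\<exists>m>0. \<forall>u\<in>UK. u ^ m \<in> V)"

definition stab :: "(complex => complex) => (complex => complex) set" where
  "stab p = {u \<in> UK. u * p - p \<in> OK}"

lemma big_UK: "big UK" unfolding big_def using UK_mult UK_inverse by (auto intro!: exI[of _ 1])

lemma big_one: "big V ==> 1 \<in> V" unfolding big_def using UK_1 by (metis power_one)

lemma big_power: "big V ==> u \<in> V ==> u ^ k \<in> V" by (induction k) (auto simp: big_one, auto simp: big_def)

lemma big_Int: assumes "big V" "big V'" shows "big (V \<inter> V')"
proof -
  obtain m m' where m: "m > 0" "\<forall>u\<in>UK. u ^ m \<in> V" "m' > 0" "\<forall>u\<in>UK. u ^ m' \<in> V'"
    using assms by (auto simp: big_def)
  have "u ^ (m * m') \<in> V \<inter> V'" if "u \<in> UK" for u using m(2,4) that big_power[OF assms(1)] big_power[OF assms(2)]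
    by (auto simp: power_mult) (metis mult.commute power_mult)
  then have "\<exists>k>0. \<forall>u\<in>UK. u ^ k \<in> V \<inter> V'" using m by (intro exI[of _ "m * m'"]) auto
  then show ?thesis using assms by (auto simp: big_def)
qed

text \<open>The coefficients are multiples of 1 / DD and bounded by \<open>cf_le\<close>. The
  functions are listed only up to equality on \<open>Z\<close>.\<close>

lemma OK_bounded_finite:
  "\<exists>F. finite F & (\<forall>a\<in>OK. (\<forall>z\<in>Z. cmod (a z) <= B) --> (\<exists>f\<in>F. \<forall>z\<in>Z. f z = a z))"
proof -
  have DD_pos: "DD > 0" by (simp add: DD_def)
  define M where "M = \<lceil>DD * (AA * B)\<rceil>"
  define F where "F = (%k z. li k z / of_nat DD) ` (\<Pi>\<^sub>E i\<in>{..<n}. {-M..M})"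
  have "\<exists>f\<in>F. \<forall>z\<in>Z. f z = a z" if a: "a \<in> OK" "\<forall>z\<in>Z. cmod (a z) <= B" for a
  proof -
    have "\<exists>k. of_nat DD * cf a i = of_int k" if "i < n" for i using DD_cf_int[OF a(1) that] by (auto elim: Ints_cases)
    then obtain k where k: "!!i. i < n ==> of_nat DD * cf a i = of_int (k i)" by metis
    have kM: "k i \<in> {-M..M}" if i: "i < n" for i
    proof -
      have "\<bar>real_of_int (k i)\<bar> = cmod (of_nat DD * cf a i)" using k[OF i] by simp
      also have "... <= DD * (AA * B)" unfolding norm_mult using cf_le[of a B i] a(2) by (simp add: mult_left_mono)
      finally have "\<bar>k i\<bar> <= M" unfolding M_def by linarith
      then show ?thesis by auto
    qed
    show ?thesis
    proof (intro bexI ballI)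
      fix z assume z: "z \<in> Z"
      have "li (restrict k {..<n}) z = (\<Sum>i<n. of_nat DD * cf a i * z ^ i)"
        unfolding li_def by (intro sum.cong) (auto simp: k)
      also have "... = of_nat DD * a z" by (simp only: mult.assoc sum_distrib_left[symmetric] cf_expand[OF z])
      finally show "(%z. li (restrict k {..<n}) z / of_nat DD) z = a z" using DD_pos by simp
    next
      show "(%z. li (restrict k {..<n}) z / of_nat DD) \<in> F"
        unfolding F_def by (rule imageI) (use kM in \<open>simp only: restrict_PiE_iff lessThan_iff, blast\<close>)
    qed
  qed
  moreover have "finite F" unfolding F_def by (intro finite_imageI finite_PiE) auto
  ultimately show ?thesis by blast
qed

text \<open>Modulo \<open>q\<close> the powers of \<open>u\<close> have representatives in the
  finite set \<open>F\<close>, so some positive exponent of at most \<open>card F\<close> gives a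
  power congruent to 1. The factorial of \<open>card F\<close> is a multiple of all these exponents
  and therefore serves every unit at once.\<close>

lemma unit_power_congruent_one:
  assumes q: "q > 0"
  shows "\<exists>m>0. \<forall>u\<in>UK. \<exists>b\<in>OK. \<forall>z\<in>Z. (u ^ m) z = 1 + of_nat q * b z"
proof -
  obtain F where F: "finite F" "\<forall>a\<in>OK. (\<forall>z\<in>Z. cmod (a z) <= real q * BB) --> (\<exists>f\<in>F. \<forall>z\<in>Z. f z = a z)"
    using OK_bounded_finite by blast
  define c where "c = card F"
  have "\<exists>b\<in>OK. \<forall>z\<in>Z. (u ^ fact c) z = 1 + of_nat q * b z" if u: "u \<in> UK" for u
  proof -
    have uOK: "u ^ i \<in> OK" for i using UK_power[OF u] UK_OK by blast
    have "\<exists>b. b \<in> OK & (\<exists>f\<in>F. \<forall>z\<in>Z. f z = (u ^ i) z + of_nat q * b z)" for i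
    proof -
      have "(%z. of_real (1 / q) * (u ^ i) z) \<in> EE" by (rule EE_scale) (use uOK OK_EE in blast)
      then obtain b where b: "b \<in> OK" "\<forall>z\<in>Z. cmod (of_real (1 / q) * (u ^ i) z + b z) <= BB"
        using reduce_OK by fastforce
      have bO: "u ^ i + (%z. of_int (int q) * b z) \<in> OK" by (intro OK_add uOK OK_scale b)
      have "cmod ((u ^ i) z + of_int (int q) * b z) <= real q * BB" if "z \<in> Z" for z
      proof -
        have "(u ^ i) z + of_int (int q) * b z = of_nat q * (of_real (1 / q) * (u ^ i) z + b z)"
          using q by (simp add: algebra_simps)
        then show ?thesis using b(2) that by (simp add: norm_mult mult_left_mono del: power_fun_apply)
      qed
      then show ?thesis using F(2)[rule_format, OF bO] b(1) by auto
    qed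
    then obtain b f where bf: "!!i. b i \<in> OK" "!!i. f i \<in> F" "!!i z. z \<in> Z ==> f i z = (u ^ i) z + of_nat q * b i z"
      by metis
    have "card (f ` {..c}) <= c" unfolding c_def by (rule card_mono[OF F(1)]) (use bf(2) in auto)
    then have "\<not> inj_on f {..c}" by (intro pigeonhole) auto
    then obtain i j where ij: "i < j" "j <= c" "f i = f j" by (auto simp: inj_on_def) (metis linorder_neqE_nat)
    define m where "m = j - i"
    define iu where "iu = (%z. inverse (u z)) ^ i"
    have iu: "iu \<in> OK" unfolding iu_def using UK_power[OF UK_inverse[OF u]] UK_OK by blast
    define d where "d = iu * (b i - b j)"
    have cO: "d \<in> OK" unfolding d_def by (intro OK_mult OK_diff iu bf)
    have m1: "(u ^ m) z = 1 + of_nat q * d z" if z: "z \<in> Z" for z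
    proof -
      have A: "(u ^ i) z * (u ^ m) z = (u ^ i) z + of_nat q * (b i z - b j z)"
        using bf(3)[OF z, of i] bf(3)[OF z, of j] ij by (simp add: m_def algebra_simps flip: power_add)
      have B: "iu z * (u ^ i) z = 1" using UK_nonzero[OF u z] by (simp add: iu_def flip: power_mult_distrib)
      have "(u ^ m) z = iu z * (u ^ i) z * (u ^ m) z" unfolding B by simp
      also have "... = iu z * (u ^ i) z + of_nat q * (iu z * (b i z - b j z))"
        by (simp only: mult.assoc A distrib_left mult.left_commute)
      finally show ?thesis unfolding B by (simp add: d_def)
    qed
    have "\<exists>b'\<in>OK. \<forall>z\<in>Z. (u ^ (m * k)) z = 1 + of_nat q * b' z" for k
    proof (induction k)
      case 0 show ?case by (intro bexI[of _ 0] OK_0) auto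
    next
      case (Suc k)
      then obtain b' where b': "b' \<in> OK" "!!z. z \<in> Z ==> (u ^ (m * k)) z = 1 + of_nat q * b' z" by blast
      have "(u ^ (m * Suc k)) z = 1 + of_nat q * (b' + d + (%z. of_int (int q) * (b' * d) z)) z" if z: "z \<in> Z" for z
      proof -
        have "(u ^ (m * Suc k)) z = (u ^ m) z * (u ^ (m * k)) z" by (simp add: power_add)
        then show ?thesis unfolding m1[OF z] b'(2)[OF z] by (simp add: algebra_simps)
      qed
      moreover have "b' + d + (%z. of_int (int q) * (b' * d) z) \<in> OK" by (intro OK_add OK_scale OK_mult b' cO)
      ultimately show ?case by blast
    qed
    moreover have "m dvd fact c" using ij by (intro dvd_fact) (auto simp: m_def)
    ultimately show ?thesis by (metis dvdE)
  qed
  then show ?thesis by (intro exI[of _ "fact c"]) auto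
qed

lemma stab_closed:
  assumes "u \<in> stab p" "v \<in> stab p" shows "u * v \<in> stab p" "(%z. inverse (u z)) \<in> stab p"
proof -
  have "u * (v * p - p) + (u * p - p) \<in> OK" using assms UK_OK by (intro OK_add OK_mult) (auto simp: stab_def)
  then show "u * v \<in> stab p" using assms by (simp add: stab_def UK_mult algebra_simps)
  define v where "v = (%z. inverse (u z))"
  have v: "v \<in> UK" unfolding v_def by (rule UK_inverse) (use assms in \<open>simp add: stab_def\<close>)
  have "- (v * (u * p - p)) \<in> OK" using assms v UK_OK by (intro OK_uminus OK_mult) (auto simp: stab_def)
  then have "v * p - p \<in> OK"
  proof (rule OK_cong)
    fix z assume "z \<in> Z"
    then have "u z ~= 0" using assms UK_nonzero by (auto simp: stab_def)
    then show "(- (v * (u * p - p))) z = (v * p - p) z" by (simp add: v_def field_simps)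
  qed
  with v show "v \<in> stab p" by (simp add: stab_def)
qed

text \<open>If \<open>q\<close> is a denominator of \<open>p\<close>, every unit congruent to 1
  modulo \<open>q\<close> fixes \<open>p\<close> modulo integers.\<close>

lemma big_stab: assumes "p \<in> KF" shows "big (stab p)"
proof -
  obtain q :: nat where q: "q > 0" "(%z. of_nat q * p z) \<in> OK" using OK_multiple[OF assms] by blast
  obtain m where m: "m > 0" "\<forall>u\<in>UK. \<exists>b\<in>OK. \<forall>z\<in>Z. (u ^ m) z = 1 + of_nat q * b z"
    using unit_power_congruent_one[OF q(1)] by blast
  have "u ^ m \<in> stab p" if u: "u \<in> UK" for u
  proof -
    obtain b where b: "b \<in> OK" "!!z. z \<in> Z ==> (u ^ m) z = 1 + of_nat q * b z" using m u by blast
    have "u ^ m * p - p \<in> OK"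
    proof (rule OK_cong[OF OK_mult[OF b(1) q(2)]])
      fix z assume "z \<in> Z"
      then show "(b * (%z. of_nat q * p z)) z = (u ^ m * p - p) z" using b(2)[of z] by (simp add: algebra_simps)
    qed
    then show ?thesis using UK_power[OF u] by (simp add: stab_def)
  qed
  then show ?thesis unfolding big_def using stab_closed m(1) by (auto simp: stab_def)
qed

text \<open>These are the preimages in \<open>EE\<close> of the closed subsets of the torus
  \<open>EE\<close> modulo \<open>OK\<close>.\<close>

definition inv :: "(complex => complex) set => bool" where
  "inv X \<longleftrightarrow> X \<subseteq> EE & closedZ X & (\<forall>x\<in>X. \<forall>a\<in>OK. x + a \<in> X)"

definition uinv :: "(complex => complex) set => (complex => complex) set => bool" where
  "uinv V X \<longleftrightarrow> (\<forall>u\<in>V. \<forall>x\<in>X. u * x \<in> X)"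

definition diffs :: "(complex => complex) set => (complex => complex) set" where
  "diffs X = {d. \<exists>x\<in>X. x + d \<in> X}"

lemma invD: "inv X ==> x \<in> X ==> a \<in> OK ==> x + a \<in> X" by (simp add: inv_def)
lemma inv_EE: "inv X ==> x \<in> X ==> x \<in> EE" by (auto simp: inv_def)
lemma inv_closed: "inv X ==> (!!k. f k \<in> X) ==> conv f l ==> l \<in> X" unfolding inv_def using closedZD by blast
lemma inv_cong: "inv X ==> x \<in> X ==> (!!z. z \<in> Z ==> x z = y z) ==> y \<in> X"
  unfolding inv_def using closedZ_cong by blast

lemma compactness:
  assumes "!!k. x k \<in> EE"
  shows "\<exists>a l r. (\<forall>k. a k \<in> OK) & strict_mono (r :: nat => nat) & conv (%k. x (r k) + a (r k)) l & l \<in> EE"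
proof -
  have "\<forall>k. \<exists>a\<in>OK. \<forall>z\<in>Z. cmod ((x k + a) z) <= BB" using reduce_OK[OF assms] by blast
  then obtain a where a: "!!k. a k \<in> OK" "!!k z. z \<in> Z ==> cmod ((x k + a k) z) <= BB" by metis
  obtain l r where r: "strict_mono (r :: nat => nat)" "conv (%k. x (r k) + a (r k)) l"
    using bounded_conv_subseq[of "%k. x k + a k" BB] a(2) by blast
  have "l \<in> EE" by (rule closedZD[OF closedZ_EE _ r(2)]) (use assms a OK_EE EE_add in blast)
  then show ?thesis using a r by blast
qed

text \<open>Closedness of the difference set comes from compactness of the torus: the base points
  are translated into a bounded region before the limit is taken.\<close>

lemma inv_diffs: assumes X: "inv X" shows "inv (diffs X)" unfolding inv_def
proof (intro conjI ballI)
  show "diffs X \<subseteq> EE"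
  proof
    fix d assume "d \<in> diffs X"
    then obtain x where "x \<in> X" "x + d \<in> X" by (auto simp: diffs_def)
    then have "(x + d) - x \<in> EE" using X by (intro EE_diff) (auto simp: inv_def)
    then show "d \<in> EE" by simp
  qed
  show "closedZ (diffs X)" unfolding closedZ_def
  proof (intro allI impI)
    fix d l assume d: "\<forall>k. d k \<in> diffs X" and l: "conv d l"
    then have "\<forall>k. \<exists>x. x \<in> X & x + d k \<in> X" by (auto simp: diffs_def)
    then obtain x where x: "!!k. x k \<in> X" "!!k. x k + d k \<in> X" by metis
    obtain a y r where a: "!!k. a k \<in> OK" "strict_mono (r :: nat => nat)" "conv (%k. x (r k) + a (r k)) y"
      using compactness[of x] x(1) inv_EE[OF X] by blast
    have "y \<in> X" by (rule inv_closed[OF X _ a(3)]) (intro invD[OF X] x a)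
    moreover have "conv (%k. x (r k) + a (r k) + d (r k)) (y + l)" by (intro conv_add a conv_subseq[OF l])
    then have "y + l \<in> X"
    proof (rule inv_closed[OF X, rotated])
      fix k show "x (r k) + a (r k) + d (r k) \<in> X" using invD[OF X x(2)[of "r k"] a(1)[of "r k"]] by (simp add: add_ac)
    qed
    ultimately show "l \<in> diffs X" by (auto simp: diffs_def)
  qed
  fix d a assume "d \<in> diffs X" "a \<in> OK"
  then show "d + a \<in> diffs X" using invD[OF X] unfolding diffs_def by (auto simp: add.assoc[symmetric])
qed

lemma uinv_diffs: "uinv V X ==> uinv V (diffs X)" unfolding uinv_def diffs_def by (clarsimp, metis distrib_left)

lemma uinv_mono: "uinv V X ==> V' \<subseteq> V ==> uinv V' X" by (auto simp: uinv_def)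

text \<open>Parametrizes the coordinate plane of \<open>EE\<close> that belongs to \<open>w\<close>
  and its conjugate, or the coordinate line for real \<open>w\<close>. In the real case only real
  \<open>t\<close> give an element of \<open>EE\<close>.\<close>

definition axis :: "complex => complex => complex => complex" where
  "axis w t = (%z. if z = w then t else if z = cnj w then cnj t else 0)"

lemma axis_EE: "w \<in> Z ==> (w = cnj w ==> t \<in> \<real>) ==> axis w t \<in> EE" by (auto simp: EE_def axis_def Reals_cnj_iff)

lemma axis_eqI: "x \<in> EE ==> w \<in> Z ==> (!!z. z \<in> Z ==> z ~= w ==> z ~= cnj w ==> x z = 0) ==> z \<in> Z ==> x z = axis w (x w) z"
  by (auto simp: EE_def axis_def)

lemma mult_axis: "u \<in> EE ==> w \<in> Z ==> u * axis w t = axis w (u w * t)" by (rule ext) (auto simp: axis_def EE_def)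

end

text \<open>The remainder of the first-order expansion is dominated by the remainder for (1 + x)^i
  with x the absolute value of \<open>e\<close>, and that one by the remainder of the exponential
  series.\<close>

lemma power_one_plus_approx:
  fixes e :: complex
  assumes "real i * cmod e <= 1"
  shows "cmod ((1 + e) ^ i - 1 - of_nat i * e) <= (real i * cmod e)\<^sup>2"
proof -
  define x where "x = cmod e"
  have "cmod ((1 + e) ^ i - 1 - of_nat i * e) <= (1 + x) ^ i - 1 - real i * x" for i
  proof (induction i)
    case (Suc i)
    define f where "f = (1 + e) ^ i - 1 - of_nat i * e"
    have "(1 + e) ^ Suc i - 1 - of_nat (Suc i) * e = f * (1 + e) + of_nat i * e\<^sup>2"
      by (simp add: f_def algebra_simps power2_eq_square)
    also have "cmod ... <= cmod f * (1 + x) + real i * x\<^sup>2" by (rule norm_triangle_le)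
         (auto simp: norm_mult norm_power x_def intro!: add_mono mult_left_mono norm_triangle_le)
    also have "... <= ((1 + x) ^ i - 1 - real i * x) * (1 + x) + real i * x\<^sup>2"
      using Suc by (intro add_right_mono mult_right_mono) (auto simp: f_def x_def)
    also have "... = (1 + x) ^ Suc i - 1 - real (Suc i) * x" by (simp add: algebra_simps power2_eq_square)
    finally show ?case .
  qed simp
  also have "(1 + x) ^ i - 1 - real i * x <= exp (real i * x) - 1 - real i * x"
    using power_mono[of "1 + x" "exp x" i] exp_ge_add_one_self[of x] by (simp add: x_def exp_of_nat_mult)
  also have "... <= (real i * x)\<^sup>2" using exp_bound[of "real i * x"] assms by (simp add: x_def)
  finally show ?thesis by (simp add: x_def)
qed

lemma bounded_seq_close_pair:
  fixes c :: "nat => complex"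
  assumes "!!i. cmod (c i) <= B" "e > 0"
  shows "\<exists>i j. i < j & cmod (c j - c i) < e"
proof -
  have "bounded (range c)" using assms(1) by (auto simp: bounded_iff)
  then obtain l r where r: "strict_mono (r :: nat => nat)" "(c \<circ> r) \<longlonglongrightarrow> l"
    using bounded_imp_convergent_subsequence by blast
  then have "Cauchy (c \<circ> r)" by (auto intro: LIMSEQ_imp_Cauchy)
  then obtain M where "\<forall>m\<ge>M. \<forall>n\<ge>M. cmod ((c \<circ> r) m - (c \<circ> r) n) < e"
    using assms(2) by (auto dest: CauchyD)
  then have "cmod (c (r (Suc M)) - c (r M)) < e" by simp
  then show ?thesis using r(1) by (intro exI[of _ "r M"] exI[of _ "r (Suc M)"]) (simp add: strict_mono_def)
qed

text \<open>Multiplicative independence, with the negative exponents moved to the other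
  side.\<close>

definition (in numfield) indep :: "(complex => complex) => (complex => complex) => bool" where
  "indep a b \<longleftrightarrow> (\<forall>i j i' j'. (\<forall>z\<in>Z. a z ^ i * b z ^ j = a z ^ i' * b z ^ j') --> i = i' & j = j')"

section \<open>Units close to 1 at a given place\<close>

locale numfield_units = numfield +
  fixes alpha beta :: "complex => complex"
  assumes alpha: "alpha \<in> UK" and beta: "beta \<in> UK" and indep: "indep alpha beta"
begin

lemma indep_commute: "indep a b ==> indep b a" unfolding indep_def by (metis mult.commute)

lemma indep_inverse:
  assumes "a \<in> UK" "indep a b" shows "indep (%z. inverse (a z)) b" unfolding indep_def
proof (intro allI impI)
  fix i j i' j'
  assume h: "\<forall>z\<in>Z. inverse (a z) ^ i * b z ^ j = inverse (a z) ^ i' * b z ^ j'"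
  have "a z ^ i' * b z ^ j = a z ^ i * b z ^ j'" if z: "z \<in> Z" for z using h[rule_format, OF z] UK_nonzero[OF assms(1) z]
    by (simp add: power_inverse field_simps)
  then show "i = i' & j = j'" using assms(2) unfolding indep_def by metis
qed

lemma indep_power: assumes "indep a b" "m > 0" shows "indep (a ^ m) (b ^ m)" unfolding indep_def
proof (intro allI impI)
  fix i j i' j'
  assume "\<forall>z\<in>Z. (a ^ m) z ^ i * (b ^ m) z ^ j = (a ^ m) z ^ i' * (b ^ m) z ^ j'"
  then have "\<forall>z\<in>Z. a z ^ (m * i) * b z ^ (m * j) = a z ^ (m * i') * b z ^ (m * j')" by (simp add: power_mult)
  then have "m * i = m * i' & m * j = m * j'" using assms(1) unfolding indep_def by blast
  then show "i = i' & j = j'" using assms(2) by simp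
qed

text \<open>If \<open>w\<close> and its conjugate were the only roots, norm 1 would put all
  conjugates of all powers of \<open>alpha\<close> on the unit circle, and by discreteness two
  powers would coincide.\<close>

lemma card_PP: assumes w: "w \<in> Z" shows "card (PP w) < n"
proof (rule ccontr)
  assume "\<not> card (PP w) < n"
  then have "card (PP w) = card Z" using card_mono[OF finite_Z PP_Z[OF w]] by (simp add: card_Z)
  then have eq: "PP w = Z" by (rule card_subset_eq[OF finite_Z PP_Z[OF w]])
  have aE: "alpha \<in> EE" using alpha UK_OK OK_EE by blast
  have abs: "cmod (alpha z) = cmod (alpha w)" if "z \<in> Z" for z
  proof -
    have "alpha (cnj w) = cnj (alpha w)" using aE w by (simp add: EE_def)
    moreover have "z = w | z = cnj w" using that eq by blast
    ultimately show ?thesis by auto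
  qed
  have "cmod (alpha w) ^ n = 1" using N_UK[OF alpha] abs by (simp add: N_def card_Z)
  then have "cmod (alpha w) = 1" using n_pos power_eq_imp_eq_base[of "cmod (alpha w)" n 1] by simp
  then have b: "cmod ((alpha ^ k) z) <= 1" if "z \<in> Z" for k z using abs[OF that] by (simp add: norm_power)
  obtain i j :: nat where "i < j" "\<forall>z\<in>Z. (alpha ^ i) z = (alpha ^ j) z"
    using OK_bounded_repeat[of "%k. alpha ^ k" 1] b UK_power[OF alpha] UK_OK by blast
  then have "\<forall>z\<in>Z. alpha z ^ i * beta z ^ 0 = alpha z ^ j * beta z ^ 0" by simp
  then have "i = j" using indep unfolding indep_def by blast
  with \<open>i < j\<close> show False by simp
qed

lemma pisot:
  assumes V: "big V" and w: "w \<in> Z"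
  shows "\<exists>u\<in>V. (\<forall>z\<in>Z. z ~= w --> z ~= cnj w --> cmod (u z) < 1) & 1 < cmod (u w)"
proof -
  obtain u where u: "u \<in> UK" "\<forall>z\<in>Z - PP w. cmod (u z) < 1 / 2" "1 < cmod (u w)"
    using exists_pisot_unit[OF w card_PP[OF w]] by blast
  obtain m where m: "m > 0" "\<forall>u\<in>UK. u ^ m \<in> V" using V by (auto simp: big_def)
  have "cmod ((u ^ m) z) < 1" if "z \<in> Z" "z ~= w" "z ~= cnj w" for z
  proof -
    have "cmod (u z) < 1 / 2" using u(2) that by blast
    then have "cmod (u z) ^ m < 1" using m(1) by (intro power_less_one_iff[THEN iffD2]) auto
    then show ?thesis by (simp add: norm_power)
  qed
  moreover have "1 < cmod ((u ^ m) w)" using u(3) m(1) by (simp add: norm_power one_less_power)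
  ultimately show ?thesis using u(1) m(2) by blast
qed

text \<open>For every i the least j for which a^i b^j has absolute value at least 1 at
  \<open>w\<close> puts this product into a fixed annulus. Two of these points are close, so their
  quotient is close to 1, and it is not 1 by independence. The exponents j do not decrease with i,
  so the quotient is again a product of nonnegative powers.\<close>

lemma ratio_near_one_aux:
  assumes V: "big V" and w: "w \<in> Z" and ab: "a \<in> V" "b \<in> V" "indep a b"
    and a1: "cmod (a w) <= 1" and b1: "cmod (b w) > 1" and e: "e > 0"
  shows "\<exists>u\<in>V. u w ~= 1 & cmod (u w - 1) < e"
proof -
  have VU: "V \<subseteq> UK" using V by (simp add: big_def)
  have aw: "a w ~= 0" using ab VU UK_nonzero w by blast
  define P where "P i j \<longleftrightarrow> 1 <= cmod (a w ^ i * b w ^ j)" for i j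
  have "\<exists>j. P i j" for i
  proof -
    obtain j where "inverse (cmod (a w) ^ i) < cmod (b w) ^ j" using real_arch_pow[OF b1] by blast
    then show ?thesis using aw unfolding P_def norm_mult norm_power by (intro exI[of _ j]) (simp add: field_simps)
  qed
  then have Pj: "P i (LEAST j. P i j)" for i by (rule LeastI_ex)
  define J where "J i = (LEAST j. P i j)" for i
  have J: "P i (J i)" for i using Pj by (simp add: J_def)
  have Pmono: "P i j" if "P (i + d) j" for i j d
  proof -
    have "cmod (a w ^ (i + d) * b w ^ j) = cmod (a w) ^ d * cmod (a w ^ i * b w ^ j)"
      by (simp add: norm_mult norm_power power_add)
    also have "... <= 1 * cmod (a w ^ i * b w ^ j)" using a1 by (intro mult_right_mono power_le_one) auto
    finally show ?thesis using that by (simp add: P_def)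
  qed
  have Jmono: "J i <= J i'" if "i <= i'" for i i'
    using Pmono[of i "i' - i" "J i'"] J[of i'] that unfolding J_def[of i] by (simp add: Least_le)
  define c where "c i = a w ^ i * b w ^ J i" for i
  have c1: "1 <= cmod (c i)" for i using J[of i] by (simp add: P_def c_def)
  have c2: "cmod (c i) <= cmod (b w)" for i
  proof (cases "J i")
    case 0
    then have "cmod (c i) <= 1" using a1 by (simp add: c_def norm_power power_le_one)
    then show ?thesis using b1 by linarith
  next
    case (Suc j)
    then have "\<not> P i j" unfolding J_def by (metis lessI not_less_Least)
    then have "cmod (a w ^ i * b w ^ j) * cmod (b w) <= 1 * cmod (b w)" unfolding P_def by (intro mult_right_mono) auto
    then show ?thesis by (simp add: c_def Suc norm_mult mult_ac)
  qed
  obtain i i' where i: "i < i'" "cmod (c i' - c i) < e" using bounded_seq_close_pair[of c, OF c2 e] by blast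
  define u where "u = a ^ (i' - i) * b ^ (J i' - J i)"
  have u: "u \<in> V" unfolding u_def using V ab big_power[OF V] by (simp add: big_def)
  have "c i' = u w * c i" using i(1) Jmono[of i i'] by (simp add: c_def u_def power_add[symmetric] mult_ac)
  then have "c i' - c i = (u w - 1) * c i" by (simp add: algebra_simps)
  then have "cmod (u w - 1) * 1 <= cmod (c i' - c i)" unfolding norm_mult using mult_left_mono[OF c1] by (simp add: norm_mult)
  then have small: "cmod (u w - 1) < e" using i(2) by linarith
  have "u w ~= 1"
  proof
    assume "u w = 1"
    then have "u z = 1" if "z \<in> Z" for z using KF_eq[of u 1 w z] u VU UK_OK OK_KF KF_1 w that by auto
    then have "\<forall>z\<in>Z. a z ^ (i' - i) * b z ^ (J i' - J i) = a z ^ 0 * b z ^ 0" by (simp add: u_def)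
    then have "i' - i = 0" using ab(3) unfolding indep_def by blast
    then show False using i by simp
  qed
  with u small show ?thesis by blast
qed

lemma ratio_near_one:
  assumes V: "big V" and w: "w \<in> Z" and e: "e > 0"
  shows "\<exists>u\<in>V. u w ~= 1 & cmod (u w - 1) < e"
proof -
  have VU: "V \<subseteq> UK" using V by (simp add: big_def)
  obtain m where m: "m > 0" "\<forall>u\<in>UK. u ^ m \<in> V" using V by (auto simp: big_def)
  have inv: "(%z. inverse (u z)) \<in> V" if "u \<in> V" for u using V that by (auto simp: big_def)
  have main: ?thesis if ab: "a \<in> V" "b \<in> V" "indep a b" and b1: "cmod (b w) ~= 1" for a b
  proof -
    have nz: "a w ~= 0" "b w ~= 0" using ab VU UK_nonzero w by blast+
    define a' where "a' = (if cmod (a w) <= 1 then a else (%z. inverse (a z)))"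
    define b' where "b' = (if cmod (b w) > 1 then b else (%z. inverse (b z)))"
    have "a' \<in> V" "b' \<in> V" using ab inv by (auto simp: a'_def b'_def)
    moreover have "indep a b'" using ab VU indep_inverse[of b a] indep_commute by (auto simp: b'_def)
    then have "indep a' b'" using ab VU indep_inverse[of a b'] by (auto simp: a'_def)
    moreover have "cmod (a' w) <= 1" using nz by (auto simp: a'_def norm_inverse inverse_le_1_iff)
    moreover have "cmod (b' w) > 1" using nz b1 by (auto simp: b'_def norm_inverse one_less_inverse_iff)
    ultimately show ?thesis using ratio_near_one_aux[OF V w _ _ _ _ _ e] by blast
  qed
  define a where "a = alpha ^ m"
  define b where "b = beta ^ m"
  have ab: "a \<in> V" "b \<in> V" "indep a b" using m alpha beta indep_power[OF indep] by (auto simp: a_def b_def)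
  show ?thesis
  proof (cases "cmod (b w) = 1")
    case False then show ?thesis using main ab by blast
  next
    \<comment> \<open>The powers of \<open>b\<close> stay on the unit circle, so they alone provide
      two close points.\<close>
    case b1: True
    obtain i j where ij: "i < j" "cmod (b w ^ j - b w ^ i) < e"
      using bounded_seq_close_pair[of "%i. b w ^ i" 1 e] b1 e by (auto simp: norm_power)
    have "b w ^ j - b w ^ i = (b w ^ (j - i) - 1) * b w ^ i" using ij(1) by (simp add: left_diff_distrib power_add[symmetric])
    then have "cmod ((b ^ (j - i)) w - 1) < e" using ij(2) b1 by (simp add: norm_mult norm_power)
    moreover have "(b ^ (j - i)) w ~= 1"
    proof
      assume "(b ^ (j - i)) w = 1"
      then have "(b ^ (j - i)) z = 1" if "z \<in> Z" for z
        using KF_eq[of "b ^ (j - i)" 1 w z] ab VU UK_OK OK_KF KF_1 w that KF_power by (metis one_fun_apply subsetD)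
      then have "\<forall>z\<in>Z. a z ^ 0 * b z ^ (j - i) = a z ^ 0 * b z ^ 0" by simp
      then have "j - i = 0" using ab(3) unfolding indep_def by blast
      then show False using ij by simp
    qed
    ultimately show ?thesis using big_power[OF V ab(2)] by blast
  qed
qed

subsection \<open>Lines in invariant sets\<close>

lemma conv_axis: "t \<longlonglongrightarrow> c ==> conv (%k. axis w (t k)) (axis w c)"
  unfolding conv_def axis_def by (auto intro: tendsto_cnj)

lemma axis_add: "axis w (s + t) = axis w s + axis w t" by (rule ext) (simp add: axis_def)
lemma axis_diff: "axis w (s - t) = axis w s - axis w t" by (rule ext) (simp add: axis_def)
lemma axis_scale: "axis w (of_real r * t) = (%z. of_real r * axis w t z)" by (rule ext) (simp add: axis_def)

text \<open>The points \<open>(1 + e\<^sub>k)\<^sup>i T\<^sub>k\<close> with large \<open>T\<^sub>k\<close> and tiny \<open>e\<^sub>k T\<^sub>k\<close> trace an almost straight line.\<close>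

lemma half_line:
  assumes D: "inv D" "uinv V D" and V: "big V" and w: "w \<in> Z"
    and T: "!!k. axis w (T k) \<in> D" and e: "!!k. e k \<in> V" "!!k. e k w ~= 1"
    and a: "!!k. a k \<in> OK" and y: "conv (%k. axis w (T k) + a k) y"
    and A: "filterlim (%k. cmod (T k)) at_top sequentially"
    and Ae: "(%k. cmod (T k) * cmod (e k w - 1)) \<longlonglongrightarrow> 0"
    and dir: "(%k. T k * (e k w - 1) / of_real (cmod (T k) * cmod (e k w - 1))) \<longlonglongrightarrow> tau"
    and s: "s >= 0"
  shows "y + axis w (of_real s * tau) \<in> D"
proof -
  define ep where "ep k = e k w - 1" for k
  \<comment> \<open>The length of one step from \<open>T k\<close>, so that \<open>i k\<close> steps
    cover approximately the length \<open>s\<close>.\<close>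
  define x where "x k = cmod (T k) * cmod (ep k)" for k
  define i where "i k = nat \<lfloor>s / x k\<rfloor>" for k
  have VE: "u \<in> EE" if "u \<in> V" for u using that V UK_OK OK_EE by (auto simp: big_def)
  have ev: "eventually (%k. cmod (T k) >= 1 + s) sequentially" using A by (simp add: filterlim_at_top)
  have evx: "eventually (%k. x k > 0) sequentially" using ev
  proof eventually_elim
    case (elim k)
    then have "cmod (T k) > 0" using s by linarith
    then show ?case using e(2)[of k] by (simp add: x_def ep_def)
  qed
  have ix: "\<bar>real (i k) * x k - s\<bar> <= x k" "real (i k) * x k <= s" if "x k > 0" for k
  proof -
    have "0 <= s / x k" using s that by simp
    then have "real (i k) <= s / x k" "s / x k < real (i k) + 1" unfolding i_def by linarith+
    then show "\<bar>real (i k) * x k - s\<bar> <= x k" "real (i k) * x k <= s" using that by (auto simp: field_simps abs_le_iff)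
  qed
  have main: "(%k. T k * ((1 + ep k) ^ i k - 1)) \<longlonglongrightarrow> of_real s * tau"
  proof -
    have x0: "x \<longlonglongrightarrow> 0" using Ae by (simp add: x_def[abs_def] ep_def)
    have l1: "(%k. real (i k) * x k) \<longlonglongrightarrow> s"
    proof (rule LIM_zero_cancel, rule tendsto_rabs_zero_cancel, rule tendsto_sandwich[OF _ _ tendsto_const x0])
      show "eventually (%k. \<bar>real (i k) * x k - s\<bar> <= x k) sequentially" using evx by eventually_elim (rule ix)
    qed auto
    have "(%k. of_real (real (i k) * x k) * (T k * ep k / of_real (x k))) \<longlonglongrightarrow> of_real s * tau"
      using dir by (intro tendsto_mult tendsto_of_real l1) (simp add: x_def ep_def)
    moreover have "(%k. T k * ((1 + ep k) ^ i k - 1) - of_real (real (i k) * x k) * (T k * ep k / of_real (x k))) \<longlonglongrightarrow> 0"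
    proof (rule tendsto_norm_zero_cancel, rule tendsto_sandwich[OF _ _ tendsto_const])
      show "eventually (%k. norm (T k * ((1 + ep k) ^ i k - 1) - of_real (real (i k) * x k) * (T k * ep k / of_real (x k)))
         <= s\<^sup>2 / cmod (T k)) sequentially" using ev evx
      proof eventually_elim
        case (elim k)
        have T0: "cmod (T k) > 0" using elim s by linarith
        have b: "real (i k) * cmod (ep k) <= s / cmod (T k)" using ix(2)[OF elim(2)] T0 by (simp add: x_def field_simps)
        also have "s / cmod (T k) <= 1" using T0 elim(1) s by (simp add: field_simps)
        finally have b1: "real (i k) * cmod (ep k) <= 1" .
        have "of_real (real (i k) * x k) * (T k * ep k / of_real (x k)) = T k * (of_nat (i k) * ep k)" using elim(2) by simp
        then have "norm (T k * ((1 + ep k) ^ i k - 1) - of_real (real (i k) * x k) * (T k * ep k / of_real (x k)))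
          = cmod (T k) * cmod ((1 + ep k) ^ i k - 1 - of_nat (i k) * ep k)"
          by (simp add: right_diff_distrib norm_mult[symmetric] mult_ac)
        also have "... <= cmod (T k) * (real (i k) * cmod (ep k))\<^sup>2" by (intro mult_left_mono power_one_plus_approx b1) auto
        also have "... <= cmod (T k) * (s / cmod (T k))\<^sup>2" by (intro mult_left_mono power_mono b) auto
        also have "... = s\<^sup>2 / cmod (T k)" using T0 by (simp add: power2_eq_square)
        finally show ?case .
      qed
      show "(%k. s\<^sup>2 / cmod (T k)) \<longlonglongrightarrow> 0" by (rule real_tendsto_divide_at_top[OF tendsto_const A])
    qed auto
    ultimately show ?thesis using tendsto_add by fastforce
  qed
  have "conv (%k. (axis w (T k) + a k) + axis w (T k * ((1 + ep k) ^ i k - 1))) (y + axis w (of_real s * tau))"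
    by (intro conv_add y conv_axis main)
  then show ?thesis
  proof (rule inv_closed[OF D(1), rotated])
    fix k
    have ee: "e k ^ i k \<in> V" using big_power[OF V e(1)] .
    have "e k ^ i k * axis w (T k) = axis w ((1 + ep k) ^ i k * T k)" using mult_axis[OF VE[OF ee] w] by (simp add: ep_def)
    also have "... = axis w (T k) + axis w (T k * ((1 + ep k) ^ i k - 1))" by (simp add: axis_add[symmetric] algebra_simps)
    finally have "axis w (T k) + axis w (T k * ((1 + ep k) ^ i k - 1)) \<in> D" using D(2) T[of k] ee unfolding uinv_def by metis
    from invD[OF D(1) this a[of k]]
    show "axis w (T k) + a k + axis w (T k * ((1 + ep k) ^ i k - 1)) \<in> D" by (simp add: add_ac)
  qed
qed

text \<open>A unit that is large at \<open>w\<close> only is applied to the small vectors until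
  their coordinate at \<open>w\<close> has absolute value between 1 and \<open>rho\<close>. The
  coordinates off \<open>w\<close> and its conjugate do not grow, so they still tend to 0 and a
  limit lies on the axis. The closed set \<open>S\<close> carries extra properties of the vectors to
  the limit; later these are being real or purely imaginary.\<close>

lemma axis_point:
  assumes D: "inv D" "uinv V D" and V: "big V"
    and v: "!!k. v k \<in> D" "conv v 0" "!!k. \<exists>z\<in>Z. v k z ~= 0"
    and S: "closedZ S" "!!k. v k \<in> S" "!!u x. u \<in> V ==> x \<in> S ==> u * x \<in> S"
  shows "\<exists>w\<in>Z. \<exists>t. t ~= 0 & axis w t \<in> D & axis w t \<in> S"
proof -
  \<comment> \<open>The place must not depend on \<open>k\<close>: some coordinate is nonzero for
    infinitely many \<open>k\<close>.\<close>
  have "\<exists>w\<in>Z. infinite {k \<in> UNIV. v k w ~= 0}" by (rule pigeonhole_infinite_rel) (use finite_Z v(3) in auto)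
  then obtain w where w: "w \<in> Z" "infinite {k. v k w ~= 0}" by auto
  obtain u where u: "u \<in> V" "\<forall>z\<in>Z. z ~= w --> z ~= cnj w --> cmod (u z) < 1" "1 < cmod (u w)"
    using pisot[OF V w(1)] by blast
  define rho where "rho = cmod (u w)"
  have uE: "u ^ j \<in> EE" for j using big_power[OF V u(1)] V UK_OK OK_EE by (auto simp: big_def)
  have "eventually (%k. \<forall>z\<in>Z. cmod (v k z) < 1) sequentially"
  proof (rule eventually_ball_finite[OF finite_Z], rule ballI)
    fix z assume "z \<in> Z"
    then have "(%k. cmod (v k z)) \<longlonglongrightarrow> 0" using v(2) by (auto simp: conv_def intro: tendsto_norm_zero)
    then show "eventually (%k. cmod (v k z) < 1) sequentially" by (rule order_tendstoD) simp
  qed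
  then obtain K where K: "!!k z. k >= K ==> z \<in> Z ==> cmod (v k z) < 1" by (auto simp: eventually_sequentially)
  have "infinite ({k. v k w ~= 0} - {..<K})" using w(2) by (rule Diff_infinite_finite[rotated]) simp
  then obtain r where r: "strict_mono (r :: nat => nat)" "!!k. r k \<in> {k. v k w ~= 0} - {..<K}"
    using infinite_enumerate by blast
  define v' where "v' k = v (r k)" for k
  have v': "v' k \<in> D" "v' k \<in> S" "v' k w ~= 0" "!!z. z \<in> Z ==> cmod (v' k z) < 1" for k
    using v(1) S(2) r(2)[of k] K by (auto simp: v'_def)
  have cv': "conv v' 0" unfolding v'_def by (rule conv_subseq[OF v(2) r(1)])
  have "\<exists>j. 1 <= rho ^ j * cmod (v' k w) & rho ^ j * cmod (v' k w) <= rho" for k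
  proof -
    define P where "P j \<longleftrightarrow> 1 <= rho ^ j * cmod (v' k w)" for j
    obtain j where "inverse (cmod (v' k w)) < rho ^ j" using real_arch_pow[of rho] u(3) by (auto simp: rho_def)
    then have "P j" using v'(3)[of k] by (simp add: P_def field_simps)
    then have L: "P (LEAST j. P j)" by (rule LeastI)
    have "\<not> P 0" using v'(4)[OF w(1), of k] by (simp add: P_def)
    then have "(LEAST j. P j) ~= 0" using L by metis
    then obtain i where i: "(LEAST j. P j) = Suc i" using not0_implies_Suc by blast
    then have "\<not> P i" by (metis lessI not_less_Least)
    then have "rho * (rho ^ i * cmod (v' k w)) <= rho * 1" unfolding P_def using u(3)
      by (intro mult_left_mono) (auto simp: rho_def)
    moreover have "P (Suc i)" using L i by simp
    ultimately show ?thesis unfolding P_def by (intro exI[of _ "Suc i"]) (simp add: mult_ac)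
  qed
  then obtain j where j: "!!k. 1 <= rho ^ j k * cmod (v' k w)" "!!k. rho ^ j k * cmod (v' k w) <= rho" by metis
  define x where "x k = u ^ j k * v' k" for k
  have xD: "x k \<in> D" "x k \<in> S" for k using D(2) v' big_power[OF V u(1)] S(3) by (auto simp: x_def uinv_def)
  have xw: "cmod (x k w) = rho ^ j k * cmod (v' k w)" for k by (simp add: x_def rho_def norm_mult norm_power)
  have xz: "cmod (x k z) <= cmod (v' k z)" if z: "z \<in> Z" "z ~= w" "z ~= cnj w" for k z
  proof -
    have "cmod (u z) ^ j k <= 1" using u(2) z by (intro power_le_one) (auto intro: less_imp_le)
    then show ?thesis by (simp add: x_def norm_mult norm_power mult_left_le_one_le)
  qed
  have xcw: "cmod (x k (cnj w)) = cmod (x k w)" for k using inv_EE[OF D(1) xD(1)[of k]] w(1) by (auto simp: EE_def)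
  have "cmod (x k z) <= 1 + rho" if "z \<in> Z" for k z
    using xz[OF that, of k] v'(4)[OF that, of k] xw[of k] j(2)[of k] xcw[of k] u(3)
    by (cases "z = w | z = cnj w") (auto simp: rho_def)
  then obtain l s where s: "strict_mono (s :: nat => nat)" "conv (%k. x (s k)) l"
    using bounded_conv_subseq[of x "1 + rho"] by blast
  have lD: "l \<in> D" by (rule inv_closed[OF D(1) _ s(2)]) (rule xD)
  have lS: "l \<in> S" by (rule closedZD[OF S(1) _ s(2)]) (rule xD)
  have lz: "l z = 0" if z: "z \<in> Z" "z ~= w" "z ~= cnj w" for z
  proof -
    have "(%k. x (s k) z) \<longlonglongrightarrow> l z" using s(2) z by (auto simp: conv_def)
    moreover have "(%k. x (s k) z) \<longlonglongrightarrow> 0"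
    proof (rule tendsto_norm_zero_cancel, rule tendsto_sandwich[OF _ _ tendsto_const])
      have "(%k. v' (s k) z) \<longlonglongrightarrow> 0" using conv_subseq[OF cv' s(1)] z by (auto simp: conv_def)
      then show "(%k. cmod (v' (s k) z)) \<longlonglongrightarrow> 0" by (rule tendsto_norm_zero)
    qed (use xz[OF z] in auto)
    ultimately show ?thesis by (rule LIMSEQ_unique)
  qed
  have "(%k. cmod (x (s k) w)) \<longlonglongrightarrow> cmod (l w)" using s(2) w by (auto simp: conv_def intro: tendsto_norm)
  then have "1 <= cmod (l w)" by (rule LIMSEQ_le_const) (use j(1) xw in auto)
  then have lw: "l w ~= 0" by auto
  have eq: "l z = axis w (l w) z" if "z \<in> Z" for z using axis_eqI[OF inv_EE[OF D(1) lD] w(1) lz that] .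
  show ?thesis using w(1) lw inv_cong[OF D(1) lD eq] closedZ_cong[OF S(1) lS eq] by blast
qed

text \<open>\<open>half_line\<close> is applied with \<open>T k = u w ^ k * t\<close>, where
  \<open>u\<close> is large at \<open>w\<close>, and with units \<open>e k\<close> that approach 1
  there much faster; the inverses of \<open>e k\<close> give the opposite ray from the same point
  \<open>y\<close>. The conclusion remembers that \<open>y\<close> is a limit of axis points from
  \<open>S\<close> modulo integers, since the position of the line can matter as well as its
  direction.\<close>

theorem line_in_invariant_set:
  assumes D: "inv D" "uinv V D" and V: "big V"
    and v: "!!k. v k \<in> D" "conv v 0" "!!k. \<exists>z\<in>Z. v k z ~= 0"
    and S: "closedZ S" "!!k. v k \<in> S" "!!u x. u \<in> V ==> x \<in> S ==> u * x \<in> S"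
      "!!u x. u \<in> V ==> x \<in> S ==> (u - 1) * x \<in> S" "!!r x. x \<in> S ==> (%z. of_real r * x z) \<in> S"
  shows "\<exists>w\<in>Z. \<exists>tau. cmod tau = 1 & axis w tau \<in> S & axis w tau \<in> EE & (\<exists>y.
    (\<exists>T a. (\<forall>k. axis w (T k) \<in> S & a k \<in> OK) & conv (%k. axis w (T k) + a k) y) \<and>
    (\<forall>s::real. y + axis w (of_real s * tau) \<in> D))"
proof -
  obtain w t where w: "w \<in> Z" and t: "t ~= 0" "axis w t \<in> D" "axis w t \<in> S" using axis_point[OF D V v S(1-3)] by blast
  obtain u where u: "u \<in> V" "1 < cmod (u w)" using pisot[OF V w] by blast
  define rho where "rho = cmod (u w)"
  have rho: "rho > 1" using u by (simp add: rho_def)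
  have VE: "u \<in> EE" if "u \<in> V" for u using that V UK_OK OK_EE by (auto simp: big_def)
  \<comment> \<open>As \<open>T k\<close> has absolute value rho^k times that of \<open>t\<close>,
    this speed makes the step lengths at most \<open>cmod t * (1 / 2) ^ k\<close>.\<close>
  have "\<forall>k. \<exists>e\<in>V. e w ~= 1 & cmod (e w - 1) < inverse ((2 * rho\<^sup>2) ^ k)"
    using ratio_near_one[OF V w] rho by simp
  then obtain e where e: "!!k. e k \<in> V" "!!k. e k w ~= 1" "!!k. cmod (e k w - 1) < inverse ((2 * rho\<^sup>2) ^ k)" by metis
  define T where "T k = u w ^ k * t" for k
  have axT: "u ^ k * axis w t = axis w (T k)" for k using mult_axis[OF VE[OF big_power[OF V u(1)]] w] by (simp add: T_def)
  have TD: "axis w (T k) \<in> D" "axis w (T k) \<in> S" for k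
    using D(2) t(2,3) S(3) big_power[OF V u(1), of k] unfolding axT[symmetric] uinv_def by blast+
  have Tn: "cmod (T k) = rho ^ k * cmod t" for k by (simp add: T_def norm_mult norm_power rho_def)
  have T0: "T k ~= 0" for k using t rho Tn[of k] by auto
  define d where "d k = T k * (e k w - 1) / of_real (cmod (T k) * cmod (e k w - 1))" for k
  have dn: "cmod (d k) = 1" for k using T0[of k] e(2)[of k] by (simp add: d_def norm_mult norm_divide)
  have "axis w (T k) \<in> EE" for k using TD inv_EE[OF D(1)] by blast
  then obtain a y r where a: "!!k. a k \<in> OK" and r: "strict_mono (r :: nat => nat)"
    and y: "conv (%k. axis w (T (r k)) + a (r k)) y" using compactness[of "%k. axis w (T k)"] by blast
  have "bounded (range (%k. d (r k)))" using dn by (auto simp: bounded_iff intro!: exI[of _ 1])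
  then obtain tau q where q: "strict_mono (q :: nat => nat)" "((%k. d (r k)) \<circ> q) \<longlonglongrightarrow> tau"
    using bounded_imp_convergent_subsequence by blast
  define p where "p k = r (q k)" for k
  have p: "strict_mono p" using strict_mono_o[OF r q(1)] by (simp add: p_def[abs_def] o_def)
  have y': "conv (%k. axis w (T (p k)) + a (p k)) y" using conv_subseq[OF y q(1)] by (simp add: p_def)
  have tau: "(%k. d (p k)) \<longlonglongrightarrow> tau" using q(2) by (simp add: o_def p_def)
  have tau1: "cmod tau = 1" using LIMSEQ_unique[OF tendsto_norm[OF tau] tendsto_eventually[of _ 1]] dn by simp
  have Tinf: "filterlim (%k. cmod (T k)) at_top sequentially" unfolding Tn using t(1) rho
    by (intro filterlim_at_top_mult_tendsto_pos[OF tendsto_const]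
        filterlim_at_infinity_imp_filterlim_at_top filterlim_realpow_sequentially_gt1) auto
  have small: "cmod (T k) * cmod (e k w - 1) <= cmod t * (1 / 2) ^ k" for k
  proof -
    have "rho ^ k * inverse ((2 * rho\<^sup>2) ^ k) = (rho / (2 * rho\<^sup>2)) ^ k" by (simp add: field_simps)
    also have "... <= (1 / 2) ^ k" using rho by (intro power_mono) (auto simp: field_simps power2_eq_square)
    finally have h: "rho ^ k * inverse ((2 * rho\<^sup>2) ^ k) <= (1 / 2) ^ k" .
    have "cmod (T k) * cmod (e k w - 1) <= (rho ^ k * cmod t) * inverse ((2 * rho\<^sup>2) ^ k)"
      unfolding Tn using e(3)[of k] rho by (intro mult_left_mono) auto
    also have "... = cmod t * (rho ^ k * inverse ((2 * rho\<^sup>2) ^ k))" by (simp only: mult_ac)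
    also have "... <= cmod t * (1 / 2) ^ k" using h by (rule mult_left_mono) simp
    finally show ?thesis .
  qed
  have half: "(%k. cmod t * (1 / 2) ^ k) \<longlonglongrightarrow> 0"
    using tendsto_mult_left[OF LIMSEQ_realpow_zero[of "1/2"], of "cmod t"] by simp
  have Ae: "(%k. cmod (T k) * cmod (e k w - 1)) \<longlonglongrightarrow> 0"
    by (rule tendsto_sandwich[OF _ _ tendsto_const half]) (use small in auto)
  have e1: "(%k. e k w) \<longlonglongrightarrow> 1"
  proof (rule LIM_zero_cancel, rule tendsto_norm_zero_cancel, rule tendsto_sandwich[OF _ _ tendsto_const])
    show "eventually (%k. norm (e k w - 1) <= (1 / 2) ^ k) sequentially"
    proof (intro always_eventually allI)
      fix k
      have "inverse ((2 * rho\<^sup>2) ^ k) <= inverse (2 ^ k)" using rho by (intro le_imp_inverse_le power_mono) auto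
      then show "norm (e k w - 1) <= (1 / 2) ^ k" using e(3)[of k] by (simp add: power_one_over inverse_eq_divide)
    qed
    show "(%k. (1 / 2 :: real) ^ k) \<longlonglongrightarrow> 0" by (rule LIMSEQ_realpow_zero) auto
  qed auto
  have ew: "e k w ~= 0" for k using e(1) V UK_nonzero w by (auto simp: big_def)
  define e' where "e' k = (%z. inverse (e k z))" for k
  have e': "e' k \<in> V" "e' k w ~= 1" for k using e(1,2) V by (auto simp: e'_def big_def)
  have e'_eq: "e' k w - 1 = - (e k w - 1) * inverse (e k w)" for k using ew[of k] by (simp add: e'_def field_simps)
  have inv1: "(%k. inverse (e k w)) \<longlonglongrightarrow> 1" using tendsto_inverse[OF e1] by simp
  have ninv1: "(%k. cmod (inverse (e k w))) \<longlonglongrightarrow> 1" using tendsto_norm[OF inv1] by simp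
  have Ae': "(%k. cmod (T k) * cmod (e' k w - 1)) \<longlonglongrightarrow> 0"
    using tendsto_mult[OF Ae ninv1] unfolding e'_eq by (simp add: norm_mult mult.assoc norm_minus_commute[of 1])
  have dir': "(%k. T (p k) * (e' (p k) w - 1) / of_real (cmod (T (p k)) * cmod (e' (p k) w - 1))) \<longlonglongrightarrow> - tau"
  proof -
    have "(%k. inverse (e (p k) w) / of_real (cmod (inverse (e (p k) w)))) \<longlonglongrightarrow> 1 / of_real 1"
      using LIMSEQ_subseq_LIMSEQ[OF inv1 p] LIMSEQ_subseq_LIMSEQ[OF ninv1 p]
      by (intro tendsto_divide tendsto_of_real) (auto simp: o_def)
    from tendsto_mult[OF tendsto_minus[OF tau] this]
    have "(%k. - d (p k) * (inverse (e (p k) w) / of_real (cmod (inverse (e (p k) w))))) \<longlonglongrightarrow> - tau" by simp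
    moreover have g: "t * (- E * I) / of_real (c * (b * i)) = - (t * E / of_real (c * b)) * (I / of_real i)"
      for t E I :: complex and c b i :: real by (simp add: mult.assoc)
    have "T k * (e' k w - 1) / of_real (cmod (T k) * cmod (e' k w - 1)) =
       - d k * (inverse (e k w) / of_real (cmod (inverse (e k w))))" for k
      unfolding e'_eq d_def norm_mult norm_minus_cancel by (rule g)
    ultimately show ?thesis by simp
  qed
  have pos: "y + axis w (of_real s * tau) \<in> D" if "s >= 0" for s by (rule half_line[OF D V w TD(1) e(1,2) a y' _ _ _ that])
       (use LIMSEQ_subseq_LIMSEQ[OF Ae p] filterlim_compose[OF Tinf filterlim_subseq[OF p]] tau in
         \<open>auto simp: o_def d_def\<close>)
  have neg: "y + axis w (of_real s * - tau) \<in> D" if "s >= 0" for s by (rule half_line[OF D V w TD(1) e' a y' _ _ dir' that])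
       (use LIMSEQ_subseq_LIMSEQ[OF Ae' p] filterlim_compose[OF Tinf filterlim_subseq[OF p]] in
         \<open>auto simp: o_def\<close>)
  have line: "y + axis w (of_real s * tau) \<in> D" for s using pos[of s] neg[of "- s"] by (cases "s >= 0") auto
  have dS: "axis w (d k) \<in> S" "axis w (d k) \<in> EE" for k
  proof -
    have "(e k - 1) * axis w (T k) = axis w ((e k w - 1) * T k)"
      using mult_axis[of "e k - 1" w "T k"] VE[OF e(1)] w KF_1 KF_EE EE_diff by auto
    moreover have "axis w (d k) = (%z. of_real (1 / (cmod (T k) * cmod (e k w - 1))) * axis w ((e k w - 1) * T k) z)"
      unfolding axis_scale[symmetric] by (simp add: d_def mult.commute)
    ultimately have eq: "axis w (d k) = (%z. of_real (1 / (cmod (T k) * cmod (e k w - 1))) * ((e k - 1) * axis w (T k)) z)"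
      by simp
    show "axis w (d k) \<in> S" unfolding eq by (intro S(4,5) e(1) TD(2))
    show "axis w (d k) \<in> EE" unfolding eq
      using VE[OF e(1)] KF_1 KF_EE inv_EE[OF D(1) TD(1)] by (intro EE_scale EE_mult EE_diff) auto
  qed
  have "axis w tau \<in> S" by (rule closedZD[OF S(1) _ conv_axis[OF tau]]) (rule dS)
  moreover have "axis w tau \<in> EE" by (rule closedZD[OF closedZ_EE _ conv_axis[OF tau]]) (rule dS)
  moreover have "(\<forall>k. axis w (T (p k)) \<in> S & a (p k) \<in> OK)" using TD a by auto
  ultimately show ?thesis using w tau1 line y' by (intro bexI[OF _ w] exI conjI allI) auto
qed

text \<open>A suitable unit fixes a given torsion point and pushes it towards a given place.\<close>

lemma torsion_near_axis:
  assumes V: "big V" and w: "w \<in> Z" and x: "x \<in> KF"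
  shows "\<exists>u b. (\<forall>k. u k \<in> V & b k \<in> OK) & conv (%k. axis w (u k w * x w) + b k) x"
proof -
  obtain u where u: "u \<in> V \<inter> stab x" "\<forall>z\<in>Z. z ~= w --> z ~= cnj w --> cmod (u z) < 1"
    using pisot[OF big_Int[OF V big_stab[OF x]] w] by blast
  have uk: "u ^ k \<in> V" "u ^ k \<in> stab x" for k using big_power[OF big_Int[OF V big_stab[OF x]] u(1)] by auto
  define b where "b k = x - u ^ k * x" for k
  have bOK: "b k \<in> OK" for k using OK_uminus[of "u ^ k * x - x"] uk(2)[of k] by (simp add: b_def stab_def)
  have uE: "u ^ k \<in> EE" for k using uk(1)[of k] V UK_OK OK_EE by (auto simp: big_def)
  have xE: "x \<in> EE" using x KF_EE by auto
  have "conv (%k. axis w ((u ^ k) w * x w) + b k) x" unfolding conv_def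
  proof
    fix z assume z: "z \<in> Z"
    show "(%k. (axis w ((u ^ k) w * x w) + b k) z) \<longlonglongrightarrow> x z"
    proof (cases "z = w | z = cnj w")
      case True
      have "(axis w ((u ^ k) w * x w) + b k) z = x z" for k using True uE[of k] xE w by (auto simp: axis_def b_def EE_def)
      then show ?thesis by simp
    next
      case False
      have "cmod (u z) < 1" using u(2) z False by auto
      then have "(%k. u z ^ k) \<longlonglongrightarrow> 0" by (rule LIMSEQ_power_zero)
      from tendsto_diff[OF tendsto_const tendsto_mult[OF this tendsto_const]]
      have "(%k. x z - u z ^ k * x z) \<longlonglongrightarrow> x z - 0 * x z" .
      then show ?thesis using False by (simp add: axis_def b_def)
    qed
  qed
  then show ?thesis using uk bOK by (intro exI[of _ "%k. u ^ k"] exI[of _ b]) auto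
qed

end

context numfield_units begin

section \<open>Invariant closed sets contain torsion points\<close>

lemma KF_enum: "\<exists>h::nat => complex => complex. (\<forall>i. h i \<in> KF) & (\<forall>x\<in>KF. \<exists>i. \<forall>z\<in>Z. h i z = x z)"
proof -
  define h :: "nat => complex => complex" where "h i z = ev (Poly (from_nat i)) z" for i z
  have "h i \<in> KF" for i unfolding h_def by (rule KF_ev)
  moreover have "\<exists>i. \<forall>z\<in>Z. h i z = x z" if x: "x \<in> KF" for x
  proof -
    obtain p where "\<forall>z\<in>Z. x z = ev p z" using x by (auto simp: KF_def)
    then show ?thesis by (intro exI[of _ "to_nat (coeffs p)"]) (simp add: h_def)
  qed
  ultimately show ?thesis by blast
qed

text \<open>Boshernitzan's argument: if all differences sets of invariant subsets contain the torsion points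
  \<open>h\<^sub>i\<close>, then the nested sets \<open>Y\<^sub>i\<^sub>+\<^sub>1 = Y\<^sub>i \<inter> (Y\<^sub>i - h\<^sub>i)\<close> have a common point.\<close>

lemma common_translates:
  assumes V: "big V" and X: "inv X" "uinv V X" "X ~= {}" "!!x r. x \<in> X ==> r \<in> Q ==> x + r \<in> X"
    and h: "!!i::nat. h i \<in> KF"
    and step: "!!V' Y i. big V' ==> V' \<subseteq> V ==> inv Y ==> uinv V' Y ==> Y ~= {} ==> Y \<subseteq> X ==>
      (!!y r. y \<in> Y ==> r \<in> Q ==> y + r \<in> Y) ==> h i \<in> diffs Y"
  shows "\<exists>x\<in>X. \<forall>i. x + h i \<in> X"
proof -
  define Y where "Y = rec_nat X (%i Y. {x \<in> Y. x + h i \<in> Y})"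
  \<comment> \<open>The units are cut down to those that fix the \<open>h i\<close> used so far
    modulo integers; this keeps \<open>Y (Suc i)\<close> invariant.\<close>
  define W where "W = rec_nat V (%i W. W \<inter> stab (h i))"
  have Y0: "Y 0 = X" and YS: "Y (Suc i) = {x \<in> Y i. x + h i \<in> Y i}" for i by (simp_all add: Y_def)
  have W0: "W 0 = V" and WS: "W (Suc i) = W i \<inter> stab (h i)" for i by (simp_all add: W_def)
  define tr where "tr S \<longleftrightarrow> (\<forall>y\<in>S. \<forall>r\<in>Q. y + r \<in> S)" for S :: "(complex => complex) set"
  have P: "big (W i) & W i \<subseteq> V & inv (Y i) & uinv (W i) (Y i) & Y i ~= {} & Y i \<subseteq> X
      & tr (Y i)" for i
  proof (induction i)
    case 0 then show ?case unfolding W0 Y0 tr_def using V X by blast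
  next
    case (Suc i)
    then have IH: "big (W i)" "W i \<subseteq> V" "inv (Y i)" "uinv (W i) (Y i)" "Y i ~= {}" "Y i \<subseteq> X"
      "!!y r. y \<in> Y i ==> r \<in> Q ==> y + r \<in> Y i" unfolding tr_def by blast+
    have "inv (Y (Suc i))" unfolding inv_def
    proof (intro conjI ballI)
      show "Y (Suc i) \<subseteq> EE" using inv_EE[OF IH(3)] by (auto simp: YS)
      show "closedZ (Y (Suc i))" unfolding closedZ_def
      proof (intro allI impI)
        fix f l assume f: "\<forall>k. f k \<in> Y (Suc i)" "conv f l"
        have "l \<in> Y i" by (rule inv_closed[OF IH(3) _ f(2)]) (use f in \<open>simp add: YS\<close>)
        moreover have "l + h i \<in> Y i"
          by (rule inv_closed[OF IH(3) _ conv_add[OF f(2) conv_const]]) (use f in \<open>simp add: YS\<close>)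
        ultimately show "l \<in> Y (Suc i)" by (simp add: YS)
      qed
      fix x a assume "x \<in> Y (Suc i)" "a \<in> OK"
      then have "x + a \<in> Y i" "(x + h i) + a \<in> Y i" using invD[OF IH(3)] by (auto simp: YS)
      then show "x + a \<in> Y (Suc i)" by (simp add: YS add_ac)
    qed
    moreover have "uinv (W (Suc i)) (Y (Suc i))" unfolding uinv_def
    proof (intro ballI)
      fix u x assume u: "u \<in> W (Suc i)" and x: "x \<in> Y (Suc i)"
      have a: "- (u * h i - h i) \<in> OK" using u by (intro OK_uminus) (simp add: WS stab_def)
      have "u * x \<in> Y i" "u * (x + h i) \<in> Y i" using IH(4) u x by (auto simp: uinv_def WS YS)
      moreover from invD[OF IH(3) this(2) a] have "u * x + h i \<in> Y i" by (simp add: algebra_simps)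
      ultimately show "u * x \<in> Y (Suc i)" by (simp add: YS)
    qed
    moreover have "Y (Suc i) ~= {}" using step[OF IH, of i] by (auto simp: YS diffs_def)
    moreover have "y + r \<in> Y (Suc i)" if "y \<in> Y (Suc i)" "r \<in> Q" for y r
    proof -
      have "y + r \<in> Y i" "(y + h i) + r \<in> Y i" using IH(7) that by (auto simp: YS)
      then show ?thesis by (simp add: YS add_ac)
    qed
    ultimately show ?case using IH big_Int[OF IH(1) big_stab[OF h]] unfolding tr_def by (auto simp: WS YS)
  qed
  have mono: "Y (i + k) \<subseteq> Y i" for i k by (induction k) (auto simp: YS)
  have "\<forall>i. \<exists>x. x \<in> Y i" using P by blast
  then obtain x where x: "!!i. x i \<in> Y i" by metis
  have "x i \<in> EE" for i using P x inv_EE by blast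
  then obtain a l r where a: "!!k. a k \<in> OK" "strict_mono (r :: nat => nat)" "conv (%k. x (r k) + a (r k)) l"
    using compactness[of x] by blast
  have "l \<in> Y j" for j
  proof (rule inv_closed[of _ "%k. x (r (k + j)) + a (r (k + j))"])
    show "inv (Y j)" using P by blast
    show "conv (%k. x (r (k + j)) + a (r (k + j))) l" by (rule conv_subseq[OF a(3), of "%k. k + j"]) (simp add: strict_mono_def)
    fix k
    have "j <= r (k + j)" using seq_suble[OF a(2), of "k + j"] by simp
    then have "x (r (k + j)) \<in> Y j" using x[of "r (k + j)"] mono[of j "r (k + j) - j"] by auto
    then show "x (r (k + j)) + a (r (k + j)) \<in> Y j" using P invD a by blast
  qed
  then have "l \<in> X" "!!i. l + h i \<in> X" using P YS Y0 by blast+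
  then show ?thesis by blast
qed

text \<open>The orbit \<open>u ^ k * x\<close> accumulates modulo integers, and consecutive members
  of a convergent subsequence have differences that tend to 0. The set \<open>H\<close> consists of
  the differences to be avoided, in the applications the integers or the larger group of points
  fixed by conjugation modulo integers.\<close>

lemma small_differences:
  assumes V: "big V" and X: "inv X" "uinv V X" and x: "x \<in> X" and u: "u \<in> V"
    and H: "!!h a. h \<in> H ==> a \<in> OK ==> h + a \<in> H"
    and ne: "!!i j. i < j ==> u ^ j * x - u ^ i * x \<notin> H"
  shows "\<exists>v. (\<forall>k::nat. v k \<in> diffs X) & conv v 0 & (\<forall>k. v k \<notin> H)"
proof -
  have ux: "u ^ k * x \<in> X" for k using X(2) x big_power[OF V u] by (auto simp: uinv_def)
  obtain a l r where a: "!!k. a k \<in> OK" "strict_mono (r :: nat => nat)" "conv (%k. u ^ r k * x + a (r k)) l"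
    using compactness[of "%k. u ^ k * x"] inv_EE[OF X(1) ux] by blast
  define b where "b k = u ^ r k * x + a (r k)" for k
  have b: "b k \<in> X" for k unfolding b_def by (intro invD[OF X(1)] ux a)
  define v where "v k = b (Suc k) - b k" for k
  have "v k \<in> diffs X" for k using b unfolding v_def diffs_def by (intro CollectI bexI[of _ "b k"]) auto
  moreover have "conv v 0"
  proof -
    have "conv (%k. b (Suc k) - b k) (l - l)"
      using a(3) by (intro conv_diff conv_subseq[of b l Suc]) (auto simp: b_def[abs_def] strict_mono_def)
    then show ?thesis by (simp add: v_def[abs_def])
  qed
  moreover have "v k \<notin> H" for k
  proof
    assume "v k \<in> H"
    from H[OF this OK_diff[OF a(1)[of "r k"] a(1)[of "r (Suc k)"]]]
    have "u ^ r (Suc k) * x - u ^ r k * x \<in> H" by (simp add: v_def b_def algebra_simps)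
    then show False using ne[of "r k" "r (Suc k)"] a(2) by (simp add: strict_mono_def)
  qed
  ultimately show ?thesis by blast
qed

lemma pisot_difference_nonzero:
  fixes u :: "complex => complex"
  assumes "1 < cmod (u w)" "i < (j::nat)" shows "(u ^ j - u ^ i) w ~= (0::complex)"
proof
  assume "(u ^ j - u ^ i) w = 0"
  then have "cmod (u w) ^ j = cmod (u w) ^ i" by (simp flip: norm_power)
  then show False using assms power_strict_increasing[of i j "cmod (u w)"] by simp
qed

text \<open>Division by \<open>u ^ j - u ^ i\<close>, which is nonzero because the two powers have
  different absolute values at \<open>w\<close>.\<close>

lemma torsion_if_fixed:
  assumes "u \<in> UK" "w \<in> Z" "1 < cmod (u w)" "i < j" "u ^ j * x - u ^ i * x \<in> OK"
  shows "x \<in> KF"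
proof -
  have k: "u ^ j - u ^ i \<in> KF" using assms(1) UK_OK OK_KF by (intro KF_diff KF_power) auto
  have nz: "(u ^ j - u ^ i) z ~= 0" if "z \<in> Z" for z
    using KF_zero[OF k that assms(2)] pisot_difference_nonzero[of u w i j] assms by auto
  show ?thesis
  proof (rule KF_cong[OF KF_divide[OF _ k assms(2) nz[OF assms(2)]]])
    show "u ^ j * x - u ^ i * x \<in> KF" using assms OK_KF by blast
    fix z assume "z \<in> Z"
    then show "(u ^ j * x - u ^ i * x) z / (u ^ j - u ^ i) z = x z"
      using nz[of z] by (simp add: left_diff_distrib[symmetric] del: power_fun_apply)
  qed
qed

lemma small_differences_no_torsion:
  assumes V: "big V" and X: "inv X" "uinv V X" "X ~= {}" and no: "X \<inter> KF = {}"
  shows "\<exists>v. (\<forall>k::nat. v k \<in> diffs X) & conv v 0 & (\<forall>k. v k \<notin> OK)"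
proof -
  obtain x where x: "x \<in> X" using X by blast
  obtain w where w: "w \<in> Z" using Z_nonempty by blast
  obtain u where u: "u \<in> V" "1 < cmod (u w)" using pisot[OF V w] by blast
  have "u ^ j * x - u ^ i * x \<notin> OK" if "i < j" for i j
    using torsion_if_fixed[of u w i j x] u w that x no V by (auto simp: big_def)
  then show ?thesis using small_differences[OF V X(1,2) x u(1) OK_add] by blast
qed

lemma not_OK_nonzero: "v \<notin> OK ==> \<exists>z\<in>Z. v z ~= 0" using OK_cong[OF OK_0, of v] by auto

lemma all_if_translate_KF:
  assumes D: "inv D" and y: "y \<in> EE" and K: "!!x. x \<in> KF ==> y + x \<in> D"
  shows "EE \<subseteq> D"
proof
  fix x assume "x \<in> EE"
  then obtain f where f: "\<forall>k. f k \<in> KF" "conv f (x - y)" using KF_dense[of "x - y"] EE_diff y by blast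
  have "conv (%k. y + f k) (y + (x - y))" by (intro conv_add conv_const f)
  then have "y + (x - y) \<in> D" by (rule inv_closed[OF D, rotated]) (use K f in blast)
  then show "x \<in> D" by simp
qed

text \<open>By \<open>torsion_near_axis\<close> every field element is a limit of axis points with
  coordinates \<open>u w * x w\<close> modulo integers. So a translate of this part of one axis
  generates a translate of all of \<open>KF\<close>.\<close>

lemma all_if_line_dense:
  assumes D: "inv D" and y: "!!t. t \<in> T ==> y + axis w t \<in> D" "y \<in> EE"
    and V: "big V" and w: "w \<in> Z" and T: "!!x u. x \<in> KF ==> u \<in> V ==> u w * x w \<in> T"
  shows "EE \<subseteq> D"
proof (rule all_if_translate_KF[OF D y(2)])
  fix x assume x: "x \<in> KF"
  obtain u b where ub: "!!k. u k \<in> V & b k \<in> OK" "conv (%k. axis w (u k w * x w) + b k) x"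
    using torsion_near_axis[OF V w x] by blast
  have "conv (%k. y + (axis w (u k w * x w) + b k)) (y + x)" by (intro conv_add conv_const ub)
  then show "y + x \<in> D"
  proof (rule inv_closed[OF D, rotated])
    fix k show "y + (axis w (u k w * x w) + b k) \<in> D"
      using invD[OF D y(1)[OF T[OF x]], of "u k" "b k"] ub(1)[of k] by (simp add: add_ac)
  qed
qed

subsection \<open>Fields without complex multiplication\<close>

text \<open>For nonreal \<open>w\<close> this is the case in which the units, up to finite index,
  cannot rotate directions at \<open>w\<close>.\<close>

definition real_place :: "complex => bool" where
  "real_place w \<longleftrightarrow> (\<exists>V. big V & (\<forall>u\<in>V. u w \<in> \<real>))"

definition directions :: "(complex => complex) set => complex => complex set" where
  "directions D w = {tau. cmod tau = 1 & (\<exists>y\<in>EE. \<forall>s::real. y + axis w (of_real s * tau) \<in> D)}"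

lemma directions_closed:
  assumes D: "inv D" and t: "!!k. t k \<in> directions D w" "t \<longlonglongrightarrow> tau"
  shows "tau \<in> directions D w"
proof -
  have "cmod tau = 1" using LIMSEQ_unique[OF tendsto_norm[OF t(2)] tendsto_eventually[of _ 1]] t(1) by (simp add: directions_def)
  have "\<forall>k. \<exists>y. y \<in> EE & (\<forall>s::real. y + axis w (of_real s * t k) \<in> D)" using t(1) by (auto simp: directions_def)
  then obtain y where y: "!!k. y k \<in> EE" "!!k s. y k + axis w (of_real (s::real) * t k) \<in> D" by metis
  obtain a l r where a: "!!k. a k \<in> OK" "strict_mono (r :: nat => nat)" "conv (%k. y (r k) + a (r k)) l" "l \<in> EE"
    using compactness[of y] y(1) by blast
  have "l + axis w (of_real s * tau) \<in> D" for s
  proof (rule inv_closed[OF D])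
    show "conv (%k. y (r k) + a (r k) + axis w (of_real s * t (r k))) (l + axis w (of_real s * tau))"
      using LIMSEQ_subseq_LIMSEQ[OF t(2) a(2)] by (intro conv_add a conv_axis tendsto_intros) (simp add: o_def)
    show "y (r k) + a (r k) + axis w (of_real s * t (r k)) \<in> D" for k
      using invD[OF D y(2) a(1), of "r k" s "r k"] by (simp add: add_ac)
  qed
  then show ?thesis using \<open>cmod tau = 1\<close> a(4) by (auto simp: directions_def)
qed

lemma directions_unit:
  assumes D: "inv D" "uinv V D" and V: "big V" and w: "w \<in> Z" and u: "u \<in> V" and t: "tau \<in> directions D w"
  shows "sgn (u w) * tau \<in> directions D w"
proof -
  have uE: "u \<in> EE" "u w ~= 0" using u V UK_OK OK_EE UK_nonzero w by (auto simp: big_def)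
  obtain y where y: "y \<in> EE" "!!s::real. y + axis w (of_real s * tau) \<in> D" using t by (auto simp: directions_def)
  have "u * y + axis w (of_real s * (sgn (u w) * tau)) \<in> D" for s :: real
  proof -
    have "u * (y + axis w (of_real (s / cmod (u w)) * tau)) \<in> D" using D(2) u y(2)[of "s / cmod (u w)"] unfolding uinv_def by blast
    also have "u * (y + axis w (of_real (s / cmod (u w)) * tau)) = u * y + axis w (u w * (of_real (s / cmod (u w)) * tau))"
      using mult_axis[OF uE(1) w] by (simp add: distrib_left)
    also have "u w * (of_real (s / cmod (u w)) * tau) = of_real s * (sgn (u w) * tau)" by (simp add: sgn_eq)
    finally show ?thesis .
  qed
  moreover have "cmod (sgn (u w) * tau) = 1" using t uE by (simp add: directions_def norm_mult norm_sgn)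
  ultimately show ?thesis using y(1) uE EE_mult by (auto simp: directions_def)
qed

text \<open>If no nontrivial rotation were small, compactness of the circle would bound the orders
  of all rotations by a fixed \<open>c\<close>, and a fixed power of every unit would be real at
  \<open>w\<close>.\<close>

lemma small_rotation:
  assumes V: "big V" and w: "w \<in> Z" and nr: "\<not> real_place w" and e: "e > 0"
  shows "\<exists>u\<in>V. sgn (u w) ~= 1 & cmod (sgn (u w) - 1) < e"
proof (rule ccontr)
  assume no: "\<not> ?thesis"
  have nz: "u w ~= 0" if "u \<in> V" for u using that V UK_nonzero w by (auto simp: big_def)
  obtain k where k: "finite k" "sphere (0::complex) 1 \<subseteq> (\<Union>x\<in>k. ball x (e / 2))"
    using compactE_image[OF compact_sphere[of "0::complex" 1], of UNIV "%x. ball x (e / 2)"] e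
    by (metis (no_types, lifting) UNIV_I centre_in_ball half_gt_zero open_ball subset_iff UN_iff)
  define c where "c = card k"
  have sp: "sgn (u w) ^ fact c = 1" if u: "u \<in> V" for u
  proof -
    define g where "g = sgn (u w)"
    have g: "cmod g = 1" using nz[OF u] by (simp add: g_def norm_sgn)
    have "\<forall>i. \<exists>x\<in>k. dist x (g ^ i) < e / 2" using k(2) g by (auto simp: norm_power subset_iff dist_norm)
    then obtain f where f: "!!i. f i \<in> k" "!!i. dist (f i) (g ^ i) < e / 2" by metis
    have "card (f ` {..c}) <= c" unfolding c_def by (rule card_mono[OF k(1)]) (use f in auto)
    then have "\<not> inj_on f {..c}" by (intro pigeonhole) auto
    then obtain i j where ij: "i < j" "j <= c" "f i = f j" by (auto simp: inj_on_def) (metis linorder_neqE_nat)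
    have "dist (g ^ j) (g ^ i) < e" using f(2)[of i] f(2)[of j] ij dist_triangle_half_r by metis
    moreover have "g ^ j - g ^ i = (g ^ (j - i) - 1) * g ^ i" using ij(1) by (simp add: left_diff_distrib power_add[symmetric])
    ultimately have "cmod (g ^ (j - i) - 1) < e" using g by (simp add: dist_norm norm_mult norm_power)
    moreover have "g ^ (j - i) = sgn ((u ^ (j - i)) w)" 
    proof -
      have "sgn (x ^ k) = sgn x ^ k" for x :: complex and k by (induction k) (auto simp: sgn_mult)
      then show ?thesis by (simp add: g_def)
    qed
    ultimately have "g ^ (j - i) = 1" using no big_power[OF V u] by metis
    moreover have "j - i dvd fact c" using ij by (intro dvd_fact) auto
    ultimately show ?thesis unfolding g_def by (metis dvdE power_mult power_one)
  qed
  define V' where "V' = {u \<in> V. u w \<in> \<real>}"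
  obtain m where m: "m > 0" "\<forall>u\<in>UK. u ^ m \<in> V" using V by (auto simp: big_def)
  have "u ^ (m * fact c) \<in> V'" if "u \<in> UK" for u
  proof -
    have um: "u ^ m \<in> V" using m that by blast
    have pw: "(u ^ (m * fact c)) = (u ^ m) ^ fact c" by (simp add: power_mult)
    have "(u ^ m) w = of_real (cmod ((u ^ m) w)) * sgn ((u ^ m) w)" by (simp add: sgn_eq)
    then have "(u ^ m) w ^ fact c = of_real (cmod ((u ^ m) w)) ^ fact c * sgn ((u ^ m) w) ^ fact c" by (metis power_mult_distrib)
    then have "((u ^ m) ^ fact c) w = of_real (cmod ((u ^ m) w) ^ fact c)" using sp[OF um] by simp
    then have "((u ^ m) ^ fact c) w \<in> \<real>" by (metis Reals_of_real)
    then show ?thesis using big_power[OF V um] unfolding V'_def pw by blast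
  qed
  then have "big V'" using V m(1) unfolding big_def V'_def by (auto intro!: exI[of _ "m * fact c"])
  then show False using nr unfolding real_place_def V'_def by blast
qed

text \<open>Iterating a rotation by a small angle reaches every direction up to that angle, and the
  set of directions is closed.\<close>

lemma all_directions:
  assumes D: "inv D" "uinv V D" and V: "big V" and w: "w \<in> Z" and nr: "\<not> real_place w"
    and t: "tau \<in> directions D w" and t': "cmod tau' = 1"
  shows "tau' \<in> directions D w"
proof -
  have t1: "cmod tau = 1" using t by (simp add: directions_def)
  define psi where "psi = Arg (tau' / tau)"
  have psi: "tau' = cis psi * tau"
  proof -
    have "cmod (tau' / tau) = 1" using t1 t' by (simp add: norm_divide)
    then have "tau' / tau = cis psi" unfolding psi_def using cis_Arg[of "tau' / tau"] by (simp add: sgn_eq) force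
    moreover have "tau ~= 0" using t1 by auto
    ultimately show ?thesis by (simp add: field_simps)
  qed
  have "\<exists>sg\<in>directions D w. cmod (sg - tau') <= d" if d: "d > 0" for d
  proof -
    have "isCont Arg 1" by (rule continuous_at_Arg) simp
    then obtain e where e: "e > 0" "!!x. cmod (x - 1) < e ==> \<bar>Arg x\<bar> < d"
      using d unfolding continuous_at_eps_delta by (auto simp: dist_norm)
    obtain u where u: "u \<in> V" "sgn (u w) ~= 1" "cmod (sgn (u w) - 1) < e" using small_rotation[OF V w nr e(1)] by blast
    have nz: "u w ~= 0" using u V UK_nonzero w by (auto simp: big_def)
    define phi where "phi = Arg (sgn (u w))"
    have cis: "cis phi = sgn (u w)" using nz cis_Arg[of "sgn (u w)"] by (simp add: phi_def sgn_zero_iff)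
    have phi: "phi ~= 0" "\<bar>phi\<bar> < d" using e(2)[OF u(3)] cis u(2) by (auto simp: phi_def)
    \<comment> \<open>The inverse is taken if the small angle and the target angle have opposite
      signs, so that a nonnegative number of steps suffices.\<close>
    define u' where "u' = (if phi * psi >= 0 then u else (%z. inverse (u z)))"
    define phi' where "phi' = (if phi * psi >= 0 then phi else - phi)"
    have u': "u' \<in> V" "cis phi' = sgn (u' w)" "phi' * psi >= 0" "phi' ~= 0" "\<bar>phi'\<bar> < d"
      using u(1) V cis phi by (auto simp: u'_def phi'_def big_def cis_inverse[symmetric])
    define k where "k = nat \<lfloor>psi / phi'\<rfloor>"
    have "psi / phi' >= 0" using u'(3) by (simp add: zero_le_divide_iff zero_le_mult_iff) argo
    then have k: "real k <= psi / phi'" "psi / phi' < real k + 1" unfolding k_def by linarith+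
    have "\<bar>psi / phi' - real k\<bar> * \<bar>phi'\<bar> <= 1 * \<bar>phi'\<bar>" using k by (intro mult_right_mono) auto
    moreover have "\<bar>psi / phi' - real k\<bar> * \<bar>phi'\<bar> = \<bar>psi - real k * phi'\<bar>"
      using u'(4) by (simp add: abs_mult[symmetric] left_diff_distrib)
    ultimately have dd: "\<bar>real k * phi' - psi\<bar> <= d" using u'(5) by linarith
    have "sgn (u' w) ^ k * tau \<in> directions D w" for k
    proof (induction k)
      case (Suc k) then show ?case using directions_unit[OF D V w u'(1) Suc] by (simp add: mult_ac)
    qed (use t in simp)
    then have "cis (real k * phi') * tau \<in> directions D w" unfolding u'(2)[symmetric] by (simp add: Complex.DeMoivre)
    moreover have "cmod (cis (real k * phi') * tau - tau') <= d"
    proof -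
      have "cmod (cis (real k * phi') * tau - tau') = cmod (cis (real k * phi') - cis psi)"
        unfolding psi by (simp add: t1 norm_mult flip: left_diff_distrib)
      also have "... = 2 * \<bar>sin ((real k * phi' - psi) / 2)\<bar>"
      proof -
        have e: "cis (real k * phi') - cis psi = cis psi * (cis (real k * phi' - psi) - 1)"
          by (simp add: right_diff_distrib cis_mult)
        have "cmod (cis x - 1) = 2 * \<bar>sin (x / 2)\<bar>" for x using dist_exp_i_1[of x] by (simp add: dist_norm cis_conv_exp)
        then show ?thesis unfolding e by (simp add: norm_mult)
      qed
      also have "... <= \<bar>real k * phi' - psi\<bar>" using abs_sin_x_le_abs_x[of "(real k * phi' - psi) / 2"] by simp
      finally show ?thesis using dd by linarith
    qed
    ultimately show ?thesis by blast
  qed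
  then have "\<forall>k::nat. \<exists>sg. sg \<in> directions D w & cmod (sg - tau') <= inverse (of_nat (Suc k))"
    by (metis inverse_positive_iff_positive of_nat_0_less_iff zero_less_Suc)
  then obtain sg where s: "!!k. sg k \<in> directions D w" "!!k. cmod (sg k - tau') <= inverse (of_nat (Suc k))" by metis
  have "sg \<longlonglongrightarrow> tau'" by (rule LIM_zero_cancel, rule tendsto_norm_zero_cancel,
        rule tendsto_sandwich[OF _ _ tendsto_const LIMSEQ_inverse_real_of_nat]) (use s(2) in auto)
  then show ?thesis using directions_closed[OF D(1), of sg w] s(1) by blast
qed

end

section \<open>Directions whose lines are dense modulo integers\<close>

context numfield_units begin

lemma cf_sum: "cf (%z. \<Sum>j\<in>J. c j * f j z) i = (\<Sum>j\<in>J. c j * cf (f j) i)"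
  unfolding cf_def by (simp add: sum_distrib_left sum_distrib_right sum_divide_distrib mult.assoc) (rule sum.swap)

lemma cf_cong: "(!!z. z \<in> Z ==> x z = y z) ==> cf x i = cf y i" by (simp add: cf_def)

lemma cf_diff: "cf (x - y) i = cf x i - cf y i" by (simp add: cf_def diff_divide_distrib left_diff_distrib sum_subtractf)

lemma monomial_OK: "(%z. z ^ j) \<in> OK" using OK_int_poly[of "monom 1 j"] by (simp add: map_poly_monom poly_monom)

text \<open>No rational linear form vanishes on an axis, since powers of a suitable unit push the lattice
  towards the axis.\<close>

lemma linear_form_nonzero_on_axis:
  assumes w: "w \<in> Z" and m: "i < n" "m i ~= (0::int)"
  shows "\<exists>t. (\<Sum>i<n. of_int (m i) * cf (axis w t) i) ~= 0"
proof (rule ccontr)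
  define phi where "phi x = (\<Sum>i<n. of_int (m i) * cf x i)" for x
  assume "\<not> ?thesis"
  then have ax: "phi (axis w t) = 0" for t by (simp add: phi_def)
  obtain u where u: "u \<in> UK" "\<forall>z\<in>Z. z ~= w --> z ~= cnj w --> cmod (u z) < 1" "1 < cmod (u w)"
    using pisot[OF big_UK w] by blast
  define M where "M = (\<Sum>i<n. \<bar>real_of_int (m i)\<bar>)"
  have bound: "cmod (phi x) <= M * (real AA * b)" if "!!z. z \<in> Z ==> cmod (x z) <= b" for x and b :: real
    unfolding phi_def M_def sum_distrib_right
    by (rule order.trans[OF norm_sum], rule sum_mono) (use cf_le[OF that] in \<open>simp add: norm_mult mult_left_mono\<close>)
  have "\<exists>K. \<forall>k\<ge>K. phi (u ^ k * (%z. z ^ j)) = 0" for j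
  proof -
    define a where "a k = u ^ k * (%z. z ^ j)" for k
    have aOK: "a k \<in> OK" for k unfolding a_def using UK_power[OF u(1)] UK_OK monomial_OK by (intro OK_mult) auto
    have int: "of_nat DD * phi (a k) \<in> \<int>" for k
    proof -
      have "of_nat DD * phi (a k) = (\<Sum>i<n. of_int (m i) * (of_nat DD * cf (a k) i))"
        by (simp add: phi_def sum_distrib_left mult_ac)
      also have "... \<in> \<int>" by (rule Ints_sum, rule Ints_mult[OF Ints_of_int DD_cf_int[OF aOK]]) simp
      finally show ?thesis .
    qed
    have "phi (a k - axis w (a k w)) = phi (a k)" for k
      using ax[of "a k w"] by (simp add: phi_def cf_diff right_diff_distrib sum_subtractf)
    have z0: "(%k. (a k - axis w (a k w)) z) \<longlonglongrightarrow> 0" if z: "z \<in> Z" for z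
    proof (cases "z = w | z = cnj w")
      case True
      have "(a k - axis w (a k w)) z = 0" for k using True aOK[of k] OK_EE w by (auto simp: axis_def EE_def)
      then show ?thesis by simp
    next
      case False
      have "cmod (u z) < 1" using u(2) z False by auto
      then have "(%k. u z ^ k * z ^ j) \<longlonglongrightarrow> 0 * z ^ j" by (intro tendsto_mult LIMSEQ_power_zero tendsto_const)
      then show ?thesis using False by (simp add: a_def axis_def)
    qed
    \<comment> \<open>Chosen so that \<open>DD * phi (a k)\<close> is an integer of absolute value
      at most 1 / 2, hence 0.\<close>
    define e where "e = 1 / (2 * (M + 1) * (AA + 1) * (DD + 1))"
    have M0: "M >= 0" by (simp add: M_def sum_nonneg)
    have e: "e > 0" using M0 by (simp add: e_def)
    have "eventually (%k. \<forall>z\<in>Z. cmod ((a k - axis w (a k w)) z) < e) sequentially"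
    proof (rule eventually_ball_finite[OF finite_Z], rule ballI)
      fix z assume "z \<in> Z"
      from tendsto_norm_zero[OF z0[OF this]] e
      show "eventually (%k. cmod ((a k - axis w (a k w)) z) < e) sequentially" by (rule order_tendstoD)
    qed
    then obtain K where K: "!!k z. k >= K ==> z \<in> Z ==> cmod ((a k - axis w (a k w)) z) < e"
      by (auto simp: eventually_sequentially)
    have "phi (a k) = 0" if "k >= K" for k
    proof -
      have "cmod (phi (a k - axis w (a k w))) <= M * (AA * e)"
        by (rule bound) (use K[OF that] in \<open>auto intro: less_imp_le\<close>)
      then have "cmod (phi (a k)) <= M * (AA * e)" using \<open>!!k. phi (a k - axis w (a k w)) = phi (a k)\<close> by simp
      then have "cmod (of_nat DD * phi (a k)) <= DD * (M * (AA * e))" by (simp add: norm_mult mult_left_mono)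
      also have "... <= (DD + 1) * ((M + 1) * ((AA + 1) * e))" using M0 e by (intro mult_mono) auto
      also have "... = 1 / 2"
      proof -
        have "1 + M ~= 0" using M0 by simp
        moreover have "1 + real AA ~= 0" "1 + real DD ~= 0" by linarith+
        ultimately show ?thesis by (simp add: e_def add.commute)
      qed
      finally have lt: "cmod (of_nat DD * phi (a k)) < 1" by simp
      obtain q where q: "of_nat DD * phi (a k) = of_int q" using int[of k] by (auto elim: Ints_cases)
      then have "\<bar>real_of_int q\<bar> < 1" using lt by (metis norm_of_int)
      then have "q = 0" by linarith
      then show ?thesis using q by (simp add: DD_def)
    qed
    then show ?thesis unfolding a_def by blast
  qed
  then obtain K where K: "!!j k. k >= K j ==> phi (u ^ k * (%z. z ^ j)) = 0" by metis
  define k where "k = (\<Sum>j<n. K j)"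
  have kK: "K j <= k" if "j < n" for j unfolding k_def by (rule member_le_sum) (use that in auto)
  \<comment> \<open>Since \<open>u\<close> is invertible in the field, \<open>z ^ i\<close> is a
    rational combination of the products of \<open>u ^ k\<close> with powers of \<open>z\<close>, on
    which \<open>phi\<close> vanishes. But \<open>phi\<close> of \<open>z ^ i\<close> is
    \<open>m i\<close>.\<close>
  have "(%z. inverse (u z)) ^ k * (%z. z ^ i) \<in> KF"
    using UK_power[OF UK_inverse[OF u(1)]] monomial_OK UK_OK OK_KF by (intro KF_mult) auto
  from KF_expand'[OF this] obtain c where c: "!!z. z \<in> Z ==> inverse (u z) ^ k * z ^ i = (\<Sum>j<n. of_rat (c j) * z ^ j)"
    by auto
  define F where "F j = u ^ k * (%z. z ^ j)" for j
  have e: "z ^ i = (\<Sum>j<n. of_rat (c j) * F j z)" if z: "z \<in> Z" for z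
  proof -
    have "u z ^ k * inverse (u z) ^ k = 1" using UK_nonzero[OF u(1) z] by (simp flip: power_mult_distrib)
    then have "z ^ i = u z ^ k * (inverse (u z) ^ k * z ^ i)" by (simp only: mult.assoc[symmetric] mult_1)
    also have "... = u z ^ k * (\<Sum>j<n. of_rat (c j) * z ^ j)" by (simp only: c[OF z])
    finally show ?thesis by (simp add: sum_distrib_left mult_ac F_def)
  qed
  have "phi (%z. z ^ i) = phi (%z. \<Sum>j<n. of_rat (c j) * F j z)" unfolding phi_def using cf_cong[OF e] by simp
  also have "... = (\<Sum>l<n. \<Sum>j<n. of_rat (c j) * (of_int (m l) * cf (F j) l))"
    unfolding phi_def cf_sum by (simp add: sum_distrib_left mult_ac)
  also have "... = (\<Sum>j<n. of_rat (c j) * phi (F j))" unfolding phi_def sum_distrib_left by (rule sum.swap)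
  also have "... = 0" using K[OF kK] by (simp add: F_def)
  finally have "phi (%z. z ^ i) = 0" .
  moreover have "cf (%z. z ^ i) l = (if l = i then 1 else 0)" if "l < n" for l
    using cf_eqI[of "%z. z ^ i" "%l. if l = i then 1 else 0" l] that m(1) by (simp add: if_distrib[of "%x. x * _"] cong: if_cong)
  then have "phi (%z. z ^ i) = (\<Sum>l<n. if l = i then of_int (m l) else 0)" unfolding phi_def by (intro sum.cong) auto
  then have "phi (%z. z ^ i) = of_int (m i)" using m(1) by simp
  ultimately show False using m(2) by simp
qed

text \<open>By Kronecker's theorem a line is dense modulo integers if the coefficients of its
  direction are linearly independent over the integers. In direction (1, t) a given integral
  relation holds for at most one t unless it holds on the whole axis, which
  \<open>linear_form_nonzero_on_axis\<close> forbids. So all but countably many t work.\<close>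

lemma dense_line_exists:
  assumes w: "w \<in> Z" "w \<notin> \<real>"
  shows "\<exists>tau. cmod tau = 1 & (\<forall>x\<in>EE. \<forall>e>0. \<exists>s::real. \<exists>h\<in>OK. \<forall>z\<in>Z. cmod (axis w (of_real s * tau) z - h z - x z) <= e)"
proof -
  have wc: "w ~= cnj w" using w by (metis Reals_cnj_iff)
  have axE: "axis w t \<in> EE" for t using axis_EE w wc by blast
  define A where "A i = Re (cf (axis w 1) i)" for i
  define B where "B i = Re (cf (axis w \<i>) i)" for i
  have cfAB: "cf (axis w t) i = of_real (Re t * A i + Im t * B i)" if "i < n" for t i
  proof -
    have "cf (axis w t) i = cf (%z. \<Sum>j<2. (if j = 0 then of_real (Re t) else of_real (Im t)) * (if j = (0::nat) then axis w 1 else axis w \<i>) z) i"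
      by (rule cf_cong) (auto simp: axis_def complex_eq_iff numeral_2_eq_2)
    also have "... = of_real (Re t) * cf (axis w 1) i + of_real (Im t) * cf (axis w \<i>) i"
      unfolding cf_sum by (simp add: numeral_2_eq_2)
    finally have "cf (axis w t) i = of_real (Re t) * cf (axis w 1) i + of_real (Im t) * cf (axis w \<i>) i" .
    moreover have "cf (axis w 1) i = of_real (A i)" "cf (axis w \<i>) i = of_real (B i)"
      using cf_real[OF axE that] by (auto simp: A_def B_def complex_is_Real_iff complex_eq_iff)
    ultimately show ?thesis by simp
  qed
  define P where "P = {m \<in> (\<Pi>\<^sub>E i\<in>{..<n}. UNIV :: int set). \<exists>i<n. m i ~= 0}"
  have cP: "countable P" unfolding P_def by (rule countable_subset[OF _ countable_PiE[of "{..<n}" "%_. UNIV :: int set"]]) auto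
  define bad where "bad = (%m. - (\<Sum>i<n. m i * A i) / (\<Sum>i<n. m i * B i)) ` P"
  have "countable bad" unfolding bad_def using cP by simp
  then obtain t where t: "t \<notin> bad" using uncountable_UNIV_real by (metis UNIV_eq_I)
  define theta where "theta i = A i + t * B i" for i
  have ind: "m i = 0" if s0: "(\<Sum>i<n. of_int (m i) * theta i) = 0" and i: "i < n" for m :: "nat => int" and i
  proof (rule ccontr)
    assume mi: "m i ~= 0"
    define m' where "m' = restrict m {..<n}"
    have m'P: "m' \<in> P" using mi i by (auto simp: P_def m'_def)
    have s1: "(\<Sum>i<n. m' i * A i) + t * (\<Sum>i<n. m' i * B i) = 0"
      using s0 by (simp add: theta_def m'_def sum.distrib sum_distrib_left algebra_simps)
    have "(\<Sum>i<n. m' i * B i) = 0"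
    proof (rule ccontr)
      assume "(\<Sum>i<n. m' i * B i) ~= 0"
      then have "t = - (\<Sum>i<n. m' i * A i) / (\<Sum>i<n. m' i * B i)" using s1 by (simp add: field_simps)
      then show False using t m'P by (auto simp: bad_def)
    qed
    moreover from this have "(\<Sum>i<n. m' i * A i) = 0" using s1 by simp
    moreover have "(\<Sum>i<n. of_int (m' i) * cf (axis w x) i) =
        of_real (Re x * (\<Sum>i<n. m' i * A i) + Im x * (\<Sum>i<n. m' i * B i))" for x
      by (simp add: cfAB sum.distrib sum_distrib_left algebra_simps)
    ultimately have "(\<Sum>i<n. of_int (m' i) * cf (axis w x) i) = 0" for x by simp
    then show False using linear_form_nonzero_on_axis[OF w(1) i, of m'] mi i by (simp add: m'_def)
  qed
  have inj: "inj_on theta {..<n}"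
  proof (rule inj_onI, rule ccontr)
    fix i j assume ij: "i \<in> {..<n}" "j \<in> {..<n}" "theta i = theta j" "i ~= j"
    define m :: "nat => int" where "m k = (if k = i then 1 else 0) - (if k = j then 1 else 0)" for k
    have "(\<Sum>k<n. of_int (m k) * theta k) = (\<Sum>k<n. (if k = i then theta k else 0) - (if k = j then theta k else 0))"
      by (intro sum.cong) (auto simp: m_def)
    also have "... = 0" using ij by (simp add: sum_subtractf)
    finally show False using ind[of m i] ij by (simp add: m_def)
  qed
  have "\<not> Zm.dependent (theta ` {..<n})"
  proof
    assume "Zm.dependent (theta ` {..<n})"
    then obtain c where c: "\<exists>v\<in>theta ` {..<n}. c v ~= 0" "(\<Sum>v\<in>theta ` {..<n}. real_of_int (c v) * v) = 0"
      by (subst (asm) Zm.dependent_finite) auto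
    have "(\<Sum>i<n. of_int (c (theta i)) * theta i) = 0" using c(2) by (simp add: sum.reindex[OF inj])
    then show False using ind[of "%i. c (theta i)"] c(1) by auto
  qed
  note kron = Kronecker_thm_1[OF this inj]
  define zeta where "zeta = Complex 1 t"
  have z0: "cmod zeta > 0" by (simp add: zeta_def complex_eq_iff)
  have main: "\<exists>s::real. \<exists>h\<in>OK. \<forall>z\<in>Z. cmod (axis w (of_real s * zeta) z - h z - x z) <= e"
    if x: "x \<in> EE" and e: "e > 0" for x e
  proof -
    obtain c :: "nat => real" where c: "!!z. z \<in> Z ==> x z = (\<Sum>i<n. of_real (c i) * z ^ i)"
      using EE_expand'[OF x] by blast
    have BB0: "real BB > 0" using BB_pos by simp
    have "e / BB > 0" using e BB0 by simp
    from kron[OF this, of c] obtain s h where sh: "!!i. i < n ==> \<bar>s * theta i - of_int (h i) - c i\<bar> < e / BB" by metis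
    show ?thesis
    proof (intro exI bexI[OF _ li_OK] ballI)
      fix z assume z: "z \<in> Z"
      have "axis w (of_real s * zeta) z = (\<Sum>i<n. cf (axis w (of_real s * zeta)) i * z ^ i)" using cf_expand[OF z] by simp
      also have "... = (\<Sum>i<n. of_real (s * theta i) * z ^ i)"
        by (intro sum.cong) (auto simp: cfAB theta_def zeta_def algebra_simps)
      finally have "axis w (of_real s * zeta) z - li h z - x z = (\<Sum>i<n. of_real (s * theta i - of_int (h i) - c i) * z ^ i)"
        using c[OF z] by (simp add: li_def sum_subtractf left_diff_distrib)
      also have "cmod ... <= real n * real R ^ n * (e / BB)"
        by (rule cmod_expand_le[OF z]) (use sh in \<open>simp add: less_imp_le del: of_real_diff of_real_mult\<close>)
      also have "... = e" using n_pos R_pos by (simp add: BB_def)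
      finally show "cmod (axis w (of_real s * zeta) z - li h z - x z) <= e" .
    qed
  qed
  show ?thesis
  proof (intro exI[of _ "sgn zeta"] conjI ballI allI impI)
    show "cmod (sgn zeta) = 1" using z0 by (simp add: norm_sgn)
    fix x and e :: real assume "x \<in> EE" "e > 0"
    then obtain s h where "h \<in> OK" "\<forall>z\<in>Z. cmod (axis w (of_real s * zeta) z - h z - x z) <= e" using main by blast
    moreover have "of_real s * zeta = of_real (s * cmod zeta) * sgn zeta" using z0 by (simp add: sgn_eq)
    ultimately show "\<exists>s::real. \<exists>h\<in>OK. \<forall>z\<in>Z. cmod (axis w (of_real s * sgn zeta) z - h z - x z) <= e" by metis
  qed
qed

text \<open>At a real \<open>w\<close> the line found is the whole axis. At a nonreal
  \<open>w\<close> the hypothesis \<open>nr\<close> allows the line to be rotated into a dense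
  direction.\<close>

lemma all_if_small_element:
  assumes nr: "!!w. w \<in> Z ==> w \<notin> \<real> ==> \<not> real_place w"
    and D: "inv D" "uinv V D" and V: "big V"
    and v: "!!k. v k \<in> D" "conv v 0" "!!k. \<exists>z\<in>Z. v k z ~= 0"
  shows "EE \<subseteq> D"
proof -
  have VE: "u \<in> EE" if "u \<in> V" for u using that V UK_OK OK_EE by (auto simp: big_def)
  obtain w tau y where w: "w \<in> Z" "cmod tau = 1" "axis w tau \<in> EE" and y: "!!s::real. y + axis w (of_real s * tau) \<in> D"
  proof -
    have m: "(u - 1) * x \<in> EE" if "u \<in> V" "x \<in> EE" for u x using VE that KF_1 KF_EE by (intro EE_mult EE_diff) auto
    show ?thesis using line_in_invariant_set[OF D V v closedZ_EE inv_EE[OF D(1) v(1)] EE_mult[OF VE] m EE_scale] that by blast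
  qed
  have "axis w 0 = 0" by (rule ext) (simp add: axis_def)
  then have yE: "y \<in> EE" using inv_EE[OF D(1) y[of 0]] by simp
  show ?thesis
  proof (cases "w \<in> \<real>")
    case True
    then have wc: "cnj w = w" by (simp add: Reals_cnj_iff)
    have tr: "tau \<in> \<real>" using w(1,3) wc by (auto simp: EE_def axis_def Reals_cnj_iff)
    show ?thesis
    proof (rule all_if_line_dense[OF D(1) _ yE V w(1), of "\<real>"])
      fix t :: complex assume "t \<in> \<real>"
      then have "t = of_real (Re (t / tau)) * tau" using tr w(2) by (auto elim!: Reals_cases)
      then show "y + axis w t \<in> D" using y by metis
    next
      fix x u assume "x \<in> KF" "u \<in> V"
      then have "u \<in> EE" "x \<in> EE" using VE KF_EE by auto
      then have "u (cnj w) = cnj (u w)" "x (cnj w) = cnj (x w)" using w(1) by (auto simp: EE_def)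
      then have "u w = cnj (u w)" "x w = cnj (x w)" by (simp_all add: wc)
      then show "u w * x w \<in> \<real>" by (metis Reals_cnj_iff Reals_mult)
    qed
  next
    case False
    have t: "tau \<in> directions D w" using w(2) yE y by (auto simp: directions_def)
    obtain sg where s: "cmod sg = 1"
      "!!x e. x \<in> EE ==> e > 0 ==> \<exists>s::real. \<exists>h\<in>OK. \<forall>z\<in>Z. cmod (axis w (of_real s * sg) z - h z - x z) <= e"
      using dense_line_exists[OF w(1) False] by blast
    have "sg \<in> directions D w" by (rule all_directions[OF D V w(1) nr[OF w(1) False] t s(1)])
    then obtain y' where y': "y' \<in> EE" "!!s::real. y' + axis w (of_real s * sg) \<in> D" by (auto simp: directions_def)
    show ?thesis
    proof
      fix x assume "x \<in> EE"
      then have "x - y' \<in> EE" using y' EE_diff by blast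
      then have "\<forall>k. \<exists>s::real. \<exists>h. h \<in> OK & (\<forall>z\<in>Z. cmod (axis w (of_real s * sg) z - h z - (x - y') z) <= inverse (of_nat (Suc k)))"
        using s(2) by (metis inverse_positive_iff_positive of_nat_0_less_iff zero_less_Suc)
      then obtain S h where S: "!!k. h k \<in> OK"
        "!!k z. z \<in> Z ==> cmod (axis w (of_real (S k) * sg) z - h k z - (x - y') z) <= inverse (of_nat (Suc k))" by metis
      have "conv (%k. y' + axis w (of_real (S k) * sg) + - h k) x" unfolding conv_def
      proof
        fix z assume z: "z \<in> Z"
        show "(%k. (y' + axis w (of_real (S k) * sg) + - h k) z) \<longlonglongrightarrow> x z"
          by (rule LIM_zero_cancel, rule tendsto_norm_zero_cancel,
              rule tendsto_sandwich[OF _ _ tendsto_const LIMSEQ_inverse_real_of_nat])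
             (use S(2)[OF z] in \<open>auto simp: algebra_simps\<close>)
      qed
      then show "x \<in> D" by (rule inv_closed[OF D(1), rotated]) (intro invD[OF D(1)] y' OK_uminus S)
    qed
  qed
qed

text \<open>Without torsion every nonempty invariant subset \<open>Y\<close> has small nonintegral
  differences, so its difference set is everything. Then \<open>common_translates\<close> gives a
  point whose translates by all of \<open>KF\<close> lie in \<open>X\<close>; by density
  \<open>X\<close> is everything and contains 0.\<close>

lemma torsion_if_no_real_place:
  assumes nr: "!!w. w \<in> Z ==> w \<notin> \<real> ==> \<not> real_place w"
    and V: "big V" and X: "inv X" "uinv V X" "X ~= {}"
  shows "X \<inter> KF ~= {}"
proof
  assume no: "X \<inter> KF = {}"
  obtain h where h: "!!i::nat. h i \<in> KF" "!!x. x \<in> KF ==> \<exists>i. \<forall>z\<in>Z. h i z = x z" using KF_enum by blast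
  have "\<exists>x\<in>X. \<forall>i. x + h i \<in> X"
  proof (rule common_translates[OF V X _ h(1), of "{}"])
    fix V' Y i assume Y: "big V'" "inv Y" "uinv V' Y" "Y ~= {}" "Y \<subseteq> X"
    then obtain v where v: "!!k::nat. v k \<in> diffs Y" "conv v 0" "!!k. v k \<notin> OK"
      using small_differences_no_torsion[of V' Y] no by blast
    have "EE \<subseteq> diffs Y"
      by (rule all_if_small_element[OF nr inv_diffs[OF Y(2)] uinv_diffs[OF Y(3)] Y(1) v(1,2) not_OK_nonzero[OF v(3)]])
    then show "h i \<in> diffs Y" using h(1) KF_EE by blast
  qed auto
  then obtain x where x: "x \<in> X" "!!i. x + h i \<in> X" by blast
  have "EE \<subseteq> X"
  proof (rule all_if_translate_KF[OF X(1) inv_EE[OF X(1) x(1)]])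
    fix a assume "a \<in> KF"
    then obtain i where "\<forall>z\<in>Z. h i z = a z" using h(2) by blast
    then show "x + a \<in> X" using inv_cong[OF X(1) x(2)[of i]] by simp
  qed
  then show False using no KF_0 KF_EE by blast
qed

end

context numfield_units begin

subsection \<open>Fields with complex multiplication\<close>

lemma rsquarefree_dvd:
  fixes d :: "complex poly"
  assumes "d dvd p" "rsquarefree p" shows "rsquarefree d" unfolding rsquarefree_roots
proof (intro allI notI)
  fix a assume a: "poly d a = 0 & poly (pderiv d) a = 0"
  obtain e where "p = d * e" using assms(1) by blast
  then have "poly p a = 0" "poly (pderiv p) a = 0" using a by (auto simp: pderiv_mult)
  then show False using assms(2) unfolding rsquarefree_roots by blast
qed

text \<open>A unit that is large at \<open>w\<close> only and real there separates \<open>w\<close> and its conjugate from all other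
  roots; so the polynomial with these two roots is a greatest common divisor over the real subfield.\<close>

lemma conjugation_in_KF:
  assumes w: "w \<in> Z" "w \<notin> \<real>" and V: "big V" and re: "!!u. u \<in> V ==> u w \<in> \<real>"
  shows "\<exists>kappa. \<forall>z\<in>Z. ev kappa z = cnj z"
proof -
  obtain u where u: "u \<in> V" "\<forall>z\<in>Z. z ~= w --> z ~= cnj w --> cmod (u z) < 1" "1 < cmod (u w)"
    using pisot[OF V w(1)] by blast
  have VK: "v \<in> KF" if "v \<in> V" for v using that V UK_OK OK_KF by (auto simp: big_def)
  obtain h where h: "!!z. z \<in> Z ==> u z = ev h z" using VK[OF u(1)] by (auto simp: KF_def)
  \<comment> \<open>The real subfield at \<open>w\<close>. It is the ground field for the greatest
    common divisor, which therefore has a trace in it.\<close>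
  define F where "F = {c \<in> \<real>. \<exists>a\<in>KF. a w = c}"
  have F: "subfield_set F" unfolding subfield_set_def F_def
  proof (intro conjI ballI CollectI)
    show "\<exists>a\<in>KF. a w = 0" "\<exists>a\<in>KF. a w = 1" using KF_0 KF_1 by (metis zero_fun_apply, metis one_fun_apply)
    fix x assume "x \<in> {c \<in> \<real>. \<exists>a\<in>KF. a w = c}"
    then obtain a where a: "x \<in> \<real>" "a \<in> KF" "a w = x" by blast
    show "inverse x \<in> \<real>" using a by simp
    show "\<exists>a\<in>KF. a w = inverse x"
    proof (cases "x = 0")
      case True then show ?thesis using KF_0 by (intro bexI[of _ 0]) auto
    next
      case False then show ?thesis using KF_inverse[OF a(2) w(1)] a(3) by (intro bexI[of _ "%z. inverse (a z)"]) auto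
    qed
    fix y assume "y \<in> {c \<in> \<real>. \<exists>a\<in>KF. a w = c}"
    then obtain b where b: "y \<in> \<real>" "b \<in> KF" "b w = y" by blast
    show "x + y \<in> \<real>" "x - y \<in> \<real>" "x * y \<in> \<real>" using a b by auto
    show "\<exists>a\<in>KF. a w = x + y" using a b KF_add by (intro bexI[of _ "a + b"]) auto
    show "\<exists>a\<in>KF. a w = x - y" using a b KF_diff by (intro bexI[of _ "a - b"]) auto
    show "\<exists>a\<in>KF. a w = x * y" using a b KF_mult by (intro bexI[of _ "a * b"]) auto
  qed auto
  have ratF: "of_rat q \<in> F" for q
    unfolding F_def using KF_of_rat[of q] cnj_of_rat[of q] by (auto simp: Reals_cnj_iff intro!: bexI[of _ "%_. of_rat q"])
  define P where "P = (map_poly of_rat G :: complex poly)"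
  define Q where "Q = map_poly of_rat h - [:u w:]"
  have intF: "of_int i \<in> F" for i using ratF[of "of_int i"] by simp
  have PF: "P \<in> polys_over F" using intF by (auto simp: polys_over_def P_def coeff_map_poly)
  have "[:u w:] \<in> polys_over F" using polys_over_monom[OF F, of "u w" 0] re[OF u(1)] VK[OF u(1)] by (auto simp: F_def monom_0)
  then have QF: "Q \<in> polys_over F" unfolding Q_def using F ratF
    by (intro polys_over_closed) (auto simp: polys_over_def coeff_map_poly)
  have P0: "P ~= 0" using cpoly_rsquarefree by (auto simp: P_def rsquarefree_def)
  obtain d A B where d: "d \<in> polys_over F" "lead_coeff d = 1" "d = A * P + B * Q" "d dvd P" "d dvd Q"
    using polys_over_gcd[OF F PF P0 QF] by blast
  have PZ: "poly P z = 0 \<longleftrightarrow> z \<in> Z" for z by (simp add: P_def Z_def ev_def)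
  have Qz: "poly Q z = u z - u w" if "z \<in> Z" for z using h[OF that] by (simp add: Q_def ev_def)
  have ucw: "u (cnj w) = u w" using re[OF u(1)] VK[OF u(1)] KF_EE w(1) by (auto simp: EE_def Reals_cnj_iff)
  have roots: "{z. poly d z = 0} = {w, cnj w}"
  proof (intro equalityI subsetI)
    fix z assume "z \<in> {z. poly d z = 0}"
    then have "poly P z = 0" "poly Q z = 0" using d(4,5) by (auto elim!: dvdE)
    then have z: "z \<in> Z" "u z = u w" using PZ Qz by auto
    then show "z \<in> {w, cnj w}" using u(2,3) by (metis insert_iff not_less_iff_gr_or_eq)
  next
    fix z assume "z \<in> {w, cnj w}"
    then have "z \<in> Z" "u z = u w" using w(1) cnj_Z ucw by auto
    then show "z \<in> {z. poly d z = 0}" unfolding d(3) using PZ Qz by simp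
  qed
  have "rsquarefree d" by (rule rsquarefree_dvd[OF d(4)]) (use cpoly_rsquarefree in \<open>simp add: P_def\<close>)
  from complex_poly_decompose_rsquarefree[OF this]
  have "d = (\<Prod>z\<in>{w, cnj w}. [:- z, 1:])" using d(2) roots by simp
  also have "... = [:- w, 1:] * [:- cnj w, 1:]" using w(2) by (subst prod.insert) (auto simp: Reals_cnj_iff)
  finally have "coeff d 1 = - (w + cnj w)" by simp
  then have "- (w + cnj w) \<in> F" using d(1) by (metis mem_Collect_eq polys_over_def)
  then obtain a where a: "a \<in> KF" "a w = - (w + cnj w)" by (auto simp: F_def)
  obtain f where f: "!!z. z \<in> Z ==> a z = ev f z" using a(1) by (auto simp: KF_def)
  \<comment> \<open>\<open>f\<close> takes the value -(w + cnj w) at \<open>w\<close>, so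
    \<open>kappa\<close> expresses \<open>cnj w\<close> as trace minus \<open>w\<close>.\<close>
  define kappa where "kappa = - f - [:0, 1:]"
  have kw: "ev kappa w = cnj w" by (simp add: kappa_def a(2) flip: f[OF w(1)])
  \<comment> \<open>By conjugacy \<open>kappa\<close> maps \<open>z\<close> to a root different from
    \<open>z\<close>. A unit that is large only at \<open>z\<close> and its conjugate takes the same
    value at both, which leaves only \<open>cnj z\<close>.\<close>
  have "ev kappa z = cnj z" if z: "z \<in> Z" for z
  proof -
    have "ev (pcompose G kappa) w = 0" using kw cnj_Z[OF w(1)] by (simp add: Z_def)
    then have "ev (pcompose G kappa) z = 0" using ev_zero_iff w(1) z by blast
    then have kz: "ev kappa z \<in> Z" by (simp add: Z_def)
    have ne: "ev kappa z ~= z"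
    proof
      assume "ev kappa z = z"
      then have "ev (kappa - [:0, 1:]) z = 0" by simp
      then have "ev (kappa - [:0, 1:]) w = 0" using ev_zero_iff w(1) z by blast
      then show False using kw w(2) by (simp add: Reals_cnj_iff)
    qed
    obtain v where v: "v \<in> V" "\<forall>y\<in>Z. y ~= z --> y ~= cnj z --> cmod (v y) < 1" "1 < cmod (v z)"
      using pisot[OF V z] by blast
    obtain p where p: "!!z. z \<in> Z ==> v z = ev p z" using VK[OF v(1)] by (auto simp: KF_def)
    have "v (cnj w) = v w" using re[OF v(1)] VK[OF v(1)] KF_EE w(1) by (auto simp: EE_def Reals_cnj_iff)
    then have "ev (pcompose p kappa - p) w = 0" using kw p w(1) cnj_Z by simp
    then have "ev (pcompose p kappa - p) z = 0" using ev_zero_iff w(1) z by blast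
    then have "v (ev kappa z) = v z" using p z kz by simp
    then show ?thesis using v(2,3) kz ne by fastforce
  qed
  then show ?thesis by blast
qed

lemma cnj_KF: assumes "\<forall>z\<in>Z. ev kappa z = cnj z" "a \<in> KF" shows "(%z. cnj (a z)) \<in> KF"
proof -
  obtain h where "!!z. z \<in> Z ==> a z = ev h z" using assms(2) by (auto simp: KF_def)
  then show ?thesis using assms(1) by (intro KFI[of _ "pcompose h kappa"]) (simp add: ev_cnj)
qed

lemma cnj_OK: "\<forall>z\<in>Z. ev kappa z = cnj z ==> a \<in> OK ==> (%z. cnj (a z)) \<in> OK"
  using cnj_KF by (auto simp: OK_def)

definition cn :: "(complex => complex) => complex => complex" where "cn x = (%z. cnj (x z))"

lemma cn_simps [simp]: "cn (x + y) = cn x + cn y" "cn (x - y) = cn x - cn y" "cn (x * y) = cn x * cn y"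
  "cn (- x) = - cn x" "cn x z = cnj (x z)" by (auto simp: cn_def)

lemma conv_cn: "conv f l ==> conv (%k. cn (f k)) (cn l)" by (auto simp: conv_def intro: tendsto_cnj)

definition RR :: "(complex => complex) set" where "RR = {x \<in> EE. \<forall>z\<in>Z. x z \<in> \<real>}"

lemma RR_I: "x \<in> EE ==> (!!z. z \<in> Z ==> x z = cnj (x z)) ==> x \<in> RR" by (auto simp: RR_def Reals_cnj_iff)

lemma real_part_RR: "x \<in> EE ==> (%z. of_real (Re (x z))) \<in> RR" by (auto simp: RR_def EE_def)

text \<open>All units of \<open>V\<close> are real, so they preserve real and imaginary parts and no
  rotation is available. The argument is run twice instead: first modulo \<open>HH\<close>, which
  contains all real points, so that only imaginary parts count and a torsion point \<open>p\<close>
  of X + HH results; then inside \<open>HH\<close>, for the points of X - p, where small differences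
  are eventually real.\<close>

lemma torsion_if_conjugation:
  assumes kappa: "\<forall>z\<in>Z. ev kappa z = cnj z" and V: "big V" and re: "!!u z. u \<in> V ==> z \<in> Z ==> u z \<in> \<real>"
    and X: "inv X" "uinv V X" "X ~= {}"
  shows "X \<inter> KF ~= {}"
proof -
  have VU: "V \<subseteq> UK" using V by (simp add: big_def)
  have VE: "u \<in> EE" if "u \<in> V" for u using that VU UK_OK OK_EE by blast
  have VO: "u \<in> OK" if "u \<in> V" for u using that VU UK_OK by blast
  \<comment> \<open>Modulo \<open>OK\<close> these are the points fixed by conjugation; the group
    contains the real points and the integers.\<close>
  define HH where "HH = {x \<in> EE. x - cn x \<in> OK}"
  have HHD: "x \<in> EE" "x - cn x \<in> OK" if "x \<in> HH" for x using that by (auto simp: HH_def)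
  have OK_HH: "a \<in> HH" if "a \<in> OK" for a
    using that cnj_OK[OF kappa that] OK_EE by (auto simp: HH_def cn_def intro: OK_diff)
  have HH_add: "x + y \<in> HH" if "x \<in> HH" "y \<in> HH" for x y
    using OK_add[OF HHD(2)[OF that(1)] HHD(2)[OF that(2)]] HHD(1)[OF that(1)] HHD(1)[OF that(2)]
    by (simp add: HH_def EE_add algebra_simps)
  have HH_uminus: "- x \<in> HH" if "x \<in> HH" for x
    using OK_uminus[OF HHD(2)[OF that]] EE_diff[OF EE_0 HHD(1)[OF that]] by (simp add: HH_def)
  have HH_diff: "x - y \<in> HH" if "x \<in> HH" "y \<in> HH" for x y using HH_add[OF that(1) HH_uminus[OF that(2)]] by simp
  have RR_HH: "r \<in> HH" if "r \<in> RR" for r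
    using that OK_cong[OF OK_0, of "r - cn r"] by (auto simp: RR_def HH_def Reals_cnj_iff)
  have HH_mult: "u * x \<in> HH" if "u \<in> V" "x \<in> HH" for u x
  proof -
    have "u * (x - cn x) \<in> OK" using HHD[OF that(2)] VO[OF that(1)] OK_mult by blast
    then have "u * x - cn (u * x) \<in> OK"
      by (rule OK_cong) (use re[OF that(1)] in \<open>simp add: Reals_cnj_iff right_diff_distrib\<close>)
    then show ?thesis using EE_mult[OF VE[OF that(1)] HHD(1)[OF that(2)]] by (simp add: HH_def)
  qed
  have HH_closed: "closedZ HH" unfolding closedZ_def
  proof (intro allI impI)
    fix f l assume f: "\<forall>k. f k \<in> HH" "conv f l"
    have "l \<in> EE" by (rule closedZD[OF closedZ_EE _ f(2)]) (use f HHD in blast)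
    moreover have "l - cn l \<in> OK" by (rule closedZD[OF closedZ_OK _ conv_diff[OF f(2) conv_cn[OF f(2)]]]) (use f HHD in blast)
    ultimately show "l \<in> HH" by (simp add: HH_def)
  qed
  \<comment> \<open>The sum X + HH; compactness of the torus makes it closed.\<close>
  define X1 where "X1 = {y \<in> EE. \<exists>h\<in>HH. y - h \<in> X}"
  have X1I: "y \<in> X1" if "y - h \<in> X" "h \<in> HH" "y \<in> EE" for y h using that by (auto simp: X1_def)
  have X1E: "y \<in> EE" if "y \<in> X1" for y using that by (simp add: X1_def)
  have X1: "inv X1" unfolding inv_def
  proof (intro conjI ballI)
    show "X1 \<subseteq> EE" by (auto simp: X1_def)
    show "closedZ X1" unfolding closedZ_def
    proof (intro allI impI)
      fix f l assume f: "\<forall>k. f k \<in> X1" "conv f l"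
      then have "\<forall>k. \<exists>h. h \<in> HH & f k - h \<in> X" by (auto simp: X1_def)
      then obtain h where h: "!!k. h k \<in> HH" "!!k. f k - h k \<in> X" by metis
      obtain a l' r where a: "!!k. a k \<in> OK" "strict_mono (r :: nat => nat)" "conv (%k. h (r k) + a (r k)) l'"
        using compactness[of h] h(1) HHD by blast
      have "l' \<in> HH" by (rule closedZD[OF HH_closed _ a(3)]) (use h a HH_add OK_HH in blast)
      moreover have "l - l' \<in> X"
      proof (rule inv_closed[OF X(1)])
        show "conv (%k. f (r k) - (h (r k) + a (r k))) (l - l')" by (intro conv_diff a conv_subseq[OF f(2)])
        show "f (r k) - (h (r k) + a (r k)) \<in> X" for k
          using invD[OF X(1) h(2) OK_uminus[OF a(1)], of "r k" "r k"] by (simp add: algebra_simps)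
      qed
      moreover have "l \<in> EE" by (rule closedZD[OF closedZ_EE _ f(2)]) (use f in \<open>simp add: X1_def\<close>)
      ultimately show "l \<in> X1" by (auto simp: X1_def)
    qed
    fix x a assume x: "x \<in> X1" and a: "a \<in> OK"
    then obtain h where "h \<in> HH" "x - h \<in> X" by (auto simp: X1_def)
    then have "(x + a) - (h + a) \<in> X" "h + a \<in> HH" using HH_add OK_HH[OF a] by auto
    then show "x + a \<in> X1" by (rule X1I) (use X1E[OF x] a OK_EE EE_add in blast)
  qed
  have X1u: "uinv V X1" unfolding uinv_def
  proof (intro ballI)
    fix u x assume u: "u \<in> V" and x: "x \<in> X1"
    then obtain h where "h \<in> HH" "x - h \<in> X" by (auto simp: X1_def)
    then have "u * x - u * h \<in> X" "u * h \<in> HH" using HH_mult[OF u] X(2) u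
      by (auto simp: uinv_def right_diff_distrib[symmetric])
    then show "u * x \<in> X1" by (rule X1I) (rule EE_mult[OF VE[OF u] X1E[OF x]])
  qed
  have X1R: "x + r \<in> X1" if x: "x \<in> X1" and r: "r \<in> RR" for x r
  proof -
    obtain h where "h \<in> HH" "x - h \<in> X" using x by (auto simp: X1_def)
    then have "(x + r) - (h + r) \<in> X" "h + r \<in> HH" using HH_add RR_HH[OF r] by auto
    then show ?thesis by (rule X1I) (use X1E[OF x] r EE_add in \<open>auto simp: RR_def\<close>)
  qed
  have X1ne: "X1 ~= {}"
  proof -
    obtain x where "x \<in> X" using X(3) by blast
    then have "x \<in> X1" using X1I[of x 0] OK_HH[OF OK_0] inv_EE[OF X(1)] by simp
    then show ?thesis by blast
  qed
  obtain h where h: "!!i::nat. h i \<in> KF" "!!x. x \<in> KF ==> \<exists>i. \<forall>z\<in>Z. h i z = x z" using KF_enum by blast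
  have "X1 \<inter> KF ~= {}"
  proof
    assume no: "X1 \<inter> KF = {}"
    have "\<exists>x\<in>X1. \<forall>i. x + h i \<in> X1"
    proof (rule common_translates[OF V X1 X1u X1ne X1R h(1)])
      fix V' Y i assume Y: "big V'" "V' \<subseteq> V" "inv Y" "uinv V' Y" "Y ~= {}" "Y \<subseteq> X1"
        and YR: "!!y r. y \<in> Y ==> r \<in> RR ==> y + r \<in> Y"
      define D where "D = diffs Y"
      have D: "inv D" "uinv V' D" unfolding D_def using inv_diffs[OF Y(3)] uinv_diffs[OF Y(4)] by auto
      have DR: "d + r \<in> D" if "d \<in> D" "r \<in> RR" for d r
        using that YR unfolding D_def diffs_def by (auto simp: add.assoc[symmetric])
      obtain x where x: "x \<in> Y" using Y by blast
      obtain w where w: "w \<in> Z" using Z_nonempty by blast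
      obtain u where u: "u \<in> V'" "1 < cmod (u w)" using pisot[OF Y(1) w] by blast
      have uV: "u \<in> V" using u Y by blast
      have xE: "x \<in> EE" using inv_EE[OF Y(3) x] .
      have "u ^ j * x - u ^ i * x \<notin> HH" if ij: "i < j" for i j
      proof
        assume "u ^ j * x - u ^ i * x \<in> HH"
        then have "(u ^ j * x - u ^ i * x) - cn (u ^ j * x - u ^ i * x) \<in> OK" by (rule HHD)
        then have "u ^ j * (x - cn x) - u ^ i * (x - cn x) \<in> OK"
        proof (rule OK_cong)
          fix z assume "z \<in> Z"
          then have "cnj (u z) = u z" using re[OF uV] by (simp add: Reals_cnj_iff)
          then show "(u ^ j * x - u ^ i * x - cn (u ^ j * x - u ^ i * x)) z = (u ^ j * (x - cn x) - u ^ i * (x - cn x)) z"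
            by (simp add: algebra_simps)
        qed
        then have k: "x - cn x \<in> KF" by (rule torsion_if_fixed[rotated 4]) (use uV VU w u(2) ij in auto)
        \<comment> \<open>The imaginary part of \<open>x\<close>, which is torsion because
          \<open>x - cn x\<close> is. It lies in \<open>X1\<close> because \<open>Y\<close> is
          stable under real translations.\<close>
        define p where "p = (%z. of_rat (1 / 2)) * (x - cn x)"
        have pK: "p \<in> KF" unfolding p_def by (intro KF_mult KF_of_rat k)
        have "(%z. of_real (Re ((- x) z))) \<in> RR" by (rule real_part_RR[of "- x"]) (use EE_diff[OF EE_0 xE] in simp)
        then have "x + (%z. of_real (Re ((- x) z))) \<in> X1" using YR[OF x] Y(6) by blast
        then have "p \<in> X1" by (rule inv_cong[OF X1]) (auto simp: p_def complex_eq_iff of_rat_divide)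
        then show False using no pK by blast
      qed
      from small_differences[OF Y(1,3,4) x u(1) HH_add[OF _ OK_HH] this]
      obtain v where v: "!!k::nat. v k \<in> D" "conv v 0" "!!k. v k \<notin> HH" unfolding D_def by blast
      \<comment> \<open>Removing the real parts leaves purely imaginary small differences; they are
        nonzero on \<open>Z\<close> since \<open>v k\<close> is not in \<open>HH\<close>.\<close>
      define v' where "v' k = v k + (%z. of_real (Re ((- v k) z)))" for k
      have vE: "v k \<in> EE" for k using inv_EE[OF D(1) v(1)] .
      have v'D: "v' k \<in> D" for k unfolding v'_def
        by (rule DR[OF v(1)], rule real_part_RR[of "- v k"]) (use EE_diff[OF EE_0 vE] in simp)
      have v'z: "v' k z = \<i> * of_real (Im (v k z))" for k z by (simp add: v'_def complex_eq_iff)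
      have v'0: "conv v' 0" unfolding conv_def
      proof
        fix z assume "z \<in> Z"
        then have "(%k. v k z) \<longlonglongrightarrow> 0" using v(2) by (auto simp: conv_def)
        then have "(%k. \<i> * of_real (Im (v k z))) \<longlonglongrightarrow> \<i> * of_real (Im 0)" by (intro tendsto_intros)
        then show "(%k. v' k z) \<longlonglongrightarrow> 0 z" by (simp add: v'z)
      qed
      have v'ne: "\<exists>z\<in>Z. v' k z ~= 0" for k
      proof (rule ccontr)
        assume "\<not> ?thesis"
        then have "v k \<in> RR" using vE[of k] by (intro RR_I) (auto simp: v'z complex_eq_iff)
        then show False using RR_HH v(3) by blast
      qed
      have Sc: "closedZ {x. \<forall>z\<in>Z. Re (x z) = 0}" unfolding closedZ_def
      proof (intro allI impI CollectI ballI)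
        fix f l z assume f: "\<forall>k. f k \<in> {x. \<forall>z\<in>Z. Re (x z) = 0}" "conv f l" and z: "z \<in> Z"
        have "(%k. Re (f k z)) \<longlonglongrightarrow> Re (l z)" using f(2) z unfolding conv_def by (intro tendsto_Re) blast
        moreover have "(%k. Re (f k z)) = (%k. 0)" using f(1) z by auto
        ultimately show "Re (l z) = 0" by (simp add: LIMSEQ_const_iff)
      qed
      have mr: "Re (u z * x z) = 0" if "u \<in> V'" "Re (x z) = 0" "z \<in> Z" for u x z
        using re[OF subsetD[OF Y(2) that(1)] that(3)] that(2) by (auto elim!: Reals_cases)
      obtain w tau y where w: "w \<in> Z" "cmod tau = 1" "\<forall>z\<in>Z. Re (axis w tau z) = 0"
        and y: "!!s::real. y + axis w (of_real s * tau) \<in> D" using line_in_invariant_set[OF D Y(1) v'D v'0 v'ne Sc] v'z mr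
        by (auto simp: left_diff_distrib)
      have "axis w 0 = 0" by (rule ext) (simp add: axis_def)
      then have yE: "y \<in> EE" using inv_EE[OF D(1) y[of 0]] by simp
      have Re0: "Re tau = 0" using w by (auto simp: axis_def dest!: bspec[of _ _ w])
      have "EE \<subseteq> D"
      proof (rule all_if_line_dense[OF D(1) _ yE Y(1) w(1), of "{t. w = cnj w --> t \<in> \<real>}"])
        fix t :: complex assume t: "t \<in> {t. w = cnj w --> t \<in> \<real>}"
        have im: "\<bar>Im tau\<bar> = 1" using w(2) Re0 by (simp add: cmod_def)
        \<comment> \<open>The line covers the imaginary direction of the axis, and translations by
          \<open>RR\<close> cover the real one.\<close>
        have "t = of_real (Im t * Im tau) * tau + of_real (Re t)"
          using Re0 im by (simp add: complex_eq_iff mult.assoc abs_square_eq_1 flip: power2_eq_square)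
        then have "y + axis w t = (y + axis w (of_real (Im t * Im tau) * tau)) + axis w (of_real (Re t))"
          by (metis axis_add add.assoc)
        moreover have "axis w (of_real (Re t)) \<in> RR"
          using axis_EE[OF w(1), of "of_real (Re t)"] by (auto simp: RR_def axis_def)
        ultimately show "y + axis w t \<in> D" using DR[OF y] by metis
      next
        fix x u assume "x \<in> KF" "u \<in> V'"
        then have "x \<in> EE" "u w \<in> \<real>" using KF_EE re Y(2) w(1) by auto
        moreover have "w = cnj w ==> x w = cnj (x w)" using \<open>x \<in> EE\<close> w(1) by (auto simp: EE_def)
        ultimately show "u w * x w \<in> {t. w = cnj w --> t \<in> \<real>}" by (auto simp: Reals_cnj_iff[of "x w"])
      qed
      then show "h i \<in> diffs Y" using h(1) KF_EE D_def by blast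
    qed
    then obtain x where x: "x \<in> X1" "!!i. x + h i \<in> X1" by blast
    have "EE \<subseteq> X1"
    proof (rule all_if_translate_KF[OF X1 inv_EE[OF X1 x(1)]])
      fix a assume "a \<in> KF"
      then obtain i where "\<forall>z\<in>Z. h i z = a z" using h(2) by blast
      then show "x + a \<in> X1" using inv_cong[OF X1 x(2)[of i]] by simp
    qed
    then show False using no KF_0 KF_EE by blast
  qed
  then obtain p where p: "p \<in> KF" "p \<in> X1" by blast
  \<comment> \<open>The part of X - p inside \<open>HH\<close>; it is invariant under those units of
    \<open>V\<close> that fix \<open>p\<close> modulo integers.\<close>
  define Y where "Y = {y \<in> HH. p + y \<in> X}"
  have Yne: "Y ~= {}"
  proof -
    obtain h where "h \<in> HH" "p - h \<in> X" using p(2) by (auto simp: X1_def)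
    then have "- h \<in> Y" using HH_uminus by (simp add: Y_def)
    then show ?thesis by blast
  qed
  have Y: "inv Y" unfolding inv_def
  proof (intro conjI ballI)
    show "Y \<subseteq> EE" using HHD by (auto simp: Y_def)
    show "closedZ Y" unfolding closedZ_def
    proof (intro allI impI)
      fix f l assume f: "\<forall>k. f k \<in> Y" "conv f l"
      have "l \<in> HH" by (rule closedZD[OF HH_closed _ f(2)]) (use f in \<open>simp add: Y_def\<close>)
      moreover have "p + l \<in> X"
        by (rule inv_closed[OF X(1) _ conv_add[OF conv_const f(2)]]) (use f in \<open>simp add: Y_def\<close>)
      ultimately show "l \<in> Y" by (simp add: Y_def)
    qed
    fix y a assume "y \<in> Y" "a \<in> OK"
    then show "y + a \<in> Y" using HH_add OK_HH invD[OF X(1), of "p + y" a] by (auto simp: Y_def add_ac)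
  qed
  have V1: "big (V \<inter> stab p)" by (rule big_Int[OF V big_stab[OF p(1)]])
  have Yu: "uinv (V \<inter> stab p) Y" unfolding uinv_def
  proof (intro ballI)
    fix u y assume u: "u \<in> V \<inter> stab p" and y: "y \<in> Y"
    have "- (u * p - p) \<in> OK" using u by (intro OK_uminus) (simp add: stab_def)
    moreover have "u * (p + y) \<in> X" using X(2) u y by (auto simp: uinv_def Y_def)
    ultimately have "u * (p + y) + - (u * p - p) \<in> X" using invD[OF X(1)] by blast
    then show "u * y \<in> Y" using HH_mult u y by (auto simp: Y_def algebra_simps)
  qed
  have "Y \<inter> KF ~= {}"
  proof
    assume no: "Y \<inter> KF = {}"
    \<comment> \<open>Only real field elements serve as translations here; the value 0 fills the
      gaps of the enumeration.\<close>
    define h' where "h' i = (if h i \<in> RR then h i else 0)" for i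
    have h'K: "h' i \<in> KF" for i using h(1) KF_0 by (simp add: h'_def)
    have h'R: "h' i \<in> RR" for i by (auto simp: h'_def RR_def EE_0)
    have "\<exists>x\<in>Y. \<forall>i. x + h' i \<in> Y"
    proof (rule common_translates[OF V1 Y Yu Yne _ h'K, of "{}"])
      fix V' Y' i assume Y': "big V'" "V' \<subseteq> V \<inter> stab p" "inv Y'" "uinv V' Y'" "Y' ~= {}" "Y' \<subseteq> Y"
      define D where "D = diffs Y'"
      have D: "inv D" "uinv V' D" unfolding D_def using inv_diffs[OF Y'(3)] uinv_diffs[OF Y'(4)] by auto
      have DH: "d \<in> HH" if d: "d \<in> D" for d
      proof -
        obtain x where "x \<in> Y'" "x + d \<in> Y'" using d by (auto simp: D_def diffs_def)
        then have "x \<in> HH" "x + d \<in> HH" using Y'(6) by (auto simp: Y_def)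
        then show ?thesis using HH_diff[of "x + d" x] by simp
      qed
      obtain v where v: "!!k::nat. v k \<in> D" "conv v 0" "!!k. v k \<notin> OK"
        using small_differences_no_torsion[OF Y'(1,3,4,5)] no Y'(6) unfolding D_def by blast
      \<comment> \<open>\<open>v k - cn (v k)\<close> is integral and tends to 0, so it vanishes
        eventually and \<open>v k\<close> is real from then on.\<close>
      have c0: "conv (%k. v k - cn (v k)) 0" using conv_diff[OF v(2) conv_cn[OF v(2)]] by (simp add: cn_def conv_def)
      obtain K where K: "!!i j z. i >= K ==> j >= K ==> z \<in> Z ==> (v i - cn (v i)) z = (v j - cn (v j)) z"
        using OK_eventually_equal[OF _ c0] HHD(2)[OF DH[OF v(1)]] by blast
      have vR: "v (K + k) \<in> RR" for k
      proof (rule RR_I[OF inv_EE[OF D(1) v(1)]])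
        fix z assume z: "z \<in> Z"
        have "(%j. (v j - cn (v j)) z) \<longlonglongrightarrow> 0" using c0 z by (auto simp: conv_def)
        moreover have "(%j. (v j - cn (v j)) z) \<longlonglongrightarrow> (v (K + k) - cn (v (K + k))) z"
          unfolding tendsto_def eventually_sequentially by (intro allI impI exI[of _ K]) (subst K[of _ "K + k"], use z in auto)
        ultimately have "(v (K + k) - cn (v (K + k))) z = 0" by (metis LIMSEQ_unique)
        then show "v (K + k) z = cnj (v (K + k) z)" by simp
      qed
      define S where "S = {x :: complex => complex. \<forall>z\<in>Z. x z \<in> \<real>}"
      have Sc: "closedZ S" unfolding closedZ_def S_def
      proof (intro allI impI CollectI ballI)
        fix f l z assume f: "\<forall>k. f k \<in> {x :: complex => complex. \<forall>z\<in>Z. x z \<in> \<real>}" "conv f l" and z: "z \<in> Z"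
        then have "(%k. f k z) \<longlonglongrightarrow> l z" by (auto simp: conv_def)
        then show "l z \<in> \<real>" by (rule closed_sequentially[OF closed_complex_Reals, rotated]) (use f(1) z in auto)
      qed
      have vS: "v (K + k) \<in> S" for k using vR by (auto simp: RR_def S_def)
      have c1: "conv (%k. v (K + k)) 0" by (rule conv_subseq[OF v(2)]) (simp add: strict_mono_def)
      have uS: "u * x \<in> S" "(u - 1) * x \<in> S" if "u \<in> V'" "x \<in> S" for u x
        using that re[of u] Y'(2) by (auto simp: S_def)
      have sS: "(%z. of_real r * x z) \<in> S" if "x \<in> S" for r x using that by (auto simp: S_def)
      obtain w tau y T a where w: "w \<in> Z" "cmod tau = 1" "axis w tau \<in> S"
        and T: "!!k. axis w (T k) \<in> S" "!!k. a k \<in> OK" "conv (%k. axis w (T k) + a k) y"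
        and y: "!!s::real. y + axis w (of_real s * tau) \<in> D"
        using line_in_invariant_set[OF D Y'(1) v(1) c1 not_OK_nonzero[OF v(3)] Sc vS uS sS] by blast
      have axw: "axis w t w = t" for t by (simp add: axis_def)
      have tr: "tau \<in> \<real>" "T k \<in> \<real>" for k using w(1,3) T(1)[of k] axw by (fastforce simp: S_def)+
      have real_mult: "c = of_real (Re (c / tau)) * tau" if "c \<in> \<real>" for c
        using tr(1) w(2) that by (auto elim!: Reals_cases)
      obtain u b where ub: "!!k. u k \<in> V' & b k \<in> OK" "conv (%k. axis w (u k w * h' i w) + b k) (h' i)"
        using torsion_near_axis[OF Y'(1) w(1) h'K] by blast
      \<comment> \<open>Both \<open>h' i\<close> and the base point \<open>y\<close> are limits of
        real axis points modulo integers, so \<open>h' i\<close> is a limit of points of the line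
        modulo integers.\<close>
      have "conv (%k. y + ((axis w (u k w * h' i w) + b k) - (axis w (T k) + a k))) (y + (h' i - y))"
        by (intro conv_add conv_const conv_diff ub T)
      then have "y + (h' i - y) \<in> D"
      proof (rule inv_closed[OF D(1), rotated])
        fix k
        have "u k w * h' i w - T k \<in> \<real>"
          using re[of "u k" w] ub(1)[of k] Y'(2) w(1) h'R[of i] tr(2)[of k] by (auto simp: RR_def)
        then have "u k w * h' i w - T k = of_real (Re ((u k w * h' i w - T k) / tau)) * tau" by (rule real_mult)
        then have "y + axis w (u k w * h' i w - T k) \<in> D" using y by metis
        from invD[OF D(1) this OK_diff[of "b k" "a k"]] ub(1) T(2)
        show "y + ((axis w (u k w * h' i w) + b k) - (axis w (T k) + a k)) \<in> D" by (simp add: axis_diff algebra_simps)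
      qed
      then show "h' i \<in> diffs Y'" by (simp add: D_def)
    qed auto
    then obtain x where x: "x \<in> Y" "!!i. x + h' i \<in> Y" by blast
    have xL: "x + r \<in> Y" if r: "r \<in> RR" "r \<in> KF" for r
    proof -
      obtain i where i: "\<forall>z\<in>Z. h i z = r z" using h(2) r(2) by blast
      then have "h i \<in> RR" using r(1) h(1)[of i] KF_EE by (auto simp: RR_def)
      then have "x + h i \<in> Y" using x(2)[of i] by (simp add: h'_def)
      then show ?thesis by (rule inv_cong[OF Y]) (use i in simp)
    qed
    \<comment> \<open>The shift by \<open>r\<close> removes the real part of \<open>x\<close>. It is
      approximated by real field elements, and half of \<open>x - cn x\<close> remains, which is
      torsion.\<close>
    define r :: "complex => complex" where "r = (%z. of_real (Re ((- x) z)))"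
    have xE: "x \<in> EE" using inv_EE[OF Y x(1)] .
    have rR: "r \<in> RR" unfolding r_def by (rule real_part_RR[of "- x"]) (use EE_diff[OF EE_0 xE] in simp)
    then have "r \<in> EE" by (simp add: RR_def)
    then obtain f where f: "!!k. f k \<in> KF" "conv f r" using KF_dense by blast
    define f' where "f' k = (%z. of_rat (1 / 2)) * (f k + cn (f k))" for k
    have f'K: "f' k \<in> KF" for k unfolding f'_def
      using cnj_KF[OF kappa f(1)] f(1) by (intro KF_mult KF_of_rat KF_add) (auto simp: cn_def)
    have "f' k \<in> RR" for k using f'K KF_EE by (intro RR_I) (auto simp: f'_def add.commute)
    then have "x + f' k \<in> Y" for k using xL f'K by blast
    moreover have "conv (%k. x + f' k) (x + (%z. of_rat (1 / 2)) * (r + cn r))"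
      unfolding f'_def by (intro conv_add conv_const conv_mult f conv_cn)
    ultimately have "x + (%z. of_rat (1 / 2)) * (r + cn r) \<in> Y" by (rule inv_closed[OF Y])
    then have "(%z. of_rat (1 / 2)) * (x - cn x) \<in> Y" by (rule inv_cong[OF Y]) (simp add: r_def complex_eq_iff of_rat_divide)
    moreover have "(%z. of_rat (1 / 2)) * (x - cn x) \<in> KF"
      using x(1) HHD OK_KF by (intro KF_mult KF_of_rat) (auto simp: Y_def)
    ultimately show False using no by blast
  qed
  then obtain y where "y \<in> Y" "y \<in> KF" by blast
  then have "p + y \<in> X \<inter> KF" using p KF_add by (auto simp: Y_def)
  then show ?thesis by blast
qed

theorem torsion_point_exists:
  assumes V: "big V" and X: "inv X" "uinv V X" "X ~= {}"
  shows "\<exists>p\<in>X. p \<in> KF"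
proof (cases "\<exists>w\<in>Z. w \<notin> \<real> & real_place w")
  case False
  then show ?thesis using torsion_if_no_real_place[OF _ V X] by blast
next
  case True
  then obtain w V' where w: "w \<in> Z" "w \<notin> \<real>" and V': "big V'" "!!u. u \<in> V' ==> u w \<in> \<real>"
    by (auto simp: real_place_def)
  obtain kappa where kappa: "\<forall>z\<in>Z. ev kappa z = cnj z" using conjugation_in_KF[OF w V'(1)] V'(2) by blast
  \<comment> \<open>Conjugation is a field automorphism, so reality at \<open>w\<close> is an
    identity between field elements and holds at every root.\<close>
  have re: "u z \<in> \<real>" if u: "u \<in> V \<inter> V'" and z: "z \<in> Z" for u z
  proof -
    have uK: "u \<in> KF" using u V UK_OK OK_KF by (auto simp: big_def)
    have "cnj (u w) = u w" using V'(2) u by (simp add: Reals_cnj_iff)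
    then have "cnj (u z) = u z" using KF_eq[OF cnj_KF[OF kappa uK] uK w(1) z] by simp
    then show ?thesis by (simp add: Reals_cnj_iff)
  qed
  have X2: "uinv (V \<inter> V') X" by (rule uinv_mono[OF X(2)]) auto
  have "X \<inter> KF ~= {}"  by (rule torsion_if_conjugation[OF kappa big_Int[OF V V'(1)] _ X(1) X2 X(3)]) (rule re)
  then show ?thesis by blast
qed

end

section \<open>Finiteness at the top of the spectrum\<close>

context numfield begin

definition mm :: "(complex => complex) => real" where "mm x = (INF a\<in>OK. N (x + a))"
definition SS :: "real => (complex => complex) set" where
  "SS t = {x \<in> EE. \<forall>a\<in>OK. t <= N (x + a)}"
definition MM :: real where "MM = (SUP x\<in>EE. mm x)"

lemma mm_le: "a \<in> OK ==> mm x <= N (x + a)" unfolding mm_def by (rule cINF_lower) (auto intro!: bdd_belowI[of _ 0] N_nonneg)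

lemma SS_iff: "x \<in> SS t \<longleftrightarrow> x \<in> EE & t <= mm x"
proof -
  have "t <= mm x" if "\<forall>a\<in>OK. t <= N (x + a)" unfolding mm_def by (rule cINF_greatest) (use OK_0 that in auto)
  then show ?thesis using mm_le[of _ x] order_trans by (auto simp: SS_def)
qed

lemma inv_SS: "inv (SS t)" unfolding inv_def closedZ_def
proof (intro conjI allI impI ballI)
  show "SS t \<subseteq> EE" by (auto simp: SS_def)
  fix f l assume f: "\<forall>k. f k \<in> SS t" "conv f l"
  have "l \<in> EE" by (rule closedZD[OF closedZ_EE _ f(2)]) (use f in \<open>simp add: SS_def\<close>)
  moreover have "t <= N (l + a)" if "a \<in> OK" for a
    by (rule LIMSEQ_le_const[OF conv_N[OF conv_add[OF f(2) conv_const]]]) (use f(1) that in \<open>auto simp: SS_def\<close>)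
  ultimately show "l \<in> SS t" by (simp add: SS_def)
next
  fix x a assume x: "x \<in> SS t" and a: "a \<in> OK"
  have "t <= N (x + a + b)" if "b \<in> OK" for b using x OK_add[OF a that] by (simp add: SS_def add.assoc)
  then show "x + a \<in> SS t" using x a OK_EE EE_add by (auto simp: SS_def)
qed

lemma uinv_SS: "uinv UK (SS t)" unfolding uinv_def
proof (intro ballI)
  fix u x assume u: "u \<in> UK" and x: "x \<in> SS t"
  have "t <= N (u * x + a)" if a: "a \<in> OK" for a
  proof -
    define b where "b = (%z. inverse (u z)) * a"
    have "b \<in> OK" unfolding b_def using UK_inverse[OF u] UK_OK a OK_mult by blast
    then have "t <= N (u * (x + b))" using x by (simp add: SS_def N_mult N_UK[OF u])
    also have "N (u * (x + b)) = N (u * x + a)" by (rule N_cong) (simp add: b_def UK_nonzero[OF u] distrib_left)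
    finally show ?thesis .
  qed
  then show "u * x \<in> SS t" using x u UK_OK OK_EE EE_mult by (auto simp: SS_def)
qed

lemma mm_UK: assumes "u \<in> UK" "x \<in> EE" shows "mm x <= mm (u * x)"
  using uinv_SS[of "mm x"] assms by (auto simp: uinv_def SS_iff)

lemma mm_add: assumes "a \<in> OK" "x \<in> EE" shows "mm x <= mm (x + a)"
  using invD[OF inv_SS[of "mm x"], of x a] assms by (auto simp: SS_iff)

lemma mm_bound: assumes "x \<in> EE" shows "mm x <= real BB ^ n"
proof -
  obtain a where a: "a \<in> OK" "\<forall>z\<in>Z. cmod ((x + a) z) <= BB" using reduce_OK[OF assms] by blast
  have "N (x + a) <= (\<Prod>z\<in>Z. real BB)" unfolding N_def by (rule prod_mono) (use a in auto)
  then show ?thesis using mm_le[OF a(1), of x] by (simp add: card_Z)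
qed

lemma bdd_mm: "bdd_above (mm ` EE)" using mm_bound by (auto intro!: bdd_aboveI)

lemma mm_le_MM: "x \<in> EE ==> mm x <= MM" unfolding MM_def by (rule cSUP_upper[OF _ bdd_mm])

text \<open>If \<open>q\<close> is a denominator of \<open>x\<close>, the norms of all translates
  are multiples of 1 / q^n, so the infimum is attained and rational.\<close>

lemma mm_torsion: assumes x: "x \<in> KF" shows "\<exists>a\<in>OK. N (x + a) = mm x & N (x + a) \<in> \<rat>"
proof -
  obtain q :: nat where q: "q > 0" "(%z. of_nat q * x z) \<in> OK" using OK_multiple[OF x] by blast
  have k: "\<exists>k::nat. N (x + a) * real q ^ n = real k" if "a \<in> OK" for a
  proof -
    have "(%z. of_nat q * (x + a) z) \<in> OK"
      using OK_add[OF q(2) OK_scale[OF that, of "int q"]] by (rule OK_cong) (simp add: distrib_left)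
    moreover have "N (%z. of_nat q * (x + a) z) = N (x + a) * real q ^ n" by (simp add: N_def norm_mult prod.distrib card_Z)
    ultimately show ?thesis using N_OK_nat by metis
  qed
  obtain a where a: "a \<in> OK" "!!b. b \<in> OK ==> nat \<lfloor>N (x + a) * real q ^ n\<rfloor> <= nat \<lfloor>N (x + b) * real q ^ n\<rfloor>"
    using ex_has_least_nat[of "%a. a \<in> OK" 0 "%a. nat \<lfloor>N (x + a) * real q ^ n\<rfloor>"] OK_0 by blast
  have qn: "real q ^ n > 0" using q by simp
  have "N (x + a) <= N (x + b)" if b: "b \<in> OK" for b
  proof -
    obtain i j where ij: "N (x + a) * real q ^ n = real i" "N (x + b) * real q ^ n = real j" using k a(1) b by meson
    then have "N (x + a) * real q ^ n <= N (x + b) * real q ^ n" using a(2)[OF b] by simp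
    then show ?thesis using qn by simp
  qed
  then have "N (x + a) <= mm x" unfolding mm_def by (intro cINF_greatest) (use a(1) in auto)
  moreover obtain i where "N (x + a) * real q ^ n = real i" using k[OF a(1)] by blast
  then have "N (x + a) = real i / real q ^ n" using qn by (simp add: field_simps)
  then have "N (x + a) \<in> \<rat>" by (simp add: Rats_divide)
  ultimately show ?thesis using mm_le[OF a(1)] a(1) by (intro bexI[of _ a]) (auto intro: antisym)
qed

lemma limit_SS:
  assumes "conv f l" "!!k. f k \<in> SS (MM - inverse (real (Suc (r k))))" "strict_mono (r :: nat => nat)"
  shows "l \<in> SS MM"
proof -
  have "l \<in> EE" by (rule closedZD[OF closedZ_EE _ assms(1)]) (use assms(2) in \<open>simp add: SS_def\<close>)
  moreover have "MM <= N (l + a)" if a: "a \<in> OK" for a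
  proof (rule LIMSEQ_le)
    have "(%k. inverse (real (Suc (r k)))) \<longlonglongrightarrow> 0"
      using LIMSEQ_subseq_LIMSEQ[OF LIMSEQ_inverse_real_of_nat assms(3)] by (simp add: o_def)
    from tendsto_diff[OF tendsto_const this]
    show "(%k. MM - inverse (real (Suc (r k)))) \<longlonglongrightarrow> MM" by simp
    show "(%k. N (f k + a)) \<longlonglongrightarrow> N (l + a)" by (rule conv_N[OF conv_add[OF assms(1) conv_const]])
    show "\<exists>N'. \<forall>k\<ge>N'. MM - inverse (real (Suc (r k))) <= N (f k + a)" using assms(2) a by (auto simp: SS_def)
  qed
  ultimately show ?thesis by (simp add: SS_def)
qed

text \<open>The minimum is upper semicontinuous and invariant under integers, so its supremum is
  attained on the compact torus.\<close>

lemma SS_MM_nonempty: "SS MM ~= {}"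
proof -
  have "\<exists>x\<in>EE. MM - inverse (real (Suc k)) < mm x" for k
    using less_cSUP_iff[OF _ bdd_mm, of "MM - inverse (real (Suc k))"] EE_0 by (auto simp: MM_def[symmetric])
  then obtain x where x: "!!k. x k \<in> EE" "!!k. MM - inverse (real (Suc k)) < mm (x k)" by metis
  obtain a l r where a: "!!k. a k \<in> OK" "strict_mono (r :: nat => nat)" "conv (%k. x (r k) + a (r k)) l"
    using compactness[of x] x(1) by blast
  have xS: "x k \<in> SS (MM - inverse (real (Suc k)))" for k using x[of k] by (simp add: SS_iff)
  have "l \<in> SS MM" by (rule limit_SS[OF a(3) _ a(2)]) (rule invD[OF inv_SS xS a(1)])
  then show ?thesis by blast
qed

lemma conv_close: assumes "conv f l" "e > 0" shows "\<exists>K. \<forall>k\<ge>K. \<forall>z\<in>Z. cmod (f k z - l z) < e"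
proof -
  have "\<forall>\<^sub>F k in sequentially. \<forall>z\<in>Z. cmod (f k z - l z) < e"
    using assms finite_Z by (auto simp: eventually_ball_finite_distrib conv_def dist_norm[symmetric] intro: tendstoD)
  then show ?thesis by (simp add: eventually_sequentially)
qed

text \<open>No translate of 1 / 2 by an integer vanishes at a conjugate. Positivity keeps all
  coordinates of translates of norm \<open>MM\<close> nonzero, as
  \<open>perpendicular_if_minimal\<close> needs.\<close>

lemma MM_pos: "MM > 0"
proof -
  define x :: "complex => complex" where "x = (%z. of_rat (1 / 2))"
  have x: "x \<in> KF" unfolding x_def by (rule KF_of_rat)
  obtain a where a: "a \<in> OK" "N (x + a) = mm x" using mm_torsion[OF x] by blast
  have "N (x + a) ~= 0"
  proof
    assume "N (x + a) = 0"
    then obtain z where z: "z \<in> Z" "of_rat (1 / 2) + a z = 0" by (auto simp: N_zero_iff x_def)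
    then have "of_rat (- 1 / 2) = a z" by (simp add: add_eq_0_iff2 of_rat_minus)
    then have "algebraic_int (of_rat (- 1 / 2) :: complex)" using a(1) z(1) by (simp add: OK_def)
    then have "of_rat (- 1 / 2) \<in> (\<int> :: complex set)" by (rule rational_algebraic_int_is_int) simp
    then obtain i :: int where "(of_rat (- 1 / 2) :: complex) = of_int i" by (elim Ints_cases)
    then have "(of_rat (- 1 / 2) :: complex) = of_rat (of_int i)" by simp
    then have "- 1 / 2 = (of_int i :: rat)" by (simp only: of_rat_eq_iff)
    then have "of_int (2 * i) = (of_int (- 1) :: rat)" by simp
    then have "2 * i = - 1" by (simp only: of_int_eq_iff)
    then show False by presburger
  qed
  then show ?thesis using a(2) N_nonneg[of "x + a"] mm_le_MM[of x] x KF_EE by fastforce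
qed

definition acc :: "real => (complex => complex) set" where
  "acc t = {x \<in> SS t. \<forall>e>0. \<exists>y\<in>SS t. (\<exists>z\<in>Z. y z ~= x z) & (\<forall>z\<in>Z. cmod (y z - x z) < e)}"

lemma accD: "x \<in> acc t ==> e > 0 ==> \<exists>y\<in>SS t. (\<exists>z\<in>Z. y z ~= x z) & (\<forall>z\<in>Z. cmod (y z - x z) < e)"
  by (simp add: acc_def)

lemma inv_acc: "inv (acc t)" unfolding inv_def closedZ_def
proof (intro conjI allI impI ballI)
  show "acc t \<subseteq> EE" by (auto simp: SS_def acc_def)
  fix f l assume f: "\<forall>k. f k \<in> acc t" "conv f l"
  have "l \<in> SS t" by (rule inv_closed[OF inv_SS _ f(2)]) (use f in \<open>simp add: acc_def\<close>)
  moreover have "\<exists>y\<in>SS t. (\<exists>z\<in>Z. y z ~= l z) & (\<forall>z\<in>Z. cmod (y z - l z) < e)" if e: "e > 0" for e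
  proof -
    obtain k where k: "\<forall>z\<in>Z. cmod (f k z - l z) < e" using conv_close[OF f(2) e] by blast
    show ?thesis
    proof (cases "\<exists>z\<in>Z. f k z ~= l z")
      case True then show ?thesis using k f(1) by (intro bexI[of _ "f k"]) (auto simp: acc_def)
    next
      case False
      then show ?thesis using accD[OF spec[OF f(1), of k] e] by simp
    qed
  qed
  ultimately show "l \<in> acc t" by (simp add: acc_def)
next
  fix x a assume x: "x \<in> acc t" and a: "a \<in> OK"
  have "\<exists>y\<in>SS t. (\<exists>z\<in>Z. y z ~= (x + a) z) & (\<forall>z\<in>Z. cmod (y z - (x + a) z) < e)" if e: "e > 0" for e
  proof -
    obtain y where "y \<in> SS t" "\<exists>z\<in>Z. y z ~= x z" "\<forall>z\<in>Z. cmod (y z - x z) < e" using accD[OF x e] by blast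
    then show ?thesis using invD[OF inv_SS _ a] by (intro bexI[of _ "y + a"]) auto
  qed
  then show "x + a \<in> acc t" using x invD[OF inv_SS _ a] by (simp add: acc_def)
qed

lemma uinv_acc: "uinv UK (acc t)" unfolding uinv_def
proof (intro ballI)
  fix u x assume u: "u \<in> UK" and x: "x \<in> acc t"
  define b where "b = 1 + (\<Sum>z\<in>Z. cmod (u z))"
  have b: "cmod (u z) < b" if "z \<in> Z" for z using member_le_sum[of z Z "%z. cmod (u z)"] that finite_Z by (simp add: b_def)
  have b0: "b > 0" using sum_nonneg[of Z "%z. cmod (u z)"] by (simp add: b_def)
  have "\<exists>y\<in>SS t. (\<exists>z\<in>Z. y z ~= (u * x) z) & (\<forall>z\<in>Z. cmod (y z - (u * x) z) < e)" if e: "e > 0" for e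
  proof -
    obtain y where y: "y \<in> SS t" "\<exists>z\<in>Z. y z ~= x z" "\<forall>z\<in>Z. cmod (y z - x z) < e / b"
      using accD[OF x, of "e / b"] e b0 by auto
    have "cmod ((u * y) z - (u * x) z) < e" if z: "z \<in> Z" for z
    proof -
      have "cmod ((u * y) z - (u * x) z) = cmod (u z) * cmod (y z - x z)" by (simp add: norm_mult[symmetric] right_diff_distrib)
      also have "... <= b * cmod (y z - x z)" using b[OF z] by (intro mult_right_mono) auto
      also have "... < b * (e / b)" using y(3) z b0 by (intro mult_strict_left_mono) auto
      finally show ?thesis using b0 by simp
    qed
    moreover have "\<exists>z\<in>Z. (u * y) z ~= (u * x) z" using y(2) UK_nonzero[OF u] by auto
    moreover have "u * y \<in> SS t" using uinv_SS u y(1) by (auto simp: uinv_def)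
    ultimately show ?thesis by blast
  qed
  then show "u * x \<in> acc t" using x uinv_SS u by (auto simp: acc_def uinv_def)
qed

text \<open>Infinitely many incongruent points accumulate on the torus, and they stay distinct after
  translation by integers.\<close>

lemma acc_if_infinite:
  assumes no: "\<not> (\<exists>F. finite F & F \<subseteq> SS t & (\<forall>x\<in>SS t. \<exists>f\<in>F. x - f \<in> OK))"
  shows "acc t ~= {}"
proof -
  have "\<exists>x\<in>SS t. \<forall>f\<in>F. x - f \<notin> OK" if "finite F" "F \<subseteq> SS t" for F using no that by meson
  then have ex: "\<exists>x. x \<in> SS t & (\<forall>f\<in>F. x - f \<notin> OK)" if "finite F" "F \<subseteq> SS t" for F using that by blast
  have "\<exists>x. \<forall>k::nat. x k \<in> SS t & (\<forall>f\<in>x ` {..<k}. x k - f \<notin> OK)"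
  proof (rule dependent_wellorder_choice)
    fix x and k :: nat assume A: "!!i. i < k ==> x i \<in> SS t & (\<forall>f\<in>x ` {..<i}. x i - f \<notin> OK)"
    show "\<exists>y. y \<in> SS t & (\<forall>f\<in>x ` {..<k}. y - f \<notin> OK)" by (rule ex) (use A in auto)
  qed auto
  then obtain x where x: "!!k::nat. x k \<in> SS t" "!!i k. i < k ==> x k - x i \<notin> OK" by blast
  obtain a l r where a: "!!k. a k \<in> OK" "strict_mono (r :: nat => nat)" "conv (%k. x (r k) + a (r k)) l"
    using compactness[of x] x(1) inv_EE[OF inv_SS] by blast
  define y where "y k = x (r k) + a (r k)" for k
  have yS: "y k \<in> SS t" for k unfolding y_def by (rule invD[OF inv_SS x(1) a(1)])
  have ne: "\<exists>z\<in>Z. y i z ~= y j z" if ij: "i < j" for i j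
  proof (rule ccontr)
    assume "\<not> ?thesis"
    then have eq: "y i z = y j z" if "z \<in> Z" for z using that by blast
    have "a (r i) - a (r j) \<in> OK" using a(1) OK_diff by blast
    then have "x (r j) - x (r i) \<in> OK" by (rule OK_cong) (use eq in \<open>simp add: y_def algebra_simps\<close>)
    then show False using x(2)[of "r i" "r j"] a(2) ij by (simp add: strict_mono_def)
  qed
  have yl: "conv y l" using a(3) by (simp add: y_def[abs_def])
  have "\<exists>y\<in>SS t. (\<exists>z\<in>Z. y z ~= l z) & (\<forall>z\<in>Z. cmod (y z - l z) < e)" if e: "e > 0" for e
  proof -
    obtain K where K: "\<forall>k\<ge>K. \<forall>z\<in>Z. cmod (y k z - l z) < e" using conv_close[OF yl e] by blast
    obtain z where z: "z \<in> Z" "y K z ~= y (Suc K) z" using ne[of K "Suc K"] by blast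
    then have "y K z ~= l z | y (Suc K) z ~= l z" by auto
    then show ?thesis
    proof
      assume "y K z ~= l z"
      then show ?thesis using K z(1) yS[of K] by (intro bexI[of _ "y K"]) auto
    next
      assume "y (Suc K) z ~= l z"
      then show ?thesis using K z(1) yS[of "Suc K"] by (intro bexI[of _ "y (Suc K)"]) auto
    qed
  qed
  moreover have "l \<in> SS t" by (rule inv_closed[OF inv_SS yS yl])
  ultimately show ?thesis by (auto simp: acc_def)
qed

text \<open>Along the line only the factors at \<open>w\<close> and \<open>cnj w\<close> change, and
  the square of the absolute value of y w + s tau is quadratic in s with leading coefficient 1.
  Minimality puts its vertex at s = 0.\<close>

lemma perpendicular_if_minimal:
  assumes y: "y \<in> EE" "N y > 0" and w: "w \<in> Z" and t: "cmod tau = 1" "axis w tau \<in> EE"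
    and le: "!!s::real. N y <= N (y + axis w (of_real s * tau))"
  shows "Re (y w * cnj tau) = 0"
proof (rule ccontr)
  assume ne: "Re (y w * cnj tau) ~= 0"
  define s where "s = - Re (y w * cnj tau)"
  define y' where "y' = y + axis w (of_real s * tau)"
  have rs: "Re (y w * cnj tau) = - s" by (simp only: s_def minus_minus)
  have ycw: "y (cnj w) = cnj (y w)" using y(1) w by (simp add: EE_def)
  have t1: "(Re tau)\<^sup>2 + (Im tau)\<^sup>2 = 1" using t(1) by (simp add: cmod_def)
  have "(cmod (y w + of_real s * tau))\<^sup>2 = (cmod (y w))\<^sup>2 + 2 * s * Re (y w * cnj tau) + s\<^sup>2 * ((Re tau)\<^sup>2 + (Im tau)\<^sup>2)"
    by (simp only: cmod_power2) (simp add: power2_eq_square algebra_simps)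
  also have "... = (cmod (y w))\<^sup>2 - s\<^sup>2" unfolding t1 rs by (simp add: power2_eq_square)
  also have "... < (cmod (y w))\<^sup>2" using ne by (simp add: s_def)
  finally have lt: "cmod (y w + of_real s * tau) < cmod (y w)" by (rule power2_less_imp_less) simp
  have y'w: "y' w = y w + of_real s * tau" by (simp add: y'_def axis_def)
  have le': "cmod (y' z) <= cmod (y z)" if "z \<in> Z" for z
  proof -
    have "cmod (cnj (y w) + of_real s * cnj tau) = cmod (y w + of_real s * tau)"
      by (metis complex_cnj_add complex_cnj_complex_of_real complex_cnj_mult complex_mod_cnj)
    then show ?thesis using lt ycw by (auto simp: y'_def axis_def)
  qed
  have pos: "cmod (y z) > 0" if "z \<in> Z" for z using y(2) that N_zero_iff[of y] by auto
  have "N y' = cmod (y' w) * (\<Prod>z\<in>Z - {w}. cmod (y' z))" unfolding N_def using finite_Z w by (simp add: prod.remove)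
  also have "... <= cmod (y' w) * (\<Prod>z\<in>Z - {w}. cmod (y z))" by (intro mult_left_mono prod_mono) (use le' in auto)
  also have "... < cmod (y w) * (\<Prod>z\<in>Z - {w}. cmod (y z))"
    using lt y'w pos by (intro mult_strict_right_mono prod_pos) auto
  also have "... = N y" unfolding N_def using finite_Z w by (simp add: prod.remove)
  finally show False using le[of s] by (simp add: y'_def)
qed

end

section \<open>Lines in the superlevel sets of the minimum\<close>

context numfield_units begin

lemma SS_UK: "u \<in> UK ==> x \<in> SS t ==> u * x \<in> SS t" using uinv_SS by (simp add: uinv_def)

definition line :: "real => complex => bool" where
  "line t w \<longleftrightarrow> (\<exists>tau y. cmod tau = 1 & axis w tau \<in> EE & (\<forall>s::real. y + axis w (of_real s * tau) \<in> SS t))"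

text \<open>A torsion point among the nonisolated points is moved to the origin; there its
  stabilizer still acts, and small nonzero vectors exist.\<close>

lemma line_if_acc: assumes "acc t ~= {}" shows "\<exists>w\<in>Z. line t w"
proof -
  obtain p where p: "p \<in> acc t" "p \<in> KF" using torsion_point_exists[OF big_UK inv_acc uinv_acc assms] by blast
  have pE: "p \<in> EE" using p(2) KF_EE by blast
  define D where "D = {d. p + d \<in> SS t}"
  have V: "big (stab p)" by (rule big_stab[OF p(2)])
  have D: "inv D" unfolding inv_def closedZ_def
  proof (intro conjI allI impI ballI)
    show "D \<subseteq> EE"
    proof
      fix d assume "d \<in> D"
      then have "p + d - p \<in> EE" using pE by (intro EE_diff) (auto simp: D_def SS_def)
      then show "d \<in> EE" by simp
    qed
    fix f l assume f: "\<forall>k. f k \<in> D" "conv f l"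
    have "p + l \<in> SS t"
      by (rule inv_closed[OF inv_SS _ conv_add[OF conv_const f(2)]]) (use f in \<open>simp add: D_def\<close>)
    then show "l \<in> D" by (simp add: D_def)
  next
    fix d a assume "d \<in> D" "a \<in> OK"
    then show "d + a \<in> D" using invD[OF inv_SS, of "p + d" t a] by (simp add: D_def add.assoc)
  qed
  have Du: "uinv (stab p) D" unfolding uinv_def
  proof (intro ballI)
    fix u d assume u: "u \<in> stab p" and d: "d \<in> D"
    have "u * (p + d) \<in> SS t" using uinv_SS u d by (auto simp: uinv_def stab_def D_def)
    moreover have "- (u * p - p) \<in> OK" using u by (intro OK_uminus) (simp add: stab_def)
    ultimately have "u * (p + d) + - (u * p - p) \<in> SS t" by (rule invD[OF inv_SS])
    then show "u * d \<in> D" by (simp add: D_def algebra_simps)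
  qed
  have "\<exists>v. v \<in> D & (\<exists>z\<in>Z. v z ~= 0) & (\<forall>z\<in>Z. cmod (v z) < inverse (real (Suc k)))" for k
  proof -
    obtain y where "y \<in> SS t" "\<exists>z\<in>Z. y z ~= p z" "\<forall>z\<in>Z. cmod (y z - p z) < inverse (real (Suc k))"
      using accD[OF p(1), of "inverse (real (Suc k))"] by auto
    then show ?thesis by (intro exI[of _ "y - p"]) (auto simp: D_def)
  qed
  then obtain v where v: "!!k. v k \<in> D" "!!k. \<exists>z\<in>Z. v k z ~= 0"
    "!!k z. z \<in> Z ==> cmod (v k z) < inverse (real (Suc k))" by metis
  have "conv v 0" unfolding conv_def
  proof
    fix z assume "z \<in> Z"
    then have "!!k. cmod (v k z) <= inverse (real (Suc k))" using v(3) less_imp_le by blast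
    then show "(%k. v k z) \<longlonglongrightarrow> 0 z"
      using Lim_null_comparison[OF _ LIMSEQ_inverse_real_of_nat, of "%k. v k z"] by simp
  qed
  from line_in_invariant_set[OF D Du V v(1) this v(2), of UNIV]
  obtain w tau y where w: "w \<in> Z" "cmod tau = 1" "axis w tau \<in> EE" "\<forall>s::real. y + axis w (of_real s * tau) \<in> D"
    by (auto simp: closedZ_def)
  then have "line t w" unfolding line_def D_def by (intro exI[of _ tau] exI[of _ "p + y"]) (simp add: add.assoc)
  then show ?thesis using w(1) by blast
qed

lemma line_mono: "line t w ==> t' <= t ==> line t' w" unfolding line_def SS_iff using order_trans by blast

lemma line_limit:
  assumes ty: "!!k s. y k + axis w (of_real s * tau k) \<in> SS (MM - inverse (real (Suc (q k))))"
    and t: "!!k. cmod (tau k) = 1" "!!k. axis w (tau k) \<in> EE" and l: "conv y l" and q: "strict_mono (q :: nat => nat)"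
  shows "\<exists>tau. cmod tau = 1 & axis w tau \<in> EE & (\<forall>s::real. l + axis w (of_real s * tau) \<in> SS MM)"
proof -
  obtain tau0 r where r: "strict_mono (r :: nat => nat)" "(%k. tau (r k)) \<longlonglongrightarrow> tau0"
    using bolzano_weierstrass_pointwise[of "{()}" "%k _. tau k" 1] t(1) by auto
  have "l + axis w (of_real s * tau0) \<in> SS MM" for s
  proof (rule limit_SS[OF _ ty])
    have "(%k. of_real s * tau (r k)) \<longlonglongrightarrow> of_real s * tau0" using r(2) by (intro tendsto_mult tendsto_const)
    then show "conv (%k. y (r k) + axis w (of_real s * tau (r k))) (l + axis w (of_real s * tau0))"
      using conv_subseq[OF l r(1)] by (intro conv_add conv_axis)
    show "strict_mono (%k. q (r k))" using strict_mono_o[OF q r(1)] by (simp add: o_def)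
  qed
  moreover have "cmod tau0 = 1" using tendsto_norm[OF r(2)] by (simp add: t(1) LIMSEQ_const_iff)
  moreover have "axis w tau0 \<in> EE" by (rule closedZD[OF closedZ_EE _ conv_axis[OF r(2)]]) (rule t(2))
  ultimately show ?thesis by blast
qed

text \<open>There are finitely many roots, so one \<open>w\<close> serves all levels below
  \<open>MM\<close>; limits of lines at this \<open>w\<close> have level \<open>MM\<close>.\<close>

lemma line_MM: assumes "!!t. t < MM ==> acc t ~= {}" shows "\<exists>w\<in>Z. line MM w"
proof -
  have "\<exists>w\<in>Z. \<forall>t<MM. line t w"
  proof (rule ccontr)
    assume "\<not> ?thesis"
    then obtain T where T: "!!w. w \<in> Z ==> T w < MM & \<not> line (T w) w" by metis
    define t where "t = Max (T ` Z)"
    have "t \<in> T ` Z" unfolding t_def using finite_Z Z_nonempty by (intro Max_in) auto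
    then have "t < MM" using T by auto
    then obtain w where w: "w \<in> Z" "line t w" using line_if_acc assms by blast
    have "T w <= t" unfolding t_def using finite_Z w(1) by auto
    then show False using line_mono[OF w(2)] T[OF w(1)] by blast
  qed
  then obtain w where w: "w \<in> Z" "!!t. t < MM ==> line t w" by blast
  have "line (MM - inverse (real (Suc k))) w" for k using w(2) by simp
  then obtain tau y where ty: "!!k. cmod (tau k) = 1" "!!k. axis w (tau k) \<in> EE"
    "!!k s. y k + axis w (of_real s * tau k) \<in> SS (MM - inverse (real (Suc k)))" unfolding line_def by metis
  have ax0: "axis w 0 = 0" by (rule ext) (simp add: axis_def)
  have yE: "y k \<in> EE" for k using ty(3)[of k 0] by (simp add: SS_def ax0)
  obtain a l r where a: "!!k. a k \<in> OK" "strict_mono (r :: nat => nat)" "conv (%k. y (r k) + a (r k)) l"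
    using compactness[of y] yE by blast
  have "y (r k) + a (r k) + axis w (of_real s * tau (r k)) \<in> SS (MM - inverse (real (Suc (r k))))" for k s
    using invD[OF inv_SS ty(3) a(1), of "r k" s "r k"] by (simp add: add_ac)
  from line_limit[OF this ty(1,2) a(3,2)] have "line MM w" unfolding line_def by blast
  then show ?thesis using w(1) by blast
qed

text \<open>Along a line through \<open>p\<close> in direction \<open>tau\<close> the minimal translates of \<open>p\<close> are perpendicular to
  \<open>tau\<close>. Hence the stabilizer of \<open>p\<close> is real at \<open>w\<close>, the field has complex multiplication, and the line
  contains torsion points of every order, which contradicts perpendicularity again.\<close>

lemma no_line: assumes w: "w \<in> Z" shows "\<not> line MM w"
proof
  assume line: "line MM w"
  \<comment> \<open>The base points of lines at level \<open>MM\<close> form a closed invariant set,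
    so one of them is a torsion point.\<close>
  define Q where "Q = {x \<in> EE. line MM w & (\<exists>tau. cmod tau = 1 & axis w tau \<in> EE & (\<forall>s::real. x + axis w (of_real s * tau) \<in> SS MM))}"
  have ax0: "axis w 0 = 0" by (rule ext) (simp add: axis_def)
  have Q: "inv Q" unfolding inv_def closedZ_def
  proof (intro conjI allI impI ballI)
    show "Q \<subseteq> EE" by (auto simp: Q_def)
    fix f l assume f: "\<forall>k. f k \<in> Q" "conv f l"
    then obtain tau where t: "!!k. cmod (tau k) = 1" "!!k. axis w (tau k) \<in> EE"
      "!!k s. f k + axis w (of_real s * tau k) \<in> SS MM" unfolding Q_def by simp metis
    have "f k + axis w (of_real s * tau k) \<in> SS (MM - inverse (real (Suc k)))" for k s
      using t(3)[of k s] inverse_nonnegative_iff_nonnegative[of "real (Suc k)"] unfolding SS_iff by linarith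
    from line_limit[OF this t(1,2) f(2)] have "\<exists>tau. cmod tau = 1 & axis w tau \<in> EE & (\<forall>s::real. l + axis w (of_real s * tau) \<in> SS MM)"
      by (simp add: strict_mono_def)
    moreover have "l \<in> EE" by (rule closedZD[OF closedZ_EE _ f(2)]) (use f in \<open>simp add: Q_def\<close>)
    ultimately show "l \<in> Q" using line unfolding Q_def by blast
  next
    fix x a assume x: "x \<in> Q" and a: "a \<in> OK"
    then obtain tau where t: "cmod tau = 1" "axis w tau \<in> EE" "\<forall>s::real. x + axis w (of_real s * tau) \<in> SS MM"
      by (auto simp: Q_def)
    have "x + a + axis w (of_real s * tau) \<in> SS MM" for s :: real
      using invD[OF inv_SS spec[OF t(3), of s] a] by (simp add: add_ac)
    moreover have "x + a \<in> EE" using x a OK_EE EE_add by (auto simp: Q_def)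
    ultimately show "x + a \<in> Q" using t(1,2) line unfolding Q_def by blast
  qed
  have Qu: "uinv UK Q" unfolding uinv_def
  proof (intro ballI)
    fix u x assume u: "u \<in> UK" and x: "x \<in> Q"
    obtain tau where t: "cmod tau = 1" "axis w tau \<in> EE" "!!s::real. x + axis w (of_real s * tau) \<in> SS MM"
      using x by (auto simp: Q_def)
    have uE: "u \<in> EE" using u UK_OK OK_EE by blast
    have uw: "cmod (u w) > 0" using UK_nonzero[OF u w] by simp
    have sg: "of_real (s * cmod (u w)) * (sgn (u w) * tau) = u w * (of_real s * tau)" for s :: real using uw by (simp add: sgn_eq)
    have "u * x + axis w (of_real s * (sgn (u w) * tau)) \<in> SS MM" for s :: real
    proof -
      have "u * (x + axis w (of_real (s / cmod (u w)) * tau)) \<in> SS MM" by (intro SS_UK u t(3))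
      moreover have "u * (x + axis w (of_real (s / cmod (u w)) * tau)) = u * x + axis w (of_real s * (sgn (u w) * tau))"
        unfolding distrib_left mult_axis[OF uE w] sg[symmetric] using uw by simp
      ultimately show ?thesis by simp
    qed
    moreover have "axis w (sgn (u w) * tau) \<in> EE"
    proof -
      have "u * axis w tau \<in> EE" using uE t(2) EE_mult by blast
      then have "(%z. of_real (1 / cmod (u w)) * (u * axis w tau) z) \<in> EE" by (rule EE_scale)
      then show ?thesis using sg[of "1 / cmod (u w)"] uw by (simp only: mult_axis[OF uE w] axis_scale[symmetric]) simp
    qed
    moreover have "cmod (sgn (u w) * tau) = 1" using t(1) uw by (simp add: norm_mult norm_sgn)
    moreover have "u * x \<in> EE" using uE x EE_mult by (simp add: Q_def)
    ultimately show "u * x \<in> Q" using line unfolding Q_def by blast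
  qed
  have "Q ~= {}"
  proof -
    obtain tau y where ty: "cmod tau = 1" "axis w tau \<in> EE" "!!s::real. y + axis w (of_real s * tau) \<in> SS MM"
      using line by (auto simp: line_def)
    then have "y \<in> EE" using ty(3)[of 0] by (simp add: SS_def ax0)
    then have "y \<in> Q" using ty line unfolding Q_def by blast
    then show ?thesis by blast
  qed
  then obtain p where p: "p \<in> Q" "p \<in> KF" using torsion_point_exists[OF big_UK Q Qu] by blast
  obtain tau where t: "cmod tau = 1" "axis w tau \<in> EE" "!!s::real. p + axis w (of_real s * tau) \<in> SS MM"
    using p(1) by (auto simp: Q_def)
  have tt: "tau * cnj tau = 1" using t(1) by (simp add: complex_norm_square[symmetric])
  have perp: "Re ((x + a) w * cnj tau) = 0"
    if x: "x \<in> KF" and s: "!!s::real. x + axis w (of_real s * tau) \<in> SS MM" and a: "a \<in> OK" "N (x + a) = MM" for x a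
  proof (rule perpendicular_if_minimal[OF _ _ w t(1,2)])
    show "x + a \<in> EE" using x a KF_EE OK_EE EE_add by blast
    show "N (x + a) > 0" using a MM_pos by simp
    show "N (x + a) <= N (x + a + axis w (of_real s * tau))" for s :: real using s[of s] a by (simp add: SS_def add_ac)
  qed
  have ex_min: "\<exists>a\<in>OK. N (x + a) = MM" if x: "x \<in> KF" "x \<in> SS MM" for x
  proof -
    have "mm x = MM" using x mm_le_MM[of x] by (auto simp: SS_iff)
    then show ?thesis using mm_torsion[OF x(1)] by auto
  qed
  have pS: "p \<in> SS MM" using t(3)[of 0] by (simp add: ax0)
  obtain a where a: "a \<in> OK" "N (p + a) = MM" using ex_min[OF p(2) pS] by blast
  define y where "y = p + a"
  have yK: "y \<in> KF" unfolding y_def using p(2) a(1) OK_KF KF_add by blast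
  have yw: "y w ~= 0" using a(2) MM_pos w N_zero_iff[of "p + a"] by (auto simp: y_def)
  have Re0: "Re (y w * cnj tau) = 0" unfolding y_def by (rule perp[OF p(2) t(3) a])
  define c where "c = Im (y w * cnj tau)"
  have yc: "y w = \<i> * of_real c * tau"
  proof -
    have "y w * cnj tau = \<i> * of_real c" using Re0 by (simp add: complex_eq_iff c_def)
    then have "y w * (tau * cnj tau) = \<i> * of_real c * tau" by (simp only: mult_ac)
    then show ?thesis by (simp add: tt)
  qed
  have c0: "c ~= 0" using yc yw by auto
  \<comment> \<open>At a real place perpendicular means zero, which the positive norm
    excludes.\<close>
  have wr: "w \<notin> \<real>"
  proof
    assume "w \<in> \<real>"
    then have cw: "cnj w = w" by (simp add: Reals_cnj_iff)
    have "tau = cnj tau" using t(2) w cw by (auto simp: EE_def axis_def)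
    moreover have "y \<in> EE" using yK KF_EE by blast
    then have "y w = cnj (y w)" using w cw by (auto simp: EE_def dest!: bspec[of _ _ w])
    ultimately have "Im (y w * cnj tau) = 0" by (simp add: complex_eq_iff)
    then show False using c0 by (simp add: c_def)
  qed
  have V: "big (stab p)" by (rule big_stab[OF p(2)])
  \<comment> \<open>For \<open>u\<close> in the stabilizer \<open>u * y\<close> is another translate
    of \<open>p\<close> of norm \<open>MM\<close> and hence also perpendicular to
    \<open>tau\<close>, while \<open>y w\<close> is a real multiple of i tau.\<close>
  have re: "u w \<in> \<real>" if u: "u \<in> stab p" for u
  proof -
    have uU: "u \<in> UK" using u by (simp add: stab_def)
    have b: "(u * p - p) + u * a \<in> OK" using u uU UK_OK a(1) OK_add OK_mult by (auto simp: stab_def)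
    have e: "p + ((u * p - p) + u * a) = u * y" by (simp add: y_def algebra_simps)
    have "N (u * y) = MM" using a(2) by (simp add: N_mult N_UK[OF uU] y_def)
    then have "Re ((u * y) w * cnj tau) = 0" using perp[OF p(2) t(3) b] e by simp
    then have "Re (u w * (\<i> * of_real c * (tau * cnj tau))) = 0" by (simp add: yc mult.assoc)
    then show ?thesis using c0 by (simp add: tt complex_is_Real_iff)
  qed
  obtain kappa where kappa: "\<forall>z\<in>Z. ev kappa z = cnj z" using conjugation_in_KF[OF w wr V] re by blast
  \<comment> \<open>A purely imaginary field element: since \<open>y w\<close> is perpendicular to
    \<open>tau\<close>, the product \<open>e * y\<close> points along \<open>tau\<close> at
    \<open>w\<close>.\<close>
  define e where "e = (%z. z - cnj z)"
  have eK: "e \<in> KF" by (rule KFI[of _ "[:0, 1:] - kappa"]) (simp add: e_def kappa)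
  define b where "b = Im w * 2"
  have ew: "e w = \<i> * of_real b" by (simp add: e_def b_def complex_eq_iff)
  have b0: "b ~= 0" using wr by (simp add: b_def complex_is_Real_iff)
  obtain m :: nat where m: "m > 0" "(%z. of_nat m * y z) \<in> OK" using OK_multiple[OF yK] by blast
  \<comment> \<open>A fixed field element, nonzero at \<open>w\<close>; \<open>int\<close> shows
    that h / q is integral for every q > 0, which its norm forbids.\<close>
  define h where "h = (%z. of_rat (of_nat (2 * m))) * (e * (y * cn y))"
  have hK: "h \<in> KF" unfolding h_def cn_def by (intro KF_mult KF_of_rat eK yK cnj_KF[OF kappa])
  have hw: "h w ~= 0" using m(1) b0 yw by (simp add: h_def ew)
  have int: "(%z. of_rat (1 / of_nat q)) * h \<in> OK" if q: "q > 0" for q :: nat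
  proof -
    \<comment> \<open>A point e y / q of the field whose coordinate at \<open>w\<close> is a real
      multiple of \<open>tau\<close>. So \<open>torsion_near_axis\<close> puts \<open>p + x\<close>,
      and the parallel line through it, into the same level set.\<close>
    define x where "x = (%z. of_rat (1 / of_nat q)) * (e * y)"
    have xK: "x \<in> KF" unfolding x_def by (intro KF_mult KF_of_rat eK yK)
    have xw: "x w = of_real (- b * c / q) * tau" by (simp add: x_def ew yc of_rat_divide field_simps)
    obtain u d where ud: "!!k. u k \<in> stab p & d k \<in> OK" "conv (%k. axis w (u k w * x w) + d k) x"
      using torsion_near_axis[OF V w xK] by blast
    have xs: "p + x + axis w (of_real s * tau) \<in> SS MM" for s :: real
    proof (rule inv_closed[OF inv_SS])
      show "conv (%k. p + (axis w (u k w * x w) + d k) + axis w (of_real s * tau)) (p + x + axis w (of_real s * tau))"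
        by (intro conv_add conv_const ud)
      fix k
      have "u k w = of_real (Re (u k w))" using re[of "u k"] ud(1) by (simp add: complex_is_Real_iff complex_eq_iff)
      then have "u k w * x w + of_real s * tau = of_real (Re (u k w) * (- b * c / q) + s) * tau"
        unfolding xw by (simp only: of_real_add of_real_mult distrib_right mult.assoc)
      then have "p + axis w (u k w * x w + of_real s * tau) \<in> SS MM" using t(3) by metis
      from invD[OF inv_SS this, of "d k"] ud(1)
      show "p + (axis w (u k w * x w) + d k) + axis w (of_real s * tau) \<in> SS MM" by (simp add: axis_add add_ac)
    qed
    have pxK: "p + x \<in> KF" using p(2) xK KF_add by blast
    have "p + x \<in> SS MM" using xs[of 0] by (simp add: ax0)
    then obtain a' where a': "a' \<in> OK" "N (p + x + a') = MM" using ex_min[OF pxK] by blast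
    have perp': "Re ((p + x + a') w * cnj tau) = 0" by (rule perp[OF pxK xs a'])
    define f where "f = a' - a"
    have fO: "f \<in> OK" unfolding f_def using a a' OK_diff by blast
    have "(p + x + a') w * cnj tau = y w * cnj tau + f w * cnj tau + of_real (- b * c / q) * (tau * cnj tau)"
      by (simp add: f_def y_def xw algebra_simps)
    then have fw: "Re (f w * cnj tau) = b * c / q" using perp' Re0 by (simp add: tt)
    \<comment> \<open>This alternating expression extracts the component of \<open>f w\<close> along
      \<open>tau\<close>, because \<open>y w\<close> is perpendicular to \<open>tau\<close>. That
      component is b c / q by perpendicularity of the new minimal translate.\<close>
    define k where "k = (%z. of_nat m * y z) * cn f - cn (%z. of_nat m * y z) * f"
    have "k \<in> OK" unfolding k_def cn_def by (intro OK_diff OK_mult m cnj_OK[OF kappa] fO)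
    have "y w * cnj (f w) - cnj (y w) * f w = \<i> * of_real c * of_real (2 * Re (f w * cnj tau))"
      by (simp add: yc complex_eq_iff algebra_simps)
    also have "... = of_rat (1 / of_nat q) * (2 * (e w * (y w * cnj (y w))))"
    proof -
      have "y w * cnj (y w) = of_real (c * c) * (tau * cnj tau)" by (simp add: yc algebra_simps)
      then show ?thesis unfolding fw ew using q by (simp add: tt of_rat_divide)
    qed
    finally have "of_nat m * (y w * cnj (f w) - cnj (y w) * f w) = of_rat (1 / of_nat q) * h w" by (simp add: h_def of_rat_mult)
    then have "k w = ((%z. of_rat (1 / of_nat q)) * h) w" by (simp add: k_def right_diff_distrib mult.assoc)
    moreover have "algebraic_int (k w)" using \<open>k \<in> OK\<close> w by (simp add: OK_def)
    ultimately show ?thesis by (intro OK_I[OF _ w] KF_mult KF_of_rat hK) simp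
  qed
  obtain q :: nat where q: "real q > 1 + N h" using reals_Archimedean2 by blast
  then have q1: "real q >= 1" using N_nonneg[of h] by linarith
  have "N ((%z. of_rat (1 / of_nat q)) * h) >= 1"
    by (rule N_ge_1[OF int w]) (use q1 hw in \<open>auto simp: of_rat_divide\<close>)
  moreover have "N (%z. of_rat (1 / of_nat q)) = 1 / real q ^ n"
    by (simp add: N_def card_Z of_rat_divide norm_divide power_one_over)
  moreover have "real q ^ n >= real q" using q1 n_pos by (simp add: self_le_power)
  ultimately show False using q q1 by (simp add: N_mult field_simps)
qed

text \<open>The points \<open>u ^ k * x\<close> stay at level \<open>t\<close>, where there are
  finitely many classes; so two of them are congruent and \<open>x\<close> is torsion.\<close>

theorem finite_top:
  "\<exists>t<MM. \<exists>F. finite F & F \<subseteq> KF & (\<forall>x\<in>SS t. \<exists>f\<in>F. x - f \<in> OK)"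
proof -
  obtain t where t: "t < MM" "acc t = {}" using line_MM no_line by blast
  obtain F where F: "finite F" "F \<subseteq> SS t" "!!x. x \<in> SS t ==> \<exists>f\<in>F. x - f \<in> OK"
    using acc_if_infinite[of t] t(2) by blast
  have tors: "x \<in> KF" if x: "x \<in> SS t" for x
  proof -
    obtain w where w: "w \<in> Z" using Z_nonempty by blast
    obtain u where u: "u \<in> UK" "1 < cmod (u w)" using pisot[OF big_UK w] by blast
    have "u ^ k * x \<in> SS t" for k using uinv_SS UK_power[OF u(1)] x by (auto simp: uinv_def)
    then have "\<forall>k. \<exists>f. f \<in> F & u ^ k * x - f \<in> OK" using F(3) by blast
    then obtain f where f: "!!k::nat. f k \<in> F" "!!k. u ^ k * x - f k \<in> OK" by metis
    have "\<not> inj f"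
    proof
      assume "inj f"
      moreover have "finite (range f)" by (rule finite_subset[OF _ F(1)]) (use f(1) in auto)
      ultimately show False using finite_imageD infinite_UNIV_nat by blast
    qed
    then obtain i j where ij: "i ~= j" "f i = f j" by (auto simp: inj_def)
    define i' where "i' = min i j" define j' where "j' = max i j"
    have ij': "i' < j'" "f i' = f j'" using ij by (auto simp: i'_def j'_def min_def max_def)
    have "(u ^ j' * x - f j') - (u ^ i' * x - f i') \<in> OK" using f(2) OK_diff by blast
    then have "u ^ j' * x - u ^ i' * x \<in> OK" using ij'(2) by simp
    then show ?thesis using torsion_if_fixed u w ij'(1) by blast
  qed
  then have "F \<subseteq> KF" using F(2) by blast
  then show ?thesis using t(1) F(1,3) by blast
qed

lemma SS_MM_torsion: "\<exists>x\<in>KF. mm x = MM"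
proof -
  obtain x where "x \<in> SS MM" "x \<in> KF" using torsion_point_exists[OF big_UK inv_SS uinv_SS SS_MM_nonempty] by blast
  then show ?thesis using mm_le_MM[of x] by (auto simp: SS_iff intro!: bexI[of _ x])
qed

lemma MM_SUP: "MM = (SUP x\<in>KF. mm x)"
proof (rule antisym)
  have bd: "bdd_above (mm ` KF)" by (rule bdd_above_mono[OF bdd_mm]) (use KF_EE in blast)
  obtain x where "x \<in> KF" "mm x = MM" using SS_MM_torsion by blast
  then show "MM <= (SUP x\<in>KF. mm x)" using cSUP_upper[OF _ bd] by metis
  show "(SUP x\<in>KF. mm x) <= MM" by (rule cSUP_least) (use KF_0 KF_EE mm_le_MM in auto)
qed

lemma MM_rat: "MM \<in> \<rat>"
proof -
  obtain x where x: "x \<in> KF" "mm x = MM" using SS_MM_torsion by blast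
  then show ?thesis using mm_torsion[OF x(1)] by auto
qed

lemma attained: assumes x: "x \<in> EE" shows "\<exists>a\<in>OK. N (x + a) <= MM"
proof (cases "mm x < MM")
  case True
  then have "Inf ((%a. N (x + a)) ` OK) < MM" by (simp add: mm_def)
  then have "\<exists>y\<in>(%a. N (x + a)) ` OK. y < MM" by (rule cInf_lessD[rotated]) (use OK_0 in auto)
  then show ?thesis by (auto intro: less_imp_le)
next
  case False
  then have "x \<in> SS MM" using x by (simp add: SS_iff)
  moreover obtain t F where F: "t < MM" "F \<subseteq> KF" "\<forall>x\<in>SS t. \<exists>f\<in>F. x - f \<in> OK" using finite_top by blast
  ultimately obtain f where f: "f \<in> F" "x - f \<in> OK" by (force simp: SS_iff)
  then have "f + (x - f) \<in> KF" using F(2) OK_KF KF_add by blast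
  then have "x \<in> KF" by simp
  then obtain a where "a \<in> OK" "N (x + a) = mm x" using mm_torsion[of x] by blast
  then show ?thesis using mm_le_MM[OF x] by (intro bexI[of _ a]) auto
qed

lemma isolated: "\<exists>t<MM. \<forall>x\<in>EE. mm x <= t | mm x = MM"
proof -
  obtain t F where F: "t < MM" "finite F" "\<forall>x\<in>SS t. \<exists>f\<in>F. x - f \<in> OK" using finite_top by blast
  have mF: "mm x \<in> mm ` F" if x: "x \<in> EE" "t <= mm x" for x
  proof -
    have "x \<in> SS t" using x by (simp add: SS_iff)
    then obtain f where f: "f \<in> F" "x - f \<in> OK" using F(3) by blast
    have fE: "f \<in> EE" using EE_diff[OF x(1), of "x - f"] f OK_EE by auto
    have "mm f <= mm x" using mm_add[OF f(2) fE] by simp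
    moreover have "mm x <= mm f" using mm_add[OF OK_uminus[OF f(2)] x(1)] by simp
    ultimately have "mm x = mm f" by simp
    then show ?thesis using f(1) by (rule image_eqI)
  qed
  \<comment> \<open>The values below \<open>MM\<close> that can occur above \<open>t\<close>,
    together with \<open>t\<close> itself; the largest of them is the new bound.\<close>
  define T where "T = insert t {s \<in> mm ` F. s < MM}"
  have T: "finite T" "T ~= {}" "!!s. s \<in> T ==> s < MM" using F by (auto simp: T_def)
  have "mm x <= Max T | mm x = MM" if x: "x \<in> EE" for x
  proof (cases "mm x < t | mm x = MM")
    case True then show ?thesis using Max_ge[OF T(1), of t] by (auto simp: T_def)
  next
    case False
    then have "mm x \<in> T" using mF[OF x] mm_le_MM[OF x] by (auto simp: T_def)
    then show ?thesis using Max_ge[OF T(1)] by blast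
  qed
  moreover have "Max T < MM" using T Max_in by blast
  ultimately show ?thesis by blast
qed

end

section \<open>Number fields with a primitive integral element\<close>

lemma (in numfield) mm_cong: assumes "!!z. z \<in> Z ==> x z = y z" shows "mm x = mm y"
proof -
  have "N (x + a) = N (y + a)" for a by (rule N_cong) (simp add: assms)
  then show ?thesis by (simp add: mm_def)
qed

locale field_model = numfield +
  fixes theta :: "'a::field_char_0" and K :: "'a set"
  assumes root: "ev G theta = 0" and K: "K = range (%h. ev h theta)"
begin

lemma K_ev: "ev h theta \<in> K" by (simp add: K)

lemma ev_transfer: "z \<in> Z ==> ev h theta = 0 \<longleftrightarrow> ev h z = 0"
  using irreducible_ev_zero_iff[OF irr root] ev_zero_iff by simp

text \<open>Gives the conjugates of an element of \<open>K\<close> as a function on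
  \<open>Z\<close>, where the choice of the polynomial does not matter.\<close>

definition io :: "'a => complex => complex" where "io x = ev (SOME h. ev h theta = x)"

lemma io_ev [simp]: assumes "z \<in> Z" shows "io (ev h theta) z = ev h z"
proof -
  have "ev (SOME h'. ev h' theta = ev h theta) theta = ev h theta" by (rule someI) (rule refl)
  then have "ev ((SOME h'. ev h' theta = ev h theta) - h) theta = 0" by simp
  then have "ev ((SOME h'. ev h' theta = ev h theta) - h) z = 0" using ev_transfer[OF assms] by blast
  then show ?thesis by (simp add: io_def)
qed

lemma io_KF: "io x \<in> KF" unfolding io_def by (rule KF_ev)

lemma KF_io: assumes "a \<in> KF" shows "\<exists>x\<in>K. \<forall>z\<in>Z. io x z = a z"
proof -
  obtain h where "!!z. z \<in> Z ==> a z = ev h z" using assms by (auto simp: KF_def)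
  then show ?thesis by (intro bexI[of _ "ev h theta"] K_ev) auto
qed

lemma K_closed: assumes "x \<in> K" "y \<in> K" shows "x + y \<in> K" "x * y \<in> K"
  using assms K_ev[of "_ + _"] K_ev[of "_ * _"] by (auto simp: K)

lemma io_add_mult: assumes "x \<in> K" "y \<in> K" "z \<in> Z"
  shows "io (x + y) z = io x z + io y z" "io (x * y) z = io x z * io y z"
proof -
  obtain h k where hk: "x = ev h theta" "y = ev k theta" using assms by (auto simp: K)
  show "io (x + y) z = io x z + io y z" using io_ev[OF assms(3), of "h + k"] assms(3) by (simp add: hk)
  show "io (x * y) z = io x z * io y z" using io_ev[OF assms(3), of "h * k"] assms(3) by (simp add: hk)
qed

lemma io_one: "z \<in> Z ==> io 1 z = 1" using io_ev[of z 1] by simp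

lemma io_inj: assumes "x \<in> K" "y \<in> K" "z \<in> Z" "io x z = io y z" shows "x = y"
proof -
  obtain h k where hk: "x = ev h theta" "y = ev k theta" using assms by (auto simp: K)
  then have "ev (h - k) z = 0" using assms by simp
  then have "ev (h - k) theta = 0" using ev_transfer[OF assms(3)] by blast
  then show ?thesis by (simp add: hk)
qed

lemma algebraic_int_transfer: assumes z: "z \<in> Z" shows "algebraic_int (ev h theta) \<longleftrightarrow> algebraic_int (ev h z)"
proof -
  have "poly (map_poly of_int p) (ev h theta) = 0 \<longleftrightarrow> poly (map_poly of_int p) (ev h z) = 0" for p :: "int poly"
    using ev_transfer[OF z, of "pcompose (map_poly of_int p) h"] by (simp add: of_int_poly_conv_ev)
  then show ?thesis unfolding algebraic_int_altdef_ipoly by blast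
qed

lemma ring_of_integers_iff: assumes "x \<in> K" shows "x \<in> ring_of_integers K \<longleftrightarrow> io x \<in> OK"
proof -
  obtain h where h: "x = ev h theta" using assms by (auto simp: K)
  obtain z where z: "z \<in> Z" using Z_nonempty by blast
  have "algebraic_int x \<longleftrightarrow> algebraic_int (io x z)" using algebraic_int_transfer[OF z] z by (simp add: h)
  also have "... \<longleftrightarrow> io x \<in> OK" using OK_I[OF io_KF z] z by (auto simp: OK_def)
  finally show ?thesis using assms by (simp add: ring_of_integers_def)
qed

lemma OK_io: assumes "b \<in> OK" shows "\<exists>a\<in>ring_of_integers K. \<forall>z\<in>Z. io a z = b z"
proof -
  obtain a where a: "a \<in> K" "\<forall>z\<in>Z. io a z = b z" using KF_io assms OK_KF by blast
  have "io a \<in> OK" by (rule OK_cong[OF assms]) (use a in simp)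
  then show ?thesis using a ring_of_integers_iff by blast
qed

lemma ring_of_integers_K: "a \<in> ring_of_integers K ==> a \<in> K" by (simp add: ring_of_integers_def)

lemma io_OK: "a \<in> ring_of_integers K ==> io a \<in> OK" using ring_of_integers_iff[of a] ring_of_integers_K[of a] by blast

lemma integer_units_io: assumes "u \<in> integer_units K" shows "io u \<in> UK"
proof -
  obtain v where uv: "u \<in> ring_of_integers K" "v \<in> ring_of_integers K" "u * v = 1"
    using assms by (auto simp: integer_units_def)
  have "io u z * io v z = 1" if "z \<in> Z" for z
    using io_add_mult(2)[of u v z] uv that io_one by (simp add: ring_of_integers_def)
  then show ?thesis using io_OK uv by (auto simp: UK_def)
qed

definition em :: "complex => 'a => complex" where "em z = restrict (%x. io x z) K"

lemma em_apply: "x \<in> K ==> em z x = io x z" by (simp add: em_def)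

lemma theta_K: "theta \<in> K" using K_ev[of "[:0, 1:]"] by simp

lemma em_theta: "z \<in> Z ==> em z theta = z" using io_ev[of z "[:0, 1:]"] theta_K by (simp add: em_apply)

lemma inj_em: "inj_on em Z" by (rule inj_onI) (metis em_theta)

lemma one_K: "1 \<in> K" using K_ev[of 1] by simp

text \<open>Respecting 1, sums and products forces an embedding to fix the rationals, so it is
  determined by the image of \<open>theta\<close>.\<close>

lemma embedding_ev:
  assumes s: "sg \<in> embeddings K" shows "sg (ev h theta) = ev h (sg theta)"
proof -
  have hom: "sg 1 = 1" "!!x y. x \<in> K ==> y \<in> K ==> sg (x + y) = sg x + sg y"
    "!!x y. x \<in> K ==> y \<in> K ==> sg (x * y) = sg x * sg y" using s by (auto simp: embeddings_def)
  have rK: "of_rat q \<in> K" for q using K_ev[of "[:q:]"] by simp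
  have s0: "sg 0 = 0" using hom(2)[of 0 0] rK[of 0] by simp
  have nat: "sg (of_nat k) = of_nat k" for k
  proof (induction k)
    case (Suc k)
    then show ?case using hom(2)[OF one_K, of "of_nat k"] rK[of "of_nat k"] hom(1) by simp
  qed (simp add: s0)
  have neg: "sg (- x) = - sg x" if "x \<in> K" for x
  proof -
    have "- 1 * x \<in> K" using K_closed(2)[OF _ that, of "-1"] rK[of "-1"] by simp
    then show ?thesis using hom(2)[OF that, of "- x"] s0 by (simp add: eq_neg_iff_add_eq_0 add.commute)
  qed
  have int: "sg (of_int k) = of_int k" for k
  proof (cases "k >= 0")
    case True then show ?thesis using nat[of "nat k"] by simp
  next
    case False
    have "of_int (- k) \<in> K" using rK[of "of_int (- k)"] by (simp only: of_rat_of_int_eq)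
    then show ?thesis using nat[of "nat (- k)"] neg[of "of_int (- k)"] False by simp
  qed
  have rat: "sg (of_rat q) = of_rat q" for q
  proof -
    obtain a b where ab: "quotient_of q = (a, b)" by force
    have q: "q = of_int a / of_int b" "b > 0" using quotient_of_div[OF ab] quotient_of_denom_pos[OF ab] by auto
    have "of_int b * of_rat q = (of_int a :: 'a)" using q by (simp add: of_rat_divide)
    then have "sg (of_int b * of_rat q) = of_int a" using int by simp
    then have f: "of_int b * sg (of_rat q) = of_int a" using hom(3)[of "of_int b" "of_rat q"] rK[of "of_int b"] rK[of q] int by simp
    have e: "of_int b * (of_rat q :: complex) = of_int a" using q(2) by (simp add: q(1) of_rat_divide)
    show ?thesis using f q(2) by (simp flip: e)
  qed
  show ?thesis
  proof (induction h rule: pCons_induct)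
    case 0 then show ?case by (simp add: s0)
  next
    case (pCons c p)
    then show ?case using hom(2)[OF rK K_closed(2)[OF theta_K K_ev], of c p] hom(3)[OF theta_K K_ev, of p] rat by simp
  qed
qed

lemma embeddings_eq: "embeddings K = em ` Z"
proof (intro equalityI subsetI)
  fix sg assume s: "sg \<in> embeddings K"
  have "ev G (sg theta) = sg (ev G theta)" by (simp only: embedding_ev[OF s])
  also have "... = ev 0 (sg theta)" using embedding_ev[OF s, of 0] root by simp
  finally have z: "sg theta \<in> Z" by (simp add: Z_def)
  have "sg = em (sg theta)"
  proof (rule extensionalityI[of _ K])
    show "sg \<in> extensional K" using s by (simp add: embeddings_def)
    show "em (sg theta) \<in> extensional K" by (simp add: em_def)
    fix x assume x: "x \<in> K"
    then obtain h where "x = ev h theta" by (auto simp: K)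
    then show "sg x = em (sg theta) x" using x z by (simp add: em_apply embedding_ev[OF s])
  qed
  then show "sg \<in> em ` Z" using z by blast
next
  fix sg assume "sg \<in> em ` Z"
  then show "sg \<in> embeddings K" using K_closed io_add_mult
    by (auto simp: embeddings_def em_apply io_one one_K) (simp_all add: em_def)
qed

lemma em_cnj: assumes "z \<in> Z" "x \<in> K" shows "em (cnj z) x = cnj (em z x)"
proof -
  obtain h where "x = ev h theta" using assms by (auto simp: K)
  then show ?thesis using assms cnj_Z by (simp add: em_apply ev_cnj)
qed

lemma conj_em: "z \<in> Z ==> conj_embedding K (em z) = em (cnj z)"
  unfolding conj_embedding_def em_def[of "cnj z"] by (rule restrict_ext) (metis em_cnj em_apply)

lemma real_em: assumes "z \<in> Z" shows "real_embedding K (em z) \<longleftrightarrow> z \<in> \<real>"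
proof
  assume "real_embedding K (em z)"
  then show "z \<in> \<real>" using theta_K em_theta[OF assms] by (force simp: real_embedding_def)
next
  assume "z \<in> \<real>"
  then have "cnj z = z" by (simp add: Reals_cnj_iff)
  then have "cnj (em z x) = em z x" if "x \<in> K" for x using em_cnj[OF assms that] by simp
  then show "real_embedding K (em z)" by (auto simp: real_embedding_def Reals_cnj_iff)
qed

lemma field_norm_N: assumes "x \<in> K" shows "cmod (field_norm K x) = N (io x)" unfolding field_norm_def embeddings_eq N_def
  by (simp add: prod.reindex[OF inj_em] em_apply[OF assms] prod_norm)

lemma euclidean_minimum_eq: "euclidean_minimum K = (SUP x\<in>KF. mm x)"
proof -
  have inf: "(INF y\<in>(%a. x + a) ` ring_of_integers K. cmod (field_norm K y)) = mm (io x)" if x: "x \<in> K" for x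
  proof -
    have 1: "cmod (field_norm K (x + a)) = N (io x + io a)" if "a \<in> ring_of_integers K" for a
    proof -
      have a: "a \<in> K" using that by (simp add: ring_of_integers_def)
      show ?thesis unfolding field_norm_N[OF K_closed(1)[OF x a]] by (rule N_cong) (simp add: io_add_mult[OF x a])
    qed
    have "(%y. cmod (field_norm K y)) ` (%a. x + a) ` ring_of_integers K = (%b. N (io x + b)) ` OK"
    proof (intro equalityI subsetI)
      fix t assume "t \<in> (%y. cmod (field_norm K y)) ` (%a. x + a) ` ring_of_integers K"
      then show "t \<in> (%b. N (io x + b)) ` OK" using 1 io_OK by auto
    next
      fix t assume "t \<in> (%b. N (io x + b)) ` OK"
      then obtain b where b: "b \<in> OK" "t = N (io x + b)" by blast
      obtain a where a: "a \<in> ring_of_integers K" "\<forall>z\<in>Z. io a z = b z" using OK_io[OF b(1)] by blast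
      have "t = N (io x + io a)" unfolding b(2) by (rule N_cong) (use a in simp)
      then show "t \<in> (%y. cmod (field_norm K y)) ` (%a. x + a) ` ring_of_integers K" 
        unfolding image_image using 1[OF a(1)] a(1) by (intro image_eqI[of _ _ a]) auto
    qed
    then show ?thesis by (simp add: mm_def)
  qed
  have eq: "(%x. mm (io x)) ` K = mm ` KF"
  proof (intro equalityI subsetI)
    fix t assume "t \<in> mm ` KF"
    then obtain a where a: "a \<in> KF" "t = mm a" by blast
    obtain x where x: "x \<in> K" "\<forall>z\<in>Z. io x z = a z" using KF_io[OF a(1)] by blast
    then have "t = mm (io x)" using mm_cong[of "io x" a] a(2) by simp
    then show "t \<in> (%x. mm (io x)) ` K" using x(1) by (rule image_eqI)
  qed (use io_KF in auto)
  have "euclidean_minimum K = (SUP x\<in>K. mm (io x))" unfolding euclidean_minimum_def by (rule SUP_cong) (simp_all only: inf)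
  then show ?thesis unfolding eq .
qed

lemma units_exist:
  assumes "3 <= unit_rank K"
  shows "\<exists>alpha beta. numfield_units g alpha beta"
proof -
  have "enat 2 < unit_rank K" using assms by (rule less_le_trans[rotated]) (simp add: numeral_eq_enat)
  then obtain S where S: "finite S" "S \<subseteq> integer_units K" "mult_independent S" "2 < card S"
    unfolding unit_rank_def less_SUP_iff by auto
  obtain a where a: "a \<in> S" using S(4) by fastforce
  have "card (S - {a}) > 0" using S(1,4) a by simp
  then obtain b where b: "b \<in> S" "a ~= b" by (metis Diff_iff card_gt_0_iff ex_in_conv singletonI)
  have aK: "a \<in> K" "b \<in> K" using a b S(2) by (auto simp: integer_units_def ring_of_integers_def)
  have unz: "u ~= 0" if "u \<in> S" for u using S(2) that by (auto simp: integer_units_def)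
  have pw: "x ^ k \<in> K" "\<forall>z\<in>Z. io (x ^ k) z = io x z ^ k" if x: "x \<in> K" for x and k :: nat
  proof -
    have "x ^ k \<in> K & (\<forall>z\<in>Z. io (x ^ k) z = io x z ^ k)"
      by (induction k) (use one_K io_one K_closed[OF x] io_add_mult[OF x] in auto)
    then show "x ^ k \<in> K" "\<forall>z\<in>Z. io (x ^ k) z = io x z ^ k" by auto
  qed
  have "indep (io a) (io b)" unfolding indep_def
  proof (intro allI impI)
    fix i j i' j' assume eq: "\<forall>z\<in>Z. io a z ^ i * io b z ^ j = io a z ^ i' * io b z ^ j'"
    obtain z where z: "z \<in> Z" using Z_nonempty by blast
    have m: "io (a ^ i * b ^ j) z = io a z ^ i * io b z ^ j" for i j
      using io_add_mult(2)[OF pw(1)[OF aK(1)] pw(1)[OF aK(2)] z] pw(2)[OF aK(1)] pw(2)[OF aK(2)] z by simp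
    have eq': "a ^ i * b ^ j = a ^ i' * b ^ j'"
      by (rule io_inj[OF K_closed(2)[OF pw(1)[OF aK(1)] pw(1)[OF aK(2)]] K_closed(2)[OF pw(1)[OF aK(1)] pw(1)[OF aK(2)]] z])
         (use eq z m in simp)
    \<comment> \<open>This vector of exponents turns the relation in \<open>indep\<close> into one
      for \<open>mult_independent\<close>.\<close>
    define e :: "'a => int" where "e u = (if u = a then int i - int i' else if u = b then int j - int j' else 0)" for u
    have "(\<Prod>u\<in>S. u powi e u) = (\<Prod>u\<in>{a, b}. u powi e u)"
      by (rule prod.mono_neutral_right) (use S(1) a b in \<open>auto simp: e_def\<close>)
    also have "... = a ^ i / a ^ i' * (b ^ j / b ^ j')" using b(2) unz[OF a] unz[OF b(1)] by (simp add: e_def power_int_diff)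
    also have "... = 1" using eq' unz[OF a] unz[OF b(1)] by (simp add: field_simps)
    finally have "e a = 0" "e b = 0" using S(3) a b(1) by (auto simp: mult_independent_def)
    then show "i = i' & j = j'" using b(2) by (simp add: e_def)
  qed
  moreover have "io a \<in> UK" "io b \<in> UK" using integer_units_io S(2) a b by auto
  ultimately have "numfield_units g (io a) (io b)"
    unfolding numfield_units_def numfield_units_axioms_def using numfield_axioms by blast
  then show ?thesis by blast
qed

section \<open>Comparison with the coordinates of \<open>K_bar\<close>\<close>

context
  fixes Phi assumes reps: "embedding_reps K Phi"
begin

definition lift :: "(('a => complex) => complex) => complex => complex" where
  "lift x = (%z. if em z \<in> Phi then x (em z) else cnj (x (em (cnj z))))"

lemma reps_cases: assumes "z \<in> Z"
  shows "em z \<in> Phi | em (cnj z) \<in> Phi" "em z \<in> Phi ==> em (cnj z) \<in> Phi ==> z \<in> \<real>"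
    "z \<in> \<real> ==> em z \<in> Phi"
proof -
  have ex1: "\<exists>!sg. sg \<in> Phi & (sg = em z | sg = em (cnj z))"
    using reps assms unfolding conj_em[OF assms, symmetric] embedding_reps_def embeddings_eq by blast
  then show 1: "em z \<in> Phi | em (cnj z) \<in> Phi" by auto
  show "z \<in> \<real>" if "em z \<in> Phi" "em (cnj z) \<in> Phi"
  proof -
    have "em z = em (cnj z)" using ex1 that by auto
    then have "z = cnj z" using em_theta assms cnj_Z by metis
    then show ?thesis by (simp add: Reals_cnj_iff)
  qed
  show "em z \<in> Phi" if "z \<in> \<real>" using 1 that by (simp add: Reals_cnj_iff)
qed

lemma K_bar_real: "x \<in> K_bar K Phi ==> z \<in> Z ==> z \<in> \<real> ==> cnj (x (em z)) = x (em z)"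
  using reps_cases(3)[of z] real_em[of z] by (force simp: K_bar_def Reals_cnj_iff[symmetric])

lemma lift_EE: assumes "x \<in> K_bar K Phi" shows "lift x \<in> EE" unfolding EE_def
proof (intro CollectI ballI)
  fix z assume z: "z \<in> Z"
  show "lift x (cnj z) = cnj (lift x z)" using reps_cases(1,2)[OF z] K_bar_real[OF assms z] by (auto simp: lift_def Reals_cnj_iff)
qed

lemma reps_eq: "Phi = em ` {z \<in> Z. em z \<in> Phi}" using reps by (auto simp: embedding_reps_def embeddings_eq)

lemma norm_bar_N: assumes x: "x \<in> K_bar K Phi" shows "\<bar>norm_bar K Phi x\<bar> = N (lift x)"
proof -
  define T where "T = {z \<in> Z. em z \<in> Phi}"
  have fT: "finite T" using finite_Z by (simp add: T_def)
  have inj: "inj_on em T" using inj_em by (rule inj_on_subset) (auto simp: T_def)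
  have "\<bar>norm_bar K Phi x\<bar> = (\<Prod>z\<in>T. \<bar>if real_embedding K (em z) then Re (x (em z)) else (cmod (x (em z)))\<^sup>2\<bar>)"
    unfolding norm_bar_def by (subst reps_eq) (simp add: T_def[symmetric] prod.reindex[OF inj] abs_prod)
  \<comment> \<open>The square at a nonreal place is split into a factor for \<open>z\<close> and
    one for \<open>cnj z\<close>; the latter factors then account for the roots outside
    \<open>T\<close>.\<close>
  also have "... = (\<Prod>z\<in>T. cmod (lift x z) * (if z \<in> \<real> then 1 else cmod (lift x z)))"
  proof (rule prod.cong[OF refl])
    fix z assume z: "z \<in> T"
    then have "\<bar>Re (x (em z))\<bar> = cmod (x (em z))" if "z \<in> \<real>"
      using K_bar_real[OF x _ that] by (metis (no_types, lifting) Reals_cnj_iff T_def in_Reals_norm mem_Collect_eq Reals_cases Re_complex_of_real norm_of_real)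
    then show "\<bar>if real_embedding K (em z) then Re (x (em z)) else (cmod (x (em z)))\<^sup>2\<bar> =
        cmod (lift x z) * (if z \<in> \<real> then 1 else cmod (lift x z))"
      using z real_em by (simp add: T_def lift_def power2_eq_square)
  qed
  also have "... = (\<Prod>z\<in>T. cmod (lift x z)) * (\<Prod>z\<in>T - \<real>. cmod (lift x z))"
    using fT by (simp add: prod.distrib prod.If_cases Diff_eq)
  also have "(\<Prod>z\<in>T - \<real>. cmod (lift x z)) = (\<Prod>z\<in>cnj ` (T - \<real>). cmod (lift x z))"
  proof -
    have "cmod (lift x (cnj z)) = cmod (lift x z)" if "z \<in> T - \<real>" for z
      using lift_EE[OF x] that by (auto simp: EE_def T_def)
    then show ?thesis by (simp add: prod.reindex inj_on_def)
  qed
  also have "(\<Prod>z\<in>T. cmod (lift x z)) * ... = (\<Prod>z\<in>T \<union> cnj ` (T - \<real>). cmod (lift x z))"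
    using fT reps_cases(2) by (subst prod.union_disjoint) (auto simp: T_def)
  also have "T \<union> cnj ` (T - \<real>) = Z"
  proof (intro equalityI subsetI)
    fix z assume z: "z \<in> Z"
    show "z \<in> T \<union> cnj ` (T - \<real>)"
    proof (cases "em z \<in> Phi")
      case False
      then have "cnj z \<in> T" "cnj z \<notin> \<real>" using reps_cases(1,3)[OF z] z cnj_Z by (auto simp: T_def Reals_cnj_iff)
      then show ?thesis by (metis DiffI UnI2 complex_cnj_cnj imageI)
    qed (use z in \<open>simp add: T_def\<close>)
  qed (use cnj_Z in \<open>auto simp: T_def\<close>)
  finally show ?thesis by (simp add: N_def)
qed

lemma coset_element:
  assumes x: "x \<in> K_bar K Phi" and a: "a \<in> ring_of_integers K"
  shows "\<bar>norm_bar K Phi (restrict (%sg. x sg + sg a) Phi)\<bar> = N (lift x + io a)"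
proof -
  let ?y = "restrict (%sg. x sg + sg a) Phi"
  have aK: "a \<in> K" using a by (simp add: ring_of_integers_def)
  have "?y \<in> K_bar K Phi" using x aK unfolding K_bar_def by (auto simp: PiE_iff real_embedding_def intro!: Reals_add)
  then have "\<bar>norm_bar K Phi ?y\<bar> = N (lift ?y)" by (rule norm_bar_N)
  also have "... = N (lift x + io a)"
  proof (rule N_cong)
    fix z assume z: "z \<in> Z"
    then show "lift ?y z = (lift x + io a) z" using reps_cases(1)[OF z] em_cnj[OF z aK] em_apply[OF aK] by (auto simp: lift_def)
  qed
  finally show ?thesis .
qed

lemma coset_norms:
  assumes x: "x \<in> K_bar K Phi"
  shows "(%y. \<bar>norm_bar K Phi y\<bar>) ` integer_coset K Phi x = (%b. N (lift x + b)) ` OK"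
proof (intro equalityI subsetI)
  fix t assume "t \<in> (%b. N (lift x + b)) ` OK"
  then obtain b where b: "b \<in> OK" "t = N (lift x + b)" by blast
  obtain a where a: "a \<in> ring_of_integers K" "\<forall>z\<in>Z. io a z = b z" using OK_io[OF b(1)] by blast
  have "t = N (lift x + io a)" unfolding b(2) by (rule N_cong) (use a in simp)
  then show "t \<in> (%y. \<bar>norm_bar K Phi y\<bar>) ` integer_coset K Phi x"
    unfolding integer_coset_def image_image using coset_element[OF x a(1)] a(1) by (intro image_eqI[of _ _ a]) auto
qed (use coset_element[OF x] io_OK in \<open>auto simp: integer_coset_def\<close>)

lemma min_bar_mm: "x \<in> K_bar K Phi ==> min_bar K Phi x = mm (lift x)" unfolding min_bar_def mm_def coset_norms by simp

lemma spectrum: "inhomogeneous_spectrum K Phi = mm ` EE"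
proof (intro equalityI subsetI)
  fix t assume "t \<in> mm ` EE"
  then obtain x where x: "x \<in> EE" "t = mm x" by blast
  define y where "y = restrict (%sg. x (sg theta)) Phi"
  have "y \<in> K_bar K Phi"
  proof -
    have "x z \<in> \<real>" if "z \<in> Z" "z \<in> \<real>" for z using x(1) that by (auto simp: EE_def Reals_cnj_iff dest!: bspec[of _ _ z])
    then show ?thesis using reps_eq real_em em_theta by (force simp: K_bar_def y_def)
  qed
  moreover have "mm (lift y) = mm x"
  proof (rule mm_cong)
    fix z assume z: "z \<in> Z"
    then show "lift y z = x z" using reps_cases(1)[OF z] em_theta cnj_Z x(1) by (auto simp: lift_def y_def EE_def)
  qed
  ultimately show "t \<in> inhomogeneous_spectrum K Phi" using min_bar_mm x(2) by (force simp: inhomogeneous_spectrum_def)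
qed (use min_bar_mm lift_EE in \<open>auto simp: inhomogeneous_spectrum_def\<close>)

theorem attained_isolated:
  assumes "3 <= unit_rank K"
  shows "minimum_attained K Phi" "euclidean_minimum K isolated_in inhomogeneous_spectrum K Phi"
proof -
  obtain alpha beta where "numfield_units g alpha beta" using units_exist[OF assms] by blast
  then interpret numfield_units g alpha beta .
  have M: "euclidean_minimum K = MM" by (simp add: euclidean_minimum_eq MM_SUP)
  show "minimum_attained K Phi" unfolding minimum_attained_def M
  proof
    fix x assume x: "x \<in> K_bar K Phi"
    obtain b where "b \<in> OK" "N (lift x + b) <= MM" using attained[OF lift_EE[OF x]] by blast
    then have "\<exists>t\<in>(%y. \<bar>norm_bar K Phi y\<bar>) ` integer_coset K Phi x. t <= MM" unfolding coset_norms[OF x] by blast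
    then show "\<exists>y\<in>integer_coset K Phi x. \<bar>norm_bar K Phi y\<bar> <= MM" by blast
  qed
  obtain t where t: "t < MM" "\<forall>x\<in>EE. mm x <= t | mm x = MM" using isolated by blast
  obtain x where "x \<in> KF" "mm x = MM" using SS_MM_torsion by blast
  then have "MM \<in> mm ` EE" using KF_EE by (intro image_eqI[of _ _ x]) auto
  moreover have "{t<..} \<inter> mm ` EE = {MM}" using t calculation by force
  ultimately show "euclidean_minimum K isolated_in inhomogeneous_spectrum K Phi"
    unfolding M spectrum isolated_in_def using t(1) open_greaterThan by blast
qed

end

end

section \<open>The primitive element theorem\<close>

lemma (in vector_space) linear_relation_exists:
  assumes T: "finite T" "card T < card I" and I: "finite I" and f: "!!i. i \<in> I ==> f i \<in> span T"
  shows "\<exists>c. (\<exists>i\<in>I. c i ~= 0) & (\<Sum>i\<in>I. scale (c i) (f i)) = 0"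
proof (cases "inj_on f I")
  case True
  have "dependent (f ` I)" using independent_span_bound[OF T(1), of "f ` I"] f T(2) card_image[OF True] by force
  then obtain u where u: "\<exists>v\<in>f ` I. u v ~= 0" "(\<Sum>v\<in>f ` I. scale (u v) v) = 0"
    using dependent_finite[of "f ` I"] I by auto
  then show ?thesis by (intro exI[of _ "u \<circ> f"]) (auto simp: sum.reindex[OF True])
next
  case False
  then obtain i j where ij: "i \<in> I" "j \<in> I" "i ~= j" "f i = f j" by (auto simp: inj_on_def)
  define c where "c k = (if k = i then 1 else if k = j then - 1 else 0 :: 'a)" for k
  have "(\<Sum>k\<in>I. scale (c k) (f k)) = (\<Sum>k\<in>{i, j}. scale (c k) (f k))"
    by (rule sum.mono_neutral_right[OF I]) (use ij in \<open>auto simp: c_def\<close>)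
  also have "... = 0" using ij by (simp add: c_def)
  finally show ?thesis using ij(1) by (intro exI[of _ c]) (auto simp: c_def)
qed

lemma vector_space_polys: "vector_space (%r p. smult (of_rat r :: 'a::field_char_0) p)"
  by unfold_locales (simp_all add: smult_add_left smult_add_right of_rat_add of_rat_mult)

text \<open>Polynomials of degree at most \<open>L\<close> with coefficients in the rational span of
  \<open>B\<close> lie in a space of dimension at most \<open>Suc L * card B\<close>.\<close>

lemma rational_relation_of_polys:
  fixes B :: "'a::field_char_0 set" and f :: "'i => 'a poly"
  assumes B: "finite B" and I: "finite I" "Suc L * card B < card I"
    and f: "!!i k. i \<in> I ==> \<exists>c::'a => rat. coeff (f i) k = (\<Sum>b\<in>B. of_rat (c b) * b)"
      "!!i. i \<in> I ==> degree (f i) <= L"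
  shows "\<exists>c::'i => rat. (\<exists>i\<in>I. c i ~= 0) & (\<Sum>i\<in>I. smult (of_rat (c i)) (f i)) = 0"
proof -
  interpret V: vector_space "%r p. smult (of_rat r :: 'a) p" by (rule vector_space_polys)
  define S where "S = (%(k, b). monom b k) ` ({..L} \<times> B)"
  have S: "finite S" using B by (simp add: S_def)
  have "card S <= card ({..L} \<times> B)" unfolding S_def by (rule card_image_le) (use B in simp)
  then have cS: "card S < card I" using I(2) by (simp add: card_cartesian_product)
  show ?thesis
  proof (rule V.linear_relation_exists[OF S cS I(1)])
    fix i assume i: "i \<in> I"
    have m: "monom (coeff (f i) k) k \<in> V.span S" if k: "k <= L" for k
    proof -
      obtain c :: "'a => rat" where c: "coeff (f i) k = (\<Sum>b\<in>B. of_rat (c b) * b)" using f(1)[OF i] by blast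
      have "monom (coeff (f i) k) k = (\<Sum>b\<in>B. smult (of_rat (c b)) (monom b k))"
        unfolding c by (simp add: monom_sum smult_monom)
      also have "... \<in> V.span S" by (intro V.span_sum V.span_scale V.span_base) (use k in \<open>auto simp: S_def\<close>)
      finally show ?thesis .
    qed
    have "f i = (\<Sum>k\<le>L. monom (coeff (f i) k) k)" by (rule poly_as_sum_of_monoms'[OF f(2)[OF i], symmetric])
    also have "... \<in> V.span S" by (intro V.span_sum m) simp
    finally show "f i \<in> V.span S" .
  qed
qed

lemma number_fieldD:
  fixes K :: "'a::field_char_0 set"
  assumes "number_field K"
  shows "0 \<in> K" "1 \<in> K" "x \<in> K ==> y \<in> K ==> x + y \<in> K" "x \<in> K ==> y \<in> K ==> x - y \<in> K"
    "x \<in> K ==> y \<in> K ==> x * y \<in> K" "x \<in> K ==> inverse x \<in> K"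
    "\<exists>B. finite B & B \<subseteq> K & (\<forall>x\<in>K. \<exists>c::'a => rat. x = (\<Sum>b\<in>B. of_rat (c b) * b))"
  using assms by (auto simp: number_field_def)

lemma subfield_number_field: "number_field K ==> subfield_set K" by (simp add: number_field_def subfield_set_def)

lemma of_rat_subfield: assumes "subfield_set (K :: 'a::field_char_0 set)" shows "of_rat q \<in> K"
proof -
  have D: "0 \<in> K" "1 \<in> K" "!!x y. x \<in> K ==> y \<in> K ==> x + y \<in> K" "!!x y. x \<in> K ==> y \<in> K ==> x - y \<in> K"
    "!!x y. x \<in> K ==> y \<in> K ==> x * y \<in> K" "!!x. x \<in> K ==> inverse x \<in> K"
    using assms by (auto simp: subfield_set_def)
  have nat: "of_nat k \<in> K" for k by (induction k) (auto intro: D)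
  have int: "of_int k \<in> K" for k using nat D(4)[OF D(1) nat] by (cases k rule: int_cases2) auto
  obtain a b where ab: "quotient_of q = (a, b)" by force
  have "(of_rat q :: 'a) = of_int a * inverse (of_int b)"
    using quotient_of_div[OF ab] by (simp add: of_rat_divide divide_inverse of_rat_mult of_rat_inverse)
  then show ?thesis using D(5)[OF int D(6)[OF int], of a b] by simp
qed

lemma ev_subfield: assumes "subfield_set (K :: 'a::field_char_0 set)" "x \<in> K" shows "ev h x \<in> K"
  using assms of_rat_subfield[OF assms(1)] by (induction h rule: pCons_induct) (auto simp: subfield_set_def)

lemma irreducible_of_algebraic:
  fixes x :: "'a::field_char_0"
  assumes "f ~= 0" "ev f x = 0"
  shows "\<exists>p. irreducible p & ev p x = 0"
proof -
  define P where "P p \<longleftrightarrow> p ~= 0 & ev p x = 0" for p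
  obtain p where p: "P p" "!!q. P q ==> degree p <= degree q" using ex_has_least_nat[of P f degree] assms by (auto simp: P_def)
  have p0: "p ~= 0" "ev p x = 0" using p(1) by (auto simp: P_def)
  have aux: "is_unit b" if "p = a * b" "ev a x = 0" for a b
  proof -
    have ab: "a ~= 0" "b ~= 0" using that p0 by auto
    then have "degree b = 0" using p(2)[of a] that by (simp add: P_def degree_mult_eq)
    then show ?thesis using ab(2) by (simp add: is_unit_iff_degree)
  qed
  have "irreducible p"
  proof (rule irreducibleI)
    show "\<not> is_unit p"
    proof
      assume "is_unit p"
      then obtain q where "1 = p * q" by blast
      then have "(1 :: 'a) = ev p x * ev q x" using ev_1 ev_mult by metis
      then show False using p0(2) by simp
    qed
    fix a b assume ab: "p = a * b"
    then have "ev a x = 0 | ev b x = 0" using p0(2) by simp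
    then show "is_unit a | is_unit b" using aux[of a b] aux[of b a] ab mult.commute[of a b] by metis
  qed fact
  then show ?thesis using p0(2) by blast
qed

lemma number_field_algebraic:
  assumes "number_field (K :: 'a::field_char_0 set)" "x \<in> K"
  shows "\<exists>p. irreducible p & ev p x = 0"
proof -
  obtain B where B: "finite B" "\<forall>x\<in>K. \<exists>c::'a => rat. x = (\<Sum>b\<in>B. of_rat (c b) * b)" using number_fieldD(7)[OF assms(1)] by blast
  have pw: "x ^ i \<in> K" for i by (induction i) (use number_fieldD[OF assms(1)] assms(2) in auto)
  have "\<exists>c::nat => rat. (\<exists>i\<in>{..card B}. c i ~= 0) & (\<Sum>i\<in>{..card B}. smult (of_rat (c i)) [:x ^ i:]) = 0"
  proof (rule rational_relation_of_polys[OF B(1), of _ 0])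
    show "\<exists>c::'a => rat. coeff [:x ^ i:] k = (\<Sum>b\<in>B. of_rat (c b) * b)" for i k
      using B(2) pw number_fieldD(1)[OF assms(1)] by (simp add: coeff_pCons split: nat.split)
  qed auto
  then obtain c i where c: "i <= card B" "c i ~= 0" "(\<Sum>i\<le>card B. smult (of_rat (c i :: rat)) [:x ^ i:]) = 0" by auto
  define f where "f = (\<Sum>i\<le>card B. monom (c i) i)"
  have "coeff f i = c i" using c(1) by (simp add: f_def coeff_sum)
  then have "f ~= 0" using c(2) by auto
  moreover have "ev f x = 0" using c(3) by (simp add: f_def ev_sum sum_to_poly)
  ultimately show ?thesis by (rule irreducible_of_algebraic)
qed

lemma ev_inverse:
  assumes "irreducible p" "ev p (x :: 'a::field_char_0) = 0" shows "\<exists>k. ev k x = inverse (ev h x)"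
proof (cases "ev h x = 0")
  case True then show ?thesis by (intro exI[of _ 0]) simp
next
  case False
  then obtain A B where "A * p + B * h = 1" using irreducible_ev_bezout[OF assms(1), of h] irreducible_ev_zero_iff[OF assms] by blast
  then have "ev (A * p + B * h) x = 1" by simp
  then have "ev B x * ev h x = 1" using assms(2) by simp
  then show ?thesis using False by (intro exI[of _ B]) (simp add: field_simps)
qed

text \<open>The coefficients of \<open>\<Sum>i\<le>e. c i * (x + T y)^i = 0\<close> are rational polynomials in \<open>T\<close>; the derivative
  of this relation with respect to \<open>T\<close> expresses \<open>y\<close> by \<open>x + t y\<close> for almost all rational \<open>t\<close>.\<close>

lemma primitive_element_two:
  assumes K: "number_field (K :: 'a::field_char_0 set)" and xy: "x \<in> K" "y \<in> K"
  shows "\<exists>s\<in>K. \<exists>h k. x = ev h s & y = ev k s"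
proof -
  note KD = number_fieldD[OF K]
  note sub = subfield_number_field[OF K]
  obtain B where B: "finite B" "\<forall>x\<in>K. \<exists>c::'a => rat. x = (\<Sum>b\<in>B. of_rat (c b) * b)" using KD(7) by blast
  define m where "m = card B"
  define \<Gamma> where "\<Gamma> = [:x, y:]"
  define M where "M c e = (\<Sum>i\<le>e. map_poly of_rat (c i) * \<Gamma> ^ i)" for c :: "nat => rat poly" and e
  define P where "P e \<longleftrightarrow> (\<exists>c. c e ~= 0 & M c e = 0)" for e
  have \<Gamma>K: "\<Gamma> ^ i \<in> polys_over K" for i
  proof (induction i)
    case 0 show ?case using polys_over_monom[OF sub, of 1 0] KD(2) by (simp add: monom_0 one_pCons)
  next
    case (Suc i)
    have "\<Gamma> \<in> polys_over K" using xy KD(1) by (auto simp: polys_over_def \<Gamma>_def coeff_pCons split: nat.split)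
    then show ?case using polys_over_closed(3)[OF sub _ Suc.IH] by simp
  qed
  have deg: "degree (\<Gamma> ^ i) <= i" for i
    using degree_power_le[of \<Gamma> i] mult_right_mono[of "degree \<Gamma>" 1 i] by (simp add: \<Gamma>_def split: if_splits)
  have "\<exists>e. P e"
  proof -
    \<comment> \<open>There are (m + 1)(m^2 + 1) unknown coefficients against (m^2 + m + 1) m
      conditions: exactly one unknown more.\<close>
    define I where "I = {..m} \<times> {..m * m}"
    have "\<exists>c::nat \<times> nat => rat. (\<exists>i\<in>I. c i ~= 0) & (\<Sum>i\<in>I. smult (of_rat (c i)) (monom 1 (snd i) * \<Gamma> ^ fst i)) = 0"
    proof (rule rational_relation_of_polys[OF B(1), of I "m * m + m"])
      show "Suc (m * m + m) * card B < card I" by (simp add: I_def card_cartesian_product m_def[symmetric] algebra_simps)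
      fix i assume i: "i \<in> I"
      show "degree (monom 1 (snd i) * \<Gamma> ^ fst i) <= m * m + m"
        using degree_mult_le[of "monom 1 (snd i)" "\<Gamma> ^ fst i"] degree_monom_le[of "1 :: 'a" "snd i"] deg[of "fst i"] i
        by (auto simp: I_def)
      have "monom 1 (snd i) * \<Gamma> ^ fst i \<in> polys_over K"
        by (intro polys_over_closed[OF sub] polys_over_monom[OF sub] KD(2) \<Gamma>K)
      then show "\<exists>c::'a => rat. coeff (monom 1 (snd i) * \<Gamma> ^ fst i) k = (\<Sum>b\<in>B. of_rat (c b) * b)" for k
        using B(2) by (simp add: polys_over_def)
    qed (simp add: I_def)
    then obtain c i0 j0 where c: "i0 <= m" "j0 <= m * m" "c (i0, j0) ~= (0 :: rat)"
      "(\<Sum>i\<in>I. smult (of_rat (c i)) (monom 1 (snd i) * \<Gamma> ^ fst i)) = 0" by (auto simp: I_def)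
    define C where "C i = (\<Sum>j\<le>m * m. monom (c (i, j)) j)" for i
    have C: "map_poly of_rat (C i) * \<Gamma> ^ i = (\<Sum>j\<le>m * m. smult (of_rat (c (i, j))) (monom 1 j * \<Gamma> ^ i))" for i
    proof -
      have "map_poly of_rat (C i) = (\<Sum>j\<le>m * m. monom (of_rat (c (i, j)) :: 'a) j)"
        by (rule poly_eqI) (simp add: C_def coeff_map_poly coeff_sum of_rat_sum if_distrib[of of_rat] cong: if_cong)
      then show ?thesis by (simp add: sum_distrib_right smult_monom flip: mult_smult_left)
    qed
    have M0: "M C m = 0" using c(4) unfolding M_def C I_def by (simp add: sum.cartesian_product case_prod_unfold)
    have "coeff (C i0) j0 = c (i0, j0)" using c(2) by (simp add: C_def coeff_sum)
    then have i0: "C i0 ~= 0" using c(3) by auto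
    define e where "e = (GREATEST i. i <= m & C i ~= 0)"
    have e: "e <= m" "C e ~= 0" unfolding e_def using GreatestI_nat[of "%i. i <= m & C i ~= 0" i0 m] c(1) i0 by auto
    have "C i = 0" if "e < i" "i <= m" for i
      using Greatest_le_nat[of "%i. i <= m & C i ~= 0" i m] that by (force simp: e_def[symmetric])
    then have "M C m = M C e" unfolding M_def by (intro sum.mono_neutral_right) (use e in auto)
    then show ?thesis using M0 e unfolding P_def by metis
  qed
  \<comment> \<open>Minimality of \<open>e\<close> makes \<open>M c' e'\<close>, the factor of
    \<open>y\<close> after differentiation, nonzero.\<close>
  define e where "e = (LEAST e. P e)"
  have Pe: "P e" "!!e'. e' < e ==> \<not> P e'" using LeastI_ex[OF \<open>\<exists>e. P e\<close>] not_less_Least by (auto simp: e_def)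
  then obtain c where c: "c e ~= 0" "M c e = 0" by (auto simp: P_def)
  have map0: "map_poly of_rat p = (0 :: 'a poly) \<longleftrightarrow> p = 0" for p :: "rat poly"
    by (auto simp: poly_eq_iff coeff_map_poly)
  have "e ~= 0"
  proof
    assume e0: "e = 0"
    then have "map_poly of_rat (c 0) = (0 :: 'a poly)" using c(2) by (simp add: M_def)
    then show False using c(1) unfolding map0 e0 by blast
  qed
  then obtain e' where e': "e = Suc e'" by (cases e) auto
  define c' where "c' i = smult (of_nat (Suc i)) (c (Suc i))" for i
  have "c' e' ~= 0" using c(1) by (simp add: c'_def e')
  then have nz: "M c' e' ~= 0" using Pe(2)[of e'] e' by (auto simp: P_def)
  have map_pd: "pderiv (map_poly of_rat p) = (map_poly of_rat (pderiv p) :: 'a poly)" for p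
    by (rule poly_eqI) (simp add: coeff_pderiv coeff_map_poly of_rat_mult of_rat_add)
  have "pderiv (M c e) = M (%i. pderiv (c i)) e + (\<Sum>i\<le>e. map_poly of_rat (c i) * pderiv (\<Gamma> ^ i))"
    by (simp add: M_def higher_pderiv_sum[of 1, simplified] pderiv_mult map_pd sum.distrib mult.commute add.commute)
  also have "(\<Sum>i\<le>e. map_poly of_rat (c i) * pderiv (\<Gamma> ^ i)) = smult y (M c' e')"
  proof -
    have "map_poly of_rat (c (Suc i)) * pderiv (\<Gamma> ^ Suc i) = smult y (map_poly of_rat (c' i) * \<Gamma> ^ i)" for i
    proof -
      have "map_poly of_rat (c' i) = smult (of_nat (Suc i)) (map_poly of_rat (c (Suc i)) :: 'a poly)"
        by (rule poly_eqI) (simp add: c'_def coeff_map_poly of_rat_mult of_rat_add)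
      then show ?thesis by (simp add: pderiv_power_Suc \<Gamma>_def pderiv_pCons mult_ac del: power_Suc of_nat_Suc)
    qed
    moreover have "smult y (sum f A) = (\<Sum>x\<in>A. smult y (f x))" for f :: "nat => 'a poly" and A
      by (induction A rule: infinite_finite_induct) (auto simp: smult_add_right)
    ultimately show ?thesis unfolding e' M_def sum.atMost_Suc_shift by (simp del: power_Suc)
  qed
  finally have rel: "M (%i. pderiv (c i)) e + smult y (M c' e') = 0" by (simp add: c(2))
  have "\<not> (\<forall>t :: rat. poly (M c' e') (of_rat t) = 0)"
  proof
    assume "\<forall>t :: rat. poly (M c' e') (of_rat t) = 0"
    then have "range (of_rat :: rat => 'a) \<subseteq> {z. poly (M c' e') z = 0}" by auto
    then have "finite (range (of_rat :: rat => 'a))" using poly_roots_finite[OF nz] finite_subset by blast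
    then show False using finite_imageD[of "of_rat :: rat => 'a" UNIV] by (simp add: inj_def infinite_UNIV_char_0)
  qed
  then obtain t :: rat where t: "poly (M c' e') (of_rat t) ~= 0" by blast
  define s where "s = x + of_rat t * y"
  have sK: "s \<in> K" unfolding s_def by (rule KD(3)[OF xy(1) KD(5)[OF of_rat_subfield[OF sub] xy(2)]])
  have pM: "poly (M c e) (of_rat t) = ev (\<Sum>i\<le>e. monom (poly (c i) t) i) s" for c e
  proof -
    have "poly (map_poly of_rat p) (of_rat t) = (of_rat (poly p t) :: 'a)" for p
      using ev_pcompose[of p "[:t:]" "0 :: 'a"] by (simp add: pcompose_pCons_0 flip: ev_def)
    then show ?thesis by (simp add: M_def poly_sum ev_sum \<Gamma>_def s_def poly_power)
  qed
  obtain p where p: "irreducible p" "ev p s = 0" using number_field_algebraic[OF K sK] by blast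
  define a where "a = (\<Sum>i\<le>e. monom (poly (pderiv (c i)) t) i)"
  define b where "b = (\<Sum>i\<le>e'. monom (poly (c' i) t) i)"
  obtain k where k: "ev k s = inverse (ev b s)" using ev_inverse[OF p] by blast
  have "ev a s + y * ev b s = 0" using arg_cong[OF rel, of "%p. poly p (of_rat t)"] by (simp add: pM a_def b_def)
  moreover have "ev b s ~= 0" using t by (simp add: pM b_def)
  ultimately have y: "y = ev (- a * k) s" by (simp add: k field_simps eq_neg_iff_add_eq_0)
  have "x = s - of_rat t * y" by (simp add: s_def)
  also have "... = ev ([:0, 1:] - smult t (- a * k)) s" by (subst y) simp
  finally have "x = ev ([:0, 1:] - smult t (- a * k)) s" .
  then show ?thesis using y sK by blast
qed

theorem primitive_element:
  assumes K: "number_field (K :: 'a::field_char_0 set)"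
  shows "\<exists>s\<in>K. K = range (%h. ev h s)"
proof -
  obtain B where B: "finite B" "B \<subseteq> K" "\<forall>x\<in>K. \<exists>c::'a => rat. x = (\<Sum>b\<in>B. of_rat (c b) * b)"
    using number_fieldD(7)[OF K] by blast
  have "\<exists>s\<in>K. \<forall>b\<in>B. \<exists>h. b = ev h s" using B(1,2)
  proof (induction B rule: finite_induct)
    case empty then show ?case using number_fieldD(1)[OF K] by blast
  next
    case (insert b B)
    then obtain s where s: "s \<in> K" "\<forall>b\<in>B. \<exists>h. b = ev h s" by auto
    obtain s' h k where s': "s' \<in> K" "s = ev h s'" "b = ev k s'"
      using primitive_element_two[OF K s(1), of b] insert.prems by blast
    have "\<exists>h. b' = ev h s'" if "b' \<in> B" for b' using s(2) that s'(2) by (metis ev_pcompose)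
    then show ?case using s' by blast
  qed
  then obtain s h where s: "s \<in> K" "!!b. b \<in> B ==> b = ev (h b) s" by metis
  have "x \<in> range (%h. ev h s)" if x: "x \<in> K" for x
  proof -
    obtain c :: "'a => rat" where c: "x = (\<Sum>b\<in>B. of_rat (c b) * b)" using B(3) x by blast
    have "x = (\<Sum>b\<in>B. of_rat (c b) * ev (h b) s)" unfolding c by (rule sum.cong) (use s(2) in auto)
    then have "x = ev (\<Sum>b\<in>B. smult (c b) (h b)) s" by (simp add: ev_sum)
    then show ?thesis by blast
  qed
  then show ?thesis using s(1) ev_subfield[OF subfield_number_field[OF K]] by blast
qed

subsection \<open>Passing to an integral generator\<close>

lemma common_denominator:
  assumes "finite S" shows "\<exists>d::nat. d > 0 & (\<forall>r\<in>S. of_nat d * r \<in> (\<int> :: rat set))" using assms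
proof (induction S rule: finite_induct)
  case empty show ?case by (intro exI[of _ 1]) simp
next
  case (insert r S)
  then obtain d where d: "d > 0" "\<forall>r\<in>S. of_nat d * r \<in> (\<int> :: rat set)" by blast
  obtain a b where ab: "r = of_int a / of_int b" "b > 0" by (cases r rule: Rat_cases) (auto simp: Fract_of_int_quotient)
  have "of_nat (nat b) * r = of_int a" using ab by simp
  then have "of_nat d * (of_nat (nat b) * r) \<in> \<int>" by simp
  moreover have "of_nat (nat b) * (of_nat d * r') \<in> \<int>" if "r' \<in> S" for r'
    by (rule Ints_mult[OF Ints_of_nat]) (use d(2) that in blast)
  ultimately show ?case using d(1) ab(2) by (intro exI[of _ "d * nat b"]) (auto simp: mult_ac)
qed

text \<open>For nonzero \<open>f\<close> of degree n this says that g(X) is c^n f(X / c) divided by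
  the leading coefficient: the monic integral polynomial for \<open>c\<close> times a root of
  \<open>f\<close>. The equations are free of division, so they can be checked on codes.\<close>

definition integral_model :: "rat poly => nat => int poly => bool" where
  "integral_model f c g \<longleftrightarrow> c > 0 & degree g = degree f \<and>
    (\<forall>i\<le>degree f. of_int (coeff g i) * lead_coeff f = of_nat c ^ (degree f - i) * coeff f i)"

lemma integral_model_exists: assumes "f ~= 0" shows "\<exists>c g. integral_model f c g"
proof -
  obtain c where c: "c > 0" "\<forall>r\<in>(%i. coeff f i / lead_coeff f) ` {..degree f}. of_nat c * r \<in> (\<int> :: rat set)"
    using common_denominator[of "(%i. coeff f i / lead_coeff f) ` {..degree f}"] by auto
  then have "\<forall>i. \<exists>k. i <= degree f --> of_nat c * (coeff f i / lead_coeff f) = of_int k" by (auto elim!: Ints_cases)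
  then obtain k where k: "!!i. i <= degree f ==> of_nat c * (coeff f i / lead_coeff f) = of_int (k i)" by metis
  define a where "a i = (if i = degree f then 1 else int c ^ (degree f - Suc i) * k i)" for i
  define g where "g = (\<Sum>i\<le>degree f. monom (a i) i)"
  have g: "coeff g i = (if i <= degree f then a i else 0)" for i by (simp add: g_def coeff_sum)
  have "of_int (a i) * lead_coeff f = of_nat c ^ (degree f - i) * coeff f i" if i: "i <= degree f" for i
  proof (cases "i = degree f")
    case False
    then have "degree f - i = Suc (degree f - Suc i)" using i by simp
    moreover have "of_int (k i) * lead_coeff f = of_nat c * coeff f i" using k[OF i] assms by (simp add: field_simps)
    ultimately show ?thesis using False by (simp add: a_def mult_ac)
  qed (simp add: a_def)
  moreover have "degree g = degree f" by (rule antisym, rule degree_le, simp add: g, rule le_degree, simp add: g a_def)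
  ultimately have "integral_model f c g" using c(1) g by (simp add: integral_model_def)
  then show ?thesis by blast
qed

lemma integral_model_monic: assumes "f ~= 0" "integral_model f c g" shows "lead_coeff g = 1"
  using assms by (auto simp: integral_model_def dest: spec[of _ "degree f"])

lemma integral_model_pcompose:
  assumes "f ~= 0" "integral_model f c g"
  shows "pcompose (map_poly of_int g) [:0, of_nat c:] = smult (of_nat c ^ degree f / lead_coeff f) f"
proof (rule poly_eqI)
  fix i
  have "of_nat c ^ i * of_int (coeff g i) = of_nat c ^ degree f / lead_coeff f * coeff f i"
  proof (cases "i <= degree f")
    case True
    then have "of_nat c ^ i * (of_int (coeff g i) * lead_coeff f) = (of_nat c ^ i * of_nat c ^ (degree f - i)) * coeff f i"
      using assms(2) by (simp add: integral_model_def mult.assoc)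
    also have "of_nat c ^ i * of_nat c ^ (degree f - i) = (of_nat c ^ degree f :: rat)" using True by (simp flip: power_add)
    finally show ?thesis using assms(1) by (simp add: field_simps)
  next
    case False then show ?thesis using assms(2) by (simp add: integral_model_def coeff_eq_0)
  qed
  then show "coeff (pcompose (map_poly of_int g) [:0, of_nat c:]) i = coeff (smult (of_nat c ^ degree f / lead_coeff f) f) i"
    by (simp add: coeff_pcompose_linear coeff_map_poly)
qed

lemma numfield_integral_model: assumes f: "irreducible f" and m: "integral_model f m g" shows "numfield g"
proof
  have f0: "f ~= 0" using f by auto
  show "lead_coeff g = 1" by (rule integral_model_monic[OF f0 m])
  define c where "c = (of_nat m :: rat)"
  have c0: "c ~= 0" using m by (simp add: c_def integral_model_def)
  define k where "k = c ^ degree f / lead_coeff f"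
  have k0: "k ~= 0" using c0 f0 by (simp add: k_def)
  have dp: "degree (pcompose p [:0, c:]) = degree p" for p using c0 by (simp add: degree_pcompose)
  show "irreducible (map_poly rat_of_int g)"
  proof (rule irreducibleI)
    have dG: "degree (map_poly rat_of_int g) = degree f" using m by (simp add: degree_map_poly integral_model_def)
    have "\<not> is_unit f" using f by (simp add: irreducible_def)
    then have "degree f > 0" using f0 by (auto simp: is_unit_iff_degree)
    then show G0: "map_poly rat_of_int g ~= 0" using dG by (metis degree_0 less_irrefl)
    then show "\<not> is_unit (map_poly rat_of_int g)" using dG is_unit_iff_degree[OF G0] \<open>degree f > 0\<close> by simp
    fix A B assume AB: "map_poly rat_of_int g = A * B"
    then have "smult k f = pcompose A [:0, c:] * pcompose B [:0, c:]"
      using integral_model_pcompose[OF f0 m] by (simp add: pcompose_mult k_def c_def)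
    then have "smult (inverse k) (smult k f) = smult (inverse k) (pcompose A [:0, c:]) * pcompose B [:0, c:]" by simp
    then have "f = smult (inverse k) (pcompose A [:0, c:]) * pcompose B [:0, c:]" using k0 by simp
    then have "is_unit (smult (inverse k) (pcompose A [:0, c:])) | is_unit (pcompose B [:0, c:])" using f by (meson irreducibleD)
    moreover have AB0: "A ~= 0" "B ~= 0" using AB G0 by auto
    moreover have "degree p = 0" if "is_unit p" for p :: "rat poly" using that is_unit_iff_degree[of p] by (cases "p = 0") auto
    moreover have "degree (smult (inverse k) (pcompose A [:0, c:])) = degree A" using k0 dp[of A] by simp
    ultimately have "degree A = 0 | degree B = 0" using dp[of B] by metis
    then show "is_unit A | is_unit B" using AB0 by (simp add: is_unit_iff_degree)
  qed
qed

lemma field_model_integral_model: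
  fixes s :: "'a::field_char_0"
  assumes f: "irreducible f" "ev f s = 0" and m: "integral_model f m g"
  shows "field_model g (of_nat m * s) (range (%h. ev h s))"
proof -
  interpret numfield g by (rule numfield_integral_model[OF f(1) m])
  define c where "c = (of_nat m :: rat)"
  have c0: "c ~= 0" using m by (simp add: c_def integral_model_def)
  have cs: "of_nat m * s = ev [:0, c:] s" by (simp add: c_def)
  show ?thesis
  proof
    have "f ~= 0" using f(1) by auto
    from integral_model_pcompose[OF this m]
    have "ev (pcompose G [:0, c:]) s = 0" using f(2) by (simp add: c_def del: ev_pcompose)
    then show "ev G (of_nat m * s) = 0" by (simp add: cs)
    have "ev [:0, inverse c:] (ev [:0, c:] s) = s" using c0 by (simp add: of_rat_inverse)
    then have 1: "ev h s = ev (pcompose h [:0, inverse c:]) (ev [:0, c:] s)" for h by (simp only: ev_pcompose)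
    have 2: "ev h (ev [:0, c:] s) = ev (pcompose h [:0, c:]) s" for h by (simp only: ev_pcompose)
    show "range (%h. ev h s) = range (%h. ev h (of_nat m * s))" unfolding cs
    proof (intro equalityI image_subsetI)
      show "ev h s \<in> range (%h. ev h (ev [:0, c:] s))" for h by (subst 1) (rule rangeI)
      show "ev h (ev [:0, c:] s) \<in> range (%h. ev h s)" for h by (subst 2) (rule rangeI)
    qed
  qed
qed

theorem attained_isolated_number_field:
  assumes "number_field (K :: 'a::field_char_0 set)" "3 <= unit_rank K" "embedding_reps K Phi"
  shows "minimum_attained K Phi & euclidean_minimum K isolated_in inhomogeneous_spectrum K Phi"
proof -
  obtain s where s: "s \<in> K" "K = range (%h. ev h s)" using primitive_element[OF assms(1)] by blast
  obtain f where f: "irreducible f" "ev f s = 0" using number_field_algebraic[OF assms(1) s(1)] by blast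
  have "f ~= 0" using f(1) by auto
  then obtain c g where "integral_model f c g" using integral_model_exists by blast
  then interpret field_model g "of_nat c * s" K using field_model_integral_model[OF f] s(2) by simp
  show ?thesis using attained_isolated assms(2,3) by blast
qed

section \<open>Certificates for the Euclidean minimum\<close>

text \<open>Digits to base \<open>b\<close>. Numbers below \<open>b ^ n\<close> enumerate the
  vectors of n entries below \<open>b\<close>, so a quantifier over a box becomes a bounded
  quantifier over one number.\<close>

definition dig :: "nat => nat => nat => nat" where "dig b w i = w div b ^ i mod b"

lemma dig_exists:
  assumes "!!i. i < n ==> m i < b" shows "\<exists>w<b ^ n. \<forall>i<n. dig b w i = m i" using assms
proof (induction n)
  case (Suc n)
  then obtain w where w: "w < b ^ n" "!!i. i < n ==> dig b w i = m i" by auto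
  have b: "b > 0" "m n < b" using Suc.prems[of n] by auto
  define v where "v = m n * b ^ n + w"
  have "v < (m n + 1) * b ^ n" using w(1) by (simp add: v_def)
  also have "... <= b ^ Suc n" using b(2) by (simp add: mult_right_mono del: mult_Suc)
  finally have "v < b ^ Suc n" .
  moreover have "dig b v i = m i" if i: "i < Suc n" for i
  proof (cases "i = n")
    case True then show ?thesis using w(1) b by (simp add: dig_def v_def)
  next
    case False
    then have "b ^ n = b ^ i * b * b ^ (n - Suc i)" using i False power_add[of b "Suc i" "n - Suc i"] by simp
    then have "v = w + b ^ i * (b * (m n * b ^ (n - Suc i)))" by (simp add: v_def)
    then have "v div b ^ i = w div b ^ i + b * (m n * b ^ (n - Suc i))" using b by simp
    then show ?thesis using w(2)[of i] i False by (simp add: dig_def)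
  qed
  ultimately show ?case by blast
qed simp

text \<open>The increase is largest when all factors equal \<open>b\<close>; so the error bound does
  not refer to the single conjugates.\<close>

lemma prod_shift_le:
  fixes a :: "'i => real"
  assumes "finite S" "!!i. i \<in> S ==> 0 <= a i & a i <= b" "h >= 0" "b >= 0"
  shows "(\<Prod>i\<in>S. a i + h) <= (\<Prod>i\<in>S. a i) + ((b + h) ^ card S - b ^ card S)" using assms(1,2)
proof (induction S rule: finite_induct)
  case (insert i S)
  define p where "p = (\<Prod>i\<in>S. a i)"
  define m where "m = card S"
  have a: "0 <= a i" "a i <= b" using insert by auto
  have "p <= (\<Prod>i\<in>S. b)" unfolding p_def by (rule prod_mono) (use insert in auto)
  then have p: "p <= b ^ m" by (simp add: m_def)
  have bh: "b ^ m <= (b + h) ^ m" using assms by (intro power_mono) auto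
  have "(a i + h) * (\<Prod>i\<in>S. a i + h) <= (a i + h) * (p + ((b + h) ^ m - b ^ m))"
    unfolding p_def m_def by (rule mult_left_mono) (use insert a assms in auto)
  also have "... = a i * p + h * p + (a i + h) * ((b + h) ^ m - b ^ m)" by (simp add: algebra_simps)
  also have "... <= a i * p + h * b ^ m + (b + h) * ((b + h) ^ m - b ^ m)"
    by (intro add_mono mult_left_mono mult_right_mono p order_refl) (use assms a bh in auto)
  also have "... = a i * p + ((b + h) ^ Suc m - b ^ Suc m)" by (simp add: algebra_simps)
  finally show ?case using insert by (simp add: p_def m_def)
qed simp

context numfield begin

text \<open>Coefficient vectors have room for 2 n entries, so that a product of two elements of
  degree below n is a convolution without reduction modulo \<open>g\<close>.\<close>

definition el :: "(nat => rat) => complex => complex" where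
  "el c = (%z. \<Sum>i<2 * n. of_rat (c i) * z ^ i)"
abbreviation tn :: "(nat => rat) => bool" where "tn c \<equiv> \<forall>i\<ge>n. c i = 0"
definition es :: "(nat => rat) => nat => rat" where "es c k = (SOME r. of_rat r = esym (el c) Z k)"
definition okc :: "(nat => rat) => bool" where "okc c \<longleftrightarrow> (\<forall>k\<le>n. es c k \<in> \<int>)"
definition nm :: "(nat => rat) => rat" where "nm c = \<bar>es c n\<bar>"
text \<open>Enumerates the vectors of multiples of 1 / DD between -L / DD and L / DD; by
  \<open>DD_cf_int\<close> they include all integers of the field with suitably bounded
  coefficients.\<close>

definition bx :: "nat => nat => nat => rat" where
  "bx L w i = (if i < n then (of_nat (dig (2 * L + 1) w i) - of_nat L) / of_nat DD else 0)"
text \<open>The corners of a grid of mesh 1 / H in the unit cube of coefficients.\<close>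

definition gr :: "nat => nat => nat => rat" where
  "gr H w i = (if i < n then of_nat (dig H w i) / of_nat H else 0)"

lemma el_KF: "el c \<in> KF" unfolding el_def by (rule KF_rat_sum)

lemma el_tn: "tn c ==> el c z = (\<Sum>i<n. of_rat (c i) * z ^ i)" unfolding el_def by (rule sum.mono_neutral_right) auto

lemma cf_el: "tn c ==> i < n ==> cf (el c) i = of_rat (c i)" by (rule cf_eqI) (simp_all add: el_tn)

lemma el_add: "el (%i. c i + d i) = el c + el d" by (rule ext) (simp add: el_def of_rat_add distrib_right sum.distrib)

lemma el_diff: "el (%i. c i - d i) = el c - el d" by (rule ext) (simp add: el_def of_rat_diff left_diff_distrib sum_subtractf)

lemma el_exists: assumes "a \<in> KF" shows "\<exists>c. tn c & (\<forall>z\<in>Z. el c z = a z)"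
proof -
  obtain c where c: "\<forall>z\<in>Z. a z = (\<Sum>i<n. of_rat (c i) * z ^ i)" using KF_expand'[OF assms] by blast
  define d where "d i = (if i < n then c i else 0)" for i
  have d: "tn d" by (simp add: d_def)
  have "\<forall>z\<in>Z. el d z = a z" using c by (simp only: el_tn[OF d]) (simp add: d_def)
  then show ?thesis using d by (intro exI[of _ d]) simp
qed

lemma el_conv:
  assumes c: "tn c" and d: "tn d"
  shows "el (%k. \<Sum>i\<le>k. c i * d (k - i)) = el c * el d"
proof (rule ext)
  fix z
  define p where "p = (\<Sum>i<n. monom (of_rat (c i) :: complex) i)"
  define q where "q = (\<Sum>i<n. monom (of_rat (d i) :: complex) i)"
  have cp: "coeff p i = of_rat (c i)" "coeff q i = of_rat (d i)" for i using c d by (simp_all add: p_def q_def coeff_sum)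
  have dp: "degree p < n" "degree q < n" using n_pos c d le_degree[of p "degree p"] le_degree[of q "degree q"] cp
    by (metis degree_0 leading_coeff_0_iff linorder_not_le of_rat_0)+
  then have "degree (p * q) < 2 * n" using degree_mult_le[of p q] by linarith
  then have "(\<Sum>k<2 * n. coeff (p * q) k * z ^ k) = poly p z * poly q z" by (simp add: poly_sum_lessThan)
  moreover have "poly p z = el c z" "poly q z = el d z" using c d by (simp_all add: el_tn p_def q_def poly_sum poly_monom)
  ultimately show "el (%k. \<Sum>i\<le>k. c i * d (k - i)) z = (el c * el d) z"
    by (simp add: el_def coeff_mult cp of_rat_sum of_rat_mult)
qed

lemma es: "of_rat (es c k) = esym (el c) Z k"
proof -
  obtain h where h: "!!z. z \<in> Z ==> el c z = ev h z" using el_KF[of c] by (auto simp: KF_def)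
  have "esym (el c) Z k = esym (ev h) Z k" by (rule esym_cong) (rule h)
  then have "\<exists>r. of_rat r = esym (el c) Z k" using esym_ev_rat[of h k] by (auto simp: Rats_def)
  then show ?thesis unfolding es_def by (rule someI_ex)
qed

lemma okc_iff: "okc c \<longleftrightarrow> el c \<in> OK"
proof -
  have "es c k \<in> \<int> \<longleftrightarrow> esym (el c) Z k \<in> \<int>" for k
  proof
    assume "esym (el c) Z k \<in> \<int>"
    then obtain i where "of_rat (es c k) = (of_rat (of_int i) :: complex)" using es[of c k] by (auto elim!: Ints_cases)
    then have "es c k = of_int i" by (simp only: of_rat_eq_iff)
    then show "es c k \<in> \<int>" by simp
  qed (auto simp flip: es elim!: Ints_cases)
  then show ?thesis using OK_iff_esym_int[OF el_KF] by (simp add: okc_def)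
qed

lemma N_el: "N (el c) = of_rat (nm c)"
proof -
  have "cmod (of_rat r) = of_rat \<bar>r\<bar>" for r
  proof -
    obtain a b where "r = of_int a / of_int b" by (cases r rule: Rat_cases) (auto simp: Fract_of_int_quotient)
    then show ?thesis by (simp add: of_rat_divide norm_divide abs_divide flip: of_int_abs)
  qed
  then show ?thesis unfolding N_esym nm_def by (simp flip: es)
qed

lemma unit_iff: "u \<in> UK \<longleftrightarrow> u \<in> OK & N u = 1"
proof
  assume u: "u \<in> OK & N u = 1"
  have "(%z. of_real (N u) / u z) \<in> OK" using conorm_OK u by blast
  moreover have "u z ~= 0" if "z \<in> Z" for z using u that N_zero_iff[of u] by auto
  ultimately show "u \<in> UK" using u by (auto simp: UK_def intro!: bexI[of _ "%z. of_real (N u) / u z"])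
qed (use N_UK UK_OK in auto)

lemma bx_exists:
  assumes x: "x \<in> OK" and B: "!!i. i < n ==> cmod (cf x i) <= real B"
  shows "\<exists>w<(2 * (DD * B) + 1) ^ n. \<forall>z\<in>Z. el (bx (DD * B) w) z = x z"
proof -
  define L where "L = DD * B"
  have DD: "DD > 0" by (simp add: DD_def)
  have "\<forall>i\<in>{..<n}. \<exists>k::int. of_nat DD * cf x i = of_int k" using DD_cf_int[OF x] by (auto elim!: Ints_cases)
  then obtain k where k: "!!i. i < n ==> of_nat DD * cf x i = of_int (k i)" by (metis lessThan_iff)
  have ab: "\<bar>k i\<bar> <= int L" if "i < n" for i
  proof -
    have "real_of_int \<bar>k i\<bar> = cmod (of_nat DD * cf x i)" using k[OF that] by simp
    also have "... <= real DD * real B" unfolding norm_mult norm_of_nat by (intro mult_left_mono B that) auto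
    finally have "real_of_int \<bar>k i\<bar> <= real_of_int (int L)" by (simp add: L_def)
    then show ?thesis by linarith
  qed
  obtain w where w: "w < (2 * L + 1) ^ n" "\<forall>i<n. dig (2 * L + 1) w i = nat (k i + int L)"
    using dig_exists[of n "%i. nat (k i + int L)" "2 * L + 1"] ab by fastforce
  have "el (bx L w) z = x z" if z: "z \<in> Z" for z
  proof -
    have "of_rat (bx L w i) = cf x i" if i: "i < n" for i
    proof -
      have "int (nat (k i + int L)) = k i + int L" using ab[OF i] by simp
      then have "of_nat (dig (2 * L + 1) w i) = (of_int (k i + int L) :: rat)" using w(2) i by (metis of_int_of_nat_eq)
      then have "bx L w i = of_int (k i) / of_nat DD" using i by (simp add: bx_def)
      then have "of_rat (bx L w i) = (of_int (k i) :: complex) / of_nat DD" by (simp add: of_rat_divide)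
      then show ?thesis unfolding k[OF i, symmetric] using DD by simp
    qed
    then show ?thesis using cf_expand[OF z, of x] by (simp add: el_tn bx_def)
  qed
  then show ?thesis using w(1) unfolding L_def by blast
qed

lemma N_perturb:
  assumes h: "!!z. z \<in> Z ==> cmod (x z - y z) <= h" and b: "!!z. z \<in> Z ==> cmod (y z) <= b"
  shows "N x <= N y + ((b + h) ^ n - b ^ n)"
proof -
  obtain z0 where z0: "z0 \<in> Z" using Z_nonempty by blast
  have bh: "b >= 0" "h >= 0" using b[OF z0] h[OF z0] norm_ge_zero order_trans by blast+
  have "N x <= (\<Prod>z\<in>Z. cmod (y z) + h)" unfolding N_def
  proof (rule prod_mono, rule conjI)
    fix z assume "z \<in> Z"
    then show "cmod (x z) <= cmod (y z) + h" using h[of z] norm_triangle_ineq[of "y z" "x z - y z"] by simp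
  qed simp
  also have "... <= N y + ((b + h) ^ n - b ^ n)"
    unfolding N_def card_Z[symmetric] by (rule prod_shift_le) (use finite_Z b bh in auto)
  finally show ?thesis .
qed

text \<open>\<open>q\<close> is the claimed minimum, and \<open>P\<close> lists \<open>s\<close>
  torsion points with common denominator \<open>d\<close>. After the bounds on these data the
  clauses say that bounded units map listed classes to listed classes; that no translate of a listed
  point by an integer from a box has norm below \<open>q\<close>; that each listed point has a
  translate of norm at most \<open>q\<close>; that 1 / K is too small for a bounded unit to carry
  the neighbourhood of one listed class into that of another; and that every grid cube either lies
  within 1 / K of a listed class or has one translate with norm at most \<open>q\<close> throughout
  the cube.\<close>

definition cert :: "rat => nat => nat => (nat => nat => rat) => nat => nat => nat => bool" where
  "cert q Q s P d K H \<longleftrightarrow> 0 < s & 0 < d & 0 < H & q <= of_nat Q \<and>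
     (\<forall>j<s. tn (P j) & (\<forall>i<n. \<bar>P j i\<bar> <= 1 & of_nat d * P j i \<in> \<int>)) \<and>
     (\<forall>j<s. \<forall>w<(2 * (DD * (AA * CC)) + 1) ^ n. okc (bx (DD * (AA * CC)) w) --> nm (bx (DD * (AA * CC)) w) = 1 -->
        (\<exists>j'<s. okc (%k. (\<Sum>i\<le>k. bx (DD * (AA * CC)) w i * P j (k - i)) - P j' k))) \<and>
     (\<forall>j<s. \<forall>w<(2 * (DD * (AA * (CC * (1 + Q)) + 1)) + 1) ^ n. okc (bx (DD * (AA * (CC * (1 + Q)) + 1)) w) -->
        q <= nm (%i. P j i + bx (DD * (AA * (CC * (1 + Q)) + 1)) w i)) \<and>
     (\<forall>j<s. \<exists>a. tn a & okc a & nm (%i. P j i + a i) <= q) \<and>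
     (AA * (CC * BB) + 1) * DD * d < K \<and>
     (\<forall>w<H ^ n. (\<exists>j<s. \<exists>a. tn a & okc a & (\<forall>i<n. \<bar>gr H w i - P j i - a i\<bar> + 1 / of_nat H <= 1 / of_nat K)) \<or>
        (\<exists>a A. tn a & okc a & (\<forall>i<n. \<bar>gr H w i + a i\<bar> <= of_nat A) \<and>
          nm (%i. gr H w i + a i) + ((of_nat (BB * A) + of_nat BB / of_nat H) ^ n - of_nat (BB * A) ^ n) <= q))"

end

section \<open>Soundness of certificates\<close>

context numfield_units begin

lemma bounded_pisot:
  assumes "w \<in> Z"
  shows "\<exists>u\<in>UK. (\<forall>z\<in>Z. cmod (u z) <= CC) & (\<forall>z\<in>Z - PP w. cmod (u z) < 1 / 2) & 1 < cmod (u w)"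
proof -
  obtain u where u: "u \<in> UK" "\<forall>z\<in>Z - PP w. cmod (u z) < 1 / 2" "1 < cmod (u w)" "cmod (u w) <= CC"
    using exists_pisot_unit[OF assms card_PP[OF assms]] by blast
  have "u \<in> EE" using u(1) UK_OK OK_EE by blast
  then have "cmod (u (cnj w)) = cmod (u w)" using assms by (simp add: EE_def)
  then have "cmod (u z) <= CC" if "z \<in> Z" for z using u(2,3,4) that by (cases "z \<in> PP w") (auto dest!: bspec[of _ _ z])
  then show ?thesis using u by blast
qed

text \<open>The norm is below \<open>t\<close>, so some conjugate, at \<open>v\<close>, is below
  \<open>t\<close>. A bounded unit that is large at \<open>v\<close> halves the bound for the
  conjugates off \<open>v\<close> and \<open>cnj v\<close> and keeps the remaining ones below CC t.
  Repeating this ends in the box.\<close>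

lemma unit_reduction:
  assumes Y: "!!u y. u \<in> UK ==> \<forall>z\<in>Z. cmod (u z) <= CC ==> y \<in> Y ==> u * y \<in> Y" and YE: "Y \<subseteq> EE"
    and y: "y \<in> Y" and N: "N y < t" and t: "t >= 1"
  shows "\<exists>y'\<in>Y. N y' = N y & (\<forall>z\<in>Z. cmod (y' z) <= real CC * t)"
proof -
  obtain w0 where w0: "w0 \<in> Z" using Z_nonempty by blast
  obtain u0 where u0: "1 < cmod (u0 w0)" "cmod (u0 w0) <= CC" using bounded_pisot[OF w0] w0 by blast
  then have CC: "real CC >= 1" by linarith
  have step: "\<exists>y'\<in>Y. N y' = N y & (\<forall>z\<in>Z. cmod (y' z) <= real CC * t)"
    if "y \<in> Y" "N y < t" "\<forall>z\<in>Z. cmod (y z) <= 2 ^ k * (real CC * t)" for y and k :: nat using that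
  proof (induction k arbitrary: y)
    case 0 then show ?case by auto
  next
    case (Suc k)
    have "\<exists>v\<in>Z. cmod (y v) < t"
    proof (rule ccontr)
      assume "\<not> ?thesis"
      then have "(\<Prod>z\<in>Z. t) <= N y" unfolding N_def using t by (intro prod_mono) (auto simp: not_less)
      moreover have "t ^ 1 <= t ^ n" using t n_pos by (intro power_increasing) auto
      ultimately show False using Suc.prems(2) by (simp add: card_Z)
    qed
    then obtain v where v: "v \<in> Z" "cmod (y v) < t" by blast
    obtain u where u: "u \<in> UK" "\<forall>z\<in>Z. cmod (u z) <= CC" "\<forall>z\<in>Z - PP v. cmod (u z) < 1 / 2" using bounded_pisot[OF v(1)] by blast
    have uy: "u * y \<in> Y" by (rule Y[OF u(1,2) Suc.prems(1)])
    have Nu: "N (u * y) = N y" by (simp add: N_mult N_UK[OF u(1)])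
    have "cmod ((u * y) z) <= 2 ^ k * (real CC * t)" if z: "z \<in> Z" for z
    proof (cases "z \<in> PP v")
      case True
      have "y \<in> EE" using Suc.prems(1) YE by blast
      then have "cmod (y (cnj v)) = cmod (y v)" using v(1) by (simp add: EE_def)
      then have "cmod (y z) < t" using True v(2) by auto
      then have "cmod ((u * y) z) <= real CC * t" using u(2) z t by (simp add: norm_mult) (intro mult_mono, auto)
      also have "... <= 2 ^ k * (real CC * t)" using CC t by simp
      finally show ?thesis .
    next
      case False
      then have "cmod (u z) * cmod (y z) <= 1 / 2 * (2 ^ Suc k * (real CC * t))"
        using u(3) z Suc.prems(3) by (intro mult_mono) (auto intro: less_imp_le)
      then show ?thesis by (simp add: norm_mult)
    qed
    then have bd: "\<forall>z\<in>Z. cmod ((u * y) z) <= 2 ^ k * (real CC * t)" by blast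
    have "N (u * y) < t" using Suc.prems(2) Nu by simp
    from Suc.IH[OF uy this bd] show ?case unfolding Nu .
  qed
  define b where "b = (\<Sum>z\<in>Z. cmod (y z))"
  obtain k :: nat where k: "b < 2 ^ k" using real_arch_pow[of 2 b] by auto
  have "cmod (y z) <= 2 ^ k * (real CC * t)" if "z \<in> Z" for z
  proof -
    have "cmod (y z) <= b" unfolding b_def by (rule member_le_sum) (use that finite_Z in auto)
    also have "... <= 2 ^ k * 1" using k by simp
    also have "... <= 2 ^ k * (real CC * t)" using mult_mono[OF CC t] by (intro mult_left_mono) auto
    finally show ?thesis .
  qed
  then show ?thesis using step[OF y N] by blast
qed

lemma cert_sound:
  assumes cert: "cert q Q s P d K H" shows "MM = of_rat q"
proof (rule antisym)
  define L1 where "L1 = DD * (AA * CC)"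
  define L2 where "L2 = DD * (AA * (CC * (1 + Q)) + 1)"
  have pos: "0 < s" "0 < d" "0 < H" "q <= of_nat Q" and P: "!!j. j < s ==> tn (P j)"
    and P1: "!!j i. j < s ==> i < n ==> \<bar>P j i\<bar> <= 1" and Pd: "!!j i. j < s ==> i < n ==> of_nat d * P j i \<in> \<int>"
    and c2: "!!j w. j < s ==> w < (2 * L1 + 1) ^ n ==> okc (bx L1 w) ==> nm (bx L1 w) = 1 ==>
        (\<exists>j'<s. okc (%k. (\<Sum>i\<le>k. bx L1 w i * P j (k - i)) - P j' k))"
    and c3: "!!j w. j < s ==> w < (2 * L2 + 1) ^ n ==> okc (bx L2 w) ==> q <= nm (%i. P j i + bx L2 w i)"
    and c4: "!!j. j < s ==> \<exists>a. tn a & okc a & nm (%i. P j i + a i) <= q"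
    and c5: "(AA * (CC * BB) + 1) * DD * d < K"
    and c6: "!!w. w < H ^ n ==> (\<exists>j<s. \<exists>a. tn a & okc a & (\<forall>i<n. \<bar>gr H w i - P j i - a i\<bar> + 1 / of_nat H <= 1 / of_nat K)) \<or>
        (\<exists>a A. tn a & okc a & (\<forall>i<n. \<bar>gr H w i + a i\<bar> <= of_nat A) \<and>
          nm (%i. gr H w i + a i) + ((of_nat (BB * A) + of_nat BB / of_nat H) ^ n - of_nat (BB * A) ^ n) <= q)"
    using cert unfolding cert_def L1_def[symmetric] L2_def[symmetric] by auto
  have DD: "DD > 0" by (simp add: DD_def)
  have elE: "el c \<in> EE" for c using el_KF KF_EE by blast
  have un: "\<exists>j'<s. u * el (P j) - el (P j') \<in> OK" if u: "u \<in> UK" "\<forall>z\<in>Z. cmod (u z) <= CC" and j: "j < s" for u j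
  proof -
    have uO: "u \<in> OK" using u UK_OK by blast
    obtain w where w: "w < (2 * L1 + 1) ^ n" "\<forall>z\<in>Z. el (bx L1 w) z = u z"
      using bx_exists[OF uO, of "AA * CC"] cf_le[of u "real CC"] u(2) by (auto simp: L1_def)
    have b: "el (bx L1 w) \<in> OK" by (rule OK_cong[OF uO]) (use w in simp)
    have "N (el (bx L1 w)) = 1" using N_cong[of "el (bx L1 w)" u] w N_UK[OF u(1)] by simp
    then have "nm (bx L1 w) = 1" by (simp add: N_el)
    then obtain j' where j': "j' < s" "okc (%k. (\<Sum>i\<le>k. bx L1 w i * P j (k - i)) - P j' k)"
      using c2[OF j w(1)] b by (auto simp: okc_iff)
    have "el (bx L1 w) * el (P j) - el (P j') \<in> OK"
      using j'(2) unfolding okc_iff el_diff by (subst (asm) el_conv) (use P j in \<open>auto simp: bx_def\<close>)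
    then have "u * el (P j) - el (P j') \<in> OK" by (rule OK_cong) (use w in simp)
    then show ?thesis using j'(1) by blast
  qed
  show "of_rat q <= MM"
  proof -
    \<comment> \<open>Stable under bounded units by \<open>un\<close>, so a translate of norm below
      \<open>q\<close> can be reduced into the box that \<open>c3\<close> inspects.\<close>
    define Y where "Y = {y \<in> EE. \<exists>j<s. y - el (P j) \<in> OK}"
    have Yu: "u * y \<in> Y" if u: "u \<in> UK" "\<forall>z\<in>Z. cmod (u z) <= CC" and y: "y \<in> Y" for u y
    proof -
      obtain j where j: "j < s" "y - el (P j) \<in> OK" "y \<in> EE" using y by (auto simp: Y_def)
      obtain j' where j': "j' < s" "u * el (P j) - el (P j') \<in> OK" using un[OF u j(1)] by blast
      have "u * (y - el (P j)) + (u * el (P j) - el (P j')) \<in> OK" using j(2) j'(2) u(1) UK_OK OK_add OK_mult by blast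
      then have "u * y - el (P j') \<in> OK" by (simp add: algebra_simps)
      then show ?thesis using j' j(3) u(1) UK_OK OK_EE EE_mult by (auto simp: Y_def)
    qed
    have "of_rat q <= N (el (P 0) + a)" if a: "a \<in> OK" for a
    proof (rule ccontr)
      assume "\<not> ?thesis"
      then have lt: "N (el (P 0) + a) < of_rat q" by simp
      have "of_rat q <= (of_rat (of_nat Q) :: real)" using pos(4) by (simp only: of_rat_less_eq)
      then have "N (el (P 0) + a) < 1 + real Q" using lt by simp
      moreover have "el (P 0) + a \<in> Y" using a pos(1) elE OK_EE EE_add by (auto simp: Y_def intro!: exI[of _ 0])
      ultimately obtain y where y: "y \<in> Y" "N y = N (el (P 0) + a)" "\<forall>z\<in>Z. cmod (y z) <= real CC * (1 + real Q)"
        using unit_reduction[of Y "el (P 0) + a" "1 + real Q"] Yu by (auto simp: Y_def)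
      then obtain j where j: "j < s" "y - el (P j) \<in> OK" by (auto simp: Y_def)
      have "cmod (cf (y - el (P j)) i) <= real (AA * (CC * (1 + Q)) + 1)" if i: "i < n" for i
      proof -
        have "cmod (cf y i) <= real AA * (real CC * (1 + real Q))" by (rule cf_le) (use y(3) in blast)
        moreover have "cmod (cf (el (P j)) i) <= 1"
        proof -
          have "\<bar>real_of_rat (P j i)\<bar> <= 1" using P1[OF j(1) i] by (metis abs_of_rat of_rat_1 of_rat_less_eq)
          moreover have "(of_rat (P j i) :: complex) = of_real (of_rat (P j i))" by (cases "P j i") (simp add: of_rat_rat)
          ultimately show ?thesis using cf_el[OF P[OF j(1)] i] by simp
        qed
        moreover have "real (AA * (CC * (1 + Q)) + 1) = real AA * (real CC * (1 + real Q)) + 1" by (simp add: distrib_left)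
        ultimately show ?thesis using norm_triangle_ineq4[of "cf y i" "cf (el (P j)) i"] unfolding cf_diff by linarith
      qed
      then obtain w where w: "w < (2 * L2 + 1) ^ n" "\<forall>z\<in>Z. el (bx L2 w) z = (y - el (P j)) z"
        using bx_exists[OF j(2), of "AA * (CC * (1 + Q)) + 1"] unfolding L2_def by blast
      have "el (bx L2 w) \<in> OK" by (rule OK_cong[OF j(2)]) (use w in simp)
      then have "q <= nm (%i. P j i + bx L2 w i)" using c3[OF j(1) w(1)] by (simp add: okc_iff)
      then have "of_rat q <= N (el (P j) + el (bx L2 w))" unfolding el_add[symmetric] N_el by (simp only: of_rat_less_eq)
      also have "N (el (P j) + el (bx L2 w)) = N y" by (rule N_cong) (use w in simp)
      finally show False using lt y(2) by simp
    qed
    then have "of_rat q <= mm (el (P 0))" using SS_iff[of "el (P 0)" "of_rat q"] elE by (auto simp: SS_def)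
    then show ?thesis using mm_le_MM[OF elE] order_trans by blast
  qed
  define E where "E = 1 / real K"
  have K: "K > 0" using c5 by auto
  \<comment> \<open>A cube of the second kind has minimum at most \<open>q\<close> everywhere, so
    the cube of \<open>x\<close> is close to the list.\<close>
  have near: "\<exists>j<s. \<exists>a\<in>OK. \<exists>delta\<in>EE. (\<forall>z\<in>Z. x z = (el (P j) + a + delta) z) & (\<forall>i<n. cmod (cf delta i) <= E)"
    if x: "x \<in> EE" "of_rat q < mm x" for x
  proof -
    obtain c where c: "!!z. z \<in> Z ==> x z = (\<Sum>i<n. of_real (c i) * z ^ i)" using EE_expand'[OF x(1)] by blast
    define b where "b = (%z::complex. \<Sum>i<n. of_int \<lfloor>c i\<rfloor> * z ^ i)"
    have b: "b \<in> OK" unfolding b_def by (rule OK_int_sum)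
    define m where "m i = nat \<lfloor>real H * frac (c i)\<rfloor>" for i
    have Hf: "0 <= real H * frac (c i)" "real H * frac (c i) < real H" for i
      using pos(3) frac_ge_0[of "c i"] frac_lt_1[of "c i"] by auto
    have mH: "m i < H" for i using Hf[of i] unfolding m_def by linarith
    obtain w where w: "w < H ^ n" "\<forall>i<n. dig H w i = m i" using dig_exists[of n m H] mH by blast
    define y where "y = gr H w"
    have tny: "tn y" by (simp add: y_def gr_def)
    have yc: "real_of_rat (y i) = real (m i) / real H" if "i < n" for i using w(2) that by (simp add: y_def gr_def of_rat_divide)
    have close: "\<bar>frac (c i) - real_of_rat (y i)\<bar> <= 1 / real H" if i: "i < n" for i
    proof -
      have "real (m i) <= real H * frac (c i)" "real H * frac (c i) < real (m i) + 1" using Hf[of i] by (auto simp: m_def)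
      then have "\<bar>real H * frac (c i) - real (m i)\<bar> <= 1" by linarith
      moreover have "frac (c i) - real_of_rat (y i) = (real H * frac (c i) - real (m i)) / real H"
        using pos(3) yc[OF i] by (simp add: field_simps)
      ultimately show ?thesis using pos(3) by (simp add: abs_divide divide_right_mono)
    qed
    have xb: "(x - b) z = (\<Sum>i<n. of_real (frac (c i)) * z ^ i)" if "z \<in> Z" for z
      using c[OF that] by (simp add: b_def frac_def left_diff_distrib sum_subtractf)
    have rc: "(of_rat r :: complex) = of_real (of_rat r)" for r by (cases r) (simp add: of_rat_rat)
    from c6[OF w(1)] show ?thesis unfolding y_def[symmetric]
    proof (elim disjE exE conjE)
      fix j a assume j: "j < s" and a: "tn a" "okc a" and le: "\<forall>i<n. \<bar>y i - P j i - a i\<bar> + 1 / rat_of_nat H <= 1 / rat_of_nat K"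
      define delta where "delta = (%z::complex. \<Sum>i<n. of_real (frac (c i) - of_rat (P j i + a i)) * z ^ i)"
      have deltaE: "delta \<in> EE" unfolding delta_def by (rule EE_real_sum)
      have "x z = (el (P j) + (b + el a) + delta) z" if "z \<in> Z" for z
        using xb[OF that] P[OF j] a(1) unfolding minus_apply diff_eq_eq
        by (simp add: delta_def el_tn rc of_rat_add left_diff_distrib distrib_right sum_subtractf sum.distrib)
      moreover have "b + el a \<in> OK" using b a(2) okc_iff OK_add by blast
      moreover have "cmod (cf delta i) <= E" if i: "i < n" for i
      proof -
        have "cf delta i = of_real (frac (c i) - of_rat (P j i + a i))" by (rule cf_eqI[OF _ i]) (simp add: delta_def)
        then have e: "cmod (cf delta i) = \<bar>frac (c i) - of_rat (P j i + a i)\<bar>" by (simp only: norm_of_real)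
        have "real_of_rat (\<bar>y i - P j i - a i\<bar> + 1 / rat_of_nat H) <= of_rat (1 / rat_of_nat K)"
          using le i by (simp only: of_rat_less_eq)
        then have "\<bar>real_of_rat (y i) - of_rat (P j i + a i)\<bar> + 1 / real H <= E"
          by (simp add: E_def of_rat_add of_rat_diff of_rat_divide abs_of_rat[symmetric] diff_diff_eq)
        then show ?thesis using close[OF i] unfolding e by linarith
      qed
      ultimately show ?thesis using j deltaE by blast
    next
      fix a A assume a: "tn a" "okc a" and A: "\<forall>i<n. \<bar>y i + a i\<bar> <= rat_of_nat A"
        and le: "nm (%i. y i + a i) + ((of_nat (BB * A) + of_nat BB / of_nat H) ^ n - of_nat (BB * A) ^ n) <= q"
      define v where "v = el (%i. y i + a i)"
      have tv: "tn (%i. y i + a i)" using tny a(1) by simp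
      have "N (x - b + el a) <= N v + ((real (BB * A) + real BB / real H) ^ n - real (BB * A) ^ n)"
      proof (rule N_perturb)
        fix z assume z: "z \<in> Z"
        have "(x - b + el a) z - v z = (\<Sum>i<n. of_real (frac (c i) - of_rat (y i)) * z ^ i)"
          using xb[OF z] a(1) tny unfolding v_def el_add by (simp add: el_tn rc left_diff_distrib sum_subtractf)
        also have "cmod ... <= real n * real R ^ n * (1 / real H)"
          by (rule cmod_expand_le[OF z]) (use close in \<open>simp del: of_real_diff\<close>)
        finally show "cmod ((x - b + el a) z - v z) <= real BB / real H" by (simp add: BB_def)
        have "cmod (v z) <= real n * real R ^ n * real A" unfolding v_def el_tn[OF tv]
        proof (rule cmod_expand_le[OF z])
          fix i assume "i < n"
          then have "real_of_rat \<bar>y i + a i\<bar> <= of_rat (rat_of_nat A)" using A by (simp only: of_rat_less_eq)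
          then show "cmod (of_rat (y i + a i)) <= real A" unfolding rc by (simp add: abs_of_rat)
        qed
        then show "cmod (v z) <= real (BB * A)" by (simp add: BB_def)
      qed
      also have "... = of_rat (nm (%i. y i + a i) + ((of_nat (BB * A) + of_nat BB / of_nat H) ^ n - of_nat (BB * A) ^ n))"
        unfolding v_def N_el of_rat_add of_rat_diff of_rat_power of_rat_divide of_rat_of_nat_eq ..
      also have "... <= of_rat q" using le by (simp only: of_rat_less_eq)
      also have "x - b + el a = x + (- b + el a)" by simp
      finally have "N (x + (- b + el a)) <= of_rat q" .
      moreover have "- b + el a \<in> OK" using b a(2) okc_iff OK_add OK_uminus by blast
      ultimately show ?thesis using mm_le[of "- b + el a" x] x(2) by linarith
    qed
  qed
  have Eb: "cmod (delta z) <= real BB * E" if "!!i. i < n ==> cmod (cf delta i) <= E" "z \<in> Z" for delta z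
    using cmod_expand_le[OF that(2), of "cf delta" E] that cf_expand[OF that(2)] by (simp add: BB_def)
  \<comment> \<open>Hypothetical small deviations from the list with minimum above \<open>q\<close>.
    Bounded units map \<open>Delta\<close> to itself, so an expanding one forces every deviation to
    be 0.\<close>
  define Delta where "Delta = {delta \<in> EE. (\<forall>i<n. cmod (cf delta i) <= E) & (\<exists>j<s. of_rat q < mm (el (P j) + delta))}"
  have Deltau: "u * delta \<in> Delta" if u: "u \<in> UK" "\<forall>z\<in>Z. cmod (u z) <= CC" and d: "delta \<in> Delta" for u delta
  proof -
    obtain j where j: "j < s" "of_rat q < mm (el (P j) + delta)" and delta: "delta \<in> EE" "!!i. i < n ==> cmod (cf delta i) <= E"
      using d by (auto simp: Delta_def)
    have uE: "u \<in> EE" using u(1) UK_OK OK_EE by blast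
    obtain j' where j': "j' < s" "u * el (P j) - el (P j') \<in> OK" using un[OF u j(1)] by blast
    have "mm (el (P j) + delta) <= mm (u * (el (P j) + delta))" by (rule mm_UK[OF u(1)]) (intro EE_add elE delta)
    also have "... <= mm (u * (el (P j) + delta) + - (u * el (P j) - el (P j')))"
      by (rule mm_add[OF OK_uminus[OF j'(2)]]) (intro EE_mult uE EE_add elE delta)
    also have "... = mm (el (P j') + u * delta)" by (simp add: algebra_simps)
    finally have mq: "of_rat q < mm (el (P j') + u * delta)" using j(2) by simp
    have udE: "u * delta \<in> EE" by (intro EE_mult uE delta)
    obtain k a delta' where k: "k < s" "a \<in> OK" "delta' \<in> EE" "\<forall>z\<in>Z. (el (P j') + u * delta) z = (el (P k) + a + delta') z"
      "\<forall>i<n. cmod (cf delta' i) <= E" using near[OF EE_add[OF elE udE] mq] by blast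
    \<comment> \<open>The two coefficients differ by a multiple of 1 / (DD d), and by
      \<open>c5\<close> their difference is smaller than that.\<close>
    have small: "cf (u * delta) i = cf delta' i" if i: "i < n" for i
    proof (rule ccontr)
      assume ne: "cf (u * delta) i ~= cf delta' i"
      have "cf (u * delta - delta') i = cf (el (P k) - el (P j') + a) i" by (rule cf_cong) (use k(4) in \<open>auto simp: algebra_simps\<close>)
      also have "el (P k) - el (P j') + a = el (P k) - (el (P j') - a)" by simp
      finally have cfe: "cf (u * delta) i - cf delta' i = of_rat (P k i) - of_rat (P j' i) + cf a i"
        using cf_el[OF P i] k(1) j'(1) by (simp only: cf_diff) simp
      obtain p1 p2 where pp: "of_nat d * P k i = of_int p1" "of_nat d * P j' i = of_int p2"
        using Pd[OF k(1) i] Pd[OF j'(1) i] by (auto elim!: Ints_cases)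
      obtain p3 where p3: "of_nat DD * cf a i = of_int p3" using DD_cf_int[OF k(2) i] by (auto elim!: Ints_cases)
      have e1: "of_nat d * of_rat (P k i) = (of_int p1 :: complex)" "of_nat d * of_rat (P j' i) = (of_int p2 :: complex)"
        using arg_cong[OF pp(1), of "of_rat :: rat => complex"] arg_cong[OF pp(2), of "of_rat :: rat => complex"] by (simp_all add: of_rat_mult)
      have "of_nat (DD * d) * (cf (u * delta) i - cf delta' i) =
          of_nat DD * (of_nat d * of_rat (P k i)) - of_nat DD * (of_nat d * of_rat (P j' i)) + of_nat d * (of_nat DD * cf a i)"
        unfolding cfe by (simp add: algebra_simps)
      also have "... = of_int (int DD * (p1 - p2) + int d * p3)" unfolding e1 p3 by (simp add: algebra_simps)
      finally have e: "of_nat (DD * d) * (cf (u * delta) i - cf delta' i) = of_int (int DD * (p1 - p2) + int d * p3)" .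
      have "of_nat (DD * d) * (cf (u * delta) i - cf delta' i) ~= 0" using ne DD pos(2) by simp
      then have "(int DD * (p1 - p2) + int d * p3) ~= 0" unfolding e by (metis of_int_0)
      then have "1 <= cmod (of_int (int DD * (p1 - p2) + int d * p3))" unfolding norm_of_int by linarith
      then have "1 <= real (DD * d) * cmod (cf (u * delta) i - cf delta' i)" unfolding e[symmetric] norm_mult norm_of_nat .
      also have "... <= real (DD * d) * (real AA * (real CC * (real BB * E)) + E)"
      proof (intro mult_left_mono order_trans[OF norm_triangle_ineq4] add_mono cf_le)
        fix z assume "z \<in> Z"
        then show "cmod ((u * delta) z) <= real CC * (real BB * E)"
          using u(2) Eb[OF delta(2)] by (simp add: norm_mult) (intro mult_mono, auto)
      qed (use k(5) i in auto)
      also have "... = real ((AA * (CC * BB) + 1) * DD * d) * E" by (simp add: algebra_simps)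
      also have "... < real K * E" using c5 K by (intro mult_strict_right_mono) (auto simp: E_def simp del: of_nat_mult of_nat_add)
      also have "... = 1" using K by (simp add: E_def)
      finally show False by simp
    qed
    then have "\<forall>i<n. cmod (cf (u * delta) i) <= E" using k(5) by simp
    then show ?thesis using udE mq j'(1) by (auto simp: Delta_def)
  qed
  have Delta0: "delta w = 0" if d: "delta \<in> Delta" and w: "w \<in> Z" for delta w
  proof (rule ccontr)
    assume ne: "delta w ~= 0"
    obtain u where u: "u \<in> UK" "\<forall>z\<in>Z. cmod (u z) <= CC" "1 < cmod (u w)" using bounded_pisot[OF w] by blast
    have "u ^ k * delta \<in> Delta" for k
    proof (induction k)
      case 0 then show ?case using d by (simp only: power_0 mult_1)
    next
      case (Suc k)
      show ?case unfolding power_Suc mult.assoc by (rule Deltau[OF u(1,2) Suc])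
    qed
    then have "cmod ((u ^ k * delta) w) <= real BB * E" for k
      by (intro Eb[OF _ w]) (use \<open>!!k. u ^ k * delta \<in> Delta\<close> in \<open>simp only: Delta_def mem_Collect_eq\<close>)
    then have *: "cmod (u w) ^ k * cmod (delta w) <= real BB * E" for k by (simp add: norm_mult norm_power)
    obtain k where "real BB * E / cmod (delta w) < cmod (u w) ^ k" using real_arch_pow[OF u(3)] by blast
    then show False using *[of k] ne by (simp add: field_simps)
  qed
  have "mm x <= of_rat q" if x: "x \<in> EE" for x
  proof (rule ccontr)
    assume "\<not> ?thesis"
    then have q: "of_rat q < mm x" by simp
    obtain j a delta where j: "j < s" "a \<in> OK" "delta \<in> EE" "\<forall>z\<in>Z. x z = (el (P j) + a + delta) z" "\<forall>i<n. cmod (cf delta i) <= E"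
      using near[OF x q] by blast
    have "mm x <= mm (x + - a)" by (rule mm_add[OF OK_uminus[OF j(2)] x])
    also have "... = mm (el (P j) + delta)" by (rule mm_cong) (use j(4) in simp)
    finally have dq: "of_rat q < mm (el (P j) + delta)" using q by simp
    then have "delta \<in> Delta" using j by (auto simp: Delta_def)
    then have e: "mm (el (P j) + delta) = mm (el (P j))" using Delta0 by (intro mm_cong) simp
    obtain b where b: "okc b" "nm (%i. P j i + b i) <= q" using c4[OF j(1)] by blast
    have "mm (el (P j)) <= N (el (P j) + el b)" using b(1) okc_iff mm_le by blast
    also have "... <= of_rat q" using b(2) unfolding el_add[symmetric] N_el by (simp only: of_rat_less_eq)
    finally show False using dq e by simp
  qed
  then show "MM <= of_rat q" unfolding MM_def using EE_0 by (intro cSUP_least) auto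
qed

end

section \<open>Existence of certificates\<close>

context numfield_units begin

lemma reduced_vector: assumes "f \<in> KF" shows "\<exists>p. tn p & (\<forall>i<n. \<bar>p i\<bar> <= 1) & f - el p \<in> OK"
proof -
  obtain c where c: "tn c" "\<forall>z\<in>Z. el c z = f z" using el_exists[OF assms] by blast
  have tf: "tn (%i. of_int \<lfloor>c i\<rfloor>)" using c(1) by simp
  have tp: "tn (%i. frac (c i))" using c(1) by simp
  have "(%z. \<Sum>i<n. of_int \<lfloor>c i\<rfloor> * z ^ i) \<in> OK" by (rule OK_int_sum)
  then have "f - el (%i. frac (c i)) \<in> OK"
  proof (rule OK_cong)
    fix z assume z: "z \<in> Z"
    have f: "f z = (\<Sum>i<n. of_rat (c i) * z ^ i)" using c(2) z el_tn[OF c(1), of z] by simp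
    show "(\<Sum>i<n. of_int \<lfloor>c i\<rfloor> * z ^ i) = (f - el (%i. frac (c i))) z"
      unfolding minus_apply el_tn[OF tp] f by (simp add: frac_def of_rat_diff left_diff_distrib sum_subtractf)
  qed
  moreover have "\<bar>frac (c i)\<bar> <= 1" for i using frac_lt_1[of "c i"] by (simp add: less_imp_le)
  ultimately show ?thesis using tp by (intro exI[of _ "%i. frac (c i)"] conjI) auto
qed

definition top_reps :: "nat => (nat => nat => rat) => bool" where
  "top_reps s P \<longleftrightarrow> s > 0 & (\<forall>j<s. tn (P j) & (\<forall>i<n. \<bar>P j i\<bar> <= 1) & el (P j) \<in> SS MM) & (\<forall>x\<in>SS MM. \<exists>j<s. x - el (P j) \<in> OK)"

lemma top_representatives: "\<exists>s P. top_reps s P"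
proof -
  obtain t F where F: "t < MM" "finite F" "F \<subseteq> KF" "\<forall>x\<in>SS t. \<exists>f\<in>F. x - f \<in> OK" using finite_top by blast
  have near: "y \<in> SS MM" if "x \<in> SS MM" "x - y \<in> OK" for x y
    using invD[OF inv_SS that(1) OK_uminus[OF that(2)]] by simp
  define F' where "F' = F \<inter> SS MM"
  have F': "\<exists>f\<in>F'. x - f \<in> OK" if x: "x \<in> SS MM" for x
  proof -
    have "x \<in> SS t" using x F(1) by (simp add: SS_iff)
    then obtain f where "f \<in> F" "x - f \<in> OK" using F(4) by blast
    then show ?thesis using near[OF x] by (auto simp: F'_def)
  qed
  have fin: "finite F'" using F(2) by (simp add: F'_def)
  obtain h where h: "bij_betw h {0..<card F'} F'" using ex_bij_betw_nat_finite[OF fin] by blast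
  have s: "card F' > 0" using F' SS_MM_nonempty fin by (metis all_not_in_conv card_gt_0_iff)
  have hF: "h j \<in> F'" if "j < card F'" for j using h that by (auto simp: bij_betw_def)
  have "\<forall>j. \<exists>p. j < card F' --> tn p & (\<forall>i<n. \<bar>p i\<bar> <= 1) & h j - el p \<in> OK"
    using reduced_vector hF F(3) by (metis F'_def IntD1 subsetD)
  then obtain P where P: "!!j. j < card F' ==> tn (P j) & (\<forall>i<n. \<bar>P j i\<bar> <= 1) & h j - el (P j) \<in> OK" by metis
  show ?thesis
  proof (rule exI[of _ "card F'"], rule exI[of _ P], unfold top_reps_def, intro conjI allI impI ballI)
    fix j assume j: "j < card F'"
    show "el (P j) \<in> SS MM" by (rule near[of "h j"]) (use hF[OF j] P[OF j] in \<open>auto simp: F'_def\<close>)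
  next
    fix x assume "x \<in> SS MM"
    then obtain f where f: "f \<in> F'" "x - f \<in> OK" using F' by blast
    then obtain j where j: "j < card F'" "f = h j" using h unfolding bij_betw_def by (metis atLeastLessThan_iff imageE)
    have "(x - f) + (h j - el (P j)) \<in> OK" using f(2) P[OF j(1)] OK_add by blast
    then show "\<exists>j<card F'. x - el (P j) \<in> OK" using j by auto
  qed (use P s in auto)
qed

text \<open>The list consists of the classes at level \<open>MM\<close>, and \<open>q\<close> is
  \<open>MM\<close>. Only the grid needs an argument: if every mesh had a bad cube, the bad corners
  would accumulate at some \<open>l\<close>. If \<open>l\<close> is at the top level, late cubes lie
  near the list; otherwise a translate of \<open>l\<close> of norm below \<open>MM\<close> still
  works for late cubes, with the error terms included.\<close>

lemma cert_complete: "\<exists>q Q s P d K H. cert q Q s P d K H"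
proof -
  obtain q where q: "MM = of_rat q" using MM_rat by (elim Rats_cases)
  obtain s P where "top_reps s P" using top_representatives by blast
  then have s: "s > 0" and P: "!!j. j < s ==> tn (P j) & (\<forall>i<n. \<bar>P j i\<bar> <= 1) & el (P j) \<in> SS MM"
    and PS: "!!x. x \<in> SS MM ==> \<exists>j<s. x - el (P j) \<in> OK" by (auto simp: top_reps_def)
  obtain d where d: "d > 0" "\<forall>r\<in>(%(j, i). P j i) ` ({..<s} \<times> {..<n}). of_nat d * r \<in> (\<int> :: rat set)"
    using common_denominator[of "(%(j, i). P j i) ` ({..<s} \<times> {..<n})"] by blast
  obtain Q where Q: "q <= of_nat Q" using real_arch_simple by blast
  define K where "K = (AA * (CC * BB) + 1) * DD * d + 1"
  have Kpos: "K > 0" by (simp add: K_def)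
  have lower: "q <= nm (%i. P j i + a i)" if "j < s" "okc a" for j a
  proof -
    have "MM <= N (el (P j) + el a)" using P[OF that(1)] that(2) by (simp add: SS_def okc_iff)
    then show ?thesis unfolding el_add[symmetric] N_el q of_rat_less_eq .
  qed
  define good where "good H w \<longleftrightarrow> (\<exists>j<s. \<exists>a. tn a & okc a & (\<forall>i<n. \<bar>gr H w i - P j i - a i\<bar> + 1 / of_nat H <= 1 / of_nat K)) \<or>
        (\<exists>a A. tn a & okc a & (\<forall>i<n. \<bar>gr H w i + a i\<bar> <= of_nat A) \<and>
          nm (%i. gr H w i + a i) + ((of_nat (BB * A) + of_nat BB / of_nat H) ^ n - of_nat (BB * A) ^ n) <= q)" for H w
  have "\<exists>H>0. \<forall>w<H ^ n. good H w"
  proof (rule ccontr)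
    assume "\<not> ?thesis"
    then have "\<forall>k. \<exists>w. w < Suc k ^ n & \<not> good (Suc k) w" by auto
    then obtain w where w: "!!k. \<not> good (Suc k) (w k)" by metis
    define y where "y k = gr (Suc k) (w k)" for k
    have ty: "tn (y k)" for k by (simp add: y_def gr_def)
    have y01: "0 <= y k i" "y k i <= 1" for k i
    proof -
      have "dig (Suc k) (w k) i < Suc k" by (simp add: dig_def)
      then have "(of_nat (dig (Suc k) (w k) i) :: rat) <= of_nat (Suc k)" by (simp only: of_nat_le_iff)
      then show "0 <= y k i" "y k i <= 1" by (auto simp: y_def gr_def simp del: of_nat_Suc)
    qed
    have yn: "cmod (of_rat (y k i)) <= 1" for k i
    proof -
      have "(of_rat (y k i) :: complex) = of_real (of_rat (y k i))" by (cases "y k i") (simp add: of_rat_rat)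
      moreover have "real_of_rat (y k i) <= of_rat 1" "of_rat 0 <= real_of_rat (y k i)" using y01[where k = k and i = i] by (simp_all only: of_rat_less_eq)
      ultimately show ?thesis by simp
    qed
    have yE: "el (y k) \<in> EE" for k using el_KF KF_EE by blast
    have "cmod (el (y k) z) <= real n * real R ^ n * 1" if "z \<in> Z" for k z
      unfolding el_tn[OF ty] by (rule cmod_expand_le[OF that yn])
    then obtain l r where r: "strict_mono (r :: nat => nat)" and l: "conv (%k. el (y (r k))) l"
      using bounded_conv_subseq[of "%k. el (y k)" "real n * real R ^ n"] by auto
    have lE: "l \<in> EE" by (rule closedZD[OF closedZ_EE yE l])
    have inv0: "(%k. inverse (real (Suc (r k)))) \<longlonglongrightarrow> 0"
      using LIMSEQ_subseq_LIMSEQ[OF LIMSEQ_inverse_real_of_nat r] by (simp add: o_def)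
    have "\<exists>k. good (Suc (r k)) (w (r k))"
    proof (cases "l \<in> SS MM")
      case True
      then obtain j where j: "j < s" "l - el (P j) \<in> OK" using PS by blast
      obtain a where a: "tn a" "\<forall>z\<in>Z. el a z = (l - el (P j)) z" using el_exists j(2) OK_KF by blast
      have aO: "okc a" unfolding okc_iff by (rule OK_cong[OF j(2)]) (use a in simp)
      \<comment> \<open>One half of the allowance 1 / K goes to the distance from \<open>l\<close>,
        the other half to the mesh.\<close>
      define e where "e = 1 / (2 * real K * (1 + real AA))"
      have e: "e > 0" using Kpos by (simp add: e_def)
      obtain k1 where k1: "\<forall>k\<ge>k1. \<forall>z\<in>Z. cmod (el (y (r k)) z - l z) < e" using conv_close[OF l e] by blast
      have "\<forall>\<^sub>F k in sequentially. inverse (real (Suc (r k))) < 1 / (2 * real K)"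
        using order_tendstoD(2)[OF inv0, of "1 / (2 * real K)"] Kpos by simp
      then obtain k2 where k2: "\<forall>k\<ge>k2. inverse (real (Suc (r k))) < 1 / (2 * real K)" by (auto simp: eventually_sequentially)
      define k where "k = max k1 k2"
      have k: "\<forall>z\<in>Z. cmod (el (y (r k)) z - l z) < e" "inverse (real (Suc (r k))) < 1 / (2 * real K)"
        using k1 k2 by (auto simp: k_def)
      have "\<bar>y (r k) i - P j i - a i\<bar> + 1 / of_nat (Suc (r k)) <= 1 / of_nat K" if i: "i < n" for i
      proof -
        have "cf (el (y (r k)) - l) i = cf (el (y (r k)) - (el (P j) + el a)) i" by (rule cf_cong) (use a(2) in simp)
        also have "... = of_rat (y (r k) i) - of_rat (P j i + a i)"
          unfolding el_add[symmetric] cf_diff using cf_el[OF ty i] cf_el[of "%i. P j i + a i", OF _ i] P[OF j(1)] a(1) by simp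
        also have "... = of_real (of_rat (y (r k) i - P j i - a i))"
          by (cases "y (r k) i - P j i - a i") (simp add: of_rat_rat flip: of_rat_diff diff_diff_eq)
        finally have "\<bar>real_of_rat (y (r k) i - P j i - a i)\<bar> = cmod (cf (el (y (r k)) - l) i)" by (simp only: norm_of_real)
        also have "... <= real AA * e" by (rule cf_le) (use k(1) in \<open>auto intro: less_imp_le\<close>)
        also have "... <= (1 + real AA) * e" using e by (intro mult_right_mono) auto
        also have "... = 1 / (2 * real K)"
        proof -
          have "1 + real AA ~= 0" by (metis of_nat_Suc of_nat_eq_0_iff nat.distinct(1) add.commute)
          then show ?thesis by (simp add: e_def)
        qed
        finally have c: "\<bar>real_of_rat (y (r k) i - P j i - a i)\<bar> <= 1 / (2 * real K)" .
        have "\<bar>real_of_rat (y (r k) i - P j i - a i)\<bar> + 1 / real (Suc (r k)) <= 1 / real K"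
        proof -
          have "1 / (2 * real K) + 1 / (2 * real K) = 1 / real K" using Kpos by (simp add: field_simps)
          moreover have "1 / real (Suc (r k)) < 1 / (2 * real K)" using k(2) by (simp only: inverse_eq_divide)
          ultimately show ?thesis using c by linarith
        qed
        then have "real_of_rat (\<bar>y (r k) i - P j i - a i\<bar> + 1 / of_nat (Suc (r k))) <= of_rat (1 / of_nat K)"
          by (simp add: of_rat_add of_rat_divide)
        then show ?thesis by (simp only: of_rat_less_eq)
      qed
      then show ?thesis using j(1) a(1) aO unfolding good_def y_def[symmetric] by blast
    next
      case False
      then obtain a where a: "a \<in> OK" "N (l + a) < MM" using lE by (auto simp: SS_def not_le)
      obtain c where c: "tn c" "\<forall>z\<in>Z. el c z = a z" using el_exists a(1) OK_KF by blast
      have cO: "okc c" unfolding okc_iff by (rule OK_cong[OF a(1)]) (use c in simp)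
      obtain A where A: "1 + (\<Sum>i<n. \<bar>c i\<bar>) <= of_nat A" using real_arch_simple by blast
      have yA: "\<bar>y k i + c i\<bar> <= of_nat A" if "i < n" for k i
      proof -
        have "\<bar>c i\<bar> <= (\<Sum>i<n. \<bar>c i\<bar>)" by (rule member_le_sum) (use that in auto)
        then show ?thesis using A y01[where k = k and i = i] by linarith
      qed
      define b where "b = real (BB * A)"
      have "(%k. (b + real BB * inverse (real (Suc (r k)))) ^ n - b ^ n) \<longlonglongrightarrow> (b + real BB * 0) ^ n - b ^ n"
        by (intro tendsto_diff tendsto_power tendsto_add tendsto_mult tendsto_const inv0)
      moreover have "(%k. N (el (y (r k)) + el c)) \<longlonglongrightarrow> N (l + el c)" by (rule conv_N[OF conv_add[OF l conv_const]])
      moreover have "N (l + el c) = N (l + a)" by (rule N_cong) (use c in simp)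
      ultimately have "(%k. N (el (y (r k)) + el c) + ((b + real BB * inverse (real (Suc (r k)))) ^ n - b ^ n)) \<longlonglongrightarrow> N (l + a)"
        using tendsto_add by fastforce
      from order_tendstoD(2)[OF this a(2)]
      obtain k where "N (el (y (r k)) + el c) + ((b + real BB * inverse (real (Suc (r k)))) ^ n - b ^ n) < MM"
        by (auto simp: eventually_sequentially)
      then have "real_of_rat (nm (%i. y (r k) i + c i) + ((of_nat (BB * A) + of_nat BB / of_nat (Suc (r k))) ^ n - of_nat (BB * A) ^ n)) < of_rat q"
        unfolding el_add[symmetric] N_el b_def q of_rat_add of_rat_diff of_rat_power divide_inverse of_rat_mult of_rat_inverse of_rat_of_nat_eq .
      then have "nm (%i. y (r k) i + c i) + ((of_nat (BB * A) + of_nat BB / of_nat (Suc (r k))) ^ n - of_nat (BB * A) ^ n) <= q"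
        by (simp only: of_rat_less less_imp_le)
      then show ?thesis using c(1) cO yA unfolding good_def y_def[symmetric] by blast
    qed
    then show False using w by blast
  qed
  then obtain H where H: "H > 0" "\<forall>w<H ^ n. good H w" by blast
  have "cert q Q s P d K H" unfolding cert_def
  proof (intro conjI allI impI)
    fix j w assume j: "j < s" and o: "okc (bx (DD * (AA * CC)) w)" and n1: "nm (bx (DD * (AA * CC)) w) = 1"
    define u where "u = el (bx (DD * (AA * CC)) w)"
    have u: "u \<in> UK" using o n1 by (simp add: unit_iff u_def okc_iff N_el)
    obtain j' where j': "j' < s" "u * el (P j) - el (P j') \<in> OK" using PS[OF SS_UK[OF u]] P[OF j] by blast
    have "okc (%k. (\<Sum>i\<le>k. bx (DD * (AA * CC)) w i * P j (k - i)) - P j' k)"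
      unfolding okc_iff el_diff using j'(2) P[OF j] by (subst el_conv) (auto simp: bx_def u_def)
    then show "\<exists>j'<s. okc (%k. (\<Sum>i\<le>k. bx (DD * (AA * CC)) w i * P j (k - i)) - P j' k)" using j'(1) by blast
  next
    fix j assume j: "j < s"
    have "mm (el (P j)) = MM" using P[OF j] mm_le_MM[of "el (P j)"] by (auto simp: SS_iff)
    then obtain a where a: "a \<in> OK" "N (el (P j) + a) = of_rat q" using mm_torsion[OF el_KF] q by metis
    obtain c where c: "tn c" "\<forall>z\<in>Z. el c z = a z" using el_exists a(1) OK_KF by blast
    have "okc c" unfolding okc_iff by (rule OK_cong[OF a(1)]) (use c in simp)
    moreover have "N (el (P j) + el c) = of_rat q" using a(2) N_cong[of "el (P j) + el c" "el (P j) + a"] c(2) by simp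
    then have "nm (%i. P j i + c i) = q" unfolding el_add[symmetric] N_el of_rat_eq_iff .
    ultimately show "\<exists>a. tn a & okc a & nm (%i. P j i + a i) <= q" using c(1) by (intro exI[of _ c]) simp
  next
    show "!!j i. j < s ==> i < n ==> of_nat d * P j i \<in> \<int>" using d(2) by auto
  qed (use s d(1) H(1) Q P lower H(2)[unfolded good_def] in \<open>auto simp: K_def\<close>)
  then show ?thesis by blast
qed

end

section \<open>Computability\<close>

definition cl :: "nat => (nat list => nat) => bool" where
  "cl k F \<longleftrightarrow> (\<exists>p. \<forall>xs. length xs = k --> computes p xs (F xs))"

lemma cl_cong: "cl k F ==> (!!xs. length xs = k ==> F xs = G xs) ==> cl k G" unfolding cl_def by metis

lemma cl_comp:
  assumes h: "cl (length Fs) h" and F: "!!F. F \<in> set Fs ==> cl k F"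
  shows "cl k (%xs. h (map (%F. F xs) Fs))"
proof -
  obtain p where p: "!!xs. length xs = length Fs ==> computes p xs (h xs)" using h by (auto simp: cl_def)
  have "\<forall>F\<in>set Fs. \<exists>q. \<forall>xs. length xs = k --> computes q xs (F xs)" using F by (simp add: cl_def)
  then obtain q where q: "!!F xs. F \<in> set Fs ==> length xs = k ==> computes (q F) xs (F xs)" by metis
  have "computes (Comp_f p (map q Fs)) xs (h (map (%F. F xs) Fs))" if "length xs = k" for xs
    by (rule computes.comp[where ys = "map (%F. F xs) Fs"]) (use p q that in auto)
  then show ?thesis unfolding cl_def by blast
qed

lemma cl_nth: "i < k ==> cl k (%xs. xs ! i)" unfolding cl_def by (intro exI[of _ "Proj_f i"] allI impI) (simp add: computes.proj)

lemma cl_0: "cl k (%_. 0)" unfolding cl_def by (intro exI[of _ Zero_f] allI impI computes.zero)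

lemma cl_app1: "cl 1 (%xs. h (xs ! 0)) ==> cl k f ==> cl k (%xs. h (f xs))" using cl_comp[of "[f]" "%xs. h (xs ! 0)" k] by simp

lemma cl_app2: "cl 2 (%xs. h (xs ! 0) (xs ! 1)) ==> cl k f ==> cl k g ==> cl k (%xs. h (f xs) (g xs))"
  using cl_comp[of "[f, g]" "%xs. h (xs ! 0) (xs ! 1)" k] by (auto simp: numeral_2_eq_2)

lemma cl_Suc: assumes "cl k f" shows "cl k (%xs. Suc (f xs))"
proof (rule cl_app1[OF _ assms])
  show "cl 1 (%xs. Suc (xs ! 0))"
    unfolding cl_def by (intro exI[of _ Succ_f] allI impI) (auto simp: length_Suc_conv computes.succ)
qed

lemma cl_rec2:
  assumes f: "cl 1 (%xs. f (xs ! 0))" and g: "cl 3 (%xs. g (xs ! 0) (xs ! 1) (xs ! 2))"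
  shows "cl 2 (%xs. rec_nat (f (xs ! 1)) (%n r. g n r (xs ! 1)) (xs ! 0))"
proof -
  obtain p where p: "!!xs. length xs = 1 ==> computes p xs (f (xs ! 0))" using f by (auto simp: cl_def)
  obtain q where q: "!!xs. length xs = 3 ==> computes q xs (g (xs ! 0) (xs ! 1) (xs ! 2))" using g by (auto simp: cl_def)
  have "computes (Prim_f p q) [m, y] (rec_nat (f y) (%n r. g n r y) m)" for m y
  proof (induction m)
    case 0 show ?case using computes.prim_0[OF p[of "[y]"]] by simp
  next
    case (Suc m) then show ?case using computes.prim_Suc[OF _ q[of "[m, rec_nat (f y) (%n r. g n r y) m, y]"]] by simp
  qed
  then show ?thesis unfolding cl_def by (intro exI[of _ "Prim_f p q"]) (auto simp: length_Suc_conv numeral_2_eq_2)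
qed

lemma cl_rec: "cl 1 (%xs. f (xs ! 0)) ==> cl 3 (%xs. g (xs ! 0) (xs ! 1) (xs ! 2)) ==> cl k h ==> cl k a ==>
    cl k (%xs. rec_nat (f (a xs)) (%n r. g n r (a xs)) (h xs))"
  by (rule cl_app2[of "%m y. rec_nat (f y) (%n r. g n r y) m"], rule cl_rec2)

lemma cl_add: assumes "cl k f" "cl k g" shows "cl k (%xs. f xs + g xs)"
proof -
  have "rec_nat y (%n r. Suc r) m = m + y" for m y by (induction m) auto
  then show ?thesis using cl_rec[of "%y. y" "%n r y. Suc r" k f g] assms by (simp add: cl_nth cl_Suc)
qed

lemma cl_pred: assumes "cl k f" shows "cl k (%xs. f xs - 1)"
proof -
  have "rec_nat 0 (%n r. n) m = m - 1" for m by (induction m) auto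
  then show ?thesis using cl_rec[of "%y. 0" "%n r y. n" k f f] assms by (simp add: cl_nth cl_0)
qed

lemma cl_sub: assumes "cl k f" "cl k g" shows "cl k (%xs. f xs - g xs)"
proof -
  have "rec_nat y (%n r. r - 1) m = y - m" for m y by (induction m) auto
  then show ?thesis using cl_rec[of "%y. y" "%n r y. r - 1" k g f] assms cl_pred[OF cl_nth[of 1 3]] by (simp add: cl_nth)
qed

lemma cl_mult: assumes "cl k f" "cl k g" shows "cl k (%xs. f xs * g xs)"
proof -
  have "rec_nat 0 (%n r. r + y) m = m * y" for m y by (induction m) auto
  then show ?thesis using cl_rec[of "%y. 0" "%n r y. r + y" k f g] assms by (simp add: cl_nth cl_0 cl_add)
qed

lemma cl_triangle: assumes "cl k f" shows "cl k (%xs. triangle (f xs))"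
proof -
  have "rec_nat 0 (%n r. r + Suc n) m = triangle m" for m by (induction m) auto
  then show ?thesis using cl_rec[of "%y. 0" "%n r y. r + Suc n" k f f] assms
    by (simp add: cl_nth cl_0 cl_add cl_Suc del: add_Suc_right)
qed

lemma cl_Least:
  assumes "cl (Suc k) F" "!!xs. length xs = k ==> \<exists>m. F (m # xs) = 0"
  shows "cl k (%xs. LEAST m. F (m # xs) = 0)"
proof -
  obtain p where p: "!!xs. length xs = Suc k ==> computes p xs (F xs)" using assms(1) by (auto simp: cl_def)
  have "computes (Min_f p) xs (LEAST m. F (m # xs) = 0)" if xs: "length xs = k" for xs
  proof (rule computes.min)
    have "F ((LEAST m. F (m # xs) = 0) # xs) = 0" using assms(2)[OF xs] by (rule LeastI_ex)
    then show "computes p ((LEAST m. F (m # xs) = 0) # xs) 0" using p[of "_ # xs"] xs by (metis length_Cons)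
    fix m assume "m < (LEAST m. F (m # xs) = 0)"
    then have "F (m # xs) ~= 0" by (rule not_less_Least)
    then show "\<exists>j. computes p (m # xs) (Suc j)" using p[of "m # xs"] xs by (metis length_Cons not0_implies_Suc)
  qed
  then show ?thesis unfolding cl_def by blast
qed

abbreviation pe :: "nat => nat => nat" where "pe a b \<equiv> prod_encode (a, b)"
definition pf :: "nat => nat" where "pf x = fst (prod_decode x)"
definition ps :: "nat => nat" where "ps x = snd (prod_decode x)"

lemma pf_pe [simp]: "pf (pe a b) = a" and ps_pe [simp]: "ps (pe a b) = b" and pe_pf_ps [simp]: "pe (pf x) (ps x) = x"
  by (simp_all add: pf_def ps_def)

text \<open>The index of the diagonal of \<open>x\<close> in the Cantor pairing, from which both
  components are computed.\<close>

definition troot :: "nat => nat" where "troot x = (LEAST m. Suc x - triangle (Suc m) = 0)"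

lemma troot: "troot x = pf x + ps x" unfolding troot_def
proof (rule Least_equality)
  have x: "x = triangle (pf x + ps x) + pf x" using pe_pf_ps[of x] by (simp only: prod_encode_def) simp
  then show "Suc x - triangle (Suc (pf x + ps x)) = 0" by simp
  fix m assume m: "Suc x - triangle (Suc m) = 0"
  have "triangle a <= triangle b" if "a <= b" for a b using that by (rule lift_Suc_mono_le[rotated]) simp
  then show "pf x + ps x <= m" using m x by (metis (full_types) Suc_leI diff_is_0_eq linorder_not_le not_less_eq_eq order_trans trans_le_add1)
qed

text \<open>Unary functions suffice because further arguments are packed by pairing; programs are
  then assembled by introduction rules.\<close>

definition cpt :: "(nat => nat) => bool" where "cpt f \<longleftrightarrow> cl 1 (%xs. f (xs ! 0))"

named_theorems cpt

lemma cpt_app: "cpt f ==> cpt g ==> cpt (%x. f (g x))" unfolding cpt_def by (rule cl_app1)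
lemma cpt_id [cpt]: "cpt (%x. x)" unfolding cpt_def by (rule cl_nth) simp
lemma cpt_Suc [cpt]: "cpt f ==> cpt (%x. Suc (f x))" unfolding cpt_def by (rule cl_Suc)
lemma cpt_const [cpt]: "cpt (%_. c)" by (induction c) (auto simp: cpt_def cl_0 cl_Suc)
lemma cpt_add [cpt]: "cpt f ==> cpt g ==> cpt (%x. f x + g x)" unfolding cpt_def by (rule cl_add)
lemma cpt_sub [cpt]: "cpt f ==> cpt g ==> cpt (%x. f x - g x)" unfolding cpt_def by (rule cl_sub)
lemma cpt_mult [cpt]: "cpt f ==> cpt g ==> cpt (%x. f x * g x)" unfolding cpt_def by (rule cl_mult)
lemma cl_pe: "cl k f ==> cl k g ==> cl k (%xs. pe (f xs) (g xs))" unfolding prod_encode_def by (simp add: cl_add cl_triangle)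
lemma cpt_pe [cpt]: "cpt f ==> cpt g ==> cpt (%x. pe (f x) (g x))" unfolding cpt_def by (rule cl_pe)

lemma cl_cpt: "cpt f ==> cl k g ==> cl k (%xs. f (g xs))" unfolding cpt_def by (rule cl_app1)

lemma cpt_troot: "cpt troot" unfolding cpt_def troot_def
proof (rule cl_cong[OF cl_Least])
  show "cl (Suc 1) (%xs. Suc (xs ! 1) - triangle (Suc (xs ! 0)))" by (intro cl_sub cl_Suc cl_triangle cl_nth) auto
  fix xs :: "nat list"
  have "m <= triangle m" for m by (induction m) auto
  then show "\<exists>m. Suc ((m # xs) ! 1) - triangle (Suc ((m # xs) ! 0)) = 0" by (intro exI[of _ "xs ! 0"]) simp
qed simp

lemma cpt_pf [cpt]: assumes "cpt f" shows "cpt (%x. pf (f x))"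
proof -
  have "x - triangle (troot x) = pf x" for x using pe_pf_ps[of x] unfolding troot prod_encode_def by simp
  then have "cpt pf" using cpt_sub[OF cpt_id, of "%x. triangle (troot x)"] cl_triangle[of 1 "%xs. troot (xs ! 0)"] cpt_troot by (simp add: cpt_def)
  then show ?thesis using assms cpt_app by blast
qed

lemma cpt_ps [cpt]: assumes "cpt f" shows "cpt (%x. ps (f x))"
proof -
  have "troot x - pf x = ps x" for x by (simp add: troot)
  then have "cpt ps" using cpt_sub[OF cpt_troot cpt_pf[OF cpt_id]] by simp
  then show ?thesis using assms cpt_app by blast
qed

lemma cpt_rec [cpt]:
  assumes "cpt h" "cpt f" "cpt (%v. g (pf v) (pf (ps v)) (ps (ps v)))"
  shows "cpt (%x. rec_nat (f x) (%n r. g n r x) (h x))"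
proof -
  have "cl 3 (%xs. g (xs ! 0) (xs ! 1) (xs ! 2))"
    using cl_cpt[OF assms(3), of 3 "%xs. pe (xs ! 0) (pe (xs ! 1) (xs ! 2))"] by (simp add: cl_pe cl_nth)
  then show ?thesis using cl_rec[of f g 1 "%xs. h (xs ! 0)" "%xs. xs ! 0"] assms by (simp add: cpt_def cl_nth)
qed

lemma cpt_Least:
  assumes "cpt (%v. F (pf v) (ps v))" "!!x. \<exists>n. F n x = 0"
  shows "cpt (%x. LEAST n. F n x = 0)"
proof -
  have "cl (Suc 1) (%xs. F (xs ! 0) (xs ! 1))"
    using cl_cpt[OF assms(1), of 2 "%xs. pe (xs ! 0) (xs ! 1)"] by (simp add: cl_pe cl_nth numeral_2_eq_2)
  from cl_Least[OF this] show ?thesis unfolding cpt_def using assms(2) by simp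
qed

text \<open>Truth is coded by 0, the value for which minimization searches.\<close>

definition dec :: "(nat => bool) => bool" where "dec P \<longleftrightarrow> cpt (%x. of_bool (\<not> P x))"

lemma dec_app: "dec P ==> cpt f ==> dec (%x. P (f x))" unfolding dec_def by (rule cpt_app)

lemma dec_le [cpt]: assumes "cpt f" "cpt g" shows "dec (%x. f x <= g x)"
proof -
  have "of_bool (\<not> f x <= g x) = 1 - (1 - (f x - g x))" for x by auto
  then show ?thesis unfolding dec_def using assms by (simp only:) (intro cpt)
qed

lemma dec_not [cpt]: assumes "dec P" shows "dec (%x. \<not> P x)"
proof -
  have "of_bool (\<not> \<not> P x) = 1 - (of_bool (\<not> P x) :: nat)" for x by auto
  then show ?thesis using assms unfolding dec_def by (simp only:) (intro cpt)
qed

lemma dec_disj [cpt]: assumes "dec P" "dec Q" shows "dec (%x. P x | Q x)"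
proof -
  have "of_bool (\<not> (P x | Q x)) = of_bool (\<not> P x) * (of_bool (\<not> Q x) :: nat)" for x by auto
  then show ?thesis using assms unfolding dec_def by (simp only:) (intro cpt)
qed

lemma dec_conj [cpt]: "dec P ==> dec Q ==> dec (%x. P x & Q x)" using dec_not[OF dec_disj[OF dec_not[of P] dec_not[of Q]]] by simp

lemma dec_imp [cpt]: "dec P ==> dec Q ==> dec (%x. P x --> Q x)" unfolding imp_conv_disj by (intro cpt)

lemma dec_less [cpt]: "cpt f ==> cpt g ==> dec (%x. f x < g x)" unfolding less_eq_Suc_le by (intro cpt)

lemma dec_eq [cpt]: "cpt f ==> cpt g ==> dec (%x. f x = g x)" unfolding order_eq_iff by (intro cpt)

lemma dec_exb [cpt]: assumes P: "dec (%v. P (pf v) (ps v))" and b: "cpt b" shows "dec (%x. \<exists>i<b x. P i x)"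
proof -
  have "rec_nat 1 (%i r. r * of_bool (\<not> P i x)) m = (of_bool (\<not> (\<exists>i<m. P i x)) :: nat)" for m x
    by (induction m) (auto simp: less_Suc_eq)
  moreover have "cpt (%x. rec_nat 1 (%i r. r * of_bool (\<not> P i x)) (b x))"
    by (intro cpt b) (use cpt_app[OF P[unfolded dec_def], of "%v. pe (pf v) (ps (ps v))"] in \<open>simp add: cpt\<close>)
  ultimately show ?thesis by (simp add: dec_def)
qed

lemma dec_allb [cpt]: "dec (%v. P (pf v) (ps v)) ==> cpt b ==> dec (%x. \<forall>i<b x. P i x)"
  using dec_not[OF dec_exb[of "%i x. \<not> P i x", OF dec_not]] by simp

lemma cpt_if [cpt]: assumes "dec P" "cpt f" "cpt g" shows "cpt (%x. if P x then f x else g x)"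
proof -
  have "(if P x then f x else g x) = (1 - of_bool (\<not> P x)) * f x + of_bool (\<not> P x) * g x" for x by auto
  then show ?thesis using assms unfolding dec_def by (simp only:) (intro cpt)
qed

lemma cpt_div [cpt]: assumes "cpt f" "cpt g" shows "cpt (%x. f x div g x)"
proof -
  \<comment> \<open>For divisor 0 the search stops at 0, the value of division by 0.\<close>
  define F where "F q x = (if g x = 0 | f x < Suc q * g x then 0 else 1 :: nat)" for q x
  have "(LEAST q. F q x = 0) = f x div g x" for x
  proof (rule Least_equality)
    show "F (f x div g x) x = 0" using dividend_less_times_div[of "g x" "f x"] by (auto simp: F_def algebra_simps)
    fix q assume "F q x = 0"
    then have "g x = 0 | f x < Suc q * g x" by (simp add: F_def split: if_splits)
    then show "f x div g x <= q" by (metis div_by_0 less_Suc_eq_le less_mult_imp_div_less zero_le)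
  qed
  moreover have "cpt (%x. LEAST q. F q x = 0)"
  proof (rule cpt_Least)
    show "cpt (%v. F (pf v) (ps v))" unfolding F_def by (intro cpt cpt_app[OF assms(1)] cpt_app[OF assms(2)])
    show "\<exists>q. F q x = 0" for x using dividend_less_times_div[of "g x" "f x"]
      by (intro exI[of _ "f x div g x"]) (auto simp: F_def algebra_simps)
  qed
  ultimately show ?thesis by simp
qed

lemma cpt_mod [cpt]: "cpt f ==> cpt g ==> cpt (%x. f x mod g x)" unfolding minus_mult_div_eq_mod[symmetric] by (intro cpt)

lemma cpt_power [cpt]: assumes "cpt f" "cpt g" shows "cpt (%x. f x ^ g x)"
proof -
  have "rec_nat 1 (%_ r. r * f x) m = f x ^ m" for x m by (induction m) auto
  moreover have "cpt (%x. rec_nat 1 (%_ r. r * f x) (g x))" by (intro cpt assms cpt_app[OF assms(1)])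
  ultimately show ?thesis by simp
qed

lemma cpt_fact [cpt]: assumes "cpt f" shows "cpt (%x. fact (f x))"
proof -
  have "rec_nat 1 (%n r. Suc n * r) m = fact m" for m by (induction m) auto
  moreover have "cpt (%x. rec_nat 1 (%n r. Suc n * r) (f x))" by (intro cpt assms)
  ultimately show ?thesis by simp
qed

subsection \<open>Semidecidable predicates\<close>

definition re :: "(nat => bool) => bool" where
  "re P \<longleftrightarrow> (\<exists>D. dec D & (\<forall>x. P x \<longleftrightarrow> (\<exists>w. D (pe w x))))"

named_theorems rei

lemma re_dec: "dec P ==> re P" unfolding re_def by (intro exI[of _ "%v. P (ps v)"]) (use dec_app[OF _ cpt_ps[OF cpt_id]] in auto)

lemma re_conj [rei]: assumes "re P" "re Q" shows "re (%x. P x & Q x)"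
proof -
  obtain D E where D: "dec D" "!!x. P x \<longleftrightarrow> (\<exists>w. D (pe w x))" and E: "dec E" "!!x. Q x \<longleftrightarrow> (\<exists>w. E (pe w x))"
    using assms unfolding re_def by metis
  have "dec (%v. D (pe (pf (pf v)) (ps v)) & E (pe (ps (pf v)) (ps v)))" by (intro cpt dec_app[OF D(1)] dec_app[OF E(1)])
  moreover have "P x & Q x \<longleftrightarrow> (\<exists>w. D (pe (pf w) x) & E (pe (ps w) x))" for x
    unfolding D(2) E(2) by (metis pf_pe ps_pe)
  ultimately show ?thesis unfolding re_def by (intro exI conjI allI) auto
qed

lemma re_disj [rei]: assumes "re P" "re Q" shows "re (%x. P x | Q x)"
proof -
  obtain D E where D: "dec D" "!!x. P x \<longleftrightarrow> (\<exists>w. D (pe w x))" and E: "dec E" "!!x. Q x \<longleftrightarrow> (\<exists>w. E (pe w x))"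
    using assms unfolding re_def by metis
  show ?thesis unfolding re_def D(2) E(2) by (intro exI[of _ "%v. D v | E v"]) (auto intro: cpt D E)
qed

lemma re_ex [rei]: assumes "re (%v. P (pf v) (ps v))" shows "re (%x. \<exists>w. P w x)"
proof -
  obtain D where D: "dec D" "!!v. P (pf v) (ps v) \<longleftrightarrow> (\<exists>w. D (pe w v))" using assms by (auto simp: re_def)
  have "(\<exists>w. P w x) \<longleftrightarrow> (\<exists>w. D (pe (pf w) (pe (ps w) x)))" for x
    using D(2)[of "pe _ x"] by (simp, metis pf_pe ps_pe)
  moreover have "dec (%v. D (pe (pf (pf v)) (pe (ps (pf v)) (ps v))))" by (intro dec_app[OF D(1)] cpt)
  ultimately show ?thesis unfolding re_def by (intro exI conjI allI) auto
qed

text \<open>Finitely many witnesses have a common bound, and this bound witnesses all of them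
  together.\<close>

lemma re_allb [rei]: assumes "re (%v. P (pf v) (ps v))" and b: "cpt b" shows "re (%x. \<forall>i<b x. P i x)"
proof -
  obtain D where D: "dec D" "!!v. P (pf v) (ps v) \<longleftrightarrow> (\<exists>w. D (pe w v))" using assms by (auto simp: re_def)
  have "(\<forall>i<b x. P i x) \<longleftrightarrow> (\<exists>B. \<forall>i<b x. \<exists>w<B. D (pe w (pe i x)))" for x
  proof
    assume "\<forall>i<b x. P i x"
    then have "\<forall>i. \<exists>w. i < b x --> D (pe w (pe i x))" using D(2)[of "pe _ x"] by auto
    then obtain w where w: "!!i. i < b x ==> D (pe (w i) (pe i x))" by metis
    have "w i < Suc (\<Sum>i<b x. w i)" if "i < b x" for i using member_le_sum[of i "{..<b x}" w] that by simp
    then show "\<exists>B. \<forall>i<b x. \<exists>w<B. D (pe w (pe i x))" using w by blast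
  qed (use D(2)[of "pe _ x"] in auto)
  moreover have "dec (%v. \<forall>i<b (ps v). \<exists>w<pf v. D (pe w (pe i (ps v))))"
    by (intro cpt dec_app[OF D(1)] cpt_app[OF b])
  ultimately show ?thesis unfolding re_def
    by (intro exI[of _ "%v. \<forall>i<b (ps v). \<exists>w<pf v. D (pe w (pe i (ps v)))"]) simp
qed

text \<open>The search runs over pairs of a witness and a value. Whichever pair is found first,
  uniqueness of the value makes the output \<open>y\<close>.\<close>

lemma re_program:
  assumes "re (%v. P (pf v) (ps v))"
  shows "\<exists>p. \<forall>x y. P y x & (\<forall>y'. P y' x --> y' = y) --> computes p [x] y"
proof -
  obtain D where D: "dec D" "!!v. P (pf v) (ps v) \<longleftrightarrow> (\<exists>w. D (pe w v))" using assms by (auto simp: re_def)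
  define F where "F t x = (of_bool (\<not> D (pe (pf t) (pe (ps t) x))) :: nat)" for t x
  have "cpt (%v. F (pf v) (ps v))" unfolding F_def
    using cpt_app[OF D(1)[unfolded dec_def], of "%v. pe (pf (pf v)) (pe (ps (pf v)) (ps v))"] by (simp add: cpt)
  from cl_cpt[OF this, of 2 "%xs. pe (xs ! 0) (xs ! 1)"]
  have "cl 2 (%xs. F (xs ! 0) (xs ! 1))" by (simp add: cl_pe cl_nth)
  then obtain r where r: "!!xs. length xs = 2 ==> computes r xs (F (xs ! 0) (xs ! 1))" by (auto simp: cl_def)
  obtain s where s: "!!xs. length xs = 1 ==> computes s xs (ps (xs ! 0))" using cpt_ps[OF cpt_id] by (auto simp: cpt_def cl_def)
  have "computes (Comp_f s [Min_f r]) [x] y" if y: "P y x" "\<forall>y'. P y' x --> y' = y" for x y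
  proof -
    define t where "t = (LEAST t. F t x = 0)"
    obtain w where "D (pe w (pe y x))" using D(2)[of "pe y x"] y(1) by auto
    then have "F (pe w y) x = 0" by (simp add: F_def)
    then have t: "F t x = 0" "!!m. m < t ==> F m x ~= 0" unfolding t_def by (rule LeastI) (rule not_less_Least)
    then have "P (ps t) x" using D(2)[of "pe (ps t) x"] by (auto simp: F_def)
    then have ty: "ps t = y" using y(2) by blast
    have "computes (Min_f r) [x] t"
    proof (rule computes.min)
      show "computes r [t, x] 0" using r[of "[t, x]"] t(1) by simp
      fix m assume "m < t"
      then have "F m x = Suc 0" using t(2) by (force simp: F_def)
      then show "\<exists>k. computes r [m, x] (Suc k)" using r[of "[m, x]"] by auto
    qed
    then show ?thesis using s[of "[t]"] ty by (intro computes.comp[where ys = "[t]"]) auto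
  qed
  then show ?thesis by blast
qed

subsection \<open>Rational arithmetic\<close>

text \<open>Every natural number codes a rational, as a difference over a successor, so that no
  denominator is 0; codes are not unique.\<close>

definition drc :: "nat => rat" where "drc t = (of_nat (pf t) - of_nat (pf (ps t))) / of_nat (Suc (ps (ps t)))"
definition rt :: "(nat => rat) => bool" where "rt F \<longleftrightarrow> (\<exists>c. cpt c & F = (%x. drc (c x)))"

lemma drc_pe: "drc (pe a (pe b c)) = (of_nat a - of_nat b) / of_nat (Suc c)" by (simp add: drc_def)

lemma rtI: assumes "cpt a" "cpt b" "cpt c" "!!x. F x = (of_nat (a x) - of_nat (b x)) / of_nat (Suc (c x))" shows "rt F"
  unfolding rt_def by (intro exI[of _ "%x. pe (a x) (pe (b x) (c x))"] conjI cpt assms(1-3) ext) (simp only: assms(4) drc_pe)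

lemma rtE: assumes "rt F"
  shows "\<exists>a b c. cpt a & cpt b & cpt c & F = (%x. (of_nat (a x) - of_nat (b x)) / of_nat (Suc (c x)))"
proof -
  obtain c where c: "cpt c" "F = (%x. drc (c x))" using assms by (auto simp: rt_def)
  show ?thesis unfolding c(2) drc_def
    by (intro exI[of _ "%x. pf (c x)"] exI[of _ "%x. pf (ps (c x))"] exI[of _ "%x. ps (ps (c x))"] conjI cpt c(1) refl)
qed

lemma rt_app: "rt F ==> cpt f ==> rt (%x. F (f x))" unfolding rt_def by (metis cpt_app)

lemma rt_app2: "rt (%v. F (pf v) (ps v)) ==> cpt f ==> cpt g ==> rt (%x. F (f x) (g x))"
  using rt_app[of "%v. F (pf v) (ps v)" "%x. pe (f x) (g x)"] by (simp add: cpt_pe)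

lemma rt_drc [cpt]: "cpt f ==> rt (%x. drc (f x))" unfolding rt_def by blast

lemma rt_nat [cpt]: "cpt f ==> rt (%x. of_nat (f x))" by (rule rtI[of f "%_. 0" "%_. 0"]) (auto intro: cpt)

lemma rt_0 [cpt]: "rt (%_. 0)" and rt_1 [cpt]: "rt (%_. 1)" using rt_nat[OF cpt_const[of 0]] rt_nat[OF cpt_const[of 1]] by auto

lemma Suc_product: "of_nat (Suc (a + b + a * b)) = of_nat (Suc a) * (of_nat (Suc b) :: rat)" by (simp add: algebra_simps)

lemma rt_add [cpt]: assumes "rt F" "rt G" shows "rt (%x. F x + G x)"
proof -
  obtain a b c a' b' c' where *: "cpt a" "cpt b" "cpt c" "cpt a'" "cpt b'" "cpt c'"
    "F = (%x. (of_nat (a x) - of_nat (b x)) / of_nat (Suc (c x)))" "G = (%x. (of_nat (a' x) - of_nat (b' x)) / of_nat (Suc (c' x)))"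
    using rtE[OF assms(1)] rtE[OF assms(2)] by blast
  show ?thesis unfolding *(7,8)
    by (rule rtI[of "%x. a x * Suc (c' x) + a' x * Suc (c x)" "%x. b x * Suc (c' x) + b' x * Suc (c x)" "%x. c x + c' x + c x * c' x"],
      (intro cpt *)+) (simp only: Suc_product, simp add: add_frac_eq algebra_simps del: of_nat_Suc mult_Suc mult_Suc_right)
qed

lemma rt_mult [cpt]: assumes "rt F" "rt G" shows "rt (%x. F x * G x)"
proof -
  obtain a b c a' b' c' where *: "cpt a" "cpt b" "cpt c" "cpt a'" "cpt b'" "cpt c'"
    "F = (%x. (of_nat (a x) - of_nat (b x)) / of_nat (Suc (c x)))" "G = (%x. (of_nat (a' x) - of_nat (b' x)) / of_nat (Suc (c' x)))"
    using rtE[OF assms(1)] rtE[OF assms(2)] by blast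
  show ?thesis unfolding *(7,8)
    by (rule rtI[of "%x. a x * a' x + b x * b' x" "%x. a x * b' x + b x * a' x" "%x. c x + c' x + c x * c' x"],
      (intro cpt *)+) (simp only: Suc_product, simp add: algebra_simps del: of_nat_Suc)
qed

lemma rt_uminus [cpt]: assumes "rt F" shows "rt (%x. - F x)"
proof -
  obtain a b c where *: "cpt a" "cpt b" "cpt c" "F = (%x. (of_nat (a x) - of_nat (b x)) / of_nat (Suc (c x)))"
    using rtE[OF assms] by blast
  show ?thesis unfolding *(4) by (rule rtI[OF *(2,1,3)]) (simp add: minus_divide_left)
qed

lemma rt_diff [cpt]: "rt F ==> rt G ==> rt (%x. F x - G x)" using rt_add[OF _ rt_uminus, of F G] by simp

lemma rt_inverse [cpt]: assumes "rt F" shows "rt (%x. inverse (F x))"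
proof -
  obtain a b c where *: "cpt a" "cpt b" "cpt c" "F = (%x. (of_nat (a x) - of_nat (b x)) / of_nat (Suc (c x)))"
    using rtE[OF assms] by blast
  show ?thesis unfolding *(4)
  \<comment> \<open>The denominator is the distance of \<open>a x\<close> and \<open>b x\<close>,
    written as a successor. If they are equal, both parts of the numerator are 0, which gives the
    inverse of 0.\<close>
  proof (rule rtI[of "%x. if b x < a x then Suc (c x) else 0" "%x. if a x < b x then Suc (c x) else 0" "%x. (a x - b x) + (b x - a x) - 1"])
    fix x
    show "inverse ((of_nat (a x) - of_nat (b x)) / of_nat (Suc (c x))) =
      (of_nat (if b x < a x then Suc (c x) else 0) - of_nat (if a x < b x then Suc (c x) else 0)) /
      (of_nat (Suc (a x - b x + (b x - a x) - 1)) :: rat)"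
    proof (cases "a x" "b x" rule: linorder_cases)
      case less
      then have "of_nat (Suc (a x - b x + (b x - a x) - 1)) = (of_nat (b x) - of_nat (a x) :: rat)" by (simp add: of_nat_diff flip: of_nat_Suc)
      moreover have "of_nat (a x) - of_nat (b x) = - (of_nat (b x) - of_nat (a x) :: rat)" by simp
      ultimately show ?thesis using less by (simp only: inverse_divide divide_minus_right) (simp add: minus_divide_left)
    next
      case greater
      then have "of_nat (Suc (a x - b x + (b x - a x) - 1)) = (of_nat (a x) - of_nat (b x) :: rat)" by (simp add: of_nat_diff flip: of_nat_Suc)
      then show ?thesis using greater by simp
    qed simp
  qed (intro cpt *)+
qed

lemma rt_divide [cpt]: "rt F ==> rt G ==> rt (%x. F x / G x)" unfolding divide_inverse by (intro cpt)

lemma rt_if [cpt]: assumes "dec P" "rt F" "rt G" shows "rt (%x. if P x then F x else G x)"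
proof -
  obtain c d where c: "cpt c" "F = (%x. drc (c x))" and d: "cpt d" "G = (%x. drc (d x))" using assms by (auto simp: rt_def)
  have "cpt (%x. if P x then c x else d x)" by (intro cpt assms c d)
  then show ?thesis unfolding rt_def c d by (intro exI conjI) auto
qed

lemma dec_rt_le [cpt]: assumes "rt F" "rt G" shows "dec (%x. F x <= G x)"
proof -
  obtain a b c where *: "cpt a" "cpt b" "cpt c" "(%x. G x - F x) = (%x. (of_nat (a x) - of_nat (b x)) / of_nat (Suc (c x)))"
    using rtE[OF rt_diff[OF assms(2,1)]] by blast
  have "F x <= G x \<longleftrightarrow> b x <= a x" for x
  proof -
    have "F x <= G x \<longleftrightarrow> 0 <= (of_nat (a x) - of_nat (b x)) / (of_nat (Suc (c x)) :: rat)" unfolding fun_cong[OF *(4), of x, symmetric] by simp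
    also have "... \<longleftrightarrow> b x <= a x" by (simp add: zero_le_divide_iff)
    finally show ?thesis .
  qed
  then show ?thesis using dec_le[OF *(2,1)] by simp
qed

lemma dec_rt_eq [cpt]: "rt F ==> rt G ==> dec (%x. F x = G x)" unfolding order_eq_iff by (intro cpt)

lemma rt_abs [cpt]: "rt F ==> rt (%x. \<bar>F x\<bar>)" unfolding abs_if not_le[symmetric] by (intro cpt)

lemma dec_rt_int [cpt]: assumes "rt F" shows "dec (%x. F x \<in> \<int>)"
proof -
  obtain a b c where *: "cpt a" "cpt b" "cpt c" "(%x. \<bar>F x\<bar>) = (%x. (of_nat (a x) - of_nat (b x)) / of_nat (Suc (c x)))"
    using rtE[OF rt_abs[OF assms]] by blast
  \<comment> \<open>The absolute value of \<open>F x\<close> is at most \<open>a x\<close>, which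
    bounds the candidates for \<open>k\<close>.\<close>
  have "F x \<in> \<int> \<longleftrightarrow> (\<exists>k<Suc (a x). \<bar>F x\<bar> = of_nat k)" for x
  proof
    assume "F x \<in> \<int>"
    then obtain i where i: "F x = of_int i" by (elim Ints_cases)
    have "\<bar>F x\<bar> <= of_nat (a x) / of_nat (Suc (c x))" unfolding fun_cong[OF *(4)] by (intro divide_right_mono) auto
    also have "... <= of_nat (a x)" by (simp add: divide_le_eq distrib_left)
    finally have "of_int \<bar>i\<bar> <= (of_int (int (a x)) :: rat)" by (simp add: i)
    then have "\<bar>i\<bar> <= int (a x)" by (simp only: of_int_le_iff)
    then show "\<exists>k<Suc (a x). \<bar>F x\<bar> = of_nat k" by (intro exI[of _ "nat \<bar>i\<bar>"]) (auto simp: i)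
  next
    assume "\<exists>k<Suc (a x). \<bar>F x\<bar> = of_nat k"
    then obtain k where "\<bar>F x\<bar> = of_nat k" by blast
    then have "F x = of_nat k | F x = - of_nat k" by linarith
    then show "F x \<in> \<int>" by auto
  qed
  moreover have "dec (%x. \<exists>k<Suc (a x). \<bar>F x\<bar> = of_nat k)" by (intro cpt * rt_app[OF assms])
  ultimately show ?thesis by simp
qed

text \<open>Walks down a list code: a nonempty list is coded by the successor of a pair, hence the
  subtraction of 1. Beyond the end of a list the code stays 0, and \<open>nthc\<close> and
  \<open>ar\<close> return 0.\<close>

definition dr :: "nat => nat => nat" where "dr w i = rec_nat w (%_ r. ps (r - 1)) i"
definition nthc :: "nat => nat => nat" where "nthc w i = pf (dr w i - 1)"
definition ar :: "nat => nat => rat" where "ar w i = drc (nthc w i)"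

lemma cpt_dr [cpt]: "cpt f ==> cpt g ==> cpt (%x. dr (f x) (g x))" unfolding dr_def by (intro cpt)
lemma cpt_nthc [cpt]: "cpt f ==> cpt g ==> cpt (%x. nthc (f x) (g x))" unfolding nthc_def by (intro cpt)
lemma rt_ar [cpt]: "cpt f ==> cpt g ==> rt (%x. ar (f x) (g x))" unfolding ar_def by (intro cpt)

lemma dr_Suc: "dr (Suc (pe a r)) (Suc j) = dr r j" by (induction j) (simp_all add: dr_def)

lemma nthc_cons [simp]: "nthc (Suc (pe a r)) 0 = a" "nthc (Suc (pe a r)) (Suc j) = nthc r j"
  by (simp_all add: nthc_def dr_Suc) (simp add: dr_def)

lemma dr_list_encode: "dr (list_encode xs) i = list_encode (drop i xs)"
proof (induction xs arbitrary: i)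
  case Nil
  have "ps 0 = 0" by (simp add: ps_def prod_decode_def prod_decode_aux.simps)
  then show ?case by (induction i) (simp_all add: dr_def)
next
  case (Cons x xs)
  then show ?case by (cases i) (simp_all add: dr_Suc, simp add: dr_def)
qed

lemma nthc_list_encode: "nthc (list_encode xs) i = (if i < length xs then xs ! i else 0)"
proof (induction xs arbitrary: i)
  case Nil show ?case using dr_list_encode[of "[]" i] by (simp add: nthc_def pf_def prod_decode_def prod_decode_aux.simps)
next
  case (Cons x xs) then show ?case by (cases i) auto
qed

lemma drc_surj: "\<exists>t. drc t = r"
proof -
  obtain a b where ab: "r = of_int a / of_int b" "b > 0" by (cases r rule: Rat_cases) (auto simp: Fract_of_int_quotient)
  have "drc (pe (nat a) (pe (nat (- a)) (nat b - 1))) = r" using ab unfolding drc_pe by (cases "a >= 0") auto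
  then show ?thesis by blast
qed

lemma ar_exists: "\<exists>w. \<forall>i. ar w i = (if i < m then f i else 0)"
proof -
  obtain t where t: "!!r. drc (t r) = r" using drc_surj by metis
  have "drc 0 = 0" by (simp add: drc_def pf_def ps_def prod_decode_def prod_decode_aux.simps)
  then show ?thesis by (intro exI[of _ "list_encode (map (%i. t (f i)) [0..<m])"]) (simp add: ar_def nthc_list_encode t)
qed

text \<open>The list of the previous values is in reverse order.\<close>

lemma rt_course:
  assumes H: "rt (%v. H (pf v) (pf (ps v)) (ps (ps v)))"
    and step: "!!w k x. (!!i. i < k ==> ar w (k - 1 - i) = F i x) ==> F k x = H w k x"
  shows "rt (%v. F (pf v) (ps v))"
proof -
  obtain c where c: "cpt c" "(%v. H (pf v) (pf (ps v)) (ps (ps v))) = (%v. drc (c v))" using H by (auto simp: rt_def)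
  have Hc: "H w k x = drc (c (pe w (pe k x)))" for w k x using fun_cong[OF c(2), of "pe w (pe k x)"] by simp
  define L where "L k x = rec_nat 0 (%m r. Suc (pe (c (pe r (pe m x))) r)) k" for k x
  have L: "ar (L k x) (k - 1 - i) = F i x" if "i < k" for i k x using that
  proof (induction k arbitrary: i)
    case (Suc k)
    have Lk: "L (Suc k) x = Suc (pe (c (pe (L k x) (pe k x))) (L k x))" by (simp add: L_def)
    show ?case
    proof (cases "i = k")
      case True
      have "F k x = H (L k x) k x" by (rule step) (rule Suc.IH)
      then show ?thesis using True by (simp add: Lk ar_def Hc)
    next
      case False
      then have "Suc k - 1 - i = Suc (k - 1 - i)" using Suc.prems by simp
      then show ?thesis using Suc.IH[of i] Suc.prems False by (simp add: Lk ar_def)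
    qed
  qed simp
  have "F k x = drc (c (pe (L k x) (pe k x)))" for k x unfolding Hc[symmetric] by (rule step) (rule L)
  moreover have "rt (%v. drc (c (pe (L (pf v) (ps v)) (pe (pf v) (ps v)))))" unfolding L_def by (intro cpt cpt_app[OF c(1)])
  ultimately show ?thesis by simp
qed

lemma rt_sum [cpt]: assumes f: "rt (%v. f (pf v) (ps v))" and b: "cpt b" shows "rt (%x. \<Sum>i<b x. f i x)"
proof -
  have "rt (%v. (%k x. \<Sum>i<k. f i x) (pf v) (ps v))"
  proof (rule rt_course[where H = "%w k x. if k = 0 then 0 else ar w 0 + f (k - 1) x"])
    show "rt (%v. if pf (ps v) = 0 then 0 else ar (pf v) 0 + f (pf (ps v) - 1) (ps (ps v)))" by (intro cpt rt_app2[OF f])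
    fix w k x assume w: "!!i. i < k ==> ar w (k - 1 - i) = (\<Sum>i<i. f i x)"
    show "(\<Sum>i<k. f i x) = (if k = 0 then 0 else ar w 0 + f (k - 1) x)" using w[of "k - 1"] by (cases k) auto
  qed
  from rt_app2[OF this b cpt_id] show ?thesis .
qed

lemma rt_power [cpt]: assumes f: "rt f" and b: "cpt b" shows "rt (%x. f x ^ b x)"
proof -
  have "rt (%v. (%k x. f x ^ k) (pf v) (ps v))"
  proof (rule rt_course[where H = "%w k x. if k = 0 then 1 else ar w 0 * f x"])
    show "rt (%v. if pf (ps v) = 0 then 1 else ar (pf v) 0 * f (ps (ps v)))" by (intro cpt rt_app[OF f])
    fix w k x assume w: "!!i. i < k ==> ar w (k - 1 - i) = f x ^ i"
    show "f x ^ k = (if k = 0 then 1 else ar w 0 * f x)" using w[of "k - 1"] by (cases k) auto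
  qed
  from rt_app2[OF this b cpt_id] show ?thesis .
qed

subsection \<open>Computing norms\<close>

text \<open>The coded form of \<open>esym_id\<close>: if \<open>gamma\<close> codes the coefficients
  of \<open>g\<close>, this is the signed elementary symmetric function of its roots.\<close>

definition hh :: "nat => nat => nat => rat" where "hh n gamma k = (if k <= n then ar gamma (n - k) else 0)"

declare sum.cong [fundef_cong]

fun sS :: "nat => nat => nat => rat" where
  "sS n gamma k = (of_nat n - of_nat k) * hh n gamma k - (\<Sum>i<k. hh n gamma (Suc i) * sS n gamma (k - Suc i))"

text \<open>For coefficients \<open>c\<close> this is the sum of c(z)^k z^j over the roots z. The
  extra exponent j makes the recursion on k possible: multiplication by c(z) only shifts j.\<close>

primrec qq :: "nat => nat => (nat => rat) => nat => nat => rat" where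
  "qq n gamma c 0 j = sS n gamma j"
| "qq n gamma c (Suc k) j = (\<Sum>i<2 * n. c i * qq n gamma c k (j + i))"

fun ees :: "nat => nat => (nat => rat) => nat => rat" where
  "ees n gamma c k = (if k = 0 then 1 else - (\<Sum>i<k. ees n gamma c i * qq n gamma c (k - i) 0) / of_nat k)"

declare sS.simps [simp del] ees.simps [simp del]

lemma rt_sS [cpt]: assumes "cpt n" "cpt gamma" "cpt k" shows "rt (%x. sS (n x) (gamma x) (k x))"
proof -
  define H where "H w k x = (of_nat (n x) - of_nat k) * hh (n x) (gamma x) k - (\<Sum>i<k. hh (n x) (gamma x) (Suc i) * ar w i)" for w k x
  have "rt (%v. (%k x. sS (n x) (gamma x) k) (pf v) (ps v))"
  proof (rule rt_course[where H = H])
    show "rt (%v. H (pf v) (pf (ps v)) (ps (ps v)))" unfolding H_def hh_def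
      by (intro cpt cpt_app[OF assms(1)] cpt_app[OF assms(2)])
    fix w k x assume w: "!!i. i < k ==> ar w (k - 1 - i) = sS (n x) (gamma x) i"
    have "sS (n x) (gamma x) (k - Suc i) = ar w i" if "i < k" for i using w[of "k - Suc i"] that by simp
    then show "sS (n x) (gamma x) k = H w k x" by (subst sS.simps) (simp add: H_def)
  qed
  from rt_app2[OF this assms(3) cpt_id] show ?thesis .
qed

text \<open>The recursion in two variables becomes a course-of-values recursion in one by numbering
  the pair (k, j) as k J + j. Each step in k consults columns up to 2 n further to the right, so
  rows of length J = 2 n^2 + 1 suffice for the entries (k, 0) with k at most n; outside the triangle
  j + 2 n k < J the value is set to 0.\<close>

lemma rt_qq: assumes "cpt n" "cpt gamma" "rt (%v. c (pf v) (ps v))"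
  shows "\<exists>F. rt F & (\<forall>k x. k <= n x --> qq (n x) (gamma x) (%i. c i x) k 0 = F (pe k x))"
proof -
  define J where "J x = Suc (2 * n x * n x)" for x
  define F where "F m x = (if m mod J x + 2 * n x * (m div J x) < J x then qq (n x) (gamma x) (%i. c i x) (m div J x) (m mod J x) else 0)" for m x
  define H where "H w m x = (if m mod J x + 2 * n x * (m div J x) < J x
      then if m div J x = 0 then sS (n x) (gamma x) (m mod J x)
        else \<Sum>i<2 * n x. c i x * ar w (m - 1 - ((m div J x - 1) * J x + (m mod J x + i)))
      else 0)" for w m x
  have J: "cpt J" unfolding J_def by (intro cpt assms)
  have "rt (%v. F (pf v) (ps v))"
  proof (rule rt_course[where H = H])
    show "rt (%v. H (pf v) (pf (ps v)) (ps (ps v)))" unfolding H_def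
      by (intro cpt cpt_app[OF assms(1)] cpt_app[OF assms(2)] cpt_app[OF J] rt_app2[OF assms(3)])
    fix w m x assume w: "!!i. i < m ==> ar w (m - 1 - i) = F i x"
    show "F m x = H w m x"
    proof (cases "m mod J x + 2 * n x * (m div J x) < J x & m div J x ~= 0")
      case False then show ?thesis by (auto simp: F_def H_def)
    next
      case True
      then obtain k where k: "m div J x = Suc k" by (cases "m div J x") auto
      define j where "j = m mod J x"
      have m: "m = Suc k * J x + j" using div_mult_mod_eq[of m "J x"] k by (simp add: j_def)
      have jk: "j + 2 * n x * Suc k < J x" using True k by (simp add: j_def)
      have "ar w (m - 1 - (k * J x + (j + i))) = qq (n x) (gamma x) (%i. c i x) k (j + i)" if i: "i < 2 * n x" for i
      proof -
        have ji: "j + i + 2 * n x * k < J x" using jk i by simp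
        then have jJ: "j + i < J x" by linarith
        have lt: "k * J x + (j + i) < m" using jJ m by simp
        have "(k * J x + (j + i)) div J x = k" "(k * J x + (j + i)) mod J x = j + i" using jJ by auto
        then show ?thesis using w[OF lt] ji by (simp add: F_def)
      qed
      then show ?thesis using True k by (simp add: F_def H_def j_def)
    qed
  qed
  moreover have "qq (n x) (gamma x) (%i. c i x) k 0 = F (k * J x) x" if "k <= n x" for k x
  proof -
    have "2 * n x * k < J x" using mult_le_mono2[OF that, of "2 * n x"] unfolding J_def by linarith
    moreover have "J x > 0" by (simp add: J_def)
    ultimately show ?thesis by (simp add: F_def)
  qed
  moreover have "cpt (%v. pf v * J (ps v))" by (intro cpt cpt_app[OF J])
  ultimately have "rt (%v. F (pf v * J (ps v)) (ps v))" "\<forall>k x. k <= n x --> qq (n x) (gamma x) (%i. c i x) k 0 = F (k * J x) x"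
    using rt_app2[of F _ ps] cpt_ps[OF cpt_id] by auto
  then show ?thesis by (intro exI[of _ "%v. F (pf v * J (ps v)) (ps v)"]) auto
qed

lemma rt_ees: assumes "cpt n" "cpt gamma" "rt (%v. c (pf v) (ps v))" "cpt k"
  shows "rt (%x. if k x <= n x then ees (n x) (gamma x) (%i. c i x) (k x) else 0)"
proof -
  obtain Q where Q: "rt Q" "!!k x. k <= n x ==> qq (n x) (gamma x) (%i. c i x) k 0 = Q (pe k x)" using rt_qq[OF assms(1-3)] by blast
  define H where "H w k x = (if k <= n x then if k = 0 then 1 else - (\<Sum>i<k. ar w (k - 1 - i) * Q (pe (k - i) x)) / of_nat k else 0)" for w k x
  have "rt (%v. (%k x. if k <= n x then ees (n x) (gamma x) (%i. c i x) k else 0) (pf v) (ps v))"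
  proof (rule rt_course[where H = H])
    show "rt (%v. H (pf v) (pf (ps v)) (ps (ps v)))" unfolding H_def by (intro cpt cpt_app[OF assms(1)] rt_app[OF Q(1)])
    fix w k x assume w: "!!i. i < k ==> ar w (k - 1 - i) = (if i <= n x then ees (n x) (gamma x) (%i. c i x) i else 0)"
    show "(if k <= n x then ees (n x) (gamma x) (%i. c i x) k else 0) = H w k x"
    proof (cases "k <= n x")
      case True
      have "(\<Sum>i<k. ees (n x) (gamma x) (%i. c i x) i * qq (n x) (gamma x) (%i. c i x) (k - i) 0) = (\<Sum>i<k. ar w (k - 1 - i) * Q (pe (k - i) x))"
        by (rule sum.cong[OF refl]) (use w Q(2) True in auto)
      then show ?thesis using True by (subst ees.simps) (simp add: H_def)
    qed (simp add: H_def)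
  qed
  from rt_app2[OF this assms(4) cpt_id] show ?thesis .
qed

text \<open>The conditionals have the form in which \<open>rt_ees\<close> provides
  \<open>ees\<close>.\<close>

definition okx :: "nat => nat => (nat => rat) => bool" where
  "okx n gamma c \<longleftrightarrow> (\<forall>k<Suc n. (if k <= n then ees n gamma c k else 0) \<in> \<int>)"
definition nmx :: "nat => nat => (nat => rat) => rat" where
  "nmx n gamma c = \<bar>if n <= n then ees n gamma c n else 0\<bar>"

lemma dec_okx [cpt]: assumes "cpt n" "cpt gamma" "rt (%v. c (pf v) (ps v))"
  shows "dec (%x. okx (n x) (gamma x) (%i. c i x))"
  unfolding okx_def by (intro dec_allb dec_rt_int rt_ees cpt_app[OF assms(1)] cpt_app[OF assms(2)]
      rt_app2[OF assms(3)] cpt_pf cpt_ps cpt_id cpt_Suc)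

lemma rt_nmx [cpt]: assumes "cpt n" "cpt gamma" "rt (%v. c (pf v) (ps v))"
  shows "rt (%x. nmx (n x) (gamma x) (%i. c i x))" unfolding nmx_def by (intro rt_abs rt_ees assms)

section \<open>Correctness of the computed norms\<close>

context numfield begin

lemma ees_es:
  assumes gamma: "!!i. i <= n ==> ar gamma i = of_int (coeff g i)" shows "ees n gamma c k = es c k"
proof -
  have h: "of_rat (hh n gamma k) = esym (%z. z) Z k" for k using gamma[of "n - k"] by (simp add: hh_def esym_id)
  have s: "of_rat (sS n gamma k) = psum (%z. z) Z k" for k
  proof (induction k rule: less_induct)
    case (less k)
    then show ?case by (subst sS.simps, subst psum_rec[OF finite_Z]) (simp add: of_rat_diff of_rat_mult of_rat_sum h card_Z)
  qed
  have q: "of_rat (qq n gamma c k j) = (\<Sum>z\<in>Z. el c z ^ k * z ^ j)" for k j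
  proof (induction k arbitrary: j)
    case 0 show ?case by (simp add: s psum_def)
  next
    case (Suc k)
    have "of_rat (qq n gamma c (Suc k) j) = (\<Sum>i<2 * n. of_rat (c i) * (\<Sum>z\<in>Z. el c z ^ k * z ^ (j + i)))"
      by (simp add: of_rat_sum of_rat_mult Suc.IH)
    also have "... = (\<Sum>z\<in>Z. (\<Sum>i<2 * n. of_rat (c i) * z ^ i) * (el c z ^ k * z ^ j))"
      unfolding sum_distrib_left sum_distrib_right by (subst sum.swap) (simp add: power_add mult_ac)
    also have "... = (\<Sum>z\<in>Z. el c z ^ Suc k * z ^ j)" by (simp add: el_def mult.assoc)
    finally show ?case .
  qed
  have "of_rat (ees n gamma c k) = esym (el c) Z k"
  proof (induction k rule: less_induct)
    case (less k)
    have "of_rat (qq n gamma c m 0) = psum (el c) Z m" for m by (simp add: q psum_def)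
    with less show ?case by (cases "k = 0") (simp add: ees.simps, subst ees.simps, subst esym_rec[OF finite_Z],
        simp_all add: of_rat_divide of_rat_minus of_rat_sum of_rat_mult)
  qed
  then have "of_rat (ees n gamma c k) = (of_rat (es c k) :: complex)" by (simp add: es)
  then show ?thesis by (simp only: of_rat_eq_iff)
qed

lemma okx_nmx:
  assumes "!!i. i <= n ==> ar gamma i = of_int (coeff g i)"
  shows "okx n gamma c \<longleftrightarrow> okc c" "nmx n gamma c = nm c"
proof -
  have "ees n gamma c k = es c k" for k by (rule ees_es) (rule assms)
  then show "okx n gamma c \<longleftrightarrow> okc c" "nmx n gamma c = nm c"
    unfolding okx_def okc_def nmx_def nm_def by (auto simp: less_Suc_eq_le)
qed

end

subsection \<open>Searching for a certificate\<close>

text \<open>Inverts \<open>encode_rat\<close> on its range: numerators are coded by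
  \<open>int_encode\<close>, nonnegative ones as even numbers.\<close>

definition dq :: "nat => rat" where
  "dq y = (if pf y mod 2 = 0 then of_nat (pf y div 2) else - of_nat (Suc (pf y) div 2)) / of_nat (ps y)"
text \<open>Says that \<open>y\<close> codes a reduced fraction; \<open>Suc (pf y) div 2\<close> is
  the absolute value of its numerator. Exactly these codes are values of \<open>encode_rat\<close>,
  so a rational number determines its accepted code.\<close>

definition canon :: "nat => bool" where
  "canon y \<longleftrightarrow> 0 < ps y & (\<forall>m<Suc (ps y). (Suc (pf y) div 2) mod m = 0 & ps y mod m = 0 --> m = 1)"
definition Pv :: "nat => nat => nat => nat => rat" where "Pv n P j i = (if i < n then ar (nthc P j) i else 0)"
definition av :: "nat => nat => nat => rat" where "av n a i = (if i < n then ar a i else 0)"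
definition Wf :: "nat => nat => nat" where "Wf n R = ((2 * R) ^ n) ^ n"
definition Af :: "nat => nat => nat" where "Af n R = n * (1 + R) ^ n * Wf n R"
definition Bf :: "nat => nat => nat" where "Bf n R = n * R ^ n"
definition Cf :: "nat => nat => nat" where
  "Cf n R = (6 * Bf n R) ^ (n + 1) * (4 * (6 * Bf n R) ^ (n + 1)) ^ (((6 * Bf n R) ^ n) ^ (n + 1) * n)"
definition bv :: "nat => nat => nat => nat => nat => rat" where
  "bv n D L w i = (if i < n then (of_nat (w div (2 * L + 1) ^ i mod (2 * L + 1)) - of_nat L) / of_nat D else 0)"
definition gv :: "nat => nat => nat => nat => rat" where
  "gv n H w i = (if i < n then of_nat (w div H ^ i mod H) / of_nat H else 0)"

text \<open>\<open>cert\<close> with vectors replaced by codes, so that every clause is built from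
  decidable conditions by bounded quantifiers and existential quantifiers over numbers.\<close>

definition certx :: "nat => nat => nat => nat => nat => nat => nat => nat => nat => nat => nat => nat => nat => bool" where
  "certx n gamma A D B C y Q s P d K H \<longleftrightarrow> 0 < s & 0 < d & 0 < H & dq y <= of_nat Q \<and>
     (\<forall>j<s. \<forall>i<n. \<bar>Pv n P j i\<bar> <= 1 & of_nat d * Pv n P j i \<in> \<int>) \<and>
     (\<forall>j<s. \<forall>w<(2 * (D * (A * C)) + 1) ^ n. okx n gamma (%i. bv n D (D * (A * C)) w i) -->
        nmx n gamma (%i. bv n D (D * (A * C)) w i) = 1 -->
        (\<exists>j'<s. okx n gamma (%k. (\<Sum>i<Suc k. bv n D (D * (A * C)) w i * Pv n P j (k - i)) - Pv n P j' k))) \<and>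
     (\<forall>j<s. \<forall>w<(2 * (D * (A * (C * (1 + Q)) + 1)) + 1) ^ n. okx n gamma (%i. bv n D (D * (A * (C * (1 + Q)) + 1)) w i) -->
        dq y <= nmx n gamma (%i. Pv n P j i + bv n D (D * (A * (C * (1 + Q)) + 1)) w i)) \<and>
     (\<forall>j<s. \<exists>a. okx n gamma (%i. av n a i) & nmx n gamma (%i. Pv n P j i + av n a i) <= dq y) \<and>
     (A * (C * B) + 1) * D * d < K \<and>
     (\<forall>w<H ^ n. (\<exists>j. j < s & (\<exists>a. okx n gamma (%i. av n a i) & (\<forall>i<n. \<bar>gv n H w i - Pv n P j i - av n a i\<bar> + 1 / of_nat H <= 1 / of_nat K))) \<or>
        (\<exists>a A'. okx n gamma (%i. av n a i) & (\<forall>i<n. \<bar>gv n H w i + av n a i\<bar> <= of_nat A') \<and>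
          nmx n gamma (%i. gv n H w i + av n a i) + ((of_nat (B * A') + of_nat B / of_nat H) ^ n - of_nat (B * A') ^ n) <= dq y))"

text \<open>The first two conditions say that the list coded by \<open>e\<close> has length n + 1.
  Then \<open>gamma\<close> codes an integral model with factor \<open>c\<close>, and
  \<open>R\<close> is its root bound.\<close>

definition modelx :: "nat => nat => nat => nat => nat => bool" where
  "modelx e n c gamma R \<longleftrightarrow> 0 < dr e n & dr e (Suc n) = 0 & 0 < c \<and>
     (\<forall>i<Suc n. ar gamma i \<in> \<int> & ar gamma i * dq (nthc e n) = of_nat c ^ (n - i) * dq (nthc e i)) \<and>
     of_nat R = 1 + (\<Sum>i<n. \<bar>ar gamma i\<bar>)"

text \<open>\<open>e\<close> is the input and \<open>y\<close> the proposed output; the quantified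
  variables are witnesses.\<close>

definition search :: "nat => nat => bool" where
  "search y e \<longleftrightarrow> (\<exists>n c gamma R Q s P d K H. (canon y & modelx e n c gamma R) \<and>
     certx n gamma (Af n R) (fact (Wf n R)) (Bf n R) (Cf n R) y Q s P d K H)"

lemma rt_dq [cpt]: "cpt f ==> rt (%x. dq (f x))" unfolding dq_def by (intro cpt)
lemma dec_canon [cpt]: "cpt f ==> dec (%x. canon (f x))" by (rule dec_app[of canon]) (unfold canon_def, intro cpt)
lemma rt_Pv [cpt]: "cpt n ==> cpt P ==> cpt j ==> cpt i ==> rt (%x. Pv (n x) (P x) (j x) (i x))" unfolding Pv_def by (intro cpt)
lemma rt_av [cpt]: "cpt n ==> cpt a ==> cpt i ==> rt (%x. av (n x) (a x) (i x))" unfolding av_def by (intro cpt)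
lemma rt_bv [cpt]: "cpt n ==> cpt D ==> cpt L ==> cpt w ==> cpt i ==> rt (%x. bv (n x) (D x) (L x) (w x) (i x))"
  unfolding bv_def by (intro cpt)
lemma rt_gv [cpt]: "cpt n ==> cpt H ==> cpt w ==> cpt i ==> rt (%x. gv (n x) (H x) (w x) (i x))" unfolding gv_def by (intro cpt)
lemma cpt_Wf [cpt]: "cpt n ==> cpt R ==> cpt (%x. Wf (n x) (R x))" unfolding Wf_def by (intro cpt)
lemma cpt_Af [cpt]: "cpt n ==> cpt R ==> cpt (%x. Af (n x) (R x))" unfolding Af_def by (intro cpt)
lemma cpt_Bf [cpt]: "cpt n ==> cpt R ==> cpt (%x. Bf (n x) (R x))" unfolding Bf_def by (intro cpt)
lemma cpt_Cf [cpt]: "cpt n ==> cpt R ==> cpt (%x. Cf (n x) (R x))" unfolding Cf_def by (intro cpt)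

lemma dec_model:
  "dec (%v. modelx (pf v) (pf (ps v)) (pf (ps (ps v))) (pf (ps (ps (ps v)))) (ps (ps (ps (ps v)))))"
  unfolding modelx_def by (intro cpt)

lemma dec_modelx [cpt]: assumes "cpt e" "cpt n" "cpt c" "cpt gamma" "cpt R"
  shows "dec (%x. modelx (e x) (n x) (c x) (gamma x) (R x))"
  using dec_app[OF dec_model, of "%x. pe (e x) (pe (n x) (pe (c x) (pe (gamma x) (R x))))"] assms by (simp add: cpt_pe)

lemma re_search: "re (%v. search (pf v) (ps v))" unfolding search_def certx_def by (intro rei) (rule re_dec | intro cpt)+

lemma abs_int_decode: "nat \<bar>int_decode k\<bar> = Suc k div 2" by (auto simp: int_decode_def sum_decode_def split: if_splits)

lemma dq_int_decode: "dq y = of_int (int_decode (pf y)) / of_nat (ps y)"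
proof -
  have "(of_nat (Suc k div 2) :: rat) = of_nat (k div 2) + 1" if "odd k" for k using that by (auto elim!: oddE)
  then show ?thesis by (auto simp: dq_def int_decode_def sum_decode_def even_iff_mod_2_eq_zero[symmetric])
qed

lemma canon_iff: "canon y \<longleftrightarrow> 0 < ps y & coprime (int_decode (pf y)) (int (ps y))"
proof -
  have "coprime (int_decode (pf y)) (int (ps y)) \<longleftrightarrow> coprime (nat \<bar>int_decode (pf y)\<bar>) (ps y)"
    using coprime_nat_abs_left_iff[of "int_decode (pf y)" "ps y"] by simp
  also have "... \<longleftrightarrow> coprime (Suc (pf y) div 2) (ps y)" by (simp only: abs_int_decode)
  finally show ?thesis unfolding canon_def coprime_def by (auto simp: mod_eq_0_iff_dvd less_Suc_eq_le dest: dvd_imp_le)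
qed

lemma canon_encode: "canon (encode_rat q)" "dq (encode_rat q) = q"
proof -
  obtain a b where ab: "quotient_of q = (a, b)" by force
  have e: "encode_rat q = pe (int_encode a) (nat b)" by (simp add: encode_rat_def ab)
  have b: "b > 0" "coprime a b" "q = of_int a / of_int b"
    using quotient_of_denom_pos[OF ab] quotient_of_coprime[OF ab] quotient_of_div[OF ab] by auto
  show "canon (encode_rat q)" "dq (encode_rat q) = q" unfolding canon_iff dq_int_decode e using b by simp_all
qed

lemma canon_dq: assumes "canon y" shows "encode_rat (dq y) = y"
proof -
  have c: "0 < ps y" "coprime (int_decode (pf y)) (int (ps y))" using assms by (auto simp: canon_iff)
  have "quotient_of (dq y) = (int_decode (pf y), int (ps y))"
    using c by (simp add: dq_int_decode Fract_of_int_quotient[symmetric, where l = "int _", simplified] quotient_of_Fract normalize_stable)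
  then show ?thesis by (simp add: encode_rat_def)
qed

section \<open>Coded certificates and abstract ones\<close>

context numfield begin

lemma constants: "W = Wf n R" "AA = Af n R" "BB = Bf n R" "CC = Cf n R"
  by (simp_all add: W_def Wf_def AA_def Af_def BB_def Bf_def CC_def Cf_def C0_def C1_def)

lemma av_ex: "(\<exists>a. tn a & Phi a) \<longleftrightarrow> (\<exists>w. Phi (av n w))"
proof
  assume "\<exists>a. tn a & Phi a"
  then obtain a where a: "tn a" "Phi a" by blast
  obtain w where "\<forall>i. ar w i = (if i < n then a i else 0)" using ar_exists by blast
  then have "av n w = a" using a(1) by (auto simp: av_def)
  then show "\<exists>w. Phi (av n w)" using a(2) by blast
next
  assume "\<exists>w. Phi (av n w)"
  then obtain w where "Phi (av n w)" by blast
  then show "\<exists>a. tn a & Phi a" by (intro exI[of _ "av n w"]) (simp add: av_def)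
qed

lemma certx_cert:
  assumes gamma: "!!i. i <= n ==> ar gamma i = of_int (coeff g i)"
  shows "certx n gamma AA DD BB CC y Q s P d K H \<longleftrightarrow> cert (dq y) Q s (Pv n P) d K H"
proof -
  have b: "bv n DD = bx" by (intro ext) (simp add: bv_def bx_def dig_def)
  have gg: "gv n = gr" by (intro ext) (simp add: gv_def gr_def dig_def)
  have t: "tn (Pv n P j)" for j by (simp add: Pv_def)
  have o: "okx n gamma = okc" "nmx n gamma = nm" using okx_nmx[OF gamma] by (auto intro!: ext)
  have a: "(\<exists>a A. tn a & Phi a A) \<longleftrightarrow> (\<exists>w A. Phi (av n w) A)" for Phi :: "(nat => rat) => nat => bool"
    using av_ex[of "%a. \<exists>A. Phi a A"] by auto
  show ?thesis unfolding certx_def cert_def o b gg a av_ex lessThan_Suc_atMost by (simp add: t)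
qed

text \<open>The list code keeps \<open>P j\<close> only for j < s, and a certificate looks at no
  other values.\<close>

lemma cert_code: assumes "cert q Q s P d K H" shows "\<exists>p. cert q Q s (Pv n p) d K H"
proof -
  have "\<exists>w. \<forall>i. ar w i = (if i < n then P j i else 0)" for j by (rule ar_exists)
  then obtain w where w: "!!j i. ar (w j) i = (if i < n then P j i else 0)" by metis
  define p where "p = list_encode (map w [0..<s])"
  have t: "!!j. j < s ==> tn (P j)" using assms by (simp add: cert_def)
  have e: "Pv n p j = P j" if j: "j < s" for j
    by (rule ext) (use t[OF j] j in \<open>simp add: Pv_def p_def nthc_list_encode w\<close>)
  have "cert q Q s (Pv n p) d K H" using assms unfolding cert_def by (simp add: e cong: conj_cong imp_cong)
  then show ?thesis by blast
qed

end

lemma dr_encode_poly: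
  assumes "f ~= 0"
  shows "0 < dr (encode_poly f) n & dr (encode_poly f) (Suc n) = 0 \<longleftrightarrow> n = degree f"
    "i <= degree f ==> dq (nthc (encode_poly f) i) = coeff f i"
proof -
  have l: "length (coeffs f) = Suc (degree f)" using assms by (simp add: length_coeffs_degree)
  have z: "list_encode xs = 0 \<longleftrightarrow> xs = []" for xs by (cases xs) auto
  show "0 < dr (encode_poly f) n & dr (encode_poly f) (Suc n) = 0 \<longleftrightarrow> n = degree f"
    using l by (auto simp: encode_poly_def dr_list_encode z simp flip: neq0_conv)
  show "dq (nthc (encode_poly f) i) = coeff f i" if "i <= degree f"
    using l that by (simp add: encode_poly_def nthc_list_encode canon_encode coeffs_nth[OF assms])
qed

lemma modelx_iff:
  assumes f: "f ~= 0"
  shows "modelx (encode_poly f) n c gamma R \<longleftrightarrow> (\<exists>g. integral_model f c g & n = degree g \<and>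
    (\<forall>i\<le>n. ar gamma i = of_int (coeff g i)) & R = 1 + (\<Sum>i<n. nat \<bar>coeff g i\<bar>))"
proof -
  have R: "of_nat R = 1 + (\<Sum>i<n. \<bar>ar gamma i\<bar>) \<longleftrightarrow> R = 1 + (\<Sum>i<n. nat \<bar>coeff g i\<bar>)"
    if "\<forall>i\<le>n. ar gamma i = of_int (coeff g i)" for g
  proof -
    have "1 + (\<Sum>i<n. \<bar>ar gamma i\<bar>) = of_nat (1 + (\<Sum>i<n. nat \<bar>coeff g i\<bar>))" using that by simp
    then show ?thesis by (simp only: of_nat_eq_iff)
  qed
  show ?thesis
  proof
    assume m: "modelx (encode_poly f) n c gamma R"
    then have n: "n = degree f" using dr_encode_poly(1)[OF f, of n] unfolding modelx_def by blast
    have "\<forall>i. \<exists>k. i <= n --> ar gamma i = of_int k" using m by (auto simp: modelx_def less_Suc_eq_le elim!: Ints_cases)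
    then obtain k where k: "!!i. i <= n ==> ar gamma i = of_int (k i)" by metis
    define g where "g = (\<Sum>i\<le>n. monom (k i) i)"
    have g: "coeff g i = (if i <= n then k i else 0)" for i by (simp add: g_def coeff_sum)
    have e: "of_int (coeff g i) * lead_coeff f = of_nat c ^ (n - i) * coeff f i" if "i <= n" for i
      using m that k dr_encode_poly(2)[OF f] by (simp add: modelx_def g n[symmetric] less_Suc_eq_le)
    have "coeff g n ~= 0" using e[of n] f n by auto
    then have "degree g = n" by (intro antisym degree_le le_degree) (simp_all add: g)
    moreover have "\<forall>i\<le>n. ar gamma i = of_int (coeff g i)" using k g by simp
    ultimately show "\<exists>g. integral_model f c g & n = degree g & (\<forall>i\<le>n. ar gamma i = of_int (coeff g i)) \<and>
        R = 1 + (\<Sum>i<n. nat \<bar>coeff g i\<bar>)"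
      using m e R[of g] n by (intro exI[of _ g]) (auto simp: modelx_def integral_model_def)
  next
    assume "\<exists>g. integral_model f c g & n = degree g & (\<forall>i\<le>n. ar gamma i = of_int (coeff g i)) & R = 1 + (\<Sum>i<n. nat \<bar>coeff g i\<bar>)"
    then obtain g where g: "integral_model f c g" "n = degree g" "\<forall>i\<le>n. ar gamma i = of_int (coeff g i)"
      "R = 1 + (\<Sum>i<n. nat \<bar>coeff g i\<bar>)" by blast
    have n: "n = degree f" using g(1,2) by (simp add: integral_model_def)
    have "0 < dr (encode_poly f) n & dr (encode_poly f) (Suc n) = 0" unfolding dr_encode_poly(1)[OF f] by (rule n)
    then show "modelx (encode_poly f) n c gamma R" using g(1,3) R[OF g(3)] g(4) dr_encode_poly(2)[OF f] unfolding modelx_def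
      by (auto simp: n integral_model_def less_Suc_eq_le)
  qed
qed

text \<open>Whichever integral model the search picks, the answer is the same, since soundness ties
  every certificate to the Euclidean minimum of the field.\<close>

theorem search_correct:
  fixes f :: "rat poly" and theta :: complex
  assumes f: "irreducible f" "poly (map_poly of_rat f) theta = 0" and u: "3 <= unit_rank (rat_adjoin theta)"
  shows "(\<exists>y. search y (encode_poly f)) \<and>
    (\<forall>y. search y (encode_poly f) --> encode_rat (dq y) = y & of_rat (dq y) = euclidean_minimum (rat_adjoin theta))"
proof -
  have f0: "f ~= 0" using f(1) by auto
  have ftheta: "ev f theta = 0" using f(2) by (simp add: ev_def)
  have K: "rat_adjoin theta = range (%h. ev h theta)" by (simp add: rat_adjoin_def ev_def)
  have key: "(\<exists>y Q s P d K H. canon y & certx (degree g) gamma (Af (degree g) R) (fact (Wf (degree g) R)) (Bf (degree g) R) (Cf (degree g) R) y Q s P d K H) \<and>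
      (\<forall>y Q s P d K H. canon y --> certx (degree g) gamma (Af (degree g) R) (fact (Wf (degree g) R)) (Bf (degree g) R) (Cf (degree g) R) y Q s P d K H -->
        of_rat (dq y) = euclidean_minimum (rat_adjoin theta))"
    if g: "integral_model f c g" and gamma: "\<forall>i\<le>degree g. ar gamma i = of_int (coeff g i)" and R: "R = 1 + (\<Sum>i<degree g. nat \<bar>coeff g i\<bar>)" for c g gamma R
  proof -
    interpret M: field_model g "of_nat c * theta" "rat_adjoin theta"
      unfolding K by (rule field_model_integral_model[OF f(1) ftheta g])
    obtain alpha beta where "numfield_units g alpha beta" using M.units_exist[OF u] by blast
    then interpret U: numfield_units g alpha beta .
    have n: "degree g = M.n" and R': "R = M.R" using R by (simp_all add: M.n_def M.R_def)
    have E: "euclidean_minimum (rat_adjoin theta) = M.MM" by (simp add: M.euclidean_minimum_eq U.MM_SUP)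
    have C: "certx M.n gamma M.AA M.DD M.BB M.CC y Q s P d K H \<longleftrightarrow> M.cert (dq y) Q s (Pv M.n P) d K H" for y Q s P d K H
      by (rule M.certx_cert) (use gamma n in simp)
    obtain q Q s P d K H where "M.cert q Q s P d K H" using U.cert_complete by blast
    then obtain p where "M.cert (dq (encode_rat q)) Q s (Pv M.n p) d K H" using M.cert_code canon_encode(2) by metis
    then show ?thesis unfolding n R' M.constants[symmetric] M.DD_def[symmetric] C E using canon_encode(1) U.cert_sound by metis
  qed
  obtain c g where g: "integral_model f c g" using integral_model_exists[OF f0] by blast
  obtain gamma where gamma: "\<forall>i. ar gamma i = (if i < Suc (degree g) then of_int (coeff g i) else 0)"
    using ar_exists[of "Suc (degree g)" "%i. of_int (coeff g i)"] by blast
  then have gamma': "\<forall>i\<le>degree g. ar gamma i = of_int (coeff g i)" by simp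
  have "modelx (encode_poly f) (degree g) c gamma (1 + (\<Sum>i<degree g. nat \<bar>coeff g i\<bar>))"
    unfolding modelx_iff[OF f0] using g gamma' by blast
  then have "\<exists>y. search y (encode_poly f)" using key[OF g gamma' refl] unfolding search_def by blast
  moreover have "of_rat (dq y) = euclidean_minimum (rat_adjoin theta)" if "search y (encode_poly f)" for y
    using that key unfolding search_def modelx_iff[OF f0] by blast
  moreover have "encode_rat (dq y) = y" if "search y (encode_poly f)" for y using that canon_dq unfolding search_def by blast
  ultimately show ?thesis by blast
qed

theorem theorem1p7:
  shows "(\<forall>(K :: 'a::field_char_0 set) \<Phi>.
            number_field K \<and> 3 \<le> unit_rank K \<and> embedding_reps K \<Phi> \<longrightarrow>
              minimum_attained K \<Phi> \<and>
              euclidean_minimum K isolated_in inhomogeneous_spectrum K \<Phi>) \<and>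
         (\<exists>algorithm. \<forall>(f :: rat poly) (\<theta> :: complex).
            irreducible f \<and> poly (map_poly of_rat f) \<theta> = 0 \<and> 3 \<le> unit_rank (rat_adjoin \<theta>) \<longrightarrow>
              (\<exists>q :: rat. of_rat q = euclidean_minimum (rat_adjoin \<theta>) \<and>
                          computes algorithm [encode_poly f] (encode_rat q)))"
proof (rule conjI)
  show "\<forall>(K :: 'a set) Phi. number_field K & 3 <= unit_rank K & embedding_reps K Phi -->
      minimum_attained K Phi & euclidean_minimum K isolated_in inhomogeneous_spectrum K Phi"
    using attained_isolated_number_field by blast
  obtain p where p: "!!x y. search y x ==> \<forall>y'. search y' x --> y' = y ==> computes p [x] y"
    using re_program[OF re_search] by blast
  have "\<exists>q :: rat. of_rat q = euclidean_minimum (rat_adjoin theta) & computes p [encode_poly f] (encode_rat q)"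
    if f: "irreducible f" "poly (map_poly of_rat f) theta = 0" and u: "3 <= unit_rank (rat_adjoin theta)"
    for f :: "rat poly" and theta :: complex
  proof -
    obtain y where y: "search y (encode_poly f)"
      and sound: "!!y'. search y' (encode_poly f) ==>
        encode_rat (dq y') = y' & of_rat (dq y') = euclidean_minimum (rat_adjoin theta)" using search_correct[OF f u] by blast
    \<comment> \<open>Both values equal the Euclidean minimum and both codes are canonical; this is
      the uniqueness that \<open>re_program\<close> asks for.\<close>
    have "y' = y" if y': "search y' (encode_poly f)" for y'
    proof -
      have "(of_rat (dq y') :: real) = of_rat (dq y)" using sound[OF y'] sound[OF y] by simp
      then have "dq y' = dq y" by (simp only: of_rat_eq_iff)
      then show ?thesis using sound[OF y'] sound[OF y] by metis
    qed
    then have "computes p [encode_poly f] y" using p[OF y] by blast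
    then show ?thesis using sound[OF y] by (intro exI[of _ "dq y"]) simp
  qed
  then show "\<exists>algorithm. \<forall>(f :: rat poly) (theta :: complex).
      irreducible f & poly (map_poly of_rat f) theta = 0 & 3 <= unit_rank (rat_adjoin theta) -->
        (\<exists>q :: rat. of_rat q = euclidean_minimum (rat_adjoin theta) & computes algorithm [encode_poly f] (encode_rat q))"
    by blast
qed

end
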